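(* Let $E$ be an admissible sequentially complete complex locally convex Hausdorff space and $A:=]-\infty,a]$ or $A:=[a,\infty[$ for some $a\in\mathbb{R}$. Then the asymptotic Laplace transform $$\mathcal{L}_A^{\mathcal{B}}\colon\mathcal{B}(A,E)\to\mathcal{LO}_{\overline{A}}(E)/\mathcal{LO}_{\overline{A}\setminus A}(E),\quad\mathcal{L}_A^{\mathcal{B}}(f):=[(\mathcal{L}\circ\mathcal{R}_A^{-1})(f)],$$ is a linear isomorphism, where the closure $\overline{A}$ is taken in $\overline{\mathbb{R}}$.
   Context: $\mathbb{N}=\{1,2,\dots\}$, $\overline{\mathbb{R}}:=\mathbb{R}\cup\{\pm\infty\}$, $\overline{\mathbb{C}}:=\overline{\mathbb{R}}+i\mathbb{R}$. $E$ carries a directed system of seminorms $(p_\alpha)_{\alpha\in\mathfrak{A}}$ generating its topology. $\mathcal{O}(\Omega,E)$ and $\mathcal{C}^\infty(\Omega,E)$ are the spaces of $E$-valued holomorphic resp. infinitely continuously partially differentiable functions on open $\Omega\subset\mathbb{C}=\mathbb{R}^2$. Put $d(z,M):=\inf_{w\in M}|z-w|$, $d(z,\emptyset):=\infty$. For compact $K\subset\overline{\mathbb{R}}$ and $c>0$, $U_{1/c}(K)$ is the union of $\{z\in\mathbb{C}\mid d(z,K\cap\mathbb{C})<c\}$ with the strip $]1/c,\infty[\,+\,i\,]-c,c[$ if $\infty\in K$ and with the strip $]-\infty,-1/c[\,+\,i\,]-c,c[$ if $-\infty\in K$. For $n\in\mathbb{N}$ put $S_n(K):=(\mathbb{C}\setminus\overline{U_n(K)})\cap\{z\mid|\operatorname{Im}z|<n\}$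 ($U_n(K)$ is $U_{1/c}(K)$ with $c=1/n$). $\mathcal{O}^{exp}(\overline{\mathbb{C}}\setminus K,E)$: all $f\in\mathcal{O}(\mathbb{C}\setminus K,E)$ with $\sup_{z\in S_n(K)}p_\alpha(f(z))e^{-\frac1n|\operatorname{Re}z|}<\infty$ for all $n\in\mathbb{N}$, $\alpha\in\mathfrak{A}$; $bv_K(E):=\mathcal{O}^{exp}(\overline{\mathbb{C}}\setminus K,E)/\mathcal{O}^{exp}(\overline{\mathbb{C}},E)$. $\mathcal{E}^{exp}(\overline{\mathbb{C}}\setminus K,E)$: all $f\in\mathcal{C}^\infty(\mathbb{C}\setminus K,E)$ with $\sup_{z\in S_n(K),\,|\beta|\le m}p_\alpha(\partial^\beta f(z))e^{-\frac1n|\operatorname{Re}z|}<\infty$ for all $n\in\mathbb{N}$, $m\in\mathbb{N}_0$, $\alpha\in\mathfrak{A}$. $E$ is admissible if the Cauchy-Riemann operator $\overline{\partial}\colon\mathcal{E}^{exp}(\overline{\mathbb{C}}\setminus K,E)\to\mathcal{E}^{exp}(\overline{\mathbb{C}}\setminus K,E)$ is surjective for every compact $K\subset\overline{\mathbb{R}}$. For closed $A\subset\mathbb{R}$, $\mathcal{B}(A,E):=\mathcal{O}(\mathbb{C}\setminus A,E)/\mathcal{O}(\mathbb{C},E)$. For $A$ a closed half-line and $E$ admissible, the canonical map $\mathcal{R}_A\colon\mathcal{O}^{exp}(\overline{\mathbb{C}}\setminus\overline{A},E)/\mathcal{O}^{exp}(\overline{\mathbb{C}}\setminus(\overline{A}\setminus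 A),E)\to\mathcal{B}(A,E)$, $[F]\mapsto[F]$, is a linear isomorphism ($\overline{A}\setminus A$ is $\{\infty\}$ or $\{-\infty\}$). $\mathcal{LO}_{[a,\infty]}(E)$, $-\infty<a\le\infty$: all $f\in\mathcal{O}(\{\operatorname{Re}z>0\},E)$ with $\sup_{\operatorname{Re}z\ge\frac1k}p_\alpha(f(z))e^{-\frac1k|z|+a|\operatorname{Re}z|}<\infty$ for all $k\in\mathbb{N}$, $\alpha\in\mathfrak{A}$ ($a$ in the exponent replaced by $k$ if $a=\infty$, i.e. for $\mathcal{LO}_{\{\infty\}}(E)$). $\mathcal{LO}_{[-\infty,a]}(E)$, $-\infty\le a<\infty$: all $f\in\mathcal{O}(\{\operatorname{Re}z<0\},E)$ with $\sup_{\operatorname{Re}z\le-\frac1k}p_\alpha(f(z))e^{-\frac1k|z|-a|\operatorname{Re}z|}<\infty$ for all $k,\alpha$ ($a$ in the exponent replaced by $-k$ if $a=-\infty$, i.e. for $\mathcal{LO}_{\{-\infty\}}(E)$). For $K=[a,\infty]$ or $K=[-\infty,a]$, $K\neq\overline{\mathbb{R}}$, the Laplace transform $\mathcal{L}=\mathcal{L}_K\colon bv_K(E)\to\mathcal{LO}_K(E)$ is $\mathcal{L}([F])(\zeta):=\int_{\gamma_K}F(z)e^{-z\zeta}dz$ (Pettis integral), $\gamma_K$ the boundary of $U_{1/c}(K)$ with clockwise orientation, $c>0$ small enough depending on $\zeta$; it is independent of $c$ and of the representative. In the definition of $\mathcal{L}_A^{\mathcal{B}}(f)$ one takes any $G\in\mathcal{O}^{exp}(\overline{\mathbb{C}}\setminus\overline{A},E)$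 representing $\mathcal{R}_A^{-1}(f)$, and the class of $\mathcal{L}_{\overline{A}}([G])$ modulo $\mathcal{LO}_{\overline{A}\setminus A}(E)$. *)

theory Defs
  imports "HOL-Analysis.Analysis"
begin

section \<open>Complex locally convex Hausdorff spaces\<close>

text \<open>
  The topology of the space is that of the type class; \<open>p\<close> is a directed system of seminorms,
  indexed by a type, that generates it. The scalar multiplication is an explicit parameter because
  the library has no type class of complex topological vector spaces.
\<close>

locale lc_hausdorff = vector_space smul
  for smul :: "complex \<Rightarrow> 'e :: {ab_group_add, t2_space} \<Rightarrow> 'e" +
  fixes p :: "'i \<Rightarrow> 'e \<Rightarrow> real"
  assumes seminorm_triangle: "p \<alpha> (x + y) \<le> p \<alpha> x + p \<alpha> y"
    and seminorm_scale: "p \<alpha> (smul c x) = cmod c * p \<alpha> x"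
    and directed: "\<exists>\<gamma>. \<exists>C>0. \<forall>x. max (p \<alpha> x) (p \<beta> x) \<le> C * p \<gamma> x"
    and generates: "open U \<longleftrightarrow> (\<forall>x\<in>U. \<exists>\<alpha>. \<exists>\<epsilon>>0. \<forall>y. p \<alpha> (y - x) < \<epsilon> \<longrightarrow> y \<in> U)"

definition seq_complete :: "('i \<Rightarrow> 'e :: {ab_group_add, t2_space} \<Rightarrow> real) \<Rightarrow> bool" where
  "seq_complete p \<longleftrightarrow>
    (\<forall>X :: nat \<Rightarrow> 'e.
      (\<forall>\<alpha>. \<forall>\<epsilon>>0. \<exists>N. \<forall>m\<ge>N. \<forall>n\<ge>N. p \<alpha> (X m - X n) < \<epsilon>) \<longrightarrow> convergent X)"

definition dual :: "(complex \<Rightarrow> 'e :: {ab_group_add, t2_space} \<Rightarrow> 'e) \<Rightarrow> ('e \<Rightarrow> complex) set" where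
  "dual smul = {\<phi>. Vector_Spaces.linear smul (*) \<phi> \<and> continuous_on UNIV \<phi>}"

definition has_pettis_integral ::
  "(complex \<Rightarrow> 'e :: {ab_group_add, t2_space} \<Rightarrow> 'e) \<Rightarrow> 'a measure \<Rightarrow> ('a \<Rightarrow> 'e) \<Rightarrow> 'e \<Rightarrow> bool" where
  "has_pettis_integral smul M f v \<longleftrightarrow>
    (\<forall>\<phi>\<in>dual smul. integrable M (\<lambda>t. \<phi> (f t)) \<and> integral\<^sup>L M (\<lambda>t. \<phi> (f t)) = \<phi> v)"


section \<open>Vector-valued holomorphic and smooth functions\<close>

text \<open>
  A function on an open set \<open>\<Omega>\<close> is modelled by a total function whose values outside
  \<open>\<Omega>\<close> are irrelevant; all spaces below are used only up to equality on \<open>\<Omega>\<close>.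
\<close>

definition hol ::
  "(complex \<Rightarrow> 'e :: {ab_group_add, t2_space} \<Rightarrow> 'e) \<Rightarrow> complex set \<Rightarrow> (complex \<Rightarrow> 'e) set" where
  "hol smul \<Omega> =
    {f. \<forall>z\<in>\<Omega>. \<exists>l. ((\<lambda>h. smul (inverse h) (f (z + h) - f z)) \<longlongrightarrow> l) (at 0)}"

text \<open>The partial derivatives in the real directions \<open>u = 1\<close> and \<open>u = \<i>\<close>.\<close>

definition has_partial ::
  "(complex \<Rightarrow> 'e :: {ab_group_add, t2_space} \<Rightarrow> 'e) \<Rightarrow> complex \<Rightarrow> (complex \<Rightarrow> 'e) \<Rightarrow>
    complex \<Rightarrow> 'e \<Rightarrow> bool" where
  "has_partial smul u f z l \<longleftrightarrow>
    ((\<lambda>h :: real. smul (of_real (inverse h)) (f (z + of_real h * u) - f z)) \<longlongrightarrow> l) (at 0)"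

definition partial ::
  "(complex \<Rightarrow> 'e :: {ab_group_add, t2_space} \<Rightarrow> 'e) \<Rightarrow> complex \<Rightarrow> (complex \<Rightarrow> 'e) \<Rightarrow>
    complex \<Rightarrow> 'e" where
  "partial smul u f z = (THE l. has_partial smul u f z l)"

definition iter_partial ::
  "(complex \<Rightarrow> 'e :: {ab_group_add, t2_space} \<Rightarrow> 'e) \<Rightarrow> nat \<times> nat \<Rightarrow> (complex \<Rightarrow> 'e) \<Rightarrow>
    complex \<Rightarrow> 'e" where
  "iter_partial smul \<beta> f = (partial smul 1 ^^ fst \<beta>) ((partial smul \<i> ^^ snd \<beta>) f)"

fun cont_diff ::
  "(complex \<Rightarrow> 'e :: {ab_group_add, t2_space} \<Rightarrow> 'e) \<Rightarrow> nat \<Rightarrow> complex set \<Rightarrow>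
    (complex \<Rightarrow> 'e) \<Rightarrow> bool" where
  "cont_diff smul 0 \<Omega> f \<longleftrightarrow> continuous_on \<Omega> f"
| "cont_diff smul (Suc k) \<Omega> f \<longleftrightarrow> continuous_on \<Omega> f \<and>
    (\<forall>u\<in>{1, \<i>}. (\<forall>z\<in>\<Omega>. \<exists>l. has_partial smul u f z l) \<and>
       cont_diff smul k \<Omega> (partial smul u f))"

definition smooth ::
  "(complex \<Rightarrow> 'e :: {ab_group_add, t2_space} \<Rightarrow> 'e) \<Rightarrow> complex set \<Rightarrow> (complex \<Rightarrow> 'e) set" where
  "smooth smul \<Omega> = {f. \<forall>k. cont_diff smul k \<Omega> f}"

definition dbar ::
  "(complex \<Rightarrow> 'e :: {ab_group_add, t2_space} \<Rightarrow> 'e) \<Rightarrow> (complex \<Rightarrow> 'e) \<Rightarrow> complex \<Rightarrow> 'e" where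
  "dbar smul f z = smul (1 / 2) (partial smul 1 f z + smul \<i> (partial smul \<i> f z))"


section \<open>Spaces of functions of infra-exponential growth\<close>

definition finite_part :: "ereal set \<Rightarrow> complex set" where
  "finite_part K = complex_of_real ` {x. ereal x \<in> K}"

text \<open>Extended-real valued, so that the distance to the empty set is \<open>\<infinity>\<close> (unlike \<^const>\<open>infdist\<close>).\<close>

definition edist_to :: "complex \<Rightarrow> complex set \<Rightarrow> ereal" where
  "edist_to z M = (INF w\<in>M. ereal (cmod (z - w)))"

text \<open>\<open>nbhd c K\<close> is the set written \<open>U\<close> with index \<open>1/c\<close>.\<close>

definition nbhd :: "real \<Rightarrow> ereal set \<Rightarrow> complex set" where
  "nbhd c K = {z. edist_to z (finite_part K) < ereal c}
     \<union> (if \<infinity> \<in> K then {z. Re z > 1 / c \<and> \<bar>Im z\<bar> < c} else {})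
     \<union> (if -\<infinity> \<in> K then {z. Re z < - (1 / c) \<and> \<bar>Im z\<bar> < c} else {})"

definition S_region :: "nat \<Rightarrow> ereal set \<Rightarrow> complex set" where
  "S_region n K = - closure (nbhd (1 / real n) K) \<inter> {z. \<bar>Im z\<bar> < real n}"

definition hol_exp ::
  "(complex \<Rightarrow> 'e :: {ab_group_add, t2_space} \<Rightarrow> 'e) \<Rightarrow> ('i \<Rightarrow> 'e \<Rightarrow> real) \<Rightarrow> ereal set \<Rightarrow>
    (complex \<Rightarrow> 'e) set" where
  "hol_exp smul p K = {f \<in> hol smul (- finite_part K).
     \<forall>n\<ge>1. \<forall>\<alpha>. bdd_above ((\<lambda>z. p \<alpha> (f z) * exp (- (1 / real n) * \<bar>Re z\<bar>)) ` S_region n K)}"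

definition smooth_exp ::
  "(complex \<Rightarrow> 'e :: {ab_group_add, t2_space} \<Rightarrow> 'e) \<Rightarrow> ('i \<Rightarrow> 'e \<Rightarrow> real) \<Rightarrow> ereal set \<Rightarrow>
    (complex \<Rightarrow> 'e) set" where
  "smooth_exp smul p K = {f \<in> smooth smul (- finite_part K).
     \<forall>n\<ge>1. \<forall>m. \<forall>\<alpha>.
       bdd_above ((\<lambda>(z, \<beta>). p \<alpha> (iter_partial smul \<beta> f z) * exp (- (1 / real n) * \<bar>Re z\<bar>)) `
         (S_region n K \<times> {\<beta>. fst \<beta> + snd \<beta> \<le> m}))}"

definition admissible ::
  "(complex \<Rightarrow> 'e :: {ab_group_add, t2_space} \<Rightarrow> 'e) \<Rightarrow> ('i \<Rightarrow> 'e \<Rightarrow> real) \<Rightarrow> bool" where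
  "admissible smul p \<longleftrightarrow>
    (\<forall>K. compact K \<longrightarrow>
      (\<forall>g\<in>smooth_exp smul p K. \<exists>f\<in>smooth_exp smul p K.
         \<forall>z\<in>- finite_part K. dbar smul f z = g z))"

text \<open>
  The spaces \<open>LO\<close> are indexed by \<open>K = [a, \<infinity>]\<close> with \<open>-\<infinity> < a\<close>, where \<open>a = Inf K\<close>, or
  \<open>K = [-\<infinity>, a]\<close> with \<open>a < \<infinity>\<close>, where \<open>a = Sup K\<close> and \<open>\<infinity> \<notin> K\<close>; both definitions are only
  meant for such \<open>K\<close>.
\<close>

definition half_plane :: "ereal set \<Rightarrow> complex set" where
  "half_plane K = (if \<infinity> \<in> K then {z. Re z > 0} else {z. Re z < 0})"

definition LO ::
  "(complex \<Rightarrow> 'e :: {ab_group_add, t2_space} \<Rightarrow> 'e) \<Rightarrow> ('i \<Rightarrow> 'e \<Rightarrow> real) \<Rightarrow> ereal set \<Rightarrow>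
    (complex \<Rightarrow> 'e) set" where
  "LO smul p K =
    (if \<infinity> \<in> K then
       {f \<in> hol smul (half_plane K). \<forall>k\<ge>1. \<forall>\<alpha>.
          let a = (if Inf K = \<infinity> then real k else real_of_ereal (Inf K)) in
          bdd_above ((\<lambda>z. p \<alpha> (f z) * exp (- (1 / real k) * cmod z + a * \<bar>Re z\<bar>)) `
            {z. Re z \<ge> 1 / real k})}
     else
       {f \<in> hol smul (half_plane K). \<forall>k\<ge>1. \<forall>\<alpha>.
          let a = (if Sup K = -\<infinity> then - real k else real_of_ereal (Sup K)) in
          bdd_above ((\<lambda>z. p \<alpha> (f z) * exp (- (1 / real k) * cmod z - a * \<bar>Re z\<bar>)) `
            {z. Re z \<le> - (1 / real k)})})"


section \<open>Quotients of function spaces\<close>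

text \<open>
  \<open>V // quot_rel \<Omega> V W\<close> is the quotient of the space \<open>V\<close> of functions on \<open>\<Omega>\<close> by the space \<open>W\<close>
  of functions on a possibly larger domain, embedded by restriction to \<open>\<Omega>\<close>. Comparing on \<open>\<Omega>\<close>
  only also identifies total functions that agree on \<open>\<Omega>\<close>.
\<close>

definition quot_rel ::
  "complex set \<Rightarrow> (complex \<Rightarrow> 'e :: ab_group_add) set \<Rightarrow> (complex \<Rightarrow> 'e) set \<Rightarrow>
    ((complex \<Rightarrow> 'e) \<times> (complex \<Rightarrow> 'e)) set" where
  "quot_rel \<Omega> V W = {(f, g). f \<in> V \<and> g \<in> V \<and> (\<exists>h\<in>W. \<forall>z\<in>\<Omega>. f z - g z = h z)}"

definition class_add ::
  "((complex \<Rightarrow> 'e :: ab_group_add) \<times> (complex \<Rightarrow> 'e)) set \<Rightarrow>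
    (complex \<Rightarrow> 'e) set \<Rightarrow> (complex \<Rightarrow> 'e) set \<Rightarrow> (complex \<Rightarrow> 'e) set" where
  "class_add r X Y = (\<Union>f\<in>X. \<Union>g\<in>Y. r `` {\<lambda>z. f z + g z})"

definition class_scale ::
  "(complex \<Rightarrow> 'e :: ab_group_add \<Rightarrow> 'e) \<Rightarrow> ((complex \<Rightarrow> 'e) \<times> (complex \<Rightarrow> 'e)) set \<Rightarrow>
    complex \<Rightarrow> (complex \<Rightarrow> 'e) set \<Rightarrow> (complex \<Rightarrow> 'e) set" where
  "class_scale smul r c X = (\<Union>f\<in>X. r `` {\<lambda>z. smul c (f z)})"

definition linear_iso_quotients ::
  "(complex \<Rightarrow> 'e :: ab_group_add \<Rightarrow> 'e) \<Rightarrow>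
    (complex \<Rightarrow> 'e) set \<Rightarrow> ((complex \<Rightarrow> 'e) \<times> (complex \<Rightarrow> 'e)) set \<Rightarrow>
    (complex \<Rightarrow> 'e) set \<Rightarrow> ((complex \<Rightarrow> 'e) \<times> (complex \<Rightarrow> 'e)) set \<Rightarrow>
    ((complex \<Rightarrow> 'e) set \<Rightarrow> (complex \<Rightarrow> 'e) set) \<Rightarrow> bool" where
  "linear_iso_quotients smul V r V' r' \<Phi> \<longleftrightarrow>
     bij_betw \<Phi> (V // r) (V' // r') \<and>
     (\<forall>X\<in>V // r. \<forall>Y\<in>V // r. \<Phi> (class_add r X Y) = class_add r' (\<Phi> X) (\<Phi> Y)) \<and>
     (\<forall>c. \<forall>X\<in>V // r. \<Phi> (class_scale smul r c X) = class_scale smul r' c (\<Phi> X))"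

text \<open>The relations defining \<open>bv\<close> with index \<open>K\<close>, hyperfunctions on \<open>A\<close>, the domain of the
  canonical map with index \<open>A\<close>, and the target of the asymptotic Laplace transform.\<close>

definition closure_ext :: "real set \<Rightarrow> ereal set" where
  "closure_ext A = closure (ereal ` A)"

definition bv_rel ::
  "(complex \<Rightarrow> 'e :: {ab_group_add, t2_space} \<Rightarrow> 'e) \<Rightarrow> ('i \<Rightarrow> 'e \<Rightarrow> real) \<Rightarrow> ereal set \<Rightarrow>
    ((complex \<Rightarrow> 'e) \<times> (complex \<Rightarrow> 'e)) set" where
  "bv_rel smul p K = quot_rel (- finite_part K) (hol_exp smul p K) (hol_exp smul p {})"

definition hyp_rel ::
  "(complex \<Rightarrow> 'e :: {ab_group_add, t2_space} \<Rightarrow> 'e) \<Rightarrow> real set \<Rightarrow>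
    ((complex \<Rightarrow> 'e) \<times> (complex \<Rightarrow> 'e)) set" where
  "hyp_rel smul A =
     quot_rel (- complex_of_real ` A) (hol smul (- complex_of_real ` A)) (hol smul UNIV)"

definition exp_rel ::
  "(complex \<Rightarrow> 'e :: {ab_group_add, t2_space} \<Rightarrow> 'e) \<Rightarrow> ('i \<Rightarrow> 'e \<Rightarrow> real) \<Rightarrow> real set \<Rightarrow>
    ((complex \<Rightarrow> 'e) \<times> (complex \<Rightarrow> 'e)) set" where
  "exp_rel smul p A =
     quot_rel (- finite_part (closure_ext A)) (hol_exp smul p (closure_ext A))
       (hol_exp smul p (closure_ext A - ereal ` A))"

definition LO_rel ::
  "(complex \<Rightarrow> 'e :: {ab_group_add, t2_space} \<Rightarrow> 'e) \<Rightarrow> ('i \<Rightarrow> 'e \<Rightarrow> real) \<Rightarrow> real set \<Rightarrow>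
    ((complex \<Rightarrow> 'e) \<times> (complex \<Rightarrow> 'e)) set" where
  "LO_rel smul p A =
     quot_rel (half_plane (closure_ext A)) (LO smul p (closure_ext A))
       (LO smul p (closure_ext A - ereal ` A))"


section \<open>The asymptotic Laplace transform\<close>

text \<open>
  Parametrization over the whole real line of the clockwise oriented boundary of \<open>nbhd c K\<close> for
  \<open>K = [a, \<infinity>]\<close>, \<open>a\<close> finite, and \<open>0 < c\<close> so small that \<open>a \<le> 1 / c\<close>: in from infinity along
  \<open>Im z = - c\<close>, around \<open>a\<close> along the left half circle through \<open>a - c\<close>, and back to infinity
  along \<open>Im z = c\<close>.
\<close>

definition path_right :: "real \<Rightarrow> real \<Rightarrow> real \<Rightarrow> complex" where
  "path_right a c t =
    (if t \<le> -1 then Complex (a - 1 - t) (- c)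
     else if t \<le> 1 then of_real a + of_real c * cis (pi - pi / 2 * t)
     else Complex (a - 1 + t) c)"

text \<open>For \<open>K = [-\<infinity>, a]\<close> rotate by \<open>pi\<close>, which preserves the orientation.\<close>

definition boundary_path :: "ereal set \<Rightarrow> real \<Rightarrow> real \<Rightarrow> complex" where
  "boundary_path K c t =
    (if \<infinity> \<in> K then path_right (real_of_ereal (Inf K)) c t
     else - path_right (- real_of_ereal (Sup K)) c t)"

definition has_path_integral ::
  "(complex \<Rightarrow> 'e :: {ab_group_add, t2_space} \<Rightarrow> 'e) \<Rightarrow> (real \<Rightarrow> complex) \<Rightarrow> (complex \<Rightarrow> 'e) \<Rightarrow>
    'e \<Rightarrow> bool" where
  "has_path_integral smul \<gamma> f v \<longleftrightarrow>
    has_pettis_integral smul lborel (\<lambda>t. smul (vector_derivative \<gamma> (at t)) (f (\<gamma> t))) v"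

text \<open>
  On a class \<open>X\<close> in \<open>bv\<close> with index \<open>K\<close>: the common value of the path integrals for all
  representatives and all sufficiently small \<open>c\<close> (depending on \<open>\<zeta>\<close>). It is significant for
  \<open>\<zeta> \<in> half_plane K\<close> only.
\<close>

definition laplace ::
  "(complex \<Rightarrow> 'e :: {ab_group_add, t2_space} \<Rightarrow> 'e) \<Rightarrow> ereal set \<Rightarrow> (complex \<Rightarrow> 'e) set \<Rightarrow>
    complex \<Rightarrow> 'e" where
  "laplace smul K X \<zeta> =
    (THE v. \<forall>F\<in>X. \<forall>\<^sub>F c in at_right 0.
       has_path_integral smul (boundary_path K c) (\<lambda>z. smul (exp (- z * \<zeta>)) (F z)) v)"

definition canonical_map ::
  "(complex \<Rightarrow> 'e :: {ab_group_add, t2_space} \<Rightarrow> 'e) \<Rightarrow> real set \<Rightarrow>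
    (complex \<Rightarrow> 'e) set \<Rightarrow> (complex \<Rightarrow> 'e) set" where
  "canonical_map smul A X = (\<Union>F\<in>X. hyp_rel smul A `` {F})"

definition asymptotic_laplace ::
  "(complex \<Rightarrow> 'e :: {ab_group_add, t2_space} \<Rightarrow> 'e) \<Rightarrow> ('i \<Rightarrow> 'e \<Rightarrow> real) \<Rightarrow> real set \<Rightarrow>
    (complex \<Rightarrow> 'e) set \<Rightarrow> (complex \<Rightarrow> 'e) set" where
  "asymptotic_laplace smul p A f =
    (\<Union>G \<in> inv_into (hol_exp smul p (closure_ext A) // exp_rel smul p A) (canonical_map smul A) f.
       LO_rel smul p A `` {laplace smul (closure_ext A) (bv_rel smul p (closure_ext A) `` {G})})"

end

theory Submission
  imports Defs "HOL-Complex_Analysis.Complex_Analysis" "HOL-Real_Asymp.Real_Asymp"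
begin

text \<open>
  Surjectivity of the canonical map: if \<open>\<theta>\<close> is a smooth cutoff that is \<open>1\<close> near the half-line, with a
  support that becomes exponentially thin at infinity, admissibility with index \<open>{\<infinity>}\<close> lets one correct
  \<open>\<theta> f\<close> to a holomorphic function of infra-exponential growth that differs from \<open>f\<close> by an entire
  function. The inverse of the Laplace transform modulo \<open>LO {\<infinity>}\<close> is, up to \<open>2 \<pi> \<i>\<close>, the Borel
  transform \<open>\<integral> e\<^sup>z\<^sup>w f(w) dw\<close> along rays from \<open>1\<close> to infinity in the directions \<open>1\<close>, \<open>\<i>\<close> and \<open>- \<i>\<close>, which
  together cover the complement of \<open>[a, \<infinity>[\<close>. If the Laplace transform of \<open>F\<close> decays faster than every
  exponential, its Borel transform in the direction \<open>1\<close> is entire, and moving the contour across \<open>z\<close>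
  in the resulting Cauchy integral expresses \<open>F\<close> by entire functions. Scalar integrals are
  transferred to the space by continuous functionals, and \<open>z \<mapsto> - z\<close> reduces the left half-line to the right one.
\<close>

section \<open>Seminorms and the Hahn-Banach theorem\<close>

text \<open>Functionals lose nothing: by the Hahn-Banach theorem a seminorm is the supremum over the
  functionals that it dominates, so scalar estimates uniform over these become estimates in the
  space. Completeness for sequences acts directly in two places: the existence of Pettis integrals
  of functions that are continuous off a finite set with exponential majorants, and the passage from
  weak to strong holomorphy. The obstacle is growth. The paths of the Borel transform start at 1, so
  the available bound for it along the ray is of order \<open>exp (Re z)\<close>, which is not
  infra-exponential. The transform is therefore replaced by a representative modulo entire
  functions, supplied by the same cutoff argument that gives surjectivity of the canonical map. The
  replacement is harmless because the contour integral of an entire function does not see the vertex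
  of the contour: with the vertex moved to any \<open>b\<close>, the Laplace integral decays like
  \<open>exp (- b * Re \<zeta>)\<close> up to infra-exponential factors, so the error lies in the
  space for infinity.\<close>

lemma tendsto_0_if_nonneg_le:
  fixes f g :: "'a \<Rightarrow> real"
  assumes "(g \<longlongrightarrow> 0) F" "\<And>x. 0 \<le> f x" "\<And>x. f x \<le> g x"
  shows "(f \<longlongrightarrow> 0) F"
  by (rule tendsto_sandwich[OF _ _ tendsto_const assms(1)]) (auto intro!: always_eventually assms)

section \<open>Seminorms and convergence\<close>

context lc_hausdorff
begin

lemma seminorm_zero [simp]: "p \<alpha> 0 = 0"
proof -
  have "p \<alpha> (smul 0 0) = 0" unfolding seminorm_scale by simp
  then show ?thesis by simp
qed

lemma seminorm_minus [simp]: "p \<alpha> (- x) = p \<alpha> x"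
  using seminorm_scale[of \<alpha> "-1" x] by (simp add: scale_minus_left)

lemma seminorm_nonneg [simp]: "0 \<le> p \<alpha> x"
  using seminorm_triangle[of \<alpha> x "- x"] by simp

lemma seminorm_commute: "p \<alpha> (x - y) = p \<alpha> (y - x)"
  using seminorm_minus[of \<alpha> "x - y"] by simp

lemma seminorm_triangle_diff: "p \<alpha> (x - y) \<le> p \<alpha> x + p \<alpha> y"
  using seminorm_triangle[of \<alpha> x "- y"] by simp

lemma seminorm_diff_trans: "p \<alpha> (x - z) \<le> p \<alpha> (x - y) + p \<alpha> (y - z)"
  using seminorm_triangle[of \<alpha> "x - y" "y - z"] by simp

lemma seminorm_abs_diff: "\<bar>p \<alpha> x - p \<alpha> y\<bar> \<le> p \<alpha> (x - y)"
  using seminorm_triangle[of \<alpha> "x - y" y] seminorm_triangle[of \<alpha> "y - x" x]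
    seminorm_commute[of \<alpha> x y] by simp

lemma open_seminorm_ball: "open {y. p \<alpha> (y - x) < \<epsilon>}"
proof (subst generates, intro ballI)
  fix y assume "y \<in> {y. p \<alpha> (y - x) < \<epsilon>}"
  then have y: "p \<alpha> (y - x) < \<epsilon>" by simp
  show "\<exists>\<beta>. \<exists>\<delta>>0. \<forall>z. p \<beta> (z - y) < \<delta> \<longrightarrow> z \<in> {y. p \<alpha> (y - x) < \<epsilon>}"
  proof (intro exI[of _ \<alpha>] exI[of _ "\<epsilon> - p \<alpha> (y - x)"] conjI allI impI)
    show "0 < \<epsilon> - p \<alpha> (y - x)" using y by simp
    fix z assume "p \<alpha> (z - y) < \<epsilon> - p \<alpha> (y - x)"
    then show "z \<in> {y. p \<alpha> (y - x) < \<epsilon>}"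
      using seminorm_diff_trans[of \<alpha> z x y] by simp
  qed
qed

text \<open>By \<open>generates\<close> every neighbourhood of a point contains a ball of a single
  seminorm, so convergence can be tested one index at a time.\<close>

lemma tendsto_iff_seminorm:
  "(f \<longlongrightarrow> l) F \<longleftrightarrow> (\<forall>\<alpha>. ((\<lambda>x. p \<alpha> (f x - l)) \<longlongrightarrow> 0) F)"
proof
  assume f: "(f \<longlongrightarrow> l) F"
  show "\<forall>\<alpha>. ((\<lambda>x. p \<alpha> (f x - l)) \<longlongrightarrow> 0) F"
  proof (intro allI tendstoI)
    fix \<alpha> and e :: real assume "0 < e"
    then have "\<forall>\<^sub>F x in F. f x \<in> {y. p \<alpha> (y - l) < e}"
      by (intro topological_tendstoD[OF f] open_seminorm_ball) simp
    then show "\<forall>\<^sub>F x in F. dist (p \<alpha> (f x - l)) 0 < e"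
      by (rule eventually_mono) simp
  qed
next
  assume f: "\<forall>\<alpha>. ((\<lambda>x. p \<alpha> (f x - l)) \<longlongrightarrow> 0) F"
  show "(f \<longlongrightarrow> l) F"
  proof (rule topological_tendstoI)
    fix U assume "open U" "l \<in> U"
    then obtain \<alpha> \<epsilon> where "\<epsilon> > 0" and U: "\<And>y. p \<alpha> (y - l) < \<epsilon> \<Longrightarrow> y \<in> U"
      using generates by blast
    then have "\<forall>\<^sub>F x in F. dist (p \<alpha> (f x - l)) 0 < \<epsilon>"
      using f by (intro tendstoD) auto
    then show "\<forall>\<^sub>F x in F. f x \<in> U"
      by (rule eventually_mono) (simp add: U)
  qed
qed

lemma tendsto_seminorm: "(f \<longlongrightarrow> l) F \<Longrightarrow> ((\<lambda>x. p \<alpha> (f x)) \<longlongrightarrow> p \<alpha> l) F"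
proof (rule LIM_zero_cancel, rule tendsto_rabs_zero_cancel)
  assume "(f \<longlongrightarrow> l) F"
  then have "((\<lambda>x. p \<alpha> (f x - l)) \<longlongrightarrow> 0) F" by (simp add: tendsto_iff_seminorm)
  then show "((\<lambda>x. \<bar>p \<alpha> (f x) - p \<alpha> l\<bar>) \<longlongrightarrow> 0) F"
    by (rule tendsto_sandwich[OF _ _ tendsto_const, rotated -1])
      (auto intro!: eventuallyI simp: seminorm_abs_diff)
qed

text \<open>The type class provides a group and a topology with no relation between them; continuity
  of the operations comes from the seminorms.\<close>

lemma tendsto_lc_add:
  fixes f g :: "'a \<Rightarrow> 'e"
  assumes "(f \<longlongrightarrow> l) F" "(g \<longlongrightarrow> m) F"
  shows "((\<lambda>x. f x + g x) \<longlongrightarrow> l + m) F"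
  unfolding tendsto_iff_seminorm
proof
  fix \<alpha>
  from assms have "((\<lambda>x. p \<alpha> (f x - l) + p \<alpha> (g x - m)) \<longlongrightarrow> 0 + 0) F"
    by (intro tendsto_add) (auto simp: tendsto_iff_seminorm)
  then have "((\<lambda>x. p \<alpha> (f x - l) + p \<alpha> (g x - m)) \<longlongrightarrow> 0) F" by simp
  moreover have "p \<alpha> (f x + g x - (l + m)) \<le> p \<alpha> (f x - l) + p \<alpha> (g x - m)" for x
    using seminorm_triangle[of \<alpha> "f x - l" "g x - m"] by (simp add: algebra_simps)
  ultimately show "((\<lambda>x. p \<alpha> (f x + g x - (l + m))) \<longlongrightarrow> 0) F"
    by (rule tendsto_0_if_nonneg_le[OF _ seminorm_nonneg])
qed

lemma tendsto_smul:
  assumes "(c \<longlongrightarrow> d) F" "(f \<longlongrightarrow> l) F"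
  shows "((\<lambda>x. smul (c x) (f x)) \<longlongrightarrow> smul d l) F"
  unfolding tendsto_iff_seminorm
proof
  fix \<alpha>
  have "((\<lambda>x. cmod (c x) * p \<alpha> (f x - l) + cmod (c x - d) * p \<alpha> l) \<longlongrightarrow> cmod d * 0 + cmod (d - d) * p \<alpha> l) F"
    using assms by (intro tendsto_intros) (auto simp: tendsto_iff_seminorm)
  then have "((\<lambda>x. cmod (c x) * p \<alpha> (f x - l) + cmod (c x - d) * p \<alpha> l) \<longlongrightarrow> 0) F" by simp
  moreover have "p \<alpha> (smul (c x) (f x) - smul d l)
      \<le> cmod (c x) * p \<alpha> (f x - l) + cmod (c x - d) * p \<alpha> l" for x
  proof -
    have "smul (c x) (f x) - smul d l = smul (c x) (f x - l) + smul (c x - d) l"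
      by (simp add: scale_right_diff_distrib scale_left_diff_distrib)
    then show ?thesis
      using seminorm_triangle[of \<alpha> "smul (c x) (f x - l)" "smul (c x - d) l"]
      by (simp add: seminorm_scale)
  qed
  ultimately show "((\<lambda>x. p \<alpha> (smul (c x) (f x) - smul d l)) \<longlongrightarrow> 0) F"
    by (rule tendsto_0_if_nonneg_le[OF _ seminorm_nonneg])
qed

lemma tendsto_lc_diff:
  fixes f g :: "'a \<Rightarrow> 'e"
  assumes "(f \<longlongrightarrow> l) F" "(g \<longlongrightarrow> m) F"
  shows "((\<lambda>x. f x - g x) \<longlongrightarrow> l - m) F"
  using tendsto_lc_add[OF assms(1) tendsto_smul[OF tendsto_const[of "-1"] assms(2)]]
  by (simp add: scale_minus_left)

lemma continuous_on_seminorm: "continuous_on S f \<Longrightarrow> continuous_on S (\<lambda>x. p \<alpha> (f x))"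
  by (auto simp: continuous_on_def intro: tendsto_seminorm)

lemma continuous_on_smul:
  "continuous_on S c \<Longrightarrow> continuous_on S f \<Longrightarrow> continuous_on S (\<lambda>x. smul (c x) (f x))"
  by (auto simp: continuous_on_def intro: tendsto_smul)

lemma continuous_on_lc_add:
  fixes f g :: "'a :: topological_space \<Rightarrow> 'e"
  shows "continuous_on S f \<Longrightarrow> continuous_on S g \<Longrightarrow> continuous_on S (\<lambda>x. f x + g x)"
  by (auto simp: continuous_on_def intro: tendsto_lc_add)

text \<open>Here the separation axiom meets the seminorms: an open set that contains
  \<open>x\<close> and misses 0 contains a ball of some seminorm around \<open>x\<close>, and if
  that seminorm vanished at \<open>x\<close>, the ball would contain 0.\<close>

lemma eq_zero_if_seminorms: "(\<And>\<alpha>. p \<alpha> x = 0) \<Longrightarrow> x = 0"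
proof (rule ccontr)
  assume p: "\<And>\<alpha>. p \<alpha> x = 0" and "x \<noteq> 0"
  then obtain U where "open U" "x \<in> U" "0 \<notin> U" by (metis separation_t1)
  then obtain \<alpha> \<epsilon> where "\<epsilon> > 0" "\<And>y. p \<alpha> (y - x) < \<epsilon> \<Longrightarrow> y \<in> U"
    using generates by blast
  from this(2)[of 0] \<open>\<epsilon> > 0\<close> p \<open>0 \<notin> U\<close> show False by simp
qed

section \<open>Continuous linear functionals\<close>

lemma dual_add: "\<phi> \<in> dual smul \<Longrightarrow> \<phi> (x + y) = \<phi> x + \<phi> y"
  by (auto simp: dual_def Vector_Spaces.linear_iff)

lemma dual_scale: "\<phi> \<in> dual smul \<Longrightarrow> \<phi> (smul c x) = c * \<phi> x"
  by (auto simp: dual_def Vector_Spaces.linear_iff)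

lemma dual_zero: "\<phi> \<in> dual smul \<Longrightarrow> \<phi> 0 = 0"
  using dual_scale[of \<phi> 0 0] by simp

lemma dual_minus: "\<phi> \<in> dual smul \<Longrightarrow> \<phi> (- x) = - \<phi> x"
  using dual_scale[of \<phi> "-1" x] by (simp add: scale_minus_left)

lemma dual_diff: "\<phi> \<in> dual smul \<Longrightarrow> \<phi> (x - y) = \<phi> x - \<phi> y"
  using dual_add[of \<phi> x "- y"] by (simp add: dual_minus)

lemma dual_sum: "\<phi> \<in> dual smul \<Longrightarrow> \<phi> (\<Sum>i\<in>I. f i) = (\<Sum>i\<in>I. \<phi> (f i))"
  by (induction I rule: infinite_finite_induct) (auto simp: dual_zero dual_add)

lemma dual_tendsto: "\<phi> \<in> dual smul \<Longrightarrow> (f \<longlongrightarrow> l) F \<Longrightarrow> ((\<lambda>x. \<phi> (f x)) \<longlongrightarrow> \<phi> l) F"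
  by (auto simp: dual_def intro: continuous_on_tendsto_compose[where s=UNIV])

lemma dual_continuous_on: "\<phi> \<in> dual smul \<Longrightarrow> continuous_on S f \<Longrightarrow> continuous_on S (\<lambda>x. \<phi> (f x))"
  by (auto simp: continuous_on_def intro: dual_tendsto)

text \<open>The preimage of the unit disc contains a ball of some seminorm of radius
  \<open>\<epsilon>\<close>; scaling \<open>x\<close> into that ball gives the bound with the
  constant \<open>2 / \<epsilon>\<close>.\<close>

lemma dual_bounded:
  assumes "\<phi> \<in> dual smul"
  obtains C \<alpha> where "C > 0" "\<And>x. cmod (\<phi> x) \<le> C * p \<alpha> x"
proof -
  have "open (\<phi> -` ball 0 1)"
    using assms by (intro open_vimage) (auto simp: dual_def)
  moreover have "0 \<in> \<phi> -` ball 0 1" using dual_zero[OF assms] by simp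
  ultimately obtain \<alpha> \<epsilon> where \<epsilon>: "\<epsilon> > 0" and ball: "\<And>y. p \<alpha> (y - 0) < \<epsilon> \<Longrightarrow> y \<in> \<phi> -` ball 0 1"
    using generates[of "\<phi> -` ball 0 1"] by blast
  have "cmod (\<phi> x) \<le> 2 / \<epsilon> * p \<alpha> x" for x
  proof (rule field_le_epsilon)
    fix e :: real assume e: "e > 0"
    \<comment> \<open>This keeps the scaling factor \<open>c\<close> finite where
      \<open>p \<alpha> x\<close> vanishes, and it contributes exactly \<open>e\<close> to the final
      bound.\<close>
    define d where "d = e * \<epsilon> / 2"
    have d: "d > 0" using e \<epsilon> by (simp add: d_def)
    define c where "c = \<epsilon> / 2 / (p \<alpha> x + d)"
    have pos: "p \<alpha> x + d > 0" using d by (simp add: add_nonneg_pos)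
    have c: "c > 0" unfolding c_def using \<epsilon> pos by simp
    have "p \<alpha> (smul (of_real c) x) = c * p \<alpha> x" using c by (simp add: seminorm_scale)
    also have "\<dots> < c * (p \<alpha> x + d) * 2" proof -
      have "0 \<le> c * p \<alpha> x" "0 < c * d" using c d by simp_all
      then show ?thesis by (simp add: algebra_simps)
    qed
    also have "\<dots> = \<epsilon>" using pos by (simp add: c_def divide_eq_eq)
    finally have "cmod (\<phi> (smul (of_real c) x)) < 1" using ball[of "smul (of_real c) x"] by simp
    then have "c * cmod (\<phi> x) < 1" using c by (simp add: dual_scale[OF assms] norm_mult)
    then have "cmod (\<phi> x) < 1 / c" using c by (simp add: field_simps)
    also have "1 / c = 2 / \<epsilon> * p \<alpha> x + e" using \<epsilon> pos by (simp add: c_def d_def field_simps)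
    finally show "cmod (\<phi> x) \<le> 2 / \<epsilon> * p \<alpha> x + e" by simp
  qed
  with \<epsilon> show thesis by (intro that[of "2 / \<epsilon>" \<alpha>]) auto
qed

lemma dualI:
  assumes add: "\<And>x y. \<phi> (x + y) = \<phi> x + \<phi> y" and scale: "\<And>c x. \<phi> (smul c x) = c * \<phi> x"
    and bound: "\<And>x. cmod (\<phi> x) \<le> C * p \<alpha> x"
  shows "\<phi> \<in> dual smul"
proof -
  have lin: "Vector_Spaces.linear smul (*) \<phi>"
    unfolding Vector_Spaces.linear_iff
    using vector_space_axioms scale add by (auto intro!: vector_space.intro simp: algebra_simps)
  have diff: "\<phi> (x - y) = \<phi> x - \<phi> y" for x y
    using add[of "x - y" y] by simp
  have "(\<phi> \<longlongrightarrow> \<phi> x) (at x)" for x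
  proof (rule LIM_zero_cancel, rule tendsto_norm_zero_cancel)
    have "((\<lambda>y. p \<alpha> (y - x)) \<longlongrightarrow> 0) (at x)"
      using tendsto_ident_at[of x UNIV] unfolding tendsto_iff_seminorm by blast
    then have "((\<lambda>y. C * p \<alpha> (y - x)) \<longlongrightarrow> 0) (at x)" by (rule tendsto_mult_right_zero)
    then show "((\<lambda>y. cmod (\<phi> y - \<phi> x)) \<longlongrightarrow> 0) (at x)"
      by (rule tendsto_sandwich[OF _ _ tendsto_const, rotated -1])
        (use bound in \<open>auto intro!: eventuallyI simp flip: diff\<close>)
  qed
  with lin show ?thesis by (simp add: dual_def continuous_on_def)
qed

section \<open>The Hahn-Banach theorem\<close>

definition polar :: "'i \<Rightarrow> ('e \<Rightarrow> complex) set" where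
  "polar \<alpha> = {\<phi> \<in> dual smul. \<forall>x. cmod (\<phi> x) \<le> p \<alpha> x}"

text \<open>Homogeneity is an inequality because this form passes to infima; applied to the inverse
  factor it becomes the equality \<open>sublinear_scale\<close>.\<close>

definition sublinear :: "('e \<Rightarrow> real) \<Rightarrow> bool" where
  "sublinear q \<longleftrightarrow> (\<forall>x y. q (x + y) \<le> q x + q y) \<and> (\<forall>r>0. \<forall>x. q (smul (of_real r) x) \<le> r * q x)"

lemma sublinear_scale:
  assumes "sublinear q" "r > 0"
  shows "q (smul (of_real r) x) = r * q x"
proof (rule antisym)
  show "q (smul (of_real r) x) \<le> r * q x" using assms by (simp add: sublinear_def)
  have "q (smul (of_real (1 / r)) (smul (of_real r) x)) \<le> 1 / r * q (smul (of_real r) x)"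
    using assms unfolding sublinear_def by (metis zero_less_divide_1_iff)
  then show "r * q x \<le> q (smul (of_real r) x)" using assms(2) by (simp add: field_simps)
qed

lemma sublinear_zero: "sublinear q \<Longrightarrow> q 0 = 0"
  using sublinear_scale[of q 2 0] by simp

lemma sublinear_ge: "sublinear q \<Longrightarrow> - q (- x) \<le> q x"
  using sublinear_zero[of q] unfolding sublinear_def
  by (metis add.right_inverse add_le_cancel_right add.left_inverse add.commute diff_minus_eq_add le_diff_eq minus_diff_eq neg_le_iff_le)

text \<open>The infimum over \<open>t \<ge> 0\<close> of \<open>q (y + t x) - t q x\<close> lowers a
  sublinear functional in one direction: at \<open>y = - x\<close> the parameter
  \<open>t = 1\<close> gives a value at most \<open>- q x\<close>. A functional that does not change
  under this operation in any direction is additive.\<close>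

lemma sublinear_shave:
  assumes q: "sublinear q"
  obtains q' where "sublinear q'" "\<And>y. q' y \<le> q y" "\<And>y. q' y \<le> q (y + x) - q x"
proof -
  define q' where "q' y = (INF t\<in>{0..}. q (y + smul (of_real t) x) - t * q x)" for y
  have sub: "q (y + z) \<le> q y + q z" for y z using q by (simp add: sublinear_def)
  have scale: "q (smul (of_real t) z) = t * q z" if "t \<ge> 0" for t z
    using that sublinear_scale[OF q, of t z] sublinear_zero[OF q] by (cases "t = 0") auto
  \<comment> \<open>Subadditivity and \<open>q (t x) = t q x\<close> bound the expression below by
    \<open>- q (- y)\<close>, so the infimum is genuine.\<close>
  have bdd: "bdd_below ((\<lambda>t. q (y + smul (of_real t) x) - t * q x) ` {0..})" for y
  proof (rule bdd_belowI2[where m = "- q (- y)"])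
    fix t :: real assume "t \<in> {0..}"
    then show "- q (- y) \<le> q (y + smul (of_real t) x) - t * q x"
      using sub[of "y + smul (of_real t) x" "- y"] scale[of t x] by simp
  qed
  have le: "q' y \<le> q (y + smul (of_real t) x) - t * q x" if "t \<ge> 0" for t y
    unfolding q'_def using that by (intro cINF_lower bdd) auto
  have add: "q' (y + z) \<le> q' y + q' z" for y z
  proof -
    \<comment> \<open>The parameters \<open>s\<close> for \<open>y\<close> and \<open>t\<close> for
      \<open>z\<close> combine to \<open>s + t\<close> for \<open>y + z\<close>; the two infima are
      then taken one after the other.\<close>
    have *: "q' (y + z) - (q (z + smul (of_real t) x) - t * q x)
        \<le> q (y + smul (of_real s) x) - s * q x" if "s \<ge> 0" "t \<ge> 0" for s t
      using le[of "s + t" "y + z"] that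
        sub[of "y + smul (of_real s) x" "z + smul (of_real t) x"]
      by (simp add: algebra_simps scale_left_distrib)
    have "q' (y + z) - (q (z + smul (of_real t) x) - t * q x) \<le> q' y" if "t \<ge> 0" for t
      unfolding q'_def[of y] using *[OF _ that] by (intro cINF_greatest) auto
    then have "q' (y + z) - q' y \<le> q (z + smul (of_real t) x) - t * q x" if "t \<ge> 0" for t
      using that by (simp add: algebra_simps)
    then have "q' (y + z) - q' y \<le> q' z"
      unfolding q'_def[of z] by (intro cINF_greatest) auto
    then show ?thesis by simp
  qed
  have hom: "q' (smul (of_real r) y) \<le> r * q' y" if r: "r > 0" for r y
  proof -
    have "q' (smul (of_real r) y) / r \<le> q (y + smul (of_real t) x) - t * q x" if "t \<ge> 0" for t
    proof -
      have "q' (smul (of_real r) y) \<le> q (smul (of_real r) y + smul (of_real (r * t)) x) - (r * t) * q x"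
        using r that by (intro le) simp
      also have "smul (of_real r) y + smul (of_real (r * t)) x = smul (of_real r) (y + smul (of_real t) x)"
        by (simp add: scale_right_distrib)
      finally show ?thesis using r scale[of r "y + smul (of_real t) x"]
        by (simp add: field_simps)
    qed
    then have "q' (smul (of_real r) y) / r \<le> q' y"
      unfolding q'_def[of y] by (intro cINF_greatest) auto
    then show ?thesis using r by (simp add: field_simps)
  qed
  show thesis
  proof
    show "sublinear q'" unfolding sublinear_def using add hom by blast
    show "q' y \<le> q y" for y using le[of 0 y] by simp
    show "q' y \<le> q (y + x) - q x" for y using le[of 1 y] by simp
  qed
qed

text \<open>Zorn's lemma applies for the reversed order, since the infimum of a nonempty chain of
  sublinear functionals is sublinear. A minimal functional equals its own lowering in every
  direction \<open>y\<close>, which turns subadditivity into additivity.\<close>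

lemma sublinear_minimal:
  assumes q: "sublinear q"
  obtains m where "sublinear m" "\<And>x. m x \<le> q x" "\<And>x y. m (x + y) = m x + m y"
proof -
  define S where "S = {m. sublinear m \<and> m \<le> q}"
  have "\<exists>m\<in>S. \<forall>m'\<in>S. m' \<le> m \<longrightarrow> m' = m"
  proof (rule predicate_Zorn)
    show "partial_order_on S (relation_of (\<lambda>m m'. m' \<le> m) S)"
      by (rule partial_order_on_relation_ofI) auto
    fix C assume C: "C \<in> Chains (relation_of (\<lambda>m m'. m' \<le> m) S)"
    show "\<exists>u\<in>S. \<forall>m\<in>C. u \<le> m"
    proof (cases "C = {}")
      case True
      then show ?thesis using q by (auto simp: S_def)
    next
      case False
      have CS: "sublinear m" "m \<le> q" if "m \<in> C" for m
        using C that by (auto simp: Chains_def relation_of_def S_def)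
      have tot: "m \<le> m' \<or> m' \<le> m" if "m \<in> C" "m' \<in> C" for m m'
        using C that by (auto simp: Chains_def relation_of_def)
      define u where "u x = (INF m\<in>C. m x)" for x
      \<comment> \<open>A sublinear functional below \<open>q\<close> is at least
        \<open>- q (- x)\<close> at \<open>x\<close>, so chains have finite infima.\<close>
      have "bdd_below ((\<lambda>m. m x) ` C)" for x
      proof (rule bdd_belowI2[where m = "- q (- x)"])
        fix m assume "m \<in> C"
        then show "- q (- x) \<le> m x"
          using sublinear_ge[OF CS(1)] CS(2) by (metis le_funD neg_le_iff_le order_trans)
      qed
      then have le: "u x \<le> m x" if "m \<in> C" for x m
        unfolding u_def using that by (intro cINF_lower) auto
      have add: "u (x + y) \<le> u x + u y" for x y
      proof -
        \<comment> \<open>In a chain the smaller of \<open>m\<close> and \<open>m'\<close> serves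
          both arguments.\<close>
        have *: "u (x + y) \<le> m x + m' y" if m: "m \<in> C" "m' \<in> C" for m m'
        proof -
          have "\<exists>n\<in>C. n x \<le> m x \<and> n y \<le> m' y"
            using tot[OF m] m by (auto simp: le_fun_def)
          then obtain n where n: "n \<in> C" "n x \<le> m x" "n y \<le> m' y" by blast
          have "n (x + y) \<le> n x + n y" using CS(1)[OF n(1)] by (simp add: sublinear_def)
          then show ?thesis using le[OF n(1), of "x + y"] n by linarith
        qed
        have "u (x + y) - m' y \<le> u x" if "m' \<in> C" for m'
          unfolding u_def[of x] using False *[OF _ that] by (intro cINF_greatest) (auto simp: algebra_simps)
        then have "u (x + y) - u x \<le> u y"
          unfolding u_def[of y] using False by (intro cINF_greatest) (auto simp: algebra_simps)
        then show ?thesis by simp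
      qed
      have hom: "u (smul (of_real r) x) \<le> r * u x" if r: "r > 0" for r x
      proof -
        have "u (smul (of_real r) x) / r \<le> m x" if "m \<in> C" for m
          using le[OF that, of "smul (of_real r) x"] sublinear_scale[OF CS(1)[OF that] r, of x] r
          by (simp add: field_simps)
        then have "u (smul (of_real r) x) / r \<le> u x"
          unfolding u_def[of x] using False by (intro cINF_greatest) auto
        then show ?thesis using r by (simp add: field_simps)
      qed
      have "u \<le> q" using False le CS(2) by (meson ex_in_conv le_funD le_funI order_trans)
      then have "u \<in> S" using add hom by (simp add: S_def sublinear_def)
      moreover have "\<forall>m\<in>C. u \<le> m" using le by (auto simp: le_fun_def)
      ultimately show ?thesis by blast
    qed
  qed
  then obtain m where m: "sublinear m" "m \<le> q"
    and min: "\<And>m'. sublinear m' \<Longrightarrow> m' \<le> m \<Longrightarrow> m' = m"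
    by (auto simp: S_def dest: order_trans)
  show thesis
  proof
    show "sublinear m" by fact
    show "m x \<le> q x" for x using m(2) by (auto simp: le_fun_def)
    show "m (x + y) = m x + m y" for x y
    proof (rule antisym)
      show "m (x + y) \<le> m x + m y" using m(1) by (simp add: sublinear_def)
      obtain m' where m': "sublinear m'" "\<And>z. m' z \<le> m z" "\<And>z. m' z \<le> m (z + y) - m y"
        using sublinear_shave[OF m(1), of y] by blast
      then have "m' = m" by (intro min) (auto simp: le_fun_def)
      then show "m x + m y \<le> m (x + y)" using m'(3)[of x] by simp
    qed
  qed
qed

text \<open>A minimal functional is taken below the seminorm lowered in the direction
  \<open>x\<close>, so that its value at \<open>- x\<close> is at most
  \<open>- p \<alpha> x\<close>. Its complexification is bounded by the seminorm and attains it at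
  \<open>x\<close>.\<close>

theorem Hahn_Banach: "\<exists>\<phi>\<in>polar \<alpha>. \<phi> x = of_real (p \<alpha> x)"
proof -
  have "sublinear (p \<alpha>)"
    by (auto simp: sublinear_def seminorm_scale intro: seminorm_triangle)
  then obtain q where q: "sublinear q" "\<And>y. q y \<le> p \<alpha> y" "\<And>y. q y \<le> p \<alpha> (y + x) - p \<alpha> x"
    by (rule sublinear_shave[of _ x]) blast
  obtain m where m: "sublinear m" "\<And>y. m y \<le> q y" "\<And>y z. m (y + z) = m y + m z"
    using sublinear_minimal[OF q(1)] by blast
  have m0: "m 0 = 0" using sublinear_zero[OF m(1)] .
  have mneg: "m (- y) = - m y" for y using m(3)[of y "- y"] m0 by simp
  have mscale: "m (smul (of_real r) y) = r * m y" for r y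
  proof (cases r "0 :: real" rule: linorder_cases)
    case less
    then have "m (smul (of_real (- r)) y) = - r * m y" by (intro sublinear_scale m) simp
    then show ?thesis using mneg[of "smul (of_real r) y"] by (simp add: scale_minus_left)
  qed (use m0 sublinear_scale[OF m(1)] in auto)
  \<comment> \<open>A complex linear functional is determined by its real part \<open>m\<close>; its
    imaginary part at \<open>y\<close> is \<open>- m\<close> of \<open>smul \<i> y\<close>.\<close>
  define \<phi> where "\<phi> y = Complex (m y) (- m (smul \<i> y))" for y
  have add: "\<phi> (y + z) = \<phi> y + \<phi> z" for y z
    by (simp add: \<phi>_def m(3) scale_right_distrib complex_eq_iff)
  have scale: "\<phi> (smul c y) = c * \<phi> y" for c y
  proof -
    have c: "c = of_real (Re c) + of_real (Im c) * \<i>" by (simp add: complex_eq_iff)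
    have "smul c y = smul (of_real (Re c)) y + smul (of_real (Im c)) (smul \<i> y)"
      by (subst c) (simp add: scale_left_distrib)
    then have 1: "m (smul c y) = Re c * m y + Im c * m (smul \<i> y)"
      by (simp only: m(3) mscale)
    have ic: "\<i> * c = of_real (Re c) * \<i> + of_real (- Im c)" by (simp add: complex_eq_iff)
    have "smul (\<i> * c) y = smul (of_real (Re c)) (smul \<i> y) + smul (of_real (- Im c)) y"
      unfolding ic by (simp only: scale_left_distrib scale_scale)
    then have 2: "m (smul (\<i> * c) y) = Re c * m (smul \<i> y) - Im c * m y"
      by (simp only: m(3) mscale)
    show ?thesis
      by (simp add: \<phi>_def 1 2 complex_eq_iff algebra_simps)
  qed
  have bound: "cmod (\<phi> y) \<le> p \<alpha> y" for y
  proof (cases "\<phi> y = 0")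
    case False
    \<comment> \<open>Rotating \<open>y\<close> makes the value real and nonnegative, so that only
      the real part \<open>m\<close> has to be estimated.\<close>
    define c where "c = cnj (sgn (\<phi> y))"
    have c: "cmod c = 1" using False by (simp add: c_def norm_sgn)
    have "\<phi> (smul c y) = of_real (cmod (\<phi> y))"
      unfolding scale c_def using False
      by (simp add: sgn_div_norm scaleR_conv_of_real field_simps complex_norm_square[symmetric] power2_eq_square
          flip: of_real_mult)
    then have "cmod (\<phi> y) = Re (\<phi> (smul c y))" by simp
    also have "\<dots> = m (smul c y)" by (simp add: \<phi>_def)
    also have "\<dots> \<le> p \<alpha> (smul c y)" using m(2) q(2) order_trans by blast
    finally show ?thesis using c by (simp add: seminorm_scale)
  qed simp
  have "m (- x) \<le> - p \<alpha> x" using m(2)[of "- x"] q(3)[of "- x"] by simp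
  then have "Re (\<phi> x) \<ge> p \<alpha> x" using mneg[of x] by (simp add: \<phi>_def)
  \<comment> \<open>A real part that reaches a bound of the modulus leaves no room for an imaginary
    part.\<close>
  then have "\<phi> x = of_real (p \<alpha> x)" using bound[of x]
    by (smt (verit, ccfv_SIG) cmod_power2 complex_Re_le_cmod complex_eq_iff Re_complex_of_real Im_complex_of_real
        power2_eq_square mult_eq_0_iff add_cancel_right_right)
  moreover have "\<phi> \<in> polar \<alpha>"
    using bound dualI[of \<phi> 1 \<alpha>, OF add scale] by (simp add: polar_def)
  ultimately show ?thesis by blast
qed

text \<open>The form in which the Hahn-Banach theorem is used: scalar estimates whose constants
  depend on the seminorm, and not on the functional, pass to the space without loss.\<close>

lemma seminorm_leI: "(\<And>\<phi>. \<phi> \<in> polar \<alpha> \<Longrightarrow> cmod (\<phi> x) \<le> C) \<Longrightarrow> p \<alpha> x \<le> C"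
  using Hahn_Banach[of \<alpha> x] by force

lemma polarD: "\<phi> \<in> polar \<alpha> \<Longrightarrow> \<phi> \<in> dual smul" "\<phi> \<in> polar \<alpha> \<Longrightarrow> cmod (\<phi> x) \<le> p \<alpha> x"
  by (auto simp: polar_def)

lemma dual_separates: "(\<And>\<phi>. \<phi> \<in> dual smul \<Longrightarrow> \<phi> x = \<phi> y) \<Longrightarrow> x = y"
proof -
  assume *: "\<And>\<phi>. \<phi> \<in> dual smul \<Longrightarrow> \<phi> x = \<phi> y"
  have "p \<alpha> (x - y) = 0" for \<alpha>
    by (rule antisym[OF seminorm_leI]) (auto simp: dual_diff[OF polarD(1)] * polarD(1))
  then show ?thesis using eq_zero_if_seminorms[of "x - y"] by simp
qed

end

section \<open>Pettis integrals and weak holomorphy\<close>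

lemma integrable_exp_minus_abs:
  assumes "d > 0"
  shows "integrable lborel (\<lambda>t::real. exp (- d * \<bar>t\<bar>))"
proof -
  have "set_integrable lborel {0..} (\<lambda>t. exp (- d * t))"
  proof -
    have "(\<lambda>t. exp (- d * t)) absolutely_integrable_on {0..}"
      using integrable_on_exp_minus_to_infinity[OF assms, of 0]
      by (intro nonnegative_absolutely_integrable_1) auto
    then show ?thesis
      unfolding set_integrable_def by (subst (asm) integrable_completion) auto
  qed
  then have 1: "integrable lborel (\<lambda>t. indicator {0..} t *\<^sub>R exp (- d * t))"
    by (simp add: set_integrable_def)
  then have 2: "integrable lborel (\<lambda>t. indicator {0..} (- t) *\<^sub>R exp (- d * - t))"
    using lborel_integrable_real_affine[OF 1, of "-1" 0] by simp
  show ?thesis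
    by (rule Bochner_Integration.integrable_bound[OF Bochner_Integration.integrable_add[OF 1 2]])
      (auto simp: indicator_def)
qed

text \<open>The integrands live on contours whose velocity jumps, or on half-lines extended by 0, so
  continuity fails at finitely many parameters.\<close>

lemma borel_measurable_except_finite:
  assumes "finite S" "\<And>t. t \<notin> S \<Longrightarrow> (f \<longlongrightarrow> f t) (at t)"
  shows "f \<in> borel_measurable (lborel :: real measure)"
proof -
  have "f \<in> borel_measurable borel"
    by (rule borel_measurable_continuous_countable_exceptions[where X=S])
      (use assms in \<open>auto simp: continuous_on_def countable_finite intro: tendsto_within_subset\<close>)
  then show ?thesis by simp
qed

lemma norm_integral_le_exp:
  fixes f :: "real \<Rightarrow> complex"
  assumes "d > 0" "\<And>t. cmod (f t) \<le> C * exp (- d * \<bar>t\<bar>)"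
  shows "cmod (integral\<^sup>L lborel f) \<le> C * (\<integral>t. exp (- d * \<bar>t\<bar>) \<partial>lborel)"
proof -
  have "cmod (integral\<^sup>L lborel f) \<le> (\<integral>t. cmod (f t) \<partial>lborel)" by simp
  also have "\<dots> \<le> (\<integral>t. C * exp (- d * \<bar>t\<bar>) \<partial>lborel)"
    by (rule integral_mono_AE'[OF integrable_mult_right[OF integrable_exp_minus_abs[OF assms(1)]] AE_I2 AE_I2])
      (rule assms(2), rule order_trans[OF norm_ge_zero assms(2)])
  finally show ?thesis by simp
qed

lemma integrable_exp_bound:
  fixes f :: "real \<Rightarrow> complex"
  assumes "f \<in> borel_measurable lborel" "d > 0" "\<And>t. cmod (f t) \<le> C * exp (- d * \<bar>t\<bar>)"
  shows "integrable lborel f"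
  by (rule Bochner_Integration.integrable_bound[OF integrable_mult_right[OF integrable_exp_minus_abs[OF assms(2)], of C] assms(1)])
    (use assms(3) in \<open>auto intro!: AE_I2 order_trans[OF _ abs_ge_self]\<close>)

text \<open>The point is the constant: it depends on \<open>g\<close> only through the bound
  \<open>M\<close>. The remainder is thus uniform over all functions with that bound, in particular
  over the functionals in a polar.\<close>

lemma holomorphic_bounded_taylor:
  assumes g: "g holomorphic_on ball z0 r" and r: "r > 0"
    and M: "\<And>z. z \<in> ball z0 r \<Longrightarrow> cmod (g z) \<le> M" and h: "cmod h < r / 4"
  shows "cmod (g (z0 + h) - g z0 - deriv g z0 * h) \<le> 8 / r\<^sup>2 * M * (cmod h)\<^sup>2"
proof -
  have der: "((deriv ^^ i) g has_field_derivative (deriv ^^ Suc i) g x) (at x within ball z0 (r/4))"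
    if "x \<in> ball z0 (r/4)" for i x
  proof -
    have x: "x \<in> ball z0 r" using that r by auto
    have "(deriv ^^ i) g holomorphic_on ball z0 r" by (rule holomorphic_higher_deriv[OF g]) simp
    from holomorphic_derivI[OF this open_ball x] show ?thesis
      by (simp add: has_field_derivative_at_within)
  qed
  \<comment> \<open>Cauchy's inequality on the disc of radius \<open>r / 2\<close> around
    \<open>x\<close> gives \<open>2! M / (r / 2)^2 = 8 M / r^2\<close>; points within
    \<open>r / 4\<close> of the centre leave room for that disc.\<close>
  have bd: "cmod ((deriv ^^ Suc 1) g x) \<le> 8 / r\<^sup>2 * M" if "x \<in> ball z0 (r/4)" for x
  proof -
    have sub: "cball x (r/2) \<subseteq> ball z0 r"
    proof
      fix y assume "y \<in> cball x (r/2)"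
      then show "y \<in> ball z0 r" using dist_triangle[of z0 y x] that r by (auto simp: dist_commute)
    qed
    have "cmod ((deriv ^^ 2) g x) \<le> fact 2 * M / (r/2)^2"
    proof (rule Cauchy_inequality)
      show "g holomorphic_on ball x (r/2)"
        by (rule holomorphic_on_subset[OF g]) (use sub in auto)
      show "continuous_on (cball x (r/2)) g"
        by (rule continuous_on_subset[OF holomorphic_on_imp_continuous_on[OF g] sub])
      show "cmod (g y) \<le> M" if "cmod (x - y) = r/2" for y
        using that sub by (intro M) (auto simp: dist_norm)
    qed (use r in auto)
    then show ?thesis by (simp add: power2_eq_square numeral_2_eq_2)
  qed
  have "cmod ((deriv ^^ 0) g (z0 + h) - (\<Sum>i\<le>1. (deriv ^^ i) g z0 * (z0 + h - z0) ^ i / fact i))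
      \<le> 8 / r\<^sup>2 * M * cmod (z0 + h - z0) ^ Suc 1 / fact 1"
    by (rule complex_Taylor[where S = "ball z0 (r/4)", OF _ der bd])
      (use h r in \<open>auto simp: dist_norm\<close>)
  then show ?thesis by (simp add: algebra_simps power2_eq_square)
qed

text \<open>Holomorphy on a disc and Cauchy's inequality turn the majorant \<open>g\<close> of the
  integrand into the majorant \<open>8 g / r\<close> of all difference quotients, to which dominated
  convergence applies. No estimate of the derivative has to be supplied.\<close>

lemma has_field_derivative_parametric_integral:
  fixes k k' :: "complex \<Rightarrow> real \<Rightarrow> complex"
  assumes \<Omega>: "open \<Omega>" "z0 \<in> \<Omega>"
    and der: "\<And>z t. z \<in> \<Omega> \<Longrightarrow> ((\<lambda>z. k z t) has_field_derivative k' z t) (at z)"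
    and meas: "\<And>z. z \<in> \<Omega> \<Longrightarrow> k z \<in> borel_measurable lborel"
    and r: "r > 0" "ball z0 r \<subseteq> \<Omega>"
    and g: "integrable lborel g" "\<And>z t. z \<in> ball z0 r \<Longrightarrow> cmod (k z t) \<le> g t"
  shows "((\<lambda>z. \<integral>t. k z t \<partial>lborel) has_field_derivative (\<integral>t. k' z0 t \<partial>lborel)) (at z0)"
proof -
  have int: "integrable lborel (k z)" if "z \<in> ball z0 r" for z
    using g(2)[OF that] r(2) that
    by (intro Bochner_Integration.integrable_bound[OF g(1) meas]) (auto intro!: AE_I2 order_trans[OF _ abs_ge_self])
  \<comment> \<open>With \<open>cmod h < r / 4\<close> the Taylor remainder contributes
    \<open>2 g / r\<close> and the first derivative another \<open>2 g / r\<close>; the factor 8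
    leaves slack.\<close>
  have bd: "cmod ((k (z0 + h) t - k z0 t) / h) \<le> 8 * g t / r" if h: "h \<noteq> 0" "cmod h < r / 4" for h t
  proof -
    have hol: "(\<lambda>z. k z t) holomorphic_on ball z0 r"
      using der r(2) by (meson holomorphic_on_open open_ball subsetD)
    have M: "\<And>z. z \<in> ball z0 r \<Longrightarrow> cmod (k z t) \<le> g t" using g(2) by blast
    have g0: "0 \<le> g t" using M[of z0] r(1) by (auto intro: order_trans[OF norm_ge_zero])
    have d1: "cmod (deriv (\<lambda>z. k z t) z0) \<le> 2 * g t / r"
    proof -
      have "cmod ((deriv ^^ 1) (\<lambda>z. k z t) z0) \<le> fact 1 * g t / (r/2)^1"
      proof (rule Cauchy_inequality)
        show "(\<lambda>z. k z t) holomorphic_on ball z0 (r/2)"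
          by (rule holomorphic_on_subset[OF hol]) (use r in auto)
        show "continuous_on (cball z0 (r/2)) (\<lambda>z. k z t)"
          by (rule continuous_on_subset[OF holomorphic_on_imp_continuous_on[OF hol]]) (use r in auto)
        show "cmod (k y t) \<le> g t" if "cmod (z0 - y) = r/2" for y
          using that r by (intro M) (auto simp: dist_norm)
      qed (use r in auto)
      then show ?thesis by (simp add: mult.commute)
    qed
    have "cmod (k (z0 + h) t - k z0 t) \<le> cmod (k (z0 + h) t - k z0 t - deriv (\<lambda>z. k z t) z0 * h)
        + cmod (deriv (\<lambda>z. k z t) z0 * h)"
      using norm_triangle_ineq[of "k (z0 + h) t - k z0 t - deriv (\<lambda>z. k z t) z0 * h" "deriv (\<lambda>z. k z t) z0 * h"] by simp
    also have "\<dots> \<le> 8 / r\<^sup>2 * g t * (cmod h)\<^sup>2 + 2 * g t / r * cmod h"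
      using holomorphic_bounded_taylor[OF hol r(1) M h(2)] d1
      by (intro add_mono) (auto simp: norm_mult simp del: times_divide_eq_left intro: mult_right_mono)
    also have "8 / r\<^sup>2 * g t * (cmod h)\<^sup>2 \<le> 8 / r\<^sup>2 * g t * (r / 4 * cmod h)"
      using h g0 by (intro mult_left_mono) (auto simp: power2_eq_square intro!: mult_right_mono)
    also have "8 / r\<^sup>2 * g t * (r / 4 * cmod h) + 2 * g t / r * cmod h = 4 * g t / r * cmod h"
      using r by (simp add: field_simps power2_eq_square)
    also have "\<dots> \<le> 8 * g t / r * cmod h"
      using r g0 by (intro mult_right_mono divide_right_mono) auto
    finally show ?thesis using h by (simp add: norm_divide field_simps)
  qed
  have "((\<lambda>h. ((\<integral>t. k (z0 + h) t \<partial>lborel) - (\<integral>t. k z0 t \<partial>lborel)) / h) \<longlongrightarrow> (\<integral>t. k' z0 t \<partial>lborel))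
      (at 0 within ball 0 (r/4))"
    \<comment> \<open>Dominated convergence is for sequences, so the limit at 0 is tested along
      arbitrary sequences in a punctured disc.\<close>
    unfolding tendsto_at_iff_sequentially comp_def
  proof (intro allI impI)
    fix X :: "nat \<Rightarrow> complex" assume X: "\<forall>n. X n \<in> ball 0 (r/4) - {0}" and lim: "X \<longlonglongrightarrow> 0"
    have X': "X n \<noteq> 0" "cmod (X n) < r / 4" for n using X by (auto simp: dist_norm)
    have in_ball: "z0 + X n \<in> ball z0 r" for n using X'(2)[of n] r(1) by (simp add: dist_norm)
    have in_O: "z0 + X n \<in> \<Omega>" for n using in_ball r(2) by blast
    have lim_k: "(\<lambda>n. (k (z0 + X n) t - k z0 t) / X n) \<longlonglongrightarrow> k' z0 t" for t
    proof -
      have "((\<lambda>h. (k (z0 + h) t - k z0 t) / h) \<longlongrightarrow> k' z0 t) (at 0)"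
        using der[OF \<Omega>(2), of t] by (simp add: DERIV_def)
      then show ?thesis
        using X' lim unfolding tendsto_at_iff_sequentially comp_def by auto
    qed
    have meas_q: "(\<lambda>t. (k (z0 + X n) t - k z0 t) / X n) \<in> borel_measurable lborel" for n
      using meas[OF in_O] meas[OF \<Omega>(2)] by (intro borel_measurable_divide borel_measurable_diff) auto
    have "(\<lambda>n. \<integral>t. (k (z0 + X n) t - k z0 t) / X n \<partial>lborel) \<longlonglongrightarrow> (\<integral>t. k' z0 t \<partial>lborel)"
    proof (rule integral_dominated_convergence)
      show "k' z0 \<in> borel_measurable lborel"
        by (rule borel_measurable_LIMSEQ_metric[OF meas_q lim_k])
      show "integrable lborel (\<lambda>t. 8 * g t / r)" using g(1) by auto
      show "AE t in lborel. cmod ((k (z0 + X n) t - k z0 t) / X n) \<le> 8 * g t / r" for n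
        using bd[OF X'] by blast
    qed (use meas_q lim_k in auto)
    moreover have "(\<integral>t. (k (z0 + X n) t - k z0 t) / X n \<partial>lborel) =
        ((\<integral>t. k (z0 + X n) t \<partial>lborel) - (\<integral>t. k z0 t \<partial>lborel)) / X n" for n
      using Bochner_Integration.integral_diff[OF int[OF in_ball[of n]] int[of z0]] r(1) by simp
    ultimately show "(\<lambda>n. ((\<integral>t. k (z0 + X n) t \<partial>lborel) - (\<integral>t. k z0 t \<partial>lborel)) / X n)
        \<longlonglongrightarrow> (\<integral>t. k' z0 t \<partial>lborel)"
      by (simp only:)
  qed
  moreover have "at 0 within ball 0 (r/4) = at (0::complex)"
    using r by (intro at_within_open) auto
  ultimately show ?thesis by (simp add: DERIV_def)
qed

section \<open>Pettis integrals and vector-valued holomorphic functions\<close>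

context lc_hausdorff
begin

lemma has_pettis_integral_unique:
  "has_pettis_integral smul M f v \<Longrightarrow> has_pettis_integral smul M f w \<Longrightarrow> v = w"
  by (rule dual_separates) (auto simp: has_pettis_integral_def)

definition pettis :: "(real \<Rightarrow> 'e) \<Rightarrow> 'e" where
  "pettis f = (THE v. has_pettis_integral smul lborel f v)"

lemma pettis_eqI: "has_pettis_integral smul lborel f v \<Longrightarrow> pettis f = v"
  unfolding pettis_def using has_pettis_integral_unique by blast

lemma hol_tendsto:
  assumes "f \<in> hol smul \<Omega>" "z \<in> \<Omega>"
  shows "(f \<longlongrightarrow> f z) (at z)"
proof -
  obtain l where l: "((\<lambda>h. smul (inverse h) (f (z + h) - f z)) \<longlongrightarrow> l) (at 0)"
    using assms by (auto simp: hol_def)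
  have "((\<lambda>h. smul h (smul (inverse h) (f (z + h) - f z)) + f z) \<longlongrightarrow> smul 0 l + f z) (at 0)"
    by (intro tendsto_lc_add tendsto_smul tendsto_ident_at l tendsto_const)
  then have "((\<lambda>h. smul h (smul (inverse h) (f (z + h) - f z)) + f z) \<longlongrightarrow> f z) (at 0)" by simp
  then have "((\<lambda>h. f (z + h)) \<longlongrightarrow> f z) (at 0)"
    by (rule Lim_transform_eventually) (auto simp: eventually_at_filter)
  then show ?thesis by (rule LIM_offset_zero_cancel)
qed

lemma hol_continuous_on: "f \<in> hol smul \<Omega> \<Longrightarrow> continuous_on \<Omega> f"
  by (auto simp: continuous_on_def intro: tendsto_within_subset[OF hol_tendsto])

lemma hol_weak:
  assumes "f \<in> hol smul \<Omega>" "open \<Omega>" "\<phi> \<in> dual smul"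
  shows "(\<lambda>z. \<phi> (f z)) holomorphic_on \<Omega>"
  unfolding holomorphic_on_open[OF assms(2)]
proof
  fix z assume "z \<in> \<Omega>"
  then obtain l where l: "((\<lambda>h. smul (inverse h) (f (z + h) - f z)) \<longlongrightarrow> l) (at 0)"
    using assms by (auto simp: hol_def)
  from dual_tendsto[OF assms(3) l]
  have "((\<lambda>h. (\<phi> (f (z + h)) - \<phi> (f z)) / h) \<longlongrightarrow> \<phi> l) (at 0)"
    by (simp add: dual_scale[OF assms(3)] dual_diff[OF assms(3)] divide_inverse mult.commute)
  then show "\<exists>l. ((\<lambda>z. \<phi> (f z)) has_field_derivative l) (at z)"
    by (auto simp: DERIV_def)
qed

lemma continuous_on_compact_bounded:
  assumes "continuous_on K f" "compact K"
  obtains C where "C \<ge> 0" "\<And>z. z \<in> K \<Longrightarrow> p \<alpha> (f z) \<le> C"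
proof -
  have "bounded ((\<lambda>z. p \<alpha> (f z)) ` K)"
    by (intro compact_imp_bounded compact_continuous_image continuous_on_seminorm assms)
  then obtain C where "\<And>z. z \<in> K \<Longrightarrow> \<bar>p \<alpha> (f z)\<bar> \<le> C" by (auto simp: bounded_iff)
  then show thesis by (intro that[of "max 0 C"]) (auto simp: le_max_iff_disj)
qed

lemma hol_cong:
  assumes "f \<in> hol smul \<Omega>" "open \<Omega>" "\<And>z. z \<in> \<Omega> \<Longrightarrow> f z = g z"
  shows "g \<in> hol smul \<Omega>"
  unfolding hol_def
proof safe
  fix z assume z: "z \<in> \<Omega>"
  then obtain l where l: "((\<lambda>h. smul (inverse h) (f (z + h) - f z)) \<longlongrightarrow> l) (at 0)"
    using assms by (auto simp: hol_def)
  have "open ((\<lambda>h. z + h) -` \<Omega>)" using assms(2) by (intro open_vimage continuous_intros)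
  then have "\<forall>\<^sub>F h in at 0. z + h \<in> \<Omega>"
    using z eventually_at_topological[of "\<lambda>h. z + h \<in> \<Omega>" 0 UNIV] by auto
  then have "\<forall>\<^sub>F h in at 0. smul (inverse h) (f (z + h) - f z) = smul (inverse h) (g (z + h) - g z)"
    by (rule eventually_mono) (simp add: assms(3) z)
  then show "\<exists>l. ((\<lambda>h. smul (inverse h) (g (z + h) - g z)) \<longlongrightarrow> l) (at 0)"
    using Lim_transform_eventually[OF l, of "\<lambda>h. smul (inverse h) (g (z + h) - g z)"] by blast
qed

lemma hol_Un: "f \<in> hol smul \<Omega> \<Longrightarrow> f \<in> hol smul \<Omega>' \<Longrightarrow> f \<in> hol smul (\<Omega> \<union> \<Omega>')"
  by (auto simp: hol_def)

lemma hol_subset: "f \<in> hol smul \<Omega> \<Longrightarrow> \<Omega>' \<subseteq> \<Omega> \<Longrightarrow> f \<in> hol smul \<Omega>'"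
  by (auto simp: hol_def)

lemma hol_zero: "(\<lambda>_. 0) \<in> hol smul \<Omega>"
  by (auto simp: hol_def intro!: exI[of _ 0])

lemma hol_add: "f \<in> hol smul \<Omega> \<Longrightarrow> g \<in> hol smul \<Omega> \<Longrightarrow> (\<lambda>z. f z + g z) \<in> hol smul \<Omega>"
  unfolding hol_def
proof safe
  fix z assume "\<forall>z\<in>\<Omega>. \<exists>l. ((\<lambda>h. smul (inverse h) (f (z + h) - f z)) \<longlongrightarrow> l) (at 0)"
    "\<forall>z\<in>\<Omega>. \<exists>l. ((\<lambda>h. smul (inverse h) (g (z + h) - g z)) \<longlongrightarrow> l) (at 0)" "z \<in> \<Omega>"
  then obtain l m where "((\<lambda>h. smul (inverse h) (f (z + h) - f z)) \<longlongrightarrow> l) (at 0)"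
    "((\<lambda>h. smul (inverse h) (g (z + h) - g z)) \<longlongrightarrow> m) (at 0)" by blast
  then have "((\<lambda>h. smul (inverse h) (f (z + h) - f z) + smul (inverse h) (g (z + h) - g z)) \<longlongrightarrow> l + m) (at 0)"
    by (rule tendsto_lc_add)
  moreover have "smul (inverse h) (f (z + h) - f z) + smul (inverse h) (g (z + h) - g z) =
      smul (inverse h) (f (z + h) + g (z + h) - (f z + g z))" for h
    by (simp only: scale_right_distrib[symmetric]) (simp add: algebra_simps del: scale_right_distrib)
  ultimately show "\<exists>l. ((\<lambda>h. smul (inverse h) (f (z + h) + g (z + h) - (f z + g z))) \<longlongrightarrow> l) (at 0)"
    by (simp only:) (rule exI)
qed

lemma hol_smul: "f \<in> hol smul \<Omega> \<Longrightarrow> (\<lambda>z. smul c (f z)) \<in> hol smul \<Omega>"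
  unfolding hol_def
proof safe
  fix z assume "\<forall>z\<in>\<Omega>. \<exists>l. ((\<lambda>h. smul (inverse h) (f (z + h) - f z)) \<longlongrightarrow> l) (at 0)" "z \<in> \<Omega>"
  then obtain l where "((\<lambda>h. smul (inverse h) (f (z + h) - f z)) \<longlongrightarrow> l) (at 0)" by blast
  then have "((\<lambda>h. smul c (smul (inverse h) (f (z + h) - f z))) \<longlongrightarrow> smul c l) (at 0)"
    by (intro tendsto_smul tendsto_const)
  moreover have "smul c (smul (inverse h) (f (z + h) - f z)) =
      smul (inverse h) (smul c (f (z + h)) - smul c (f z))" for h
    by (simp add: scale_right_diff_distrib mult.commute)
  ultimately show "\<exists>l. ((\<lambda>h. smul (inverse h) (smul c (f (z + h)) - smul c (f z))) \<longlongrightarrow> l) (at 0)"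
    by (simp only:) (rule exI)
qed

lemma hol_minus: "f \<in> hol smul \<Omega> \<Longrightarrow> (\<lambda>z. - f z) \<in> hol smul \<Omega>"
  using hol_smul[of f \<Omega> "-1"] by (simp add: scale_minus_left)

lemma hol_diff: "f \<in> hol smul \<Omega> \<Longrightarrow> g \<in> hol smul \<Omega> \<Longrightarrow> (\<lambda>z. f z - g z) \<in> hol smul \<Omega>"
  using hol_add[OF _ hol_minus, of f \<Omega> g] by simp

lemma has_pettis_integral_bound:
  assumes "has_pettis_integral smul lborel f v" "d > 0" "\<And>t. p \<alpha> (f t) \<le> C * exp (- d * \<bar>t\<bar>)"
  shows "p \<alpha> v \<le> C * (\<integral>t. exp (- d * \<bar>t\<bar>) \<partial>lborel)"
proof (rule seminorm_leI)
  fix \<phi> assume \<phi>: "\<phi> \<in> polar \<alpha>"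
  then have "\<phi> v = (\<integral>t. \<phi> (f t) \<partial>lborel)"
    using assms(1) polarD(1)[OF \<phi>] by (auto simp: has_pettis_integral_def)
  also have "cmod \<dots> \<le> C * (\<integral>t. exp (- d * \<bar>t\<bar>) \<partial>lborel)"
    by (intro norm_integral_le_exp assms(2) order_trans[OF polarD(2)[OF \<phi>] assms(3)])
  finally show "cmod (\<phi> v) \<le> C * (\<integral>t. exp (- d * \<bar>t\<bar>) \<partial>lborel)" .
qed

end

section \<open>Consequences of sequential completeness\<close>

locale sc_lc_hausdorff = lc_hausdorff smul p
  for smul :: "complex \<Rightarrow> 'e :: {ab_group_add, t2_space} \<Rightarrow> 'e" and p :: "'i \<Rightarrow> 'e \<Rightarrow> real" +
  assumes sequentially_complete: "seq_complete p"
begin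

text \<open>The integral is the limit of the Riemann sums \<open>v n\<close>. Tested on a functional
  dominated by a seminorm, the error is at most the scalar integral of that seminorm of the step
  function minus \<open>f\<close>. This bound is the same for all such functionals and tends to 0 by
  dominated convergence, so the sums form a Cauchy sequence and their limit has the required images
  under all functionals.\<close>

lemma pettis_exists:
  fixes f :: "real \<Rightarrow> 'e"
  assumes S: "finite S" and cont: "\<And>t. t \<notin> S \<Longrightarrow> (f \<longlongrightarrow> f t) (at t)"
    and bound: "\<And>\<alpha>. \<exists>C d. d > 0 \<and> (\<forall>t. p \<alpha> (f t) \<le> C * exp (- d * \<bar>t\<bar>))"
  shows "\<exists>v. has_pettis_integral smul lborel f v"
proof -
  define N where "N n = real (Suc n)" for n
  have N: "N n > 0" for n by (simp add: N_def)
  \<comment> \<open>With cells of length \<open>1 / (n + 1)\<close> these \<open>2 n (n + 1)\<close>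
    indices tile the interval from \<open>- n\<close> to \<open>n\<close>, so mesh and truncation
    improve together.\<close>
  define J where "J n = {- int (n * Suc n)..<int (n * Suc n)}" for n
  define fl where "fl n t = \<lfloor>N n * t\<rfloor>" for n and t :: real
  define F where "F n t = (if fl n t \<in> J n then f (of_int (fl n t) / N n) else 0)" for n t
  define v where "v n = (\<Sum>j\<in>J n. smul (of_real (1 / N n)) (f (of_int j / N n)))" for n
  have close: "of_int (fl n t) / N n \<le> t \<and> t < of_int (fl n t) / N n + 1 / N n" for n t
    using N[of n] unfolding fl_def by (simp add: field_simps) linarith
  have phi_f: "(\<lambda>t. \<phi> (f t)) \<in> borel_measurable lborel" if "\<phi> \<in> dual smul" for \<phi>
    by (rule borel_measurable_except_finite[OF S]) (rule dual_tendsto[OF that cont])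
  have int_f: "integrable lborel (\<lambda>t. \<phi> (f t))" if \<phi>: "\<phi> \<in> dual smul" for \<phi>
  proof -
    obtain B \<alpha> where B: "B > 0" "\<And>x. cmod (\<phi> x) \<le> B * p \<alpha> x" using \<phi> by (rule dual_bounded) (rule that)
    obtain C d where "d > 0" "\<And>t. p \<alpha> (f t) \<le> C * exp (- d * \<bar>t\<bar>)" using bound by blast
    then have "cmod (\<phi> (f t)) \<le> B * (C * exp (- d * \<bar>t\<bar>))" for t
      using order_trans[OF B(2) mult_left_mono] B(1) by (simp add: less_imp_le)
    then show ?thesis
      using \<open>d > 0\<close> by (intro integrable_exp_bound[OF phi_f[OF \<phi>], of d "B * C"]) (simp_all add: mult.assoc)
  qed
  have phi_v: "integrable lborel (\<lambda>t. \<phi> (F n t)) \<and> (\<integral>t. \<phi> (F n t) \<partial>lborel) = \<phi> (v n)"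
    if \<phi>: "\<phi> \<in> dual smul" for \<phi> n
  proof -
    have eq: "\<phi> (F n t) = (\<Sum>j\<in>J n. indicator {of_int j / N n..<of_int j / N n + 1 / N n} t *\<^sub>R \<phi> (f (of_int j / N n)))"
      (is "_ = sum ?g _") for t
    proof -
      have "fl n t = j \<longleftrightarrow> of_int j / N n \<le> t \<and> t < of_int j / N n + 1 / N n" for j
        unfolding fl_def floor_eq_iff using N[of n] by (simp add: field_simps)
      then have "sum ?g (J n) = (\<Sum>j\<in>J n. if j = fl n t then \<phi> (f (of_int j / N n)) else 0)"
        by (intro sum.cong) (simp_all add: indicator_def eq_commute[of _ "fl n t"])
      also have "\<dots> = \<phi> (F n t)" by (simp add: F_def J_def dual_zero[OF \<phi>])
      finally show ?thesis by simp
    qed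
    have "(\<integral>t. indicator {of_int j / N n..<of_int j / N n + 1 / N n} t *\<^sub>R \<phi> (f (of_int j / N n)) \<partial>lborel)
        = of_real (1 / N n) * \<phi> (f (of_int j / N n))" for j
      using N[of n] by (simp add: scaleR_conv_of_real)
    moreover have int: "integrable lborel (\<lambda>t. indicator {of_int j / N n..<of_int j / N n + 1 / N n} t *\<^sub>R \<phi> (f (of_int j / N n)))" for j
      using N[of n] by (intro integrable_scaleR_left integrable_real_indicator) (auto simp: ennreal_less_top)
    ultimately show ?thesis unfolding eq
      by (subst Bochner_Integration.integral_sum)
        (auto simp: v_def dual_sum[OF \<phi>] dual_scale[OF \<phi>])
  qed
  \<comment> \<open>A real function that controls all functionals dominated by
    \<open>p \<alpha>\<close> at once.\<close>
  define e where "e \<alpha> n t = p \<alpha> (F n t - f t)" for \<alpha> n t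
  have e_lim: "(\<lambda>n. e \<alpha> n t) \<longlonglongrightarrow> 0" if "t \<notin> S" for \<alpha> t
  proof -
    have "(\<lambda>n. of_int (fl n t) / N n) \<longlonglongrightarrow> t"
    proof (rule tendsto_sandwich[where f = "\<lambda>n. t - 1 / N n" and h = "\<lambda>n. t"])
      have "(\<lambda>n. t - 1 / N n) \<longlonglongrightarrow> t - 0"
        unfolding N_def by (intro tendsto_intros LIMSEQ_Suc lim_const_over_n)
      then show "(\<lambda>n. t - 1 / N n) \<longlonglongrightarrow> t" by simp
    qed (use close in \<open>auto intro!: always_eventually simp: diff_le_eq less_imp_le\<close>)
    then have "(\<lambda>n. f (of_int (fl n t) / N n)) \<longlonglongrightarrow> f t"
      using tendsto_compose[OF cont[OF that]] by blast
    then have "(\<lambda>n. p \<alpha> (f (of_int (fl n t) / N n) - f t)) \<longlonglongrightarrow> 0"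
      by (simp add: tendsto_iff_seminorm)
    moreover have "\<forall>\<^sub>F n in sequentially. e \<alpha> n t = p \<alpha> (f (of_int (fl n t) / N n) - f t)"
    proof (rule eventually_sequentiallyI[of "nat \<lceil>\<bar>t\<bar>\<rceil> + 1"])
      fix n assume "nat \<lceil>\<bar>t\<bar>\<rceil> + 1 \<le> n"
      then have n: "\<bar>t\<bar> + 1 \<le> real n" by linarith
      have "N n * \<bar>t\<bar> \<le> N n * (real n - 1)" using n N[of n] by (intro mult_left_mono) auto
      moreover have "\<bar>N n * t\<bar> = N n * \<bar>t\<bar>" using N[of n] by (simp add: abs_mult)
      moreover have "N n * (real n - 1) \<le> real (n * Suc n) - 1" by (simp add: N_def algebra_simps)
      ultimately have "\<bar>N n * t\<bar> \<le> real (n * Suc n) - 1" by linarith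
      then have "fl n t \<in> J n" unfolding fl_def J_def
        by (simp add: abs_le_iff le_floor_iff floor_less_iff)
      then show "e \<alpha> n t = p \<alpha> (f (of_int (fl n t) / N n) - f t)" by (simp add: e_def F_def)
    qed
    ultimately show ?thesis by (subst tendsto_cong) auto
  qed
  have e_meas: "e \<alpha> n \<in> borel_measurable lborel" for \<alpha> n
    unfolding e_def
  \<comment> \<open>The sample point depends on \<open>t\<close> only through the countably many
    values of \<open>fl n\<close>; for a fixed value \<open>j\<close> the expression is continuous
    in \<open>t\<close> off \<open>S\<close>.\<close>
  proof (rule measurable_compose_countable[where g = "fl n"
        and f = "\<lambda>j t. p \<alpha> ((if j \<in> J n then f (of_int j / N n) else 0) - f t)", folded F_def])
    show "fl n \<in> lborel \<rightarrow>\<^sub>M count_space UNIV" unfolding fl_def by measurable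
    show "(\<lambda>t. p \<alpha> ((if j \<in> J n then f (of_int j / N n) else 0) - f t)) \<in> borel_measurable lborel" for j
      by (rule borel_measurable_except_finite[OF S])
        (intro tendsto_seminorm tendsto_lc_diff tendsto_const cont)
  qed
  have e_int_lim: "(\<lambda>n. \<integral>t. e \<alpha> n t \<partial>lborel) \<longlonglongrightarrow> 0" and e_int: "integrable lborel (e \<alpha> n)" for \<alpha> n
  proof -
    obtain C d where d: "d > 0" and C: "\<And>t. p \<alpha> (f t) \<le> C * exp (- d * \<bar>t\<bar>)" using bound by blast
    have C0: "C \<ge> 0" using order_trans[OF seminorm_nonneg C[of 0]] by simp
    \<comment> \<open>The sample point lies within 1 of \<open>t\<close>, which costs the factor
      \<open>exp d\<close>.\<close>
    have F: "p \<alpha> (F n t) \<le> C * exp d * exp (- d * \<bar>t\<bar>)" for n t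
    proof -
      have "1 / N n \<le> 1" by (simp add: N_def)
      then have "\<bar>t\<bar> \<le> \<bar>of_int (fl n t) / N n\<bar> + 1" using close[of n t] by linarith
      then have "exp (- d * \<bar>of_int (fl n t) / N n\<bar>) \<le> exp (d - d * \<bar>t\<bar>)"
        using d mult_left_mono[of "\<bar>t\<bar>" "\<bar>of_int (fl n t) / N n\<bar> + 1" d] by (simp add: algebra_simps)
      then have "C * exp (- d * \<bar>of_int (fl n t) / N n\<bar>) \<le> C * (exp d * exp (- d * \<bar>t\<bar>))"
        using C0 by (intro mult_left_mono) (simp_all flip: exp_add)
      then show ?thesis using C[of "of_int (fl n t) / N n"] C0 by (auto simp: F_def mult.assoc)
    qed
    have le: "e \<alpha> n t \<le> (C * exp d + C) * exp (- d * \<bar>t\<bar>)" for n t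
      using seminorm_triangle_diff[of \<alpha> "F n t" "f t"] F[of n t] C[of t] by (simp add: e_def algebra_simps)
    have bdd: "integrable lborel (\<lambda>t. (C * exp d + C) * exp (- d * \<bar>t\<bar>))"
      using integrable_exp_minus_abs[OF d] by simp
    have "AE t in lborel. t \<notin> S" by (rule AE_not_in) (simp add: S countable_imp_null_set_lborel countable_finite)
    then have ae: "AE t in lborel. (\<lambda>n. e \<alpha> n t) \<longlonglongrightarrow> 0"
      by (rule AE_mp) (auto intro!: AE_I2 e_lim)
    have ae2: "AE t in lborel. norm (e \<alpha> n t) \<le> (C * exp d + C) * exp (- d * \<bar>t\<bar>)" for n
      using le by (simp add: e_def)
    show "integrable lborel (e \<alpha> n)"
      using le by (intro Bochner_Integration.integrable_bound[OF bdd e_meas] AE_I2) (auto simp: e_def simp del: mult_minus_left intro!: order_trans[OF _ abs_ge_self])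
    have "(\<lambda>n. \<integral>t. e \<alpha> n t \<partial>lborel) \<longlonglongrightarrow> integral\<^sup>L lborel (\<lambda>t :: real. 0 :: real)"
    proof (rule integral_dominated_convergence[OF _ _ bdd])
      show "(\<lambda>t. 0 :: real) \<in> borel_measurable lborel" by simp
    qed (rule e_meas ae ae2)+
    then show "(\<lambda>n. \<integral>t. e \<alpha> n t \<partial>lborel) \<longlonglongrightarrow> 0" by simp
  qed
  have err: "cmod (\<phi> (v n) - (\<integral>t. \<phi> (f t) \<partial>lborel)) \<le> B * (\<integral>t. e \<alpha> n t \<partial>lborel)"
    if \<phi>: "\<phi> \<in> dual smul" "\<And>x. cmod (\<phi> x) \<le> B * p \<alpha> x" for \<phi> B \<alpha> n
  proof -
    have "\<phi> (v n) - (\<integral>t. \<phi> (f t) \<partial>lborel) = (\<integral>t. \<phi> (F n t - f t) \<partial>lborel)"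
      using phi_v[OF \<phi>(1), of n] int_f[OF \<phi>(1)] by (simp add: dual_diff[OF \<phi>(1)])
    also have "cmod \<dots> \<le> (\<integral>t. B * e \<alpha> n t \<partial>lborel)"
      by (rule order_trans[OF integral_norm_bound integral_mono_AE'[OF integrable_mult_right[OF e_int] AE_I2 AE_I2]])
        (simp_all add: e_def \<phi>(2) order_trans[OF norm_ge_zero \<phi>(2)])
    finally show ?thesis by simp
  qed
  have "convergent v"
  proof (rule sequentially_complete[unfolded seq_complete_def, rule_format])
    fix \<alpha> and \<epsilon> :: real assume "\<epsilon> > 0"
    then obtain M where M: "\<And>n. n \<ge> M \<Longrightarrow> \<bar>\<integral>t. e \<alpha> n t \<partial>lborel\<bar> < \<epsilon> / 3"
      using e_int_lim[of \<alpha>] unfolding LIMSEQ_iff by (metis diff_zero divide_pos_pos real_norm_def zero_less_numeral)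
    have "p \<alpha> (v m - v n) < \<epsilon>" if "m \<ge> M" "n \<ge> M" for m n
    proof -
      \<comment> \<open>\<open>seminorm_leI\<close> yields only a weak inequality; thirds instead of
        halves make the final one strict.\<close>
      have "p \<alpha> (v m - v n) \<le> 2 * \<epsilon> / 3"
      proof (rule seminorm_leI)
        fix \<phi> assume \<phi>: "\<phi> \<in> polar \<alpha>"
        let ?I = "\<integral>t. \<phi> (f t) \<partial>lborel"
        have le: "cmod (\<phi> (v k) - ?I) \<le> \<epsilon> / 3" if "k \<ge> M" for k
          using err[of \<phi> 1 \<alpha> k] polarD[OF \<phi>] M[OF that] by auto
        have "\<phi> (v m - v n) = (\<phi> (v m) - ?I) - (\<phi> (v n) - ?I)"
          by (simp add: dual_diff[OF polarD(1)[OF \<phi>]])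
        also have "cmod \<dots> \<le> \<epsilon> / 3 + \<epsilon> / 3"
          using that by (intro order_trans[OF norm_triangle_ineq4 add_mono] le)
        finally show "cmod (\<phi> (v m - v n)) \<le> 2 * \<epsilon> / 3" by simp
      qed
      then show ?thesis using \<open>\<epsilon> > 0\<close> by simp
    qed
    then show "\<exists>M. \<forall>m\<ge>M. \<forall>n\<ge>M. p \<alpha> (v m - v n) < \<epsilon>" by blast
  qed
  then obtain w where w: "v \<longlonglongrightarrow> w" by (auto simp: convergent_def)
  have "\<phi> w = (\<integral>t. \<phi> (f t) \<partial>lborel)" if \<phi>: "\<phi> \<in> dual smul" for \<phi>
  proof -
    obtain B \<alpha> where B: "B > 0" "\<And>x. cmod (\<phi> x) \<le> B * p \<alpha> x" using \<phi> by (rule dual_bounded) (rule that)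
    have "(\<lambda>n. B * (\<integral>t. e \<alpha> n t \<partial>lborel)) \<longlonglongrightarrow> 0" by (intro tendsto_mult_right_zero e_int_lim)
    then have "(\<lambda>n. cmod (\<phi> (v n) - (\<integral>t. \<phi> (f t) \<partial>lborel))) \<longlonglongrightarrow> 0"
      by (rule tendsto_0_if_nonneg_le) (use err[OF \<phi> B(2)] in auto)
    then have "(\<lambda>n. \<phi> (v n)) \<longlonglongrightarrow> (\<integral>t. \<phi> (f t) \<partial>lborel)"
      by (rule LIM_zero_cancel[OF tendsto_norm_zero_cancel])
    then show ?thesis using dual_tendsto[OF \<phi> w] LIMSEQ_unique by blast
  qed
  then show ?thesis using int_f by (auto simp: has_pettis_integral_def)
qed

text \<open>The Taylor bound is uniform over a polar once the seminorm of \<open>f\<close> is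
  bounded near the point, so the difference quotients satisfy an estimate of
  \<open>D h - D k\<close> by a multiple of \<open>cmod h + cmod k\<close>. Sequential completeness
  yields a limit along \<open>1 / (n + 1)\<close>, and the same estimate extends it to the full
  limit at 0.\<close>

lemma hol_if_weakly_hol:
  assumes weak: "\<And>\<phi>. \<phi> \<in> dual smul \<Longrightarrow> (\<lambda>z. \<phi> (f z)) holomorphic_on \<Omega>" and \<Omega>: "open \<Omega>"
    and bdd: "\<And>\<alpha> z0. z0 \<in> \<Omega> \<Longrightarrow> \<exists>r>0. \<exists>C. \<forall>z\<in>ball z0 r. p \<alpha> (f z) \<le> C"
  shows "f \<in> hol smul \<Omega>"
  unfolding hol_def
proof safe
  fix z0 assume z0: "z0 \<in> \<Omega>"
  define D where "D h = smul (inverse h) (f (z0 + h) - f z0)" for h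
  have key: "\<exists>r>0. \<exists>K\<ge>0. \<forall>h k. h \<noteq> 0 \<longrightarrow> k \<noteq> 0 \<longrightarrow> cmod h < r \<longrightarrow> cmod k < r \<longrightarrow>
      p \<alpha> (D h - D k) \<le> K * (cmod h + cmod k)" for \<alpha>
  proof -
    obtain r1 C where r1: "r1 > 0" "\<forall>z\<in>ball z0 r1. p \<alpha> (f z) \<le> C" using bdd[OF z0] by blast
    obtain r2 where r2: "r2 > 0" "ball z0 r2 \<subseteq> \<Omega>" using \<Omega> z0 openE by blast
    define r where "r = min r1 r2"
    have r: "r > 0" "ball z0 r \<subseteq> \<Omega>" and C: "\<And>z. z \<in> ball z0 r \<Longrightarrow> p \<alpha> (f z) \<le> C"
      using r1 r2 by (auto simp: r_def)
    have C0: "C \<ge> 0" using order_trans[OF seminorm_nonneg C[of z0]] r(1) by simp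
    have "p \<alpha> (D h - D k) \<le> 8 / r\<^sup>2 * C * (cmod h + cmod k)"
      if h: "h \<noteq> 0" "cmod h < r / 4" and k: "k \<noteq> 0" "cmod k < r / 4" for h k
    proof (rule seminorm_leI)
      fix \<phi> assume \<phi>: "\<phi> \<in> polar \<alpha>"
      define g where "g z = \<phi> (f z)" for z
      have g: "g holomorphic_on ball z0 r"
        unfolding g_def by (rule holomorphic_on_subset[OF weak[OF polarD(1)[OF \<phi>]] r(2)])
      have M: "cmod (g z) \<le> C" if "z \<in> ball z0 r" for z
        unfolding g_def using polarD(2)[OF \<phi>] C[OF that] order_trans by blast
      have one: "cmod (\<phi> (D h) - deriv g z0) \<le> 8 / r\<^sup>2 * C * cmod h" if h: "h \<noteq> 0" "cmod h < r / 4" for h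
      proof -
        have "\<phi> (D h) - deriv g z0 = (g (z0 + h) - g z0 - deriv g z0 * h) / h"
          using h by (simp add: D_def g_def dual_scale[OF polarD(1)[OF \<phi>]] dual_diff[OF polarD(1)[OF \<phi>]] field_simps)
        then show ?thesis
          using holomorphic_bounded_taylor[OF g r(1) M h(2)] h(1)
          by (simp add: norm_divide pos_divide_le_eq power2_eq_square)
      qed
      have "cmod (\<phi> (D h - D k)) \<le> cmod (\<phi> (D h) - deriv g z0) + cmod (\<phi> (D k) - deriv g z0)"
        using norm_triangle_ineq4[of "\<phi> (D h) - deriv g z0" "\<phi> (D k) - deriv g z0"]
        by (simp add: dual_diff[OF polarD(1)[OF \<phi>]])
      then show "cmod (\<phi> (D h - D k)) \<le> 8 / r\<^sup>2 * C * (cmod h + cmod k)"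
        using one[OF h] one[OF k] by (simp only: distrib_left)
    qed
    then show ?thesis using r C0 by (intro exI[of _ "r/4"] conjI exI[of _ "8 / r\<^sup>2 * C"]) auto
  qed
  define X where "X n = (of_real (1 / real (Suc n)) :: complex)" for n
  have X0: "X n \<noteq> 0" for n unfolding X_def of_real_eq_0_iff by simp
  have Xn: "cmod (X n) = 1 / real (Suc n)" for n unfolding X_def norm_of_real by simp
  have Xlim: "(\<lambda>n. cmod (X n)) \<longlonglongrightarrow> 0" unfolding Xn by (rule LIMSEQ_Suc[OF lim_const_over_n])
  have "convergent (\<lambda>n. D (X n))"
  proof (rule sequentially_complete[unfolded seq_complete_def, rule_format])
    fix \<alpha> and \<epsilon> :: real assume "\<epsilon> > 0"
    obtain r K where rK: "r > 0" "K \<ge> 0" and K: "\<And>h k. h \<noteq> 0 \<Longrightarrow> k \<noteq> 0 \<Longrightarrow> cmod h < r \<Longrightarrow> cmod k < r \<Longrightarrow>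
      p \<alpha> (D h - D k) \<le> K * (cmod h + cmod k)" using key[of \<alpha>] by blast
    have "\<forall>\<^sub>F n in sequentially. cmod (X n) < min r (\<epsilon> / (2 * (K + 1)))"
      using \<open>\<epsilon> > 0\<close> rK by (intro order_tendstoD[OF Xlim]) auto
    then obtain M where M: "\<And>n. n \<ge> M \<Longrightarrow> cmod (X n) < min r (\<epsilon> / (2 * (K + 1)))"
      by (auto simp: eventually_sequentially)
    have "p \<alpha> (D (X m) - D (X n)) < \<epsilon>" if "m \<ge> M" "n \<ge> M" for m n
    proof -
      have "\<epsilon> / (2 * (K + 1)) + \<epsilon> / (2 * (K + 1)) = \<epsilon> / (K + 1)" using rK by (simp add: divide_simps)
      then have "cmod (X m) + cmod (X n) < \<epsilon> / (K + 1)" using M[OF that(1)] M[OF that(2)] by simp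
      then have "(K + 1) * (cmod (X m) + cmod (X n)) < \<epsilon>" using rK by (simp add: field_simps)
      moreover have "K * (cmod (X m) + cmod (X n)) \<le> (K + 1) * (cmod (X m) + cmod (X n))"
        by (intro mult_right_mono) auto
      ultimately show ?thesis using K[OF X0 X0, of m n] M[OF that(1)] M[OF that(2)] by simp
    qed
    then show "\<exists>M. \<forall>m\<ge>M. \<forall>n\<ge>M. p \<alpha> (D (X m) - D (X n)) < \<epsilon>" by blast
  qed
  then obtain l where l: "(\<lambda>n. D (X n)) \<longlonglongrightarrow> l" by (auto simp: convergent_def)
  have "(D \<longlongrightarrow> l) (at 0)"
    unfolding tendsto_iff_seminorm
  proof
    fix \<alpha>
    obtain r K where rK: "r > 0" "K \<ge> 0" and K: "\<And>h k. h \<noteq> 0 \<Longrightarrow> k \<noteq> 0 \<Longrightarrow> cmod h < r \<Longrightarrow> cmod k < r \<Longrightarrow>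
      p \<alpha> (D h - D k) \<le> K * (cmod h + cmod k)" using key[of \<alpha>] by blast
    \<comment> \<open>The second argument of \<open>key\<close> runs through \<open>X n\<close>,
      whose norm tends to 0; what remains of the bound is \<open>K * cmod h\<close>.\<close>
    have le: "p \<alpha> (D h - l) \<le> K * cmod h" if h: "h \<noteq> 0" "cmod h < r" for h
    proof (rule tendsto_le[OF sequentially_bot])
      show "(\<lambda>n. p \<alpha> (D h - D (X n))) \<longlonglongrightarrow> p \<alpha> (D h - l)"
        by (intro tendsto_seminorm tendsto_lc_diff tendsto_const l)
      have "(\<lambda>n. K * (cmod h + cmod (X n))) \<longlonglongrightarrow> K * (cmod h + 0)"
        by (intro tendsto_intros Xlim)
      then show "(\<lambda>n. K * (cmod h + cmod (X n))) \<longlonglongrightarrow> K * cmod h" by simp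
      have "\<forall>\<^sub>F n in sequentially. cmod (X n) < r"
        using rK by (intro order_tendstoD[OF Xlim])
      then show "\<forall>\<^sub>F n in sequentially. p \<alpha> (D h - D (X n)) \<le> K * (cmod h + cmod (X n))"
        by (rule eventually_mono) (use K h X0 in auto)
    qed
    have "((\<lambda>h. K * cmod h) \<longlongrightarrow> K * cmod 0) (at 0)" by (intro tendsto_intros)
    then have lim: "((\<lambda>h. K * cmod h) \<longlongrightarrow> 0) (at 0)" by simp
    have ev: "\<forall>\<^sub>F h in at 0. p \<alpha> (D h - l) \<le> K * cmod h"
      unfolding eventually_at using rK le by (intro exI[of _ r]) (auto simp: dist_norm)
    show "((\<lambda>h. p \<alpha> (D h - l)) \<longlongrightarrow> 0) (at 0)"
      by (rule tendsto_sandwich[OF _ ev tendsto_const lim]) simp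
  qed
  then show "\<exists>l. ((\<lambda>h. smul (inverse h) (f (z0 + h) - f z0)) \<longlongrightarrow> l) (at 0)"
    unfolding D_def by blast
qed

text \<open>The Laplace, Borel and Cauchy transforms below all have this shape: a scalar kernel,
  holomorphic in its parameter, against a fixed vector function. A locally uniform exponential
  majorant gives existence, the derivative of the scalarizations and strong holomorphy
  together.\<close>

lemma parametric_pettis_integral:
  fixes F :: "real \<Rightarrow> 'e" and s s' :: "complex \<Rightarrow> real \<Rightarrow> complex"
  assumes S: "finite S" and F: "\<And>t. t \<notin> S \<Longrightarrow> (F \<longlongrightarrow> F t) (at t)" and \<Omega>: "open \<Omega>"
    and der: "\<And>z t. z \<in> \<Omega> \<Longrightarrow> ((\<lambda>z. s z t) has_field_derivative s' z t) (at z)"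
    and cont: "\<And>z t. z \<in> \<Omega> \<Longrightarrow> t \<notin> S \<Longrightarrow> (s z \<longlongrightarrow> s z t) (at t)"
    and dom: "\<And>z0 \<alpha>. z0 \<in> \<Omega> \<Longrightarrow>
      \<exists>r C d. r > 0 \<and> d > 0 \<and> (\<forall>z\<in>ball z0 r. \<forall>t. cmod (s z t) * p \<alpha> (F t) \<le> C * exp (- d * \<bar>t\<bar>))"
  defines "v \<equiv> \<lambda>z. pettis (\<lambda>t. smul (s z t) (F t))"
  shows "\<And>z. z \<in> \<Omega> \<Longrightarrow> has_pettis_integral smul lborel (\<lambda>t. smul (s z t) (F t)) (v z)"
    and "\<And>z \<phi>. z \<in> \<Omega> \<Longrightarrow> \<phi> \<in> dual smul \<Longrightarrow>
      ((\<lambda>z. \<phi> (v z)) has_field_derivative (\<integral>t. s' z t * \<phi> (F t) \<partial>lborel)) (at z)"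
    and "v \<in> hol smul \<Omega>"
proof -
  have dom': "\<exists>r C d. r > 0 \<and> d > 0 \<and> ball z0 r \<subseteq> \<Omega> \<and> (\<forall>z\<in>ball z0 r. \<forall>t. p \<alpha> (smul (s z t) (F t)) \<le> C * exp (- d * \<bar>t\<bar>))"
    if z0: "z0 \<in> \<Omega>" for z0 \<alpha>
  proof -
    obtain r C d where "r > 0" "d > 0" "\<forall>z\<in>ball z0 r. \<forall>t. cmod (s z t) * p \<alpha> (F t) \<le> C * exp (- d * \<bar>t\<bar>)"
      using dom[OF z0, of \<alpha>] by blast
    moreover obtain r' where "r' > 0" "ball z0 r' \<subseteq> \<Omega>" using \<Omega> z0 openE by blast
    ultimately show ?thesis
      by (intro exI[of _ "min r r'"] exI[of _ C] exI[of _ d]) (auto simp: seminorm_scale)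
  qed
  show v: "has_pettis_integral smul lborel (\<lambda>t. smul (s z t) (F t)) (v z)" if "z \<in> \<Omega>" for z
  proof -
    have "\<exists>v. has_pettis_integral smul lborel (\<lambda>t. smul (s z t) (F t)) v"
    proof (rule pettis_exists[OF S])
      show "((\<lambda>t. smul (s z t) (F t)) \<longlongrightarrow> smul (s z t) (F t)) (at t)" if "t \<notin> S" for t
        using that \<open>z \<in> \<Omega>\<close> by (intro tendsto_smul cont F)
      show "\<exists>C d. d > 0 \<and> (\<forall>t. p \<alpha> (smul (s z t) (F t)) \<le> C * exp (- d * \<bar>t\<bar>))" for \<alpha>
        using dom'[OF that, of \<alpha>] by (meson centre_in_ball)
    qed
    then show ?thesis unfolding v_def using pettis_eqI by blast
  qed
  show *: "((\<lambda>z. \<phi> (v z)) has_field_derivative (\<integral>t. s' z t * \<phi> (F t) \<partial>lborel)) (at z)"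
    if z: "z \<in> \<Omega>" and \<phi>: "\<phi> \<in> dual smul" for z \<phi>
  proof -
    obtain B \<alpha> where B: "B > 0" "\<And>x. cmod (\<phi> x) \<le> B * p \<alpha> x" using \<phi> by (rule dual_bounded) (rule that)
    obtain r C d where r: "r > 0" "d > 0" "ball z r \<subseteq> \<Omega>"
      "\<And>w t. w \<in> ball z r \<Longrightarrow> p \<alpha> (smul (s w t) (F t)) \<le> C * exp (- d * \<bar>t\<bar>)" using dom'[OF z, of \<alpha>] by blast
    have "((\<lambda>z. \<integral>t. s z t * \<phi> (F t) \<partial>lborel) has_field_derivative (\<integral>t. s' z t * \<phi> (F t) \<partial>lborel)) (at z)"
    proof (rule has_field_derivative_parametric_integral[OF \<Omega> z _ _ r(1) r(3)])
      show "((\<lambda>w. s w t * \<phi> (F t)) has_field_derivative s' w t * \<phi> (F t)) (at w)" if "w \<in> \<Omega>" for w t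
        by (rule DERIV_cmult_right[OF der[OF that]])
      show "(\<lambda>t. s w t * \<phi> (F t)) \<in> borel_measurable lborel" if "w \<in> \<Omega>" for w
        by (rule borel_measurable_except_finite[OF S])
          (intro tendsto_mult cont[OF that] dual_tendsto[OF \<phi>] F)
      show "integrable lborel (\<lambda>t. B * (C * exp (- d * \<bar>t\<bar>)))"
        using integrable_exp_minus_abs[OF r(2)] by simp
      show "cmod (s w t * \<phi> (F t)) \<le> B * (C * exp (- d * \<bar>t\<bar>))" if "w \<in> ball z r" for w t
        using order_trans[OF B(2)[of "smul (s w t) (F t)"] mult_left_mono[OF r(4)[OF that, of t]]] B(1)
        by (simp add: dual_scale[OF \<phi>])
    qed
    moreover have "\<forall>\<^sub>F w in nhds z. \<phi> (v w) = (\<integral>t. s w t * \<phi> (F t) \<partial>lborel)"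
      unfolding eventually_nhds using \<Omega> z v \<phi>
      by (intro exI[of _ \<Omega>]) (auto simp: has_pettis_integral_def dual_scale)
    ultimately show ?thesis using DERIV_cong_ev[OF refl _ refl] by fast
  qed
  show "v \<in> hol smul \<Omega>"
  proof (rule hol_if_weakly_hol[OF _ \<Omega>])
    show "(\<lambda>z. \<phi> (v z)) holomorphic_on \<Omega>" if "\<phi> \<in> dual smul" for \<phi>
      unfolding holomorphic_on_open[OF \<Omega>] using *[OF _ that] by blast
    show "\<exists>r>0. \<exists>C. \<forall>z\<in>ball z0 r. p \<alpha> (v z) \<le> C" if z0: "z0 \<in> \<Omega>" for z0 \<alpha>
    proof -
      obtain r C d where r: "r > 0" "d > 0" "ball z0 r \<subseteq> \<Omega>"
        "\<And>w t. w \<in> ball z0 r \<Longrightarrow> p \<alpha> (smul (s w t) (F t)) \<le> C * exp (- d * \<bar>t\<bar>)" using dom'[OF z0, of \<alpha>] by blast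
      show ?thesis
        using has_pettis_integral_bound[OF v r(2) r(4)] r(1,3) by blast
    qed
  qed
qed

end

section \<open>Contours around a ray\<close>

definition ray :: "real \<Rightarrow> complex set" where
  "ray a = complex_of_real ` {a..}"

text \<open>The distance to \<open>ray a\<close> in closed form: the nearest point has the real part
  of \<open>z\<close> or is the vertex. The contour of radius \<open>c\<close> lies on the level set
  \<open>c\<close>.\<close>

definition dray :: "real \<Rightarrow> complex \<Rightarrow> real" where
  "dray a z = (if a \<le> Re z then \<bar>Im z\<bar> else cmod (z - of_real a))"

lemma mem_ray: "z \<in> ray a \<longleftrightarrow> Im z = 0 \<and> a \<le> Re z"
  by (auto simp: ray_def image_iff complex_eq_iff)

lemma closed_ray: "closed (ray a)"
proof -
  have "ray a = {z. Im z = 0} \<inter> {z. a \<le> Re z}" by (auto simp: mem_ray)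
  then show ?thesis
    by (auto intro!: closed_Int closed_Collect_eq closed_Collect_le continuous_intros)
qed

lemma open_slit: "open (- ray a)"
  using closed_ray by (simp add: open_Compl)

lemma dray_le:
  assumes "a \<le> x"
  shows "dray a z \<le> cmod (z - of_real x)"
proof (cases "a \<le> Re z")
  case True
  then show ?thesis using abs_Im_le_cmod[of "z - of_real x"] by (simp add: dray_def)
next
  case False
  have "cmod (z - of_real a) \<le> cmod (z - of_real x)"
    using False assms by (auto simp: cmod_def intro!: real_sqrt_le_mono abs_le_square_iff[THEN iffD1])
  then show ?thesis using False by (simp add: dray_def)
qed

lemma dray_attained: "\<exists>x\<ge>a. dray a z = cmod (z - of_real x)"
proof (cases "a \<le> Re z")
  case True
  then show ?thesis by (intro exI[of _ "Re z"]) (simp add: dray_def cmod_def)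
qed (auto simp: dray_def)

lemma dray_nonneg: "0 \<le> dray a z"
  by (simp add: dray_def)

lemma dray_triangle: "dray a z \<le> dray a w + cmod (z - w)"
proof -
  obtain x where x: "x \<ge> a" "dray a w = cmod (w - of_real x)" using dray_attained by blast
  then show ?thesis using dray_le[OF x(1), of z] norm_triangle_ineq[of "z - w" "w - of_real x"] by simp
qed

lemma continuous_on_dray: "continuous_on S (dray a)"
proof (rule continuous_on_subset[OF _ subset_UNIV], rule lipschitz_on_continuous_on)
  have "dist (dray a x) (dray a y) \<le> 1 * dist x y" for x y
    using dray_triangle[of a x y] dray_triangle[of a y x] by (simp add: dist_norm norm_minus_commute)
  then show "1-lipschitz_on UNIV (dray a)" by (intro lipschitz_onI) auto
qed

lemma dray_pos_iff: "dray a z > 0 \<longleftrightarrow> z \<notin> ray a"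
  by (auto simp: dray_def mem_ray complex_eq_iff)

lemma abs_Im_le_dray: "\<bar>Im z\<bar> \<le> dray a z"
  using abs_Im_le_cmod[of "z - of_real a"] by (simp add: dray_def)

lemma Re_ge_dray: "a - dray a z \<le> Re z"
  using abs_Re_le_cmod[of "z - of_real a"] by (auto simp: dray_def)

text \<open>Translation to the right maps the ray into itself.\<close>

lemma dray_add_nonneg:
  assumes "t \<ge> 0"
  shows "dray a (z + of_real t) \<le> dray a z"
proof -
  obtain x where x: "x \<ge> a" "dray a z = cmod (z - of_real x)" using dray_attained by blast
  have "z + of_real t - of_real (x + t) = z - of_real x" by simp
  then show ?thesis using dray_le[of a "x + t" "z + of_real t"] x assms by simp
qed

lemma starlike_slit: "starlike (- ray a)"
  unfolding starlike_def
proof (intro bexI ballI)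
  show "complex_of_real (a - 1) \<in> - ray a" by (simp add: mem_ray)
  fix z assume z: "z \<in> - ray a"
  show "closed_segment (complex_of_real (a - 1)) z \<subseteq> - ray a"
  proof
    fix w assume "w \<in> closed_segment (complex_of_real (a - 1)) z"
    then obtain u where u: "0 \<le> u" "u \<le> 1" "w = (1 - u) *\<^sub>R complex_of_real (a - 1) + u *\<^sub>R z"
      by (auto simp: in_segment)
    show "w \<in> - ray a"
    proof
      assume "w \<in> ray a"
      then have 1: "u * Im z = 0" and 2: "a \<le> (1 - u) * (a - 1) + u * Re z"
        using u by (auto simp: mem_ray)
      have "u \<noteq> 0" using 2 by auto
      then have "Re z < a" using 1 z by (auto simp: mem_ray)
      then have "u * Re z \<le> u * a" using u by (intro mult_left_mono) auto
      moreover have "(1 - u) * (a - 1) \<le> (1 - u) * a" using u by (intro mult_left_mono) auto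
      moreover have "u * Re z < u * a" using \<open>Re z < a\<close> \<open>u \<noteq> 0\<close> u by simp
      ultimately show False using 2 by (simp add: algebra_simps)
    qed
  qed
qed

text \<open>The slit plane is starlike with respect to \<open>a - 1\<close>, so primitives exist
  globally. This reduces Cauchy's theorem for the unbounded contours to limits of values of a
  primitive.\<close>

lemma slit_primitive:
  assumes "h holomorphic_on - ray a"
  obtains H where "\<And>z. z \<notin> ray a \<Longrightarrow> (H has_field_derivative h z) (at z)"
proof -
  have "\<exists>H. \<forall>z\<in>- ray a. (H has_field_derivative h z) (at z)"
  proof (rule holomorphic_starlike_primitive[OF _ starlike_slit open_slit finite.emptyI])
    show "h field_differentiable at z" if "z \<in> - ray a - {}" for z
      using that assms open_slit by (simp add: holomorphic_on_imp_differentiable_at)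
  qed (use assms in \<open>rule holomorphic_on_imp_continuous_on\<close>)
  then show thesis using that by auto
qed

lemma convex_primitive:
  assumes "h holomorphic_on U" "convex U" "open U"
  obtains H where "\<And>z. z \<in> U \<Longrightarrow> (H has_field_derivative h z) (at z)"
proof -
  obtain H where "\<And>z. z \<in> U \<Longrightarrow> (H has_field_derivative h z) (at z within U)"
    using holomorphic_convex_primitive'[OF assms(2,3,1)] by blast
  then show thesis using that assms(3) by (metis at_within_open)
qed

section \<open>The contour around the ray\<close>

definition path_deriv :: "real \<Rightarrow> real \<Rightarrow> complex" where
  "path_deriv c t = (if t \<le> -1 then -1
     else if t \<le> 1 then of_real c * (of_real (- pi / 2) * (\<i> * cis (pi - pi / 2 * t))) else 1)"

lemma path_right_mid:
  "-1 \<le> t \<Longrightarrow> t \<le> 1 \<Longrightarrow> path_right a c t = of_real a + of_real c * cis (pi - pi / 2 * t)"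
  by (auto simp: path_right_def complex_eq_iff cos_diff sin_diff)

lemma path_right_left: "t \<le> -1 \<Longrightarrow> path_right a c t = Complex (a - 1 - t) (- c)"
  by (simp add: path_right_def)

lemma path_right_right: "t \<ge> 1 \<Longrightarrow> path_right a c t = Complex (a - 1 + t) c"
  using path_right_mid[of 1 a c] by (cases "t = 1") (auto simp: path_right_def complex_eq_iff cos_diff sin_diff)

lemma continuous_on_path_right: "continuous_on S (path_right a c)"
proof (rule continuous_on_subset[OF _ subset_UNIV])
  have e: "3 * pi / 2 = 3 / 2 * pi" by simp
  have cs: "cos (3 * pi / 2) = 0" "sin (3 * pi / 2) = - 1" unfolding e by (rule cos_3over2_pi sin_3over2_pi)+
  have 1: "continuous_on {t \<in> UNIV. -1 \<le> t} (\<lambda>t. if t \<le> 1 then of_real a + of_real c * cis (pi - pi / 2 * t) else Complex (a - 1 + t) c)"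
    by (rule continuous_on_cases_le) (auto intro!: continuous_intros simp: complex_eq_iff cos_diff sin_diff Complex_eq)
  show "continuous_on UNIV (path_right a c)"
    unfolding path_right_def[abs_def]
    by (rule continuous_on_cases_le[OF _ 1]) (auto intro!: continuous_intros simp: complex_eq_iff cs Complex_eq)
qed

lemma cos_half_nonneg: "-1 \<le> t \<Longrightarrow> t \<le> 1 \<Longrightarrow> 0 \<le> cos (pi / 2 * t)"
  using mult_left_mono[of "-1" t "pi / 2"] mult_left_mono[of t 1 "pi / 2"] by (intro cos_ge_zero) auto

lemma dray_path_right:
  assumes "c > 0"
  shows "dray a (path_right a c t) = c"
proof -
  consider "t \<le> -1" | "-1 \<le> t" "t \<le> 1" | "t \<ge> 1" by linarith
  then show ?thesis
  proof cases
    case 2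
    \<comment> \<open>The half circle lies to the left of \<open>a\<close>; only its end points,
      where the cosine vanishes, reach the real part \<open>a\<close>.\<close>
    have "dray a (path_right a c t) = c" if "Re (path_right a c t) \<ge> a"
    proof -
      have "cos (pi / 2 * t) = 0"
        using that cos_half_nonneg[OF 2] assms by (simp add: path_right_mid[OF 2] cos_diff mult_le_0_iff)
      moreover from this have "\<bar>sin (pi / 2 * t)\<bar> = 1"
        using sin_cos_squared_add[of "pi / 2 * t"] by (auto simp: power2_eq_1_iff)
      ultimately show ?thesis using that assms
        by (simp add: dray_def path_right_mid[OF 2] sin_diff abs_mult)
    qed
    moreover have "dray a (path_right a c t) = c" if "\<not> Re (path_right a c t) \<ge> a"
      using that assms by (simp add: dray_def path_right_mid[OF 2] norm_mult)
    ultimately show ?thesis by blast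
  qed (use assms in \<open>auto simp: path_right_left path_right_right dray_def\<close>)
qed

lemma path_right_bounds:
  assumes "c > 0"
  shows "a - c \<le> Re (path_right a c t)" "a - c - 1 + \<bar>t\<bar> \<le> Re (path_right a c t)"
    "Re (path_right a c t) \<le> a + \<bar>t\<bar>" "\<bar>Im (path_right a c t)\<bar> \<le> c"
proof -
  show *: "a - c \<le> Re (path_right a c t)" using Re_ge_dray[of a "path_right a c t"] dray_path_right[OF assms] by simp
  show "\<bar>Im (path_right a c t)\<bar> \<le> c" using abs_Im_le_dray[of "path_right a c t" a] dray_path_right[OF assms] by simp
  consider "t \<le> -1" | "-1 \<le> t" "t \<le> 1" | "t \<ge> 1" by linarith
  then show "a - c - 1 + \<bar>t\<bar> \<le> Re (path_right a c t)" "Re (path_right a c t) \<le> a + \<bar>t\<bar>"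
  proof (atomize(full), cases)
    case 2
    have "Re (path_right a c t) \<le> a" using cos_half_nonneg[OF 2] assms by (simp add: path_right_mid[OF 2] cos_diff)
    then show "a - c - 1 + \<bar>t\<bar> \<le> Re (path_right a c t) \<and> Re (path_right a c t) \<le> a + \<bar>t\<bar>"
      using * 2 by auto
  qed (use assms in \<open>auto simp: path_right_left path_right_right\<close>)
qed

lemma path_right_abs_Re: "c > 0 \<Longrightarrow> \<bar>Re (path_right a c t)\<bar> \<le> \<bar>a\<bar> + c + \<bar>t\<bar>"
  using path_right_bounds[of c a t] by linarith

lemma path_right_notin_ray: "c > 0 \<Longrightarrow> path_right a c t \<notin> ray a"
  using dray_pos_iff[of a "path_right a c t"] dray_path_right[of c a t] by simp

lemma norm_path_deriv: "c > 0 \<Longrightarrow> cmod (path_deriv c t) \<le> 1 + 2 * c"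
proof -
  assume "c > 0"
  then have "c * pi \<le> c * 4" using pi_less_4 by (intro mult_left_mono) auto
  then have "c * pi \<le> 2 + 4 * c" using \<open>c > 0\<close> by linarith
  with \<open>c > 0\<close> show ?thesis by (simp add: path_deriv_def norm_mult)
qed

text \<open>At \<open>t = -1\<close> and \<open>t = 1\<close> the direction is continuous, but the
  speed changes between 1 and \<open>c * pi / 2\<close>; hence these two parameters are exceptional
  in everything that follows.\<close>

lemma path_right_vector_derivative:
  assumes "t \<notin> {-1, 1}"
  shows "(path_right a c has_vector_derivative path_deriv c t) (at t)"
proof -
  consider "t < -1" | "-1 < t" "t < 1" | "t > 1"
    using assms linorder_less_linear[of t "-1"] linorder_less_linear[of t 1] by auto
  then show ?thesis
  proof cases
    case 1
    have "((\<lambda>t. of_real (a - 1 - t) - \<i> * of_real c) has_vector_derivative -1) (at t)"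
      by (auto intro!: derivative_eq_intros simp: has_vector_derivative_complex_iff)
    then have "(path_right a c has_vector_derivative -1) (at t)"
      by (rule has_vector_derivative_transform_within_open[where S = "{..<-1}"])
        (use 1 in \<open>auto simp: path_right_left complex_eq_iff\<close>)
    then show ?thesis using 1 by (simp add: path_deriv_def)
  next
    case 2
    have "((\<lambda>t. of_real a + of_real c * cis (pi - pi / 2 * t)) has_vector_derivative
        of_real c * (of_real (- pi / 2) * (\<i> * cis (pi - pi / 2 * t)))) (at t)"
      unfolding has_vector_derivative_complex_iff
      by (auto intro!: derivative_eq_intros simp: algebra_simps)
    then have "(path_right a c has_vector_derivative
        of_real c * (of_real (- pi / 2) * (\<i> * cis (pi - pi / 2 * t)))) (at t)"
      by (rule has_vector_derivative_transform_within_open[where S = "{-1<..<1}"])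
        (use 2 in \<open>auto simp: path_right_mid\<close>)
    then show ?thesis using 2 by (simp add: path_deriv_def)
  next
    case 3
    have "((\<lambda>t. of_real (a - 1 + t) + \<i> * of_real c) has_vector_derivative 1) (at t)"
      by (auto intro!: derivative_eq_intros simp: has_vector_derivative_complex_iff)
    then have "(path_right a c has_vector_derivative 1) (at t)"
      by (rule has_vector_derivative_transform_within_open[where S = "{1<..}"])
        (use 3 in \<open>auto simp: path_right_right complex_eq_iff\<close>)
    then show ?thesis using 3 by (simp add: path_deriv_def)
  qed
qed

lemma path_deriv_tendsto:
  assumes "t \<notin> {-1, 1}"
  shows "(path_deriv c \<longlongrightarrow> path_deriv c t) (at t)"
proof -
  consider "t < -1" | "-1 < t" "t < 1" | "t > 1"
    using assms linorder_less_linear[of t "-1"] linorder_less_linear[of t 1] by auto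
  then have "isCont (path_deriv c) t"
  proof cases
    case 1
    have "continuous_on {..<-1} (path_deriv c)"
      by (rule continuous_on_eq[where f = "\<lambda>_. -1"]) (auto simp: path_deriv_def)
    then show ?thesis using 1 by (simp add: continuous_on_eq_continuous_at)
  next
    case 2
    have "continuous_on {-1<..<1} (path_deriv c)"
      by (rule continuous_on_eq[where f = "\<lambda>t. of_real c * (of_real (- pi / 2) * (\<i> * cis (pi - pi / 2 * t)))"])
        (auto simp: path_deriv_def intro!: continuous_intros)
    then show ?thesis using 2 by (simp add: continuous_on_eq_continuous_at)
  next
    case 3
    have "continuous_on {1<..} (path_deriv c)"
      by (rule continuous_on_eq[where f = "\<lambda>_. 1"]) (auto simp: path_deriv_def)
    then show ?thesis using 3 by (simp add: continuous_on_eq_continuous_at)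
  qed
  then show ?thesis by (simp add: isCont_def)
qed

section \<open>Contour integrals as limits of primitives\<close>

definition pint :: "real \<Rightarrow> real \<Rightarrow> (complex \<Rightarrow> complex) \<Rightarrow> complex" where
  "pint a c h = (\<integral>t. path_deriv c t * h (path_right a c t) \<partial>lborel)"

definition path_integrable :: "real \<Rightarrow> real \<Rightarrow> (complex \<Rightarrow> complex) \<Rightarrow> bool" where
  "path_integrable a c h \<longleftrightarrow> integrable lborel (\<lambda>t. path_deriv c t * h (path_right a c t))"

definition decays :: "complex set \<Rightarrow> (complex \<Rightarrow> complex) \<Rightarrow> bool" where
  "decays X h \<longleftrightarrow> (\<exists>C d. d > 0 \<and> (\<forall>z\<in>X. cmod (h z) \<le> C * exp (- d * Re z)))"

lemma decays_subset: "decays X h \<Longrightarrow> Y \<subseteq> X \<Longrightarrow> decays Y h"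
  unfolding decays_def by blast

text \<open>The region swept by the contours whose radii run from \<open>c1\<close> to
  \<open>c2\<close>.\<close>

definition band :: "real \<Rightarrow> real \<Rightarrow> real \<Rightarrow> complex set" where
  "band a c1 c2 = {z. c1 \<le> dray a z \<and> dray a z \<le> c2}"

lemma path_right_in_band: "c > 0 \<Longrightarrow> c1 \<le> c \<Longrightarrow> c \<le> c2 \<Longrightarrow> path_right a c t \<in> band a c1 c2"
  by (simp add: band_def dray_path_right)

lemma band_subset_slit: "0 < c1 \<Longrightarrow> band a c1 c2 \<subseteq> - ray a"
  using dray_pos_iff by (fastforce simp: band_def)

lemma compact_band_part: "compact (band a c1 c2 \<inter> {z. Re z \<le> R})"
proof -
  have eq: "band a c1 c2 \<inter> {z. Re z \<le> R} = {z. c1 \<le> dray a z} \<inter> {z. dray a z \<le> c2} \<inter> {z. Re z \<le> R}"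
    by (auto simp: band_def)
  have "closed (band a c1 c2 \<inter> {z. Re z \<le> R})"
    unfolding eq by (intro closed_Int closed_Collect_le continuous_on_dray continuous_intros)
  moreover have "bounded (band a c1 c2 \<inter> {z. Re z \<le> R})"
  proof (rule boundedI)
    fix z assume z: "z \<in> band a c1 c2 \<inter> {z. Re z \<le> R}"
    have "cmod z \<le> \<bar>Re z\<bar> + \<bar>Im z\<bar>" by (rule cmod_le)
    also have "\<dots> \<le> (\<bar>R\<bar> + \<bar>a\<bar> + \<bar>c2\<bar>) + \<bar>c2\<bar>"
      using z Re_ge_dray[of a z] abs_Im_le_dray[of z a] by (auto simp: band_def)
    finally show "cmod z \<le> (\<bar>R\<bar> + \<bar>a\<bar> + \<bar>c2\<bar>) + \<bar>c2\<bar>" .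
  qed
  ultimately show ?thesis by (simp add: compact_eq_bounded_closed)
qed

text \<open>Cut off at a real part \<open>R\<close>, the band is compact, so only its end at the
  right has to be estimated.\<close>

lemma decays_bandI:
  assumes cont: "continuous_on (band a c1 c2) h" and d: "d > 0"
    and bd: "\<And>z. z \<in> band a c1 c2 \<Longrightarrow> R \<le> Re z \<Longrightarrow> cmod (h z) \<le> C * exp (- d * Re z)"
  shows "decays (band a c1 c2) h"
proof -
  have "bounded (h ` (band a c1 c2 \<inter> {z. Re z \<le> R}))"
    by (intro compact_imp_bounded compact_continuous_image compact_band_part continuous_on_subset[OF cont]) auto
  then obtain B where B: "\<And>z. z \<in> band a c1 c2 \<Longrightarrow> Re z \<le> R \<Longrightarrow> cmod (h z) \<le> B"
    by (auto simp: bounded_iff)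
  have "cmod (h z) \<le> (\<bar>B\<bar> * exp (d * R) + \<bar>C\<bar>) * exp (- d * Re z)" if z: "z \<in> band a c1 c2" for z
  proof (cases "Re z \<le> R")
    case True
    have "cmod (h z) \<le> \<bar>B\<bar> * 1" using B[OF z True] by simp
    also have "\<dots> \<le> \<bar>B\<bar> * exp (d * R - d * Re z)" using True d by (intro mult_left_mono) auto
    also have "\<dots> \<le> (\<bar>B\<bar> * exp (d * R) + \<bar>C\<bar>) * exp (- d * Re z)"
      by (simp add: algebra_simps exp_diff exp_minus divide_inverse)
    finally show ?thesis .
  next
    case False
    then have "cmod (h z) \<le> \<bar>C\<bar> * exp (- d * Re z)"
      using bd[OF z] by (auto intro!: order_trans[OF _ mult_right_mono[of C "\<bar>C\<bar>"]])
    also have "\<dots> \<le> (\<bar>B\<bar> * exp (d * R) + \<bar>C\<bar>) * exp (- d * Re z)" by (intro mult_right_mono) auto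
    finally show ?thesis .
  qed
  then show ?thesis using d by (auto simp: decays_def)
qed

lemma path_integrableI:
  assumes c: "c > 0" and cont: "continuous_on (range (path_right a c)) h"
    and dec: "decays (range (path_right a c)) h"
  shows "path_integrable a c h"
proof -
  obtain C d where d: "d > 0" and C: "\<And>t. cmod (h (path_right a c t)) \<le> C * exp (- d * Re (path_right a c t))"
    using dec by (auto simp: decays_def)
  have cont': "continuous_on UNIV (\<lambda>t. h (path_right a c t))"
    by (rule continuous_on_compose2[OF cont continuous_on_path_right]) auto
  have "cmod (path_deriv c t * h (path_right a c t)) \<le> ((1 + 2 * c) * \<bar>C\<bar> * exp (- d * (a - c - 1))) * exp (- d * \<bar>t\<bar>)" for t
  proof -
    have "cmod (h (path_right a c t)) \<le> \<bar>C\<bar> * exp (- d * Re (path_right a c t))"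
      using C[of t] by (auto intro!: order_trans[OF _ mult_right_mono[of C "\<bar>C\<bar>"]])
    also have "\<dots> \<le> \<bar>C\<bar> * exp (- d * (a - c - 1 + \<bar>t\<bar>))"
      using path_right_bounds(2)[OF c, of a t] d by (intro mult_left_mono) auto
    finally have "cmod (path_deriv c t * h (path_right a c t)) \<le> (1 + 2 * c) * (\<bar>C\<bar> * exp (- d * (a - c - 1 + \<bar>t\<bar>)))"
      unfolding norm_mult using norm_path_deriv[OF c] c by (intro mult_mono) auto
    also have "exp (- d * (a - c - 1 + \<bar>t\<bar>)) = exp (- d * (a - c - 1)) * exp (- d * \<bar>t\<bar>)"
      by (simp flip: exp_add add: algebra_simps)
    finally show ?thesis by (simp only: mult.assoc)
  qed
  moreover have "(\<lambda>t. path_deriv c t * h (path_right a c t)) \<in> borel_measurable lborel"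
    by (rule borel_measurable_except_finite[of "{-1, 1}"])
      (use cont' in \<open>auto simp: continuous_on_def intro!: tendsto_mult path_deriv_tendsto\<close>)
  ultimately show ?thesis unfolding path_integrable_def by (intro integrable_exp_bound[OF _ d])
qed

text \<open>The part of the integral over the parameters from \<open>- T\<close> to \<open>T\<close>
  is an increment of the primitive, by the fundamental theorem with two exceptional points. Its end
  points lie over the same real part on the lines \<open>Im z = c\<close> and
  \<open>Im z = - c\<close>, so the vertex \<open>a\<close> disappears from the limit.\<close>

lemma pint_tendsto:
  assumes H: "\<And>t. (H has_field_derivative h (path_right a c t)) (at (path_right a c t))"
    and int: "path_integrable a c h"
  shows "((\<lambda>x. H (Complex x c) - H (Complex x (- c))) \<longlongrightarrow> pint a c h) at_top"
proof -
  define g where "g t = path_deriv c t * h (path_right a c t)" for t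
  have g: "integrable lborel g" using int by (simp add: path_integrable_def g_def[abs_def])
  have "((\<lambda>T. \<integral>t. indicator {- T..T} t *\<^sub>R g t \<partial>lborel) \<longlongrightarrow> (\<integral>t. g t \<partial>lborel)) at_top"
  proof (rule integral_dominated_convergence_at_top)
    show "integrable lborel (\<lambda>t. norm (g t))" using g by simp
    show "g \<in> borel_measurable lborel" using g by auto
    show "(\<lambda>t. indicator {- T..T} t *\<^sub>R g t) \<in> borel_measurable lborel" for T using g by auto
    show "\<forall>\<^sub>F T in at_top. AE t in lborel. norm (indicator {- T..T} t *\<^sub>R g t) \<le> norm (g t)"
      by (auto intro!: always_eventually simp: indicator_def)
    have "\<forall>\<^sub>F T in at_top. indicator {- T..T} t *\<^sub>R g t = g t" for t
      using eventually_ge_at_top[of "\<bar>t\<bar>"] by eventually_elim (auto simp: indicator_def abs_le_iff)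
    then show "AE t in lborel. ((\<lambda>T. indicator {- T..T} t *\<^sub>R g t) \<longlongrightarrow> g t) at_top"
      by (auto intro!: AE_I2 tendsto_eventually)
  qed
  moreover have "\<forall>\<^sub>F T in at_top. (\<integral>t. indicator {- T..T} t *\<^sub>R g t \<partial>lborel)
      = H (Complex (a - 1 + T) c) - H (Complex (a - 1 + T) (- c))"
    using eventually_ge_at_top[of 1]
  proof eventually_elim
    case (elim T)
    have "(g has_integral H (path_right a c T) - H (path_right a c (- T))) {- T..T}"
    proof (rule fundamental_theorem_of_calculus_interior_strong[of "{-1, 1}"])
      show "continuous_on {- T..T} (\<lambda>t. H (path_right a c t))"
        using H continuous_on_path_right
        by (auto intro!: continuous_at_imp_continuous_on isCont_o2[where g = H] DERIV_isCont
            simp: continuous_on_eq_continuous_at[OF open_UNIV, THEN iffD1, rule_format])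
      show "((\<lambda>t. H (path_right a c t)) has_vector_derivative g t) (at t)" if "t \<in> {- T<..<T} - {-1, 1}" for t
        using field_vector_diff_chain_at[OF path_right_vector_derivative H] that
        by (auto simp: g_def comp_def)
    qed (use elim in auto)
    moreover have "set_integrable lborel {- T..T} g"
      using g by (auto simp: set_integrable_def intro: integrable_mult_indicator)
    ultimately have "(\<integral>t. indicator {- T..T} t *\<^sub>R g t \<partial>lborel) = H (path_right a c T) - H (path_right a c (- T))"
      using set_borel_integral_eq_integral(2)[of "{- T..T}" g] by (simp add: set_lebesgue_integral_def integral_unique)
    then show ?case using elim by (simp add: path_right_left path_right_right)
  qed
  ultimately have "((\<lambda>T. H (Complex (a - 1 + T) c) - H (Complex (a - 1 + T) (- c))) \<longlongrightarrow> (\<integral>t. g t \<partial>lborel)) at_top"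
    by (rule Lim_transform_eventually)
  \<comment> \<open>The real part \<open>x = a - 1 + T\<close> of the end points becomes the
    variable of the limit.\<close>
  then have "((\<lambda>x. H (Complex (a - 1 + (x - (a - 1))) c) - H (Complex (a - 1 + (x - (a - 1))) (- c))) \<longlongrightarrow> (\<integral>t. g t \<partial>lborel)) at_top"
    by (rule filterlim_compose) (rule filterlim_at_top_mono[OF filterlim_tendsto_add_at_top[OF tendsto_const[of "- (a - 1)"] filterlim_ident]], simp)
  then show ?thesis by (simp add: pint_def g_def)
qed

lemma pint_eqI:
  assumes "\<And>t. (H has_field_derivative h (path_right a c t)) (at (path_right a c t))"
    and "path_integrable a c h"
    and "((\<lambda>x. H (Complex x c) - H (Complex x (- c))) \<longlongrightarrow> L) at_top"
  shows "pint a c h = L"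
  using tendsto_unique[OF _ pint_tendsto[OF assms(1,2)] assms(3)] by simp

text \<open>Vertical segments of fixed length contribute nothing in the limit, by the mean value
  estimate and the decay of the integrand.\<close>

lemma segment_difference_tendsto:
  assumes H: "\<And>x s. x \<ge> R \<Longrightarrow> s \<in> closed_segment c1 c2 \<Longrightarrow>
      (H has_field_derivative h (Complex x s)) (at (Complex x s))"
    and d: "d > 0" and bd: "\<And>x s. x \<ge> R \<Longrightarrow> s \<in> closed_segment c1 c2 \<Longrightarrow> cmod (h (Complex x s)) \<le> C * exp (- d * x)"
  shows "((\<lambda>x. H (Complex x c1) - H (Complex x c2)) \<longlongrightarrow> 0) at_top"
proof (rule tendsto_norm_zero_cancel, rule tendsto_sandwich[OF _ _ tendsto_const])
  have "((\<lambda>x. C * exp (- d * x) * \<bar>c1 - c2\<bar>) \<longlongrightarrow> C * 0 * \<bar>c1 - c2\<bar>) at_top"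
    using d by (intro tendsto_intros) real_asymp
  then show "((\<lambda>x. C * exp (- d * x) * \<bar>c1 - c2\<bar>) \<longlongrightarrow> 0) at_top" by simp
  show "\<forall>\<^sub>F x in at_top. cmod (H (Complex x c1) - H (Complex x c2)) \<le> C * exp (- d * x) * \<bar>c1 - c2\<bar>"
    using eventually_ge_at_top[of R]
  proof eventually_elim
    case (elim x)
    have seg: "\<exists>s\<in>closed_segment c1 c2. z = Complex x s" if "z \<in> closed_segment (Complex x c1) (Complex x c2)" for z
    proof -
      obtain u where u: "0 \<le> u" "u \<le> 1" "z = (1 - u) *\<^sub>R Complex x c1 + u *\<^sub>R Complex x c2"
        using \<open>z \<in> closed_segment (Complex x c1) (Complex x c2)\<close> by (auto simp: in_segment)
      then have "z = Complex x ((1 - u) * c1 + u * c2)" by (simp add: complex_eq_iff algebra_simps)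
      then show ?thesis using u by (auto simp: in_segment intro!: bexI[of _ "(1 - u) * c1 + u * c2"] exI[of _ u])
    qed
    have "cmod (H (Complex x c1) - H (Complex x c2)) \<le> C * exp (- d * x) * cmod (Complex x c1 - Complex x c2)"
    proof (rule field_differentiable_bound[OF convex_closed_segment])
      show "(H has_field_derivative h z) (at z within closed_segment (Complex x c1) (Complex x c2))"
        if "z \<in> closed_segment (Complex x c1) (Complex x c2)" for z
        using seg[OF that] H[OF elim] by (auto intro: has_field_derivative_at_within)
      show "cmod (h z) \<le> C * exp (- d * x)" if "z \<in> closed_segment (Complex x c1) (Complex x c2)" for z
        using seg[OF that] bd[OF elim] by auto
    qed auto
    also have "cmod (Complex x c1 - Complex x c2) = \<bar>c1 - c2\<bar>" by (simp add: cmod_def)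
    finally show ?case .
  qed
qed simp

text \<open>Cauchy's theorem for the region between two contours: the two integrals differ by the
  increments of one primitive over two vertical segments, which vanish at infinity.\<close>

lemma pint_band_eq:
  assumes c: "0 < c1" "c1 \<le> c2" and H: "\<And>z. z \<in> band a c1 c2 \<Longrightarrow> (H has_field_derivative h z) (at z)"
    and dec: "decays (band a c1 c2) h" and cont: "continuous_on (band a c1 c2) h"
  shows "pint a c1 h = pint a c2 h"
proof -
  have int: "path_integrable a c h" if "c1 \<le> c" "c \<le> c2" for c
  proof (rule path_integrableI)
    show "decays (range (path_right a c)) h" "continuous_on (range (path_right a c)) h"
      using that c by (auto intro!: decays_subset[OF dec] continuous_on_subset[OF cont] path_right_in_band)
  qed (use that c in auto)
  obtain C d where d: "d > 0" and C: "\<And>z. z \<in> band a c1 c2 \<Longrightarrow> cmod (h z) \<le> C * exp (- d * Re z)"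
    using dec by (auto simp: decays_def)
  have in_band: "Complex x s \<in> band a c1 c2" if "x \<ge> a" "s \<in> closed_segment c1 c2 \<or> s \<in> closed_segment (- c1) (- c2)" for x s
    using that c by (auto simp: band_def dray_def closed_segment_eq_real_ivl split: if_splits)
  have 1: "((\<lambda>x. H (Complex x c1) - H (Complex x c2)) \<longlongrightarrow> 0) at_top"
    using H C in_band by (intro segment_difference_tendsto[where R = a and h = h and C = C, OF _ d]) fastforce+
  have 2: "((\<lambda>x. H (Complex x (- c1)) - H (Complex x (- c2))) \<longlongrightarrow> 0) at_top"
    using H C in_band by (intro segment_difference_tendsto[where R = a and h = h and C = C, OF _ d]) fastforce+
  have p: "((\<lambda>x. H (Complex x c2) - H (Complex x (- c2))) \<longlongrightarrow> pint a c2 h) at_top"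
    using c by (intro pint_tendsto H int path_right_in_band) auto
  have "((\<lambda>x. (H (Complex x c2) - H (Complex x (- c2))) + (H (Complex x c1) - H (Complex x c2))
      - (H (Complex x (- c1)) - H (Complex x (- c2)))) \<longlongrightarrow> pint a c2 h + 0 - 0) at_top"
    by (intro tendsto_intros 1 2 p)
  then show ?thesis
    using c by (intro pint_eqI[where H=H] H int path_right_in_band) (auto simp: algebra_simps)
qed

text \<open>The primitive exists on the whole half strip around the ray, so a vertical segment far
  to the right closes the contour inside it.\<close>

lemma pint_eq_0:
  assumes c: "0 < c" and H: "\<And>z. a - c \<le> Re z \<Longrightarrow> \<bar>Im z\<bar> \<le> c \<Longrightarrow> (H has_field_derivative h z) (at z)"
    and cont: "continuous_on {z. a - c \<le> Re z \<and> \<bar>Im z\<bar> \<le> c} h" and d: "d > 0"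
    and bd: "\<And>z. a - c \<le> Re z \<Longrightarrow> \<bar>Im z\<bar> \<le> c \<Longrightarrow> cmod (h z) \<le> C * exp (- d * Re z)"
  shows "pint a c h = 0"
proof (rule pint_eqI[where H=H])
  have *: "path_right a c t \<in> {z. a - c \<le> Re z \<and> \<bar>Im z\<bar> \<le> c}" for t
    using path_right_bounds[OF c] by auto
  show "(H has_field_derivative h (path_right a c t)) (at (path_right a c t))" for t
    using * by (intro H) auto
  show "path_integrable a c h"
  proof (rule path_integrableI[OF c])
    show "continuous_on (range (path_right a c)) h"
      using * by (intro continuous_on_subset[OF cont]) blast
    show "decays (range (path_right a c)) h"
      unfolding decays_def using * d bd by (intro exI[of _ C] exI[of _ d]) auto
  qed
  show "((\<lambda>x. H (Complex x c) - H (Complex x (- c))) \<longlongrightarrow> 0) at_top"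
    using c by (intro segment_difference_tendsto[where R = "a - c" and h = h and C = C, OF _ d] H
          order_trans[OF bd])
      (auto simp: closed_segment_eq_real_ivl)
qed

lemma pint_add:
  "path_integrable a c g \<Longrightarrow> path_integrable a c h \<Longrightarrow> pint a c (\<lambda>z. g z + h z) = pint a c g + pint a c h"
  by (simp add: pint_def path_integrable_def distrib_left)

lemma pint_cmult: "pint a c (\<lambda>z. k * h z) = k * pint a c h"
  by (simp add: pint_def mult.left_commute[of _ k])

lemma pint_cong: "c > 0 \<Longrightarrow> (\<And>z. dray a z = c \<Longrightarrow> g z = h z) \<Longrightarrow> pint a c g = pint a c h"
  unfolding pint_def by (simp add: dray_path_right)

section \<open>The exponentially damped Cauchy kernel\<close>

lemma pint_kernel_outside:
  assumes c: "c > 0" and z: "Re z < a - c" and l: "Re l > 0"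
  shows "pint a c (\<lambda>w. exp (- l * (w - z)) / (w - z)) = 0"
proof -
  \<comment> \<open>The half plane to the right of \<open>z\<close> is convex and contains the
    closed half strip around the contour.\<close>
  have hol: "(\<lambda>w. exp (- l * (w - z)) / (w - z)) holomorphic_on {w. Re w > Re z}"
    by (intro holomorphic_intros) auto
  obtain H where H: "\<And>w. Re w > Re z \<Longrightarrow> (H has_field_derivative exp (- l * (w - z)) / (w - z)) (at w)"
    using convex_primitive[OF hol convex_halfspace_Re_gt open_halfspace_Re_gt] by auto
  show ?thesis
  proof (rule pint_eq_0[OF c, where H = H and d = "Re l"])
    show "continuous_on {w. a - c \<le> Re w \<and> \<bar>Im w\<bar> \<le> c} (\<lambda>w. exp (- l * (w - z)) / (w - z))"
      using z by (intro continuous_on_subset[OF holomorphic_on_imp_continuous_on[OF hol]]) auto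
    fix w assume w: "a - c \<le> Re w" "\<bar>Im w\<bar> \<le> c"
    then show "(H has_field_derivative exp (- l * (w - z)) / (w - z)) (at w)" using z by (intro H) auto
    have "cmod (w - z) \<ge> a - c - Re z" using w abs_Re_le_cmod[of "w - z"] by auto
    then have "inverse (cmod (w - z)) \<le> inverse (a - c - Re z)" using z by (intro le_imp_inverse_le) auto
    moreover have "Re (- l * (w - z)) \<le> - Re l * Re w + (Re l * Re z + \<bar>Im l\<bar> * (c + \<bar>Im z\<bar>))"
    proof -
      have "Im l * (Im w - Im z) \<le> \<bar>Im l\<bar> * \<bar>Im w - Im z\<bar>" by (metis abs_ge_self abs_mult)
      also have "\<dots> \<le> \<bar>Im l\<bar> * (c + \<bar>Im z\<bar>)" using w by (intro mult_left_mono) auto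
      finally show ?thesis by (simp add: algebra_simps)
    qed
    then have "cmod (exp (- l * (w - z))) \<le> exp (Re l * Re z + \<bar>Im l\<bar> * (c + \<bar>Im z\<bar>)) * exp (- Re l * Re w)"
      by (simp flip: exp_add)
    ultimately have "cmod (exp (- l * (w - z))) * inverse (cmod (w - z)) \<le>
        (exp (Re l * Re z + \<bar>Im l\<bar> * (c + \<bar>Im z\<bar>)) * exp (- Re l * Re w)) * inverse (a - c - Re z)"
      by (intro mult_mono) auto
    then show "cmod (exp (- l * (w - z)) / (w - z)) \<le>
        (exp (Re l * Re z + \<bar>Im l\<bar> * (c + \<bar>Im z\<bar>)) * inverse (a - c - Re z)) * exp (- Re l * Re w)"
      by (simp only: norm_divide divide_inverse norm_mult norm_inverse mult_ac)
  qed (rule l)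
qed

text \<open>\<open>N\<close> is a primitive of the kernel, cut along the positive real axis. Its
  increment from below to above that axis tends to the jump of the logarithm; the sign is negative,
  as befits clockwise contours.\<close>

lemma kernel_primitive:
  assumes l: "Re l > 0"
  obtains N where "\<And>u. \<not> (Im u = 0 \<and> Re u \<ge> 0) \<Longrightarrow> (N has_field_derivative exp (- l * u) / u) (at u)"
    "\<And>c x0. \<bar>y\<bar> < c \<Longrightarrow> ((\<lambda>x. N (Complex (x - x0) (c - y)) - N (Complex (x - x0) (- c - y))) \<longlongrightarrow> - (2 * pi * \<i>)) at_top"
proof -
  have "(\<lambda>u. exp (- l * u)) holomorphic_on UNIV" by (intro holomorphic_intros)
  note hol = pole_lemma_open[OF this open_UNIV, of 0]
  \<comment> \<open>An entire primitive of \<open>(exp (- l * u) - 1) / u\<close>, whose singularity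
    at 0 is removable.\<close>
  obtain E where E0: "\<And>u. u \<in> UNIV \<Longrightarrow> (E has_field_derivative (if u = 0 then deriv (\<lambda>u. exp (- l * u)) 0
      else (exp (- l * u) - exp (- l * 0)) / (u - 0))) (at u)"
    by (rule convex_primitive[OF hol convex_UNIV open_UNIV]) (rule that)
  have E: "(E has_field_derivative (exp (- l * u) - 1) / u) (at u)" if "u \<noteq> 0" for u
    using E0[of u] that by simp
  \<comment> \<open>The cut of \<open>Ln (- u)\<close> is the positive axis, which the shifted
    contours avoid. \<open>M\<close> below uses \<open>Ln u\<close> instead, which is regular in the
    right half plane, so its increments vanish at infinity.\<close>
  define N where "N u = Ln (- u) + E u" for u
  show thesis
  proof
    show "(N has_field_derivative exp (- l * u) / u) (at u)" if u: "\<not> (Im u = 0 \<and> Re u \<ge> 0)" for u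
    proof -
      have nz: "u \<noteq> 0" and np: "- u \<notin> \<real>\<^sub>\<le>\<^sub>0" using u by (auto simp: complex_nonpos_Reals_iff)
      show ?thesis unfolding N_def using nz np
        by (auto intro!: derivative_eq_intros E simp: diff_divide_distrib inverse_eq_divide)
    qed
    fix c x0 :: real assume c: "\<bar>y\<bar> < c"
    define M where "M u = Ln u + E u" for u
    have M: "(M has_field_derivative exp (- l * u) / u) (at u)" if "Re u > 0" for u
      using that unfolding M_def by (auto intro!: derivative_eq_intros E simp: complex_nonpos_Reals_iff diff_divide_distrib inverse_eq_divide)
    have "((\<lambda>x. M (Complex x (c - y)) - M (Complex x (- c - y))) \<longlongrightarrow> 0) at_top"
    proof (rule segment_difference_tendsto[where R = 1 and h = "\<lambda>u. exp (- l * u) / u", OF _ l])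
      fix x s :: real assume x: "1 \<le> x" and s: "s \<in> closed_segment (c - y) (- c - y)"
      show "(M has_field_derivative exp (- l * Complex x s) / Complex x s) (at (Complex x s))"
        using x by (intro M) auto
      have s': "\<bar>s\<bar> \<le> 2 * c" using s c by (auto simp: closed_segment_eq_real_ivl split: if_splits)
      have "1 \<le> cmod (Complex x s)" using x abs_Re_le_cmod[of "Complex x s"] by simp
      then have "cmod (exp (- l * Complex x s) / Complex x s) \<le> cmod (exp (- l * Complex x s))"
        by (simp add: norm_divide divide_le_eq mult_le_cancel_left1)
      also have "\<dots> = exp (- Re l * x + Im l * s)" by simp
      also have "Im l * s \<le> \<bar>Im l\<bar> * (2 * c)" using s'
        by (metis abs_ge_self abs_ge_zero abs_mult mult_left_mono order_trans)
      finally show "cmod (exp (- l * Complex x s) / Complex x s) \<le> exp (\<bar>Im l\<bar> * (2 * c)) * exp (- Re l * x)"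
        by (simp add: exp_add[symmetric] add.commute)
    qed
    then have "((\<lambda>x. M (Complex x (c - y)) - M (Complex x (- c - y)) - 2 * pi * \<i>) \<longlongrightarrow> 0 - 2 * pi * \<i>) at_top"
      by (intro tendsto_intros)
    moreover have "N (Complex x (c - y)) - N (Complex x (- c - y)) = M (Complex x (c - y)) - M (Complex x (- c - y)) - 2 * pi * \<i>" for x
    proof -
      \<comment> \<open>The two branches differ by \<open>- \<i> * pi\<close> above the axis and by
        \<open>\<i> * pi\<close> below it, which makes \<open>- 2 * pi * \<i>\<close> for the
        increment.\<close>
      have "Ln (- Complex x (c - y)) = Ln (Complex x (c - y)) - \<i> * pi"
        using c by (subst Ln_minus) (auto simp: complex_eq_iff)
      moreover have "Ln (- Complex x (- c - y)) = Ln (Complex x (- c - y)) + \<i> * pi"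
        using c by (subst Ln_minus) (auto simp: complex_eq_iff)
      ultimately show ?thesis by (simp add: N_def M_def algebra_simps)
    qed
    ultimately have "((\<lambda>x. N (Complex x (c - y)) - N (Complex x (- c - y))) \<longlongrightarrow> - (2 * pi * \<i>)) at_top" by simp
    then show "((\<lambda>x. N (Complex (x - x0) (c - y)) - N (Complex (x - x0) (- c - y))) \<longlongrightarrow> - (2 * pi * \<i>)) at_top"
      by (rule filterlim_compose) (rule filterlim_at_top_mono[OF filterlim_tendsto_add_at_top[OF tendsto_const[of "- x0"] filterlim_ident]], simp)
  qed
qed

lemma kernel_decays:
  assumes l: "Re l > 0" and z: "z \<notin> band a c1 c2"
  shows "decays (band a c1 c2) (\<lambda>w. exp (- l * (w - z)) / (w - z))"
proof (rule decays_bandI[where d = "Re l" and R = "Re z + 1"])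
  show "continuous_on (band a c1 c2) (\<lambda>w. exp (- l * (w - z)) / (w - z))"
    using z by (intro continuous_intros) auto
  fix w assume w: "w \<in> band a c1 c2" "Re z + 1 \<le> Re w"
  have "1 \<le> cmod (w - z)" using w abs_Re_le_cmod[of "w - z"] by auto
  then have "cmod (exp (- l * (w - z)) / (w - z)) \<le> cmod (exp (- l * (w - z)))"
    by (simp add: norm_divide divide_le_eq mult_le_cancel_left1)
  also have "\<dots> = exp (- Re l * Re w + (Re l * Re z + Im l * (Im w - Im z)))" by (simp add: algebra_simps)
  also have "\<dots> \<le> exp (- Re l * Re w + (Re l * Re z + \<bar>Im l\<bar> * (c2 + \<bar>Im z\<bar>)))"
  proof -
    have "Im l * (Im w - Im z) \<le> \<bar>Im l\<bar> * \<bar>Im w - Im z\<bar>" by (metis abs_ge_self abs_mult)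
    also have "\<dots> \<le> \<bar>Im l\<bar> * (c2 + \<bar>Im z\<bar>)"
      using w abs_Im_le_dray[of w a] by (intro mult_left_mono) (auto simp: band_def)
    finally show ?thesis by simp
  qed
  finally show "cmod (exp (- l * (w - z)) / (w - z)) \<le> exp (Re l * Re z + \<bar>Im l\<bar> * (c2 + \<bar>Im z\<bar>)) * exp (- Re l * Re w)"
    by (simp add: exp_add[symmetric] algebra_simps)
qed (rule l)

lemma kernel_path_integrable:
  assumes "c > 0" "Re l > 0" "dray a z \<noteq> c"
  shows "path_integrable a c (\<lambda>w. exp (- l * (w - z)) / (w - z))"
proof (rule path_integrableI[OF assms(1)])
  have sub: "range (path_right a c) \<subseteq> band a c c" using path_right_in_band[OF assms(1)] by auto
  have z: "z \<notin> band a c c" using assms(3) by (auto simp: band_def)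
  show "decays (range (path_right a c)) (\<lambda>w. exp (- l * (w - z)) / (w - z))"
    by (rule decays_subset[OF kernel_decays[OF assms(2) z] sub])
  show "continuous_on (range (path_right a c)) (\<lambda>w. exp (- l * (w - z)) / (w - z))"
    using z sub by (intro continuous_intros) auto
qed

text \<open>The residue theorem for a clockwise contour. The cut of \<open>N\<close>, shifted to
  start at \<open>z\<close>, does not meet the contour: moving from \<open>z\<close> to the right
  never increases the distance to the ray, whereas the contour lies at the larger distance
  \<open>c\<close>.\<close>

lemma pint_kernel_inside:
  assumes z: "dray a z < c" and l: "Re l > 0"
  shows "pint a c (\<lambda>w. exp (- l * (w - z)) / (w - z)) = - (2 * pi * \<i>)"
proof -
  have c: "c > 0" using z dray_nonneg[of a z] by simp
  have y: "\<bar>Im z\<bar> < c" using z abs_Im_le_dray[of z a] by simp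
  obtain N where N: "\<And>u. \<not> (Im u = 0 \<and> Re u \<ge> 0) \<Longrightarrow> (N has_field_derivative exp (- l * u) / u) (at u)"
    and lim: "\<And>c x0. \<bar>Im z\<bar> < c \<Longrightarrow> ((\<lambda>x. N (Complex (x - x0) (c - Im z)) - N (Complex (x - x0) (- c - Im z))) \<longlongrightarrow> - (2 * pi * \<i>)) at_top"
    using kernel_primitive[OF l, of "Im z"] by blast
  show ?thesis
  proof (rule pint_eqI[where H = "\<lambda>w. N (w - z)"])
    show "((\<lambda>w. N (w - z)) has_field_derivative exp (- l * (path_right a c t - z)) / (path_right a c t - z)) (at (path_right a c t))" for t
    proof -
      have "\<not> (Im (path_right a c t - z) = 0 \<and> Re (path_right a c t - z) \<ge> 0)"
      proof
        assume *: "Im (path_right a c t - z) = 0 \<and> Re (path_right a c t - z) \<ge> 0"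
        then have "path_right a c t = z + of_real (Re (path_right a c t - z))" by (simp add: complex_eq_iff)
        then have "c \<le> dray a z" using dray_add_nonneg[of "Re (path_right a c t - z)" a z] * dray_path_right[OF c, of a t] by simp
        then show False using z by simp
      qed
      from DERIV_chain2[OF N[OF this] DERIV_diff[OF DERIV_ident DERIV_const]] show ?thesis by simp
    qed
    show "path_integrable a c (\<lambda>w. exp (- l * (w - z)) / (w - z))"
      using z by (intro kernel_path_integrable c l) auto
    have "Complex x s - z = Complex (x - Re z) (s - Im z)" for x s by (simp add: complex_eq_iff)
    then show "((\<lambda>x. N (Complex x c - z) - N (Complex x (- c) - z)) \<longlongrightarrow> - (2 * pi * \<i>)) at_top"
      using lim[OF y, of "Re z"] by simp
  qed
qed

section \<open>Growth conditions and the Laplace transform\<close>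

lemma closure_ext_right: "closure_ext {a..} = {ereal a..}"
proof
  show "closure_ext {a..} \<subseteq> {ereal a..}"
    unfolding closure_ext_def by (rule closure_minimal) auto
  have inf: "\<infinity> \<in> closure (ereal ` {a..})"
  proof (rule Lim_in_closed_set[OF closed_closure _ _ ])
    show "((\<lambda>x. ereal x) \<longlongrightarrow> \<infinity>) at_top" by (simp add: tendsto_PInfty_eq_at_top filterlim_ident)
    show "\<forall>\<^sub>F x in at_top. ereal x \<in> closure (ereal ` {a..})"
      using eventually_ge_at_top[of a] by eventually_elim (auto intro!: subsetD[OF closure_subset])
  qed simp
  show "{ereal a..} \<subseteq> closure_ext {a..}"
  proof
    fix x assume "x \<in> {ereal a..}"
    then show "x \<in> closure_ext {a..}"
      using inf closure_subset[of "ereal ` {a..}"] by (cases x) (auto simp: closure_ext_def)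
  qed
qed

lemma closure_ext_right_diff: "closure_ext {a..} - ereal ` {a..} = {\<infinity>}"
proof -
  have "x \<in> ereal ` {a..}" if "ereal a \<le> x" "x \<noteq> \<infinity>" for x using that by (cases x) auto
  then show ?thesis by (auto simp: closure_ext_right)
qed

lemma finite_part_right: "finite_part {ereal a..} = ray a"
  by (auto simp: finite_part_def ray_def)

lemma finite_part_inf: "finite_part {\<infinity>} = {}"
  by (auto simp: finite_part_def)

lemma finite_part_empty: "finite_part {} = {}"
  by (auto simp: finite_part_def)

lemma nbhd_right: "nbhd c {ereal a..} = {z. dray a z < c} \<union> {z. Re z > 1 / c \<and> \<bar>Im z\<bar> < c}"
proof -
  have "edist_to z (ray a) < ereal c \<longleftrightarrow> dray a z < c" for z
  proof
    assume "edist_to z (ray a) < ereal c"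
    then obtain x where "x \<ge> a" "cmod (z - of_real x) < c"
      by (auto simp: edist_to_def INF_less_iff ray_def)
    then show "dray a z < c" using dray_le[of a x z] by simp
  next
    assume "dray a z < c"
    then obtain x where "x \<ge> a" "cmod (z - of_real x) < c" using dray_attained[of a z] by auto
    then show "edist_to z (ray a) < ereal c"
      by (auto simp: edist_to_def INF_less_iff ray_def)
  qed
  then show ?thesis by (auto simp: nbhd_def finite_part_right)
qed

lemma nbhd_inf: "nbhd c {\<infinity>} = {z. Re z > 1 / c \<and> \<bar>Im z\<bar> < c}"
  by (auto simp: nbhd_def finite_part_inf edist_to_def top_ereal_def)

lemma nbhd_empty: "nbhd c {} = {}"
  by (auto simp: nbhd_def finite_part_empty edist_to_def top_ereal_def)

lemma S_region_right_subset:
  assumes "n \<ge> 1"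
  shows "S_region n {ereal a..} \<subseteq> {z. 1 / real n \<le> dray a z \<and> \<bar>Im z\<bar> \<le> real n}"
  using closure_subset[of "nbhd (1 / real n) {ereal a..}"] by (force simp: S_region_def nbhd_right)

text \<open>If \<open>real n < a\<close>, the strip at infinity may begin to the left of the tube
  around the ray; from \<open>a \<le> real n\<close> on it lies inside the tube.\<close>

lemma S_region_right_supset:
  assumes "n \<ge> 1" "a \<le> real n"
  shows "{z. 1 / real n < dray a z \<and> \<bar>Im z\<bar> < real n} \<subseteq> S_region n {ereal a..}"
proof -
  have "nbhd (1 / real n) {ereal a..} \<subseteq> {z. dray a z \<le> 1 / real n}"
    using assms by (auto simp: nbhd_right dray_def)
  moreover have "closed {z. dray a z \<le> 1 / real n}"
    by (intro closed_Collect_le continuous_on_dray continuous_intros)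
  ultimately have "closure (nbhd (1 / real n) {ereal a..}) \<subseteq> {z. dray a z \<le> 1 / real n}"
    by (rule closure_minimal)
  then show ?thesis by (auto simp: S_region_def)
qed

lemma S_region_inf_subset:
  assumes "n \<ge> 1"
  shows "S_region n {\<infinity>} \<subseteq> {z. (Re z \<le> real n \<or> 1 / real n \<le> \<bar>Im z\<bar>) \<and> \<bar>Im z\<bar> \<le> real n}"
  using closure_subset[of "nbhd (1 / real n) {\<infinity>}"] by (force simp: S_region_def nbhd_inf)

lemma S_region_inf_supset:
  "{z. (Re z < real n \<or> 1 / real n < \<bar>Im z\<bar>) \<and> \<bar>Im z\<bar> < real n} \<subseteq> S_region n {\<infinity>}"
proof -
  have "closure (nbhd (1 / real n) {\<infinity>}) \<subseteq> {z. real n \<le> Re z} \<inter> {z. \<bar>Im z\<bar> \<le> 1 / real n}"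
    by (rule closure_minimal) (auto simp: nbhd_inf intro!: closed_Int closed_Collect_le continuous_intros)
  then show ?thesis by (auto simp: S_region_def)
qed

lemma S_region_empty: "S_region n {} = {z. \<bar>Im z\<bar> < real n}"
  by (simp add: S_region_def nbhd_empty)

lemma ex_large_nat:
  assumes "(0::real) < c" "0 < \<epsilon>"
  obtains n where "n \<ge> 1" "1 / real n < c" "1 / real n \<le> \<epsilon>" "R < real n"
proof -
  obtain n where n: "max (max (1 / c) (1 / \<epsilon>)) (max R 1) < real n" using reals_Archimedean2 by blast
  show thesis
  proof
    show "n \<ge> 1" using n by simp
    show "1 / real n < c" "1 / real n \<le> \<epsilon>" "R < real n"
      using n assms by (auto simp: field_simps)
  qed
qed

section \<open>Growth conditions with real parameters\<close>

context lc_hausdorff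
begin

definition growth_on :: "complex set \<Rightarrow> (complex \<Rightarrow> 'e) \<Rightarrow> 'i \<Rightarrow> real \<Rightarrow> bool" where
  "growth_on X f \<alpha> \<epsilon> \<longleftrightarrow> (\<exists>M. \<forall>z\<in>X. p \<alpha> (f z) \<le> M * exp (\<epsilon> * \<bar>Re z\<bar>))"

lemma bdd_above_growth:
  "bdd_above ((\<lambda>z. p \<alpha> (f z) * exp (- (1 / real n) * \<bar>Re z\<bar>)) ` X) \<longleftrightarrow> growth_on X f \<alpha> (1 / real n)"
proof -
  have "p \<alpha> (f z) * exp (- (1 / real n) * \<bar>Re z\<bar>) \<le> M \<longleftrightarrow> p \<alpha> (f z) \<le> M * exp (1 / real n * \<bar>Re z\<bar>)" for z M
    by (simp add: exp_minus field_simps)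
  then show ?thesis by (auto simp: bdd_above_def growth_on_def)
qed

lemma growth_on_subset: "growth_on X f \<alpha> \<epsilon> \<Longrightarrow> Y \<subseteq> X \<Longrightarrow> growth_on Y f \<alpha> \<epsilon>"
  unfolding growth_on_def by blast

lemma growth_on_mono:
  assumes "growth_on X f \<alpha> \<epsilon>" "\<epsilon> \<le> \<epsilon>'"
  shows "growth_on X f \<alpha> \<epsilon>'"
proof -
  obtain M where M: "\<And>z. z \<in> X \<Longrightarrow> p \<alpha> (f z) \<le> M * exp (\<epsilon> * \<bar>Re z\<bar>)" using assms by (auto simp: growth_on_def)
  have "p \<alpha> (f z) \<le> \<bar>M\<bar> * exp (\<epsilon>' * \<bar>Re z\<bar>)" if "z \<in> X" for z
  proof -
    have "p \<alpha> (f z) \<le> M * exp (\<epsilon> * \<bar>Re z\<bar>)" by (rule M[OF that])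
    also have "\<dots> \<le> \<bar>M\<bar> * exp (\<epsilon>' * \<bar>Re z\<bar>)" using assms(2) by (intro mult_mono) (auto intro: mult_right_mono)
    finally show ?thesis .
  qed
  then show ?thesis by (auto simp: growth_on_def)
qed

lemma growth_on_Un:
  assumes "growth_on X f \<alpha> \<epsilon>" "growth_on Y f \<alpha> \<epsilon>"
  shows "growth_on (X \<union> Y) f \<alpha> \<epsilon>"
proof -
  obtain M N where M: "\<And>z. z \<in> X \<Longrightarrow> p \<alpha> (f z) \<le> M * exp (\<epsilon> * \<bar>Re z\<bar>)"
    and N: "\<And>z. z \<in> Y \<Longrightarrow> p \<alpha> (f z) \<le> N * exp (\<epsilon> * \<bar>Re z\<bar>)" using assms by (auto simp: growth_on_def)
  have "p \<alpha> (f z) \<le> max M N * exp (\<epsilon> * \<bar>Re z\<bar>)" if "z \<in> X \<union> Y" for z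
    using that by (auto intro: order_trans[OF M] order_trans[OF N])
  then show ?thesis by (auto simp: growth_on_def)
qed

lemma growth_on_compact:
  assumes "compact X" "continuous_on X f" "\<epsilon> \<ge> 0"
  shows "growth_on X f \<alpha> \<epsilon>"
proof -
  obtain C where C: "C \<ge> 0" "\<And>z. z \<in> X \<Longrightarrow> p \<alpha> (f z) \<le> C" using continuous_on_compact_bounded[OF assms(2,1)] by blast
  have "p \<alpha> (f z) \<le> C * exp (\<epsilon> * \<bar>Re z\<bar>)" if "z \<in> X" for z
    using C(2)[OF that] mult_left_mono[of 1 "exp (\<epsilon> * \<bar>Re z\<bar>)" C] C(1) assms(3) by simp
  then show ?thesis by (auto simp: growth_on_def)
qed

lemma growth_on_add:
  assumes "growth_on X f \<alpha> \<epsilon>" "growth_on X g \<alpha> \<epsilon>"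
  shows "growth_on X (\<lambda>z. f z + g z) \<alpha> \<epsilon>"
proof -
  obtain M N where M: "\<And>z. z \<in> X \<Longrightarrow> p \<alpha> (f z) \<le> M * exp (\<epsilon> * \<bar>Re z\<bar>)"
    and N: "\<And>z. z \<in> X \<Longrightarrow> p \<alpha> (g z) \<le> N * exp (\<epsilon> * \<bar>Re z\<bar>)" using assms by (auto simp: growth_on_def)
  have "p \<alpha> (f z + g z) \<le> (M + N) * exp (\<epsilon> * \<bar>Re z\<bar>)" if "z \<in> X" for z
    using M[OF that] N[OF that] seminorm_triangle[of \<alpha> "f z" "g z"] by (simp add: distrib_right)
  then show ?thesis by (auto simp: growth_on_def)
qed

lemma growth_on_smul:
  assumes "growth_on X f \<alpha> \<epsilon>"
  shows "growth_on X (\<lambda>z. smul c (f z)) \<alpha> \<epsilon>"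
proof -
  obtain M where M: "\<And>z. z \<in> X \<Longrightarrow> p \<alpha> (f z) \<le> M * exp (\<epsilon> * \<bar>Re z\<bar>)" using assms by (auto simp: growth_on_def)
  have "p \<alpha> (smul c (f z)) \<le> (cmod c * M) * exp (\<epsilon> * \<bar>Re z\<bar>)" if "z \<in> X" for z
    using mult_left_mono[OF M[OF that], of "cmod c"] by (simp add: seminorm_scale mult.assoc)
  then show ?thesis by (auto simp: growth_on_def)
qed

lemma growth_on_cong: "growth_on X f \<alpha> \<epsilon> \<Longrightarrow> (\<And>z. z \<in> X \<Longrightarrow> f z = g z) \<Longrightarrow> growth_on X g \<alpha> \<epsilon>"
  by (auto simp: growth_on_def)

text \<open>The growth condition of \<open>hol_exp\<close> for \<open>{ereal a..}\<close>, its
  single index \<open>n\<close> resolved into independent parameters: the distance \<open>c\<close>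
  from the ray, the height \<open>C\<close> of the strip and the rate
  \<open>\<epsilon>\<close>.\<close>

definition infra :: "real \<Rightarrow> (complex \<Rightarrow> 'e) \<Rightarrow> bool" where
  "infra a f \<longleftrightarrow> (\<forall>\<alpha> c C. \<forall>\<epsilon>>0. 0 < c \<longrightarrow> growth_on {z. c \<le> dray a z \<and> \<bar>Im z\<bar> \<le> C} f \<alpha> \<epsilon>)"

lemma infraD: "infra a f \<Longrightarrow> 0 < \<epsilon> \<Longrightarrow> 0 < c \<Longrightarrow> growth_on {z. c \<le> dray a z \<and> \<bar>Im z\<bar> \<le> C} f \<alpha> \<epsilon>"
  by (auto simp: infra_def)

lemma hol_exp_right_iff: "f \<in> hol_exp smul p {ereal a..} \<longleftrightarrow> f \<in> hol smul (- ray a) \<and> infra a f"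
proof -
  have "(\<forall>n\<ge>1. \<forall>\<alpha>. growth_on (S_region n {ereal a..}) f \<alpha> (1 / real n)) \<longleftrightarrow> infra a f"
  proof
    assume *: "\<forall>n\<ge>1. \<forall>\<alpha>. growth_on (S_region n {ereal a..}) f \<alpha> (1 / real n)"
    show "infra a f"
      unfolding infra_def
    proof (intro allI impI)
      fix \<alpha> and c C \<epsilon> :: real assume "\<epsilon> > 0" "c > 0"
      obtain n where n: "n \<ge> 1" "1 / real n < c" "1 / real n \<le> \<epsilon>" "max a C < real n"
        by (rule ex_large_nat[OF \<open>c > 0\<close> \<open>\<epsilon> > 0\<close>]) (rule that)
      have "{z. c \<le> dray a z \<and> \<bar>Im z\<bar> \<le> C} \<subseteq> S_region n {ereal a..}"
        using S_region_right_supset[of n a] n by fastforce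
      then show "growth_on {z. c \<le> dray a z \<and> \<bar>Im z\<bar> \<le> C} f \<alpha> \<epsilon>"
        using * n by (meson growth_on_mono growth_on_subset)
    qed
  next
    assume *: "infra a f"
    show "\<forall>n\<ge>1. \<forall>\<alpha>. growth_on (S_region n {ereal a..}) f \<alpha> (1 / real n)"
      using growth_on_subset[OF infraD[OF *] S_region_right_subset] by simp
  qed
  then show ?thesis by (simp only: hol_exp_def bdd_above_growth finite_part_right mem_Collect_eq)
qed

lemma infra_if_growth_inf:
  assumes "\<And>n \<alpha>. n \<ge> 1 \<Longrightarrow> growth_on (S_region n {\<infinity>}) f \<alpha> (1 / real n)"
  shows "infra a f"
  unfolding infra_def
proof (intro allI impI)
  fix \<alpha> and c C \<epsilon> :: real assume "\<epsilon> > 0" "c > 0"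
  obtain n where n: "n \<ge> 1" "1 / real n < c" "1 / real n \<le> \<epsilon>" "max a C < real n"
    by (rule ex_large_nat[OF \<open>c > 0\<close> \<open>\<epsilon> > 0\<close>]) (rule that)
  have "{z. c \<le> dray a z \<and> \<bar>Im z\<bar> \<le> C} \<subseteq> S_region n {\<infinity>}"
    using S_region_inf_supset[of n] n by (fastforce simp: dray_def split: if_splits)
  then show "growth_on {z. c \<le> dray a z \<and> \<bar>Im z\<bar> \<le> C} f \<alpha> \<epsilon>"
    using assms n by (meson growth_on_mono growth_on_subset)
qed

text \<open>The regions of \<open>{\<infinity>}\<close> also contain points near and on the ray,
  which \<open>infra a\<close> leaves out. Those with large real part are excluded from the regions
  as well, so a compact set remains, on which an entire function is bounded. As a consequence the
  vertex \<open>a\<close> does not matter for entire functions.\<close>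

lemma hol_exp_inf_iff: "f \<in> hol_exp smul p {\<infinity>} \<longleftrightarrow> f \<in> hol smul UNIV \<and> infra a f"
proof -
  have "(\<forall>n\<ge>1. \<forall>\<alpha>. growth_on (S_region n {\<infinity>}) f \<alpha> (1 / real n)) \<longleftrightarrow> infra a f" if hol: "f \<in> hol smul UNIV"
  proof
    assume "\<forall>n\<ge>1. \<forall>\<alpha>. growth_on (S_region n {\<infinity>}) f \<alpha> (1 / real n)"
    then show "infra a f" by (intro infra_if_growth_inf) blast
  next
    assume *: "infra a f"
    show "\<forall>n\<ge>1. \<forall>\<alpha>. growth_on (S_region n {\<infinity>}) f \<alpha> (1 / real n)"
    proof (intro allI impI)
      fix n :: nat and \<alpha> assume n: "n \<ge> 1"
      \<comment> \<open>\<open>?Y\<close> holds the points near the ray with real part up to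
        \<open>max a (real n)\<close>; distance 1 is enough because
        \<open>1 / real n \<le> 1\<close>.\<close>
      let ?X = "{z. 1 / real n \<le> dray a z \<and> \<bar>Im z\<bar> \<le> real n}" and ?Y = "band a 0 1 \<inter> {z. Re z \<le> max a (real n)}"
      have "growth_on (?X \<union> ?Y) f \<alpha> (1 / real n)"
        using n by (intro growth_on_Un infraD[OF *] growth_on_compact compact_band_part)
          (auto intro: continuous_on_subset[OF hol_continuous_on[OF hol]])
      moreover have "S_region n {\<infinity>} \<subseteq> ?X \<union> ?Y"
      proof
        fix z assume "z \<in> S_region n {\<infinity>}"
        then have z: "Re z \<le> real n \<or> 1 / real n \<le> \<bar>Im z\<bar>" "\<bar>Im z\<bar> \<le> real n"
          using S_region_inf_subset[OF n] by auto
        have "1 / real n \<le> 1" using n by simp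
        then show "z \<in> ?X \<union> ?Y"
          using z abs_Im_le_dray[of z a] dray_nonneg[of a z] by (auto simp: band_def not_le)
      qed
      ultimately show "growth_on (S_region n {\<infinity>}) f \<alpha> (1 / real n)" by (rule growth_on_subset)
    qed
  qed
  then show ?thesis by (auto simp only: hol_exp_def bdd_above_growth finite_part_inf mem_Collect_eq Compl_empty_eq)
qed

lemma infra_shift: "f \<in> hol smul UNIV \<Longrightarrow> infra a f \<Longrightarrow> infra b f"
  using hol_exp_inf_iff by blast

lemma hol_exp_emptyD:
  assumes "f \<in> hol_exp smul p {}"
  shows "f \<in> hol smul UNIV" "\<epsilon> > 0 \<Longrightarrow> growth_on {z. \<bar>Im z\<bar> \<le> C} f \<alpha> \<epsilon>"
proof -
  show "f \<in> hol smul UNIV" using assms by (simp add: hol_exp_def finite_part_empty)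
  assume "\<epsilon> > 0"
  then obtain n where n: "n \<ge> 1" "1 / real n \<le> \<epsilon>" "C < real n"
    using ex_large_nat[OF zero_less_one \<open>\<epsilon> > 0\<close>, of C] by metis
  then have "growth_on {z. \<bar>Im z\<bar> < real n} f \<alpha> (1 / real n)"
    using assms by (simp only: hol_exp_def bdd_above_growth S_region_empty mem_Collect_eq)
  then show "growth_on {z. \<bar>Im z\<bar> \<le> C} f \<alpha> \<epsilon>"
    using n by (auto intro: growth_on_mono growth_on_subset)
qed

lemma zero_hol_exp: "(\<lambda>_. 0) \<in> hol_exp smul p K"
  by (auto simp: hol_exp_def hol_zero)

text \<open>The condition of \<open>LO\<close> for \<open>{ereal a..}\<close>. As
  \<open>1 / k\<close> does there, one number \<open>\<epsilon>\<close> serves both as the distance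
  to the imaginary axis and as the growth rate.\<close>

definition lo :: "real \<Rightarrow> (complex \<Rightarrow> 'e) \<Rightarrow> bool" where
  "lo a f \<longleftrightarrow> f \<in> hol smul {z. Re z > 0} \<and>
     (\<forall>\<epsilon>>0. \<forall>\<alpha>. \<exists>C. \<forall>z. \<epsilon> \<le> Re z \<longrightarrow> p \<alpha> (f z) \<le> C * exp (\<epsilon> * cmod z - a * Re z))"

lemma lo_bound: "lo a f \<Longrightarrow> \<epsilon> > 0 \<Longrightarrow> \<exists>C. \<forall>z. \<epsilon> \<le> Re z \<longrightarrow> p \<alpha> (f z) \<le> C * exp (\<epsilon> * cmod z - a * Re z)"
  by (auto simp: lo_def)

lemma bdd_above_lo:
  "bdd_above ((\<lambda>z. p \<alpha> (f z) * exp (- (1 / real k) * cmod z + a * \<bar>Re z\<bar>)) ` {z. Re z \<ge> 1 / real k}) \<longleftrightarrow>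
    (\<exists>C. \<forall>z. 1 / real k \<le> Re z \<longrightarrow> p \<alpha> (f z) \<le> C * exp (1 / real k * cmod z - a * Re z))"
proof -
  have "p \<alpha> (f z) * exp (- (1 / real k) * cmod z + a * \<bar>Re z\<bar>) \<le> M \<longleftrightarrow> p \<alpha> (f z) \<le> M * exp (1 / real k * cmod z - a * Re z)"
    if "1 / real k \<le> Re z" for z M
  proof -
    have "Re z \<ge> 0" using that order_trans[of 0 "1 / real k" "Re z"] by simp
    then have "exp (1 / real k * cmod z - a * Re z) = inverse (exp (- (1 / real k) * cmod z + a * \<bar>Re z\<bar>))"
      by (simp flip: exp_minus)
    then show ?thesis by (simp add: pos_le_divide_eq divide_inverse[symmetric])
  qed
  then show ?thesis by (auto simp: bdd_above_def)
qed

lemma lo_weaken: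
  assumes b: "\<forall>z. \<epsilon> \<le> Re z \<longrightarrow> p \<alpha> (f z) \<le> C * exp (\<epsilon> * cmod z - a * Re z)"
    and "\<epsilon> \<le> \<epsilon>'" "b \<le> a" "0 < \<epsilon>"
  shows "\<forall>z. \<epsilon>' \<le> Re z \<longrightarrow> p \<alpha> (f z) \<le> \<bar>C\<bar> * exp (\<epsilon>' * cmod z - b * Re z)"
proof (intro allI impI)
  fix z assume z: "\<epsilon>' \<le> Re z"
  then have "p \<alpha> (f z) \<le> C * exp (\<epsilon> * cmod z - a * Re z)" using b assms by simp
  also have "\<dots> \<le> \<bar>C\<bar> * exp (\<epsilon>' * cmod z - b * Re z)"
    using assms z by (intro mult_mono) (auto intro!: diff_mono mult_right_mono)
  finally show "p \<alpha> (f z) \<le> \<bar>C\<bar> * exp (\<epsilon>' * cmod z - b * Re z)" .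
qed

lemma LO_right_iff: "f \<in> LO smul p {ereal a..} \<longleftrightarrow> lo a f"
proof -
  have I: "Inf {ereal a..} = ereal a" by simp
  have "(\<forall>k\<ge>1. \<forall>\<alpha>. \<exists>C. \<forall>z. 1 / real k \<le> Re z \<longrightarrow> p \<alpha> (f z) \<le> C * exp (1 / real k * cmod z - a * Re z)) \<longleftrightarrow>
      (\<forall>\<epsilon>>0. \<forall>\<alpha>. \<exists>C. \<forall>z. \<epsilon> \<le> Re z \<longrightarrow> p \<alpha> (f z) \<le> C * exp (\<epsilon> * cmod z - a * Re z))" (is "?L \<longleftrightarrow> ?R")
  proof
    assume L: ?L
    show ?R
    proof (intro allI impI)
      fix \<epsilon> :: real and \<alpha> assume "\<epsilon> > 0"
      then obtain n where n: "n \<ge> 1" "1 / real n \<le> \<epsilon>" using ex_large_nat[OF zero_less_one \<open>\<epsilon> > 0\<close>, of 0] by metis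
      then obtain C where "\<forall>z. 1 / real n \<le> Re z \<longrightarrow> p \<alpha> (f z) \<le> C * exp (1 / real n * cmod z - a * Re z)"
        using L by blast
      from lo_weaken[OF this n(2) order_refl] n
      show "\<exists>C. \<forall>z. \<epsilon> \<le> Re z \<longrightarrow> p \<alpha> (f z) \<le> C * exp (\<epsilon> * cmod z - a * Re z)" by auto
    qed
  next
    assume R: ?R
    show ?L
    proof (intro allI impI)
      fix k :: nat and \<alpha> assume "1 \<le> k"
      then have "0 < 1 / real k" by simp
      with R show "\<exists>C. \<forall>z. 1 / real k \<le> Re z \<longrightarrow> p \<alpha> (f z) \<le> C * exp (1 / real k * cmod z - a * Re z)" by blast
    qed
  qed
  moreover have "f \<in> LO smul p {ereal a..} \<longleftrightarrow> f \<in> hol smul {z. Re z > 0} \<and> (\<forall>k\<ge>1. \<forall>\<alpha>.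
      bdd_above ((\<lambda>z. p \<alpha> (f z) * exp (- (1 / real k) * cmod z + a * \<bar>Re z\<bar>)) ` {z. Re z \<ge> 1 / real k}))"
    by (simp add: LO_def half_plane_def I)
  ultimately show ?thesis by (simp only: bdd_above_lo lo_def)
qed

text \<open>The exponential rate \<open>k\<close> is coupled to the precision \<open>1 / k\<close>.
  Raising \<open>k\<close> strengthens both, so the condition separates into an arbitrary
  \<open>b\<close> and an arbitrary \<open>\<epsilon>\<close>.\<close>

lemma LO_inf_iff: "f \<in> LO smul p {\<infinity>} \<longleftrightarrow> (\<forall>b. lo b f)"
proof -
  have "(\<forall>k\<ge>1. \<forall>\<alpha>. \<exists>C. \<forall>z. 1 / real k \<le> Re z \<longrightarrow> p \<alpha> (f z) \<le> C * exp (1 / real k * cmod z - real k * Re z)) \<longleftrightarrow>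
      (\<forall>b. \<forall>\<epsilon>>0. \<forall>\<alpha>. \<exists>C. \<forall>z. \<epsilon> \<le> Re z \<longrightarrow> p \<alpha> (f z) \<le> C * exp (\<epsilon> * cmod z - b * Re z))" (is "?L \<longleftrightarrow> ?R")
  proof
    assume L: ?L
    show ?R
    proof (intro allI impI)
      fix b \<epsilon> :: real and \<alpha> assume "\<epsilon> > 0"
      then obtain n where n: "n \<ge> 1" "1 / real n \<le> \<epsilon>" "b < real n" using ex_large_nat[OF zero_less_one \<open>\<epsilon> > 0\<close>, of b] by metis
      then obtain C where "\<forall>z. 1 / real n \<le> Re z \<longrightarrow> p \<alpha> (f z) \<le> C * exp (1 / real n * cmod z - real n * Re z)"
        using L by blast
      from lo_weaken[OF this n(2) less_imp_le[OF n(3)]] n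
      show "\<exists>C. \<forall>z. \<epsilon> \<le> Re z \<longrightarrow> p \<alpha> (f z) \<le> C * exp (\<epsilon> * cmod z - b * Re z)" by auto
    qed
  next
    assume R: ?R
    show ?L
    proof (intro allI impI)
      fix k :: nat and \<alpha> assume "1 \<le> k"
      then have "0 < 1 / real k" by simp
      with R show "\<exists>C. \<forall>z. 1 / real k \<le> Re z \<longrightarrow> p \<alpha> (f z) \<le> C * exp (1 / real k * cmod z - real k * Re z)" by blast
    qed
  qed
  moreover have "f \<in> LO smul p {\<infinity>} \<longleftrightarrow> f \<in> hol smul {z. Re z > 0} \<and> (\<forall>k\<ge>1. \<forall>\<alpha>.
      bdd_above ((\<lambda>z. p \<alpha> (f z) * exp (- (1 / real k) * cmod z + real k * \<bar>Re z\<bar>)) ` {z. Re z \<ge> 1 / real k}))"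
    by (simp add: LO_def half_plane_def)
  ultimately show ?thesis by (auto simp only: bdd_above_lo lo_def)
qed

text \<open>The pointwise estimate behind the bounds for contour integrals. Of the decay
  \<open>Re \<zeta>\<close> of the kernel, the part \<open>\<sigma>\<close> pays for integrability
  in \<open>t\<close> against the growth rate \<open>\<mu>\<close>. The dependence on
  \<open>\<zeta>\<close> stays in the factor
  \<open>exp (- (b - c) * Re \<zeta> + c * \<bar>Im \<zeta>\<bar>)\<close>, which is of the kind
  that \<open>LO\<close> prescribes.\<close>

lemma path_weight_bound:
  assumes c: "c > 0" and \<mu>: "\<mu> \<ge> 0" and \<sigma>: "\<sigma> \<ge> 0" "\<sigma> \<le> Re \<zeta>"
    and G: "p \<alpha> (G (path_right b c t)) \<le> M * exp (\<mu> * \<bar>Re (path_right b c t)\<bar>)"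
  shows "cmod (exp (- path_right b c t * \<zeta>)) * p \<alpha> (smul (path_deriv c t) (G (path_right b c t))) \<le>
    ((1 + 2 * c) * \<bar>M\<bar> * exp (\<mu> * (\<bar>b\<bar> + c) + \<sigma>) * exp (- (b - c) * Re \<zeta> + c * \<bar>Im \<zeta>\<bar>)) * exp (- (\<sigma> - \<mu>) * \<bar>t\<bar>)"
proof -
  let ?w = "path_right b c t"
  note w = path_right_bounds[OF c, of b t]
  have "p \<alpha> (G ?w) \<le> \<bar>M\<bar> * exp (\<mu> * (\<bar>b\<bar> + c + \<bar>t\<bar>))"
    using G path_right_abs_Re[OF c, of b t] \<mu>
    by (elim order_trans) (intro mult_mono, auto intro!: mult_left_mono)
  then have 1: "p \<alpha> (smul (path_deriv c t) (G ?w)) \<le> (1 + 2 * c) * (\<bar>M\<bar> * exp (\<mu> * (\<bar>b\<bar> + c + \<bar>t\<bar>)))"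
    unfolding seminorm_scale using norm_path_deriv[OF c] c by (intro mult_mono) auto
  have "Re (- ?w * \<zeta>) \<le> - (b - c) * Re \<zeta> + c * \<bar>Im \<zeta>\<bar> + \<sigma> - \<sigma> * \<bar>t\<bar>"
  proof -
    have "Im ?w * Im \<zeta> \<le> \<bar>Im ?w\<bar> * \<bar>Im \<zeta>\<bar>" by (metis abs_ge_self abs_mult)
    also have "\<dots> \<le> c * \<bar>Im \<zeta>\<bar>" using w(4) by (intro mult_right_mono) auto
    finally have i: "Im ?w * Im \<zeta> \<le> c * \<bar>Im \<zeta>\<bar>" .
    \<comment> \<open>\<open>Re ?w - (b - c)\<close> is at least \<open>\<bar>t\<bar> - 1\<close>,
      and it is nonnegative, which allows replacing \<open>\<sigma>\<close> by the larger
      \<open>Re \<zeta>\<close>.\<close>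
    have "\<sigma> * (\<bar>t\<bar> - 1) \<le> \<sigma> * (Re ?w - (b - c))" using w(2) \<sigma> by (intro mult_left_mono) auto
    also have "\<dots> \<le> Re \<zeta> * (Re ?w - (b - c))" using w(1) \<sigma> by (intro mult_right_mono) auto
    finally have "\<sigma> * (\<bar>t\<bar> - 1) \<le> Re \<zeta> * (Re ?w - (b - c))" .
    with i show ?thesis by (simp add: algebra_simps)
  qed
  then have 2: "cmod (exp (- ?w * \<zeta>)) \<le> exp (- (b - c) * Re \<zeta> + c * \<bar>Im \<zeta>\<bar> + \<sigma> - \<sigma> * \<bar>t\<bar>)"
    by (simp only: norm_exp_eq_Re exp_le_cancel_iff)
  have "cmod (exp (- ?w * \<zeta>)) * p \<alpha> (smul (path_deriv c t) (G ?w)) \<le>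
      exp (- (b - c) * Re \<zeta> + c * \<bar>Im \<zeta>\<bar> + \<sigma> - \<sigma> * \<bar>t\<bar>) * ((1 + 2 * c) * (\<bar>M\<bar> * exp (\<mu> * (\<bar>b\<bar> + c + \<bar>t\<bar>))))"
    by (intro mult_mono 1 2) auto
  also have "\<dots> = ((1 + 2 * c) * \<bar>M\<bar>) * (exp (- (b - c) * Re \<zeta> + c * \<bar>Im \<zeta>\<bar> + \<sigma> - \<sigma> * \<bar>t\<bar>) * exp (\<mu> * (\<bar>b\<bar> + c + \<bar>t\<bar>)))"
    by (simp only: mult_ac)
  also have "exp (- (b - c) * Re \<zeta> + c * \<bar>Im \<zeta>\<bar> + \<sigma> - \<sigma> * \<bar>t\<bar>) * exp (\<mu> * (\<bar>b\<bar> + c + \<bar>t\<bar>)) =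
      exp (\<mu> * (\<bar>b\<bar> + c) + \<sigma>) * exp (- (b - c) * Re \<zeta> + c * \<bar>Im \<zeta>\<bar>) * exp (- (\<sigma> - \<mu>) * \<bar>t\<bar>)"
    by (simp flip: exp_add add: algebra_simps)
  finally show ?thesis by (simp only: mult_ac)
qed

end

section \<open>The Laplace transform of a representative\<close>

context sc_lc_hausdorff
begin

text \<open>The Laplace integral of one representative over one contour. Kernel and vector part are
  kept apart so that \<open>parametric_pettis_integral\<close> applies.\<close>

definition lap :: "real \<Rightarrow> real \<Rightarrow> (complex \<Rightarrow> 'e) \<Rightarrow> complex \<Rightarrow> 'e" where
  "lap a c G \<zeta> = pettis (\<lambda>t. smul (exp (- path_right a c t * \<zeta>)) (smul (path_deriv c t) (G (path_right a c t))))"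

lemma continuous_path_deriv_comp:
  assumes "c > 0" "G \<in> hol smul (- ray a)" "t \<notin> {-1, 1}"
  shows "((\<lambda>t. smul (path_deriv c t) (G (path_right a c t))) \<longlongrightarrow> smul (path_deriv c t) (G (path_right a c t))) (at t)"
proof -
  have "continuous_on UNIV (\<lambda>t. G (path_right a c t))"
    by (rule continuous_on_compose2[OF hol_continuous_on[OF assms(2)] continuous_on_path_right])
      (use path_right_notin_ray[OF assms(1)] in auto)
  then show ?thesis
    using assms(3) by (intro tendsto_smul path_deriv_tendsto) (auto simp: continuous_on_def)
qed

lemma infra_path:
  assumes "infra a G" "c > 0" "\<epsilon> > 0"
  obtains M where "\<And>t. p \<alpha> (G (path_right a c t)) \<le> M * exp (\<epsilon> * \<bar>Re (path_right a c t)\<bar>)"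
proof -
  obtain M where "\<And>z. c \<le> dray a z \<Longrightarrow> \<bar>Im z\<bar> \<le> c \<Longrightarrow> p \<alpha> (G z) \<le> M * exp (\<epsilon> * \<bar>Re z\<bar>)"
    using infraD[OF assms(1,3,2), of c \<alpha>] by (auto simp: growth_on_def)
  then show thesis by (intro that[of M]) (simp add: dray_path_right[OF assms(2)] path_right_bounds(4)[OF assms(2)])
qed

lemma lap_pettis:
  assumes G: "G \<in> hol smul (- ray a)" "infra a G" and c: "c > 0"
  shows "\<And>\<zeta>. Re \<zeta> > 0 \<Longrightarrow> has_pettis_integral smul lborel
      (\<lambda>t. smul (exp (- path_right a c t * \<zeta>)) (smul (path_deriv c t) (G (path_right a c t)))) (lap a c G \<zeta>)"
    and "lap a c G \<in> hol smul {\<zeta>. Re \<zeta> > 0}"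
proof -
  have cont: "continuous_on UNIV (path_right a c)" by (rule continuous_on_path_right)
  have ptend: "(path_right a c \<longlongrightarrow> path_right a c t) (at t)" for t using cont by (auto simp: continuous_on_def)
  have dom: "\<exists>r C d. r > 0 \<and> d > 0 \<and> (\<forall>\<zeta>\<in>ball \<zeta>0 r. \<forall>t. cmod (exp (- path_right a c t * \<zeta>)) *
      p \<alpha> (smul (path_deriv c t) (G (path_right a c t))) \<le> C * exp (- d * \<bar>t\<bar>))" if "\<zeta>0 \<in> {\<zeta>. Re \<zeta> > 0}" for \<zeta>0 \<alpha>
  proof -
    \<comment> \<open>On the disc of this radius \<open>Re \<zeta>\<close> stays above
      \<open>\<sigma>\<close>; growth of \<open>G\<close> at the rate \<open>\<sigma> / 2\<close>
      leaves the decay rate \<open>\<sigma> / 2\<close>.\<close>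
    define \<sigma> where "\<sigma> = Re \<zeta>0 / 2"
    have \<sigma>: "\<sigma> > 0" using that by (simp add: \<sigma>_def)
    obtain M where M: "\<And>t. p \<alpha> (G (path_right a c t)) \<le> M * exp (\<sigma> / 2 * \<bar>Re (path_right a c t)\<bar>)"
      using infra_path[OF G(2) c, of "\<sigma> / 2" \<alpha>] \<sigma> by auto
    define K where "K = (1 + 2 * c) * \<bar>M\<bar> * exp (\<sigma> / 2 * (\<bar>a\<bar> + c) + \<sigma>)"
    define L where "L = exp (\<bar>a - c\<bar> * (Re \<zeta>0 + \<sigma>) + c * (\<bar>Im \<zeta>0\<bar> + \<sigma>))"
    have "cmod (exp (- path_right a c t * \<zeta>)) * p \<alpha> (smul (path_deriv c t) (G (path_right a c t)))
        \<le> K * L * exp (- (\<sigma> / 2) * \<bar>t\<bar>)" if "\<zeta> \<in> ball \<zeta>0 \<sigma>" for \<zeta> t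
    proof -
      have d: "\<bar>Re \<zeta> - Re \<zeta>0\<bar> < \<sigma>" "\<bar>Im \<zeta> - Im \<zeta>0\<bar> < \<sigma>"
        using that abs_Re_le_cmod[of "\<zeta> - \<zeta>0"] abs_Im_le_cmod[of "\<zeta> - \<zeta>0"] by (auto simp: dist_norm norm_minus_commute)
      have "Re \<zeta>0 = 2 * \<sigma>" by (simp add: \<sigma>_def)
      then have re: "\<sigma> \<le> Re \<zeta>" "Re \<zeta> \<le> Re \<zeta>0 + \<sigma>" using d(1) by linarith+
      have im: "\<bar>Im \<zeta>\<bar> \<le> \<bar>Im \<zeta>0\<bar> + \<sigma>" using d(2) by linarith
      have "- (a - c) * Re \<zeta> \<le> \<bar>a - c\<bar> * (Re \<zeta>0 + \<sigma>)" using re \<sigma> by (intro mult_mono) auto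
      moreover have "c * \<bar>Im \<zeta>\<bar> \<le> c * (\<bar>Im \<zeta>0\<bar> + \<sigma>)" using im c by (intro mult_left_mono) auto
      ultimately have L: "exp (- (a - c) * Re \<zeta> + c * \<bar>Im \<zeta>\<bar>) \<le> L" by (simp add: L_def)
      have "cmod (exp (- path_right a c t * \<zeta>)) * p \<alpha> (smul (path_deriv c t) (G (path_right a c t)))
          \<le> K * exp (- (a - c) * Re \<zeta> + c * \<bar>Im \<zeta>\<bar>) * exp (- (\<sigma> - \<sigma> / 2) * \<bar>t\<bar>)"
        unfolding K_def using \<sigma> re by (intro path_weight_bound c M) auto
      also have "\<dots> \<le> K * L * exp (- (\<sigma> - \<sigma> / 2) * \<bar>t\<bar>)"
        using L c by (intro mult_right_mono mult_left_mono) (auto simp: K_def)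
      finally show ?thesis by simp
    qed
    then show ?thesis using \<sigma> by (intro exI[of _ \<sigma>] exI[of _ "K * L"] exI[of _ "\<sigma> / 2"]) auto
  qed
  have der: "((\<lambda>\<zeta>. exp (- path_right a c t * \<zeta>)) has_field_derivative - path_right a c t * exp (- path_right a c t * \<zeta>)) (at \<zeta>)" for \<zeta> t
    by (auto intro!: derivative_eq_intros)
  have scont: "((\<lambda>t. exp (- path_right a c t * \<zeta>)) \<longlongrightarrow> exp (- path_right a c t * \<zeta>)) (at t)" for \<zeta> t
    by (intro tendsto_intros ptend)
  note * = parametric_pettis_integral[where S = "{-1, 1}" and F = "\<lambda>t. smul (path_deriv c t) (G (path_right a c t))"
      and s = "\<lambda>\<zeta> t. exp (- path_right a c t * \<zeta>)", OF _ continuous_path_deriv_comp[OF c G(1)] open_halfspace_Re_gt der scont dom]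
  show "\<And>\<zeta>. Re \<zeta> > 0 \<Longrightarrow> has_pettis_integral smul lborel
      (\<lambda>t. smul (exp (- path_right a c t * \<zeta>)) (smul (path_deriv c t) (G (path_right a c t)))) (lap a c G \<zeta>)"
    unfolding lap_def by (rule *(1)) auto
  show "lap a c G \<in> hol smul {\<zeta>. Re \<zeta> > 0}"
    unfolding lap_def[abs_def] by (rule *(3)) auto
qed

lemma lap_weak:
  assumes "G \<in> hol smul (- ray a)" "infra a G" "c > 0" "Re \<zeta> > 0" "\<phi> \<in> dual smul"
  shows "\<phi> (lap a c G \<zeta>) = pint a c (\<lambda>z. exp (- z * \<zeta>) * \<phi> (G z))"
    and "path_integrable a c (\<lambda>z. exp (- z * \<zeta>) * \<phi> (G z))"
  using lap_pettis(1)[OF assms(1-4)] assms(5)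
  by (auto simp: has_pettis_integral_def dual_scale pint_def path_integrable_def mult_ac)

text \<open>Growth at half the rate of the kernel leaves the other half as decay.\<close>

lemma dual_exp_decays:
  assumes X: "growth_on X G \<alpha> (Re \<zeta> / 2)" and re: "Re \<zeta> > 0" and B: "\<And>x. cmod (\<phi> x) \<le> B * p \<alpha> x" "B > 0"
    and im: "\<And>z. z \<in> X \<Longrightarrow> \<bar>Im z\<bar> \<le> C" and Re: "\<And>z. z \<in> X \<Longrightarrow> R \<le> Re z"
  shows "decays X (\<lambda>z. exp (- z * \<zeta>) * \<phi> (G z))"
proof -
  obtain M where M: "\<And>z. z \<in> X \<Longrightarrow> p \<alpha> (G z) \<le> M * exp (Re \<zeta> / 2 * \<bar>Re z\<bar>)" using X by (auto simp: growth_on_def)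
  have "cmod (exp (- z * \<zeta>) * \<phi> (G z)) \<le> (B * \<bar>M\<bar> * exp (Re \<zeta> * \<bar>R\<bar> + C * \<bar>Im \<zeta>\<bar>)) * exp (- (Re \<zeta> / 2) * Re z)" if z: "z \<in> X" for z
  proof -
    have "cmod (\<phi> (G z)) \<le> B * (\<bar>M\<bar> * exp (Re \<zeta> / 2 * \<bar>Re z\<bar>))"
      using B(2) by (intro order_trans[OF B(1)] mult_left_mono order_trans[OF M[OF z]] mult_right_mono) auto
    also have "\<dots> \<le> B * (\<bar>M\<bar> * exp (Re \<zeta> / 2 * Re z + Re \<zeta> * \<bar>R\<bar>))"
    proof -
      have "\<bar>Re z\<bar> \<le> Re z + 2 * \<bar>R\<bar>" using Re[OF z] by auto
      then have "Re \<zeta> / 2 * \<bar>Re z\<bar> \<le> Re \<zeta> / 2 * (Re z + 2 * \<bar>R\<bar>)" using re by (intro mult_left_mono) auto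
      then show ?thesis using B(2) by (intro mult_left_mono) (auto simp: algebra_simps)
    qed
    finally have 1: "cmod (\<phi> (G z)) \<le> B * (\<bar>M\<bar> * exp (Re \<zeta> / 2 * Re z + Re \<zeta> * \<bar>R\<bar>))" .
    have "Im z * Im \<zeta> \<le> \<bar>Im z\<bar> * \<bar>Im \<zeta>\<bar>" by (metis abs_ge_self abs_mult)
    also have "\<dots> \<le> C * \<bar>Im \<zeta>\<bar>" using im[OF z] by (intro mult_right_mono) auto
    finally have 2: "cmod (exp (- z * \<zeta>)) \<le> exp (- Re z * Re \<zeta> + C * \<bar>Im \<zeta>\<bar>)" by simp
    have "cmod (exp (- z * \<zeta>) * \<phi> (G z)) \<le> exp (- Re z * Re \<zeta> + C * \<bar>Im \<zeta>\<bar>) * (B * (\<bar>M\<bar> * exp (Re \<zeta> / 2 * Re z + Re \<zeta> * \<bar>R\<bar>)))"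
      unfolding norm_mult by (intro mult_mono 1 2) auto
    also have "\<dots> = B * \<bar>M\<bar> * (exp (- Re z * Re \<zeta> + C * \<bar>Im \<zeta>\<bar>) * exp (Re \<zeta> / 2 * Re z + Re \<zeta> * \<bar>R\<bar>))" by (simp only: mult_ac)
    also have "exp (- Re z * Re \<zeta> + C * \<bar>Im \<zeta>\<bar>) * exp (Re \<zeta> / 2 * Re z + Re \<zeta> * \<bar>R\<bar>) = exp (Re \<zeta> * \<bar>R\<bar> + C * \<bar>Im \<zeta>\<bar>) * exp (- (Re \<zeta> / 2) * Re z)"
      by (simp flip: exp_add add: algebra_simps)
    finally show ?thesis by (simp only: mult_ac)
  qed
  then show ?thesis using re unfolding decays_def by (intro exI[of _ "B * \<bar>M\<bar> * exp (Re \<zeta> * \<bar>R\<bar> + C * \<bar>Im \<zeta>\<bar>)"] exI[of _ "Re \<zeta> / 2"]) auto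
qed

lemma infra_band_decays:
  assumes "infra a G" "0 < c1" "Re \<zeta> > 0" "\<phi> \<in> dual smul"
  shows "decays (band a c1 c2) (\<lambda>z. exp (- z * \<zeta>) * \<phi> (G z))"
proof -
  obtain B \<alpha> where B: "B > 0" "\<And>x. cmod (\<phi> x) \<le> B * p \<alpha> x" using assms(4) by (rule dual_bounded) (rule that)
  show ?thesis
  proof (rule dual_exp_decays[OF _ assms(3) B(2,1), where C = c2 and R = "a - c2"])
    show "growth_on (band a c1 c2) G \<alpha> (Re \<zeta> / 2)"
      using assms by (intro growth_on_subset[OF infraD[OF assms(1) _ assms(2), of _ c2]])
        (auto simp: band_def intro: order_trans[OF abs_Im_le_dray])
    show "\<bar>Im z\<bar> \<le> c2" "a - c2 \<le> Re z" if "z \<in> band a c1 c2" for z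
      using that abs_Im_le_dray[of z a] Re_ge_dray[of a z] by (auto simp: band_def)
  qed
qed

text \<open>Cauchy's theorem in the band, applied to each scalarization.\<close>

lemma lap_radius:
  assumes G: "G \<in> hol smul (- ray a)" "infra a G" and c: "0 < c1" "0 < c2" and re: "Re \<zeta> > 0"
  shows "lap a c1 G \<zeta> = lap a c2 G \<zeta>"
  using c
proof (induction c1 c2 rule: linorder_wlog)
  case (le c1 c2)
  show ?case
  proof (rule dual_separates)
    fix \<phi> assume \<phi>: "\<phi> \<in> dual smul"
    define h where "h z = exp (- z * \<zeta>) * \<phi> (G z)" for z
    have hol: "h holomorphic_on - ray a"
      unfolding h_def by (intro holomorphic_intros hol_weak[OF G(1) open_slit \<phi>])
    obtain H where H: "\<And>z. z \<notin> ray a \<Longrightarrow> (H has_field_derivative h z) (at z)"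
      using slit_primitive[OF hol] by blast
    have "pint a c1 h = pint a c2 h"
    proof (rule pint_band_eq[where H = H])
      show "decays (band a c1 c2) h" unfolding h_def by (rule infra_band_decays[OF G(2) le(2) re \<phi>])
      show "continuous_on (band a c1 c2) h"
        by (rule continuous_on_subset[OF holomorphic_on_imp_continuous_on[OF hol] band_subset_slit[OF le(2)]])
    qed (use le H band_subset_slit[OF le(2), of a c2] in auto)
    then show "\<phi> (lap a c1 G \<zeta>) = \<phi> (lap a c2 G \<zeta>)"
      using le by (simp add: lap_weak(1)[OF G _ re \<phi>] h_def[abs_def])
  qed
qed simp

text \<open>The bound concerns any vector whose images under functionals are the contour integrals,
  and it asks for growth of \<open>G\<close> on the contour alone. Thus it also covers an entire
  function whose growth is known only there.\<close>

lemma path_integral_bound: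
  assumes c: "c > 0" and G: "\<And>t. p \<alpha> (G (path_right b c t)) \<le> M * exp (\<mu> * \<bar>Re (path_right b c t)\<bar>)"
    and \<mu>: "0 \<le> \<mu>" "\<mu> < \<sigma>"
  shows "\<exists>K. \<forall>\<zeta> v. \<sigma> \<le> Re \<zeta> \<longrightarrow> (\<forall>\<phi>\<in>polar \<alpha>. \<phi> v = pint b c (\<lambda>z. exp (- z * \<zeta>) * \<phi> (G z))) \<longrightarrow>
    p \<alpha> v \<le> K * exp (- (b - c) * Re \<zeta> + c * \<bar>Im \<zeta>\<bar>)"
proof -
  define K where "K = (1 + 2 * c) * \<bar>M\<bar> * exp (\<mu> * (\<bar>b\<bar> + c) + \<sigma>)"
  define I where "I = (\<integral>t. exp (- (\<sigma> - \<mu>) * \<bar>t\<bar>) \<partial>lborel)"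
  have "p \<alpha> v \<le> (K * I) * exp (- (b - c) * Re \<zeta> + c * \<bar>Im \<zeta>\<bar>)"
    if \<zeta>: "\<sigma> \<le> Re \<zeta>" and v: "\<forall>\<phi>\<in>polar \<alpha>. \<phi> v = pint b c (\<lambda>z. exp (- z * \<zeta>) * \<phi> (G z))" for \<zeta> v
  proof (rule seminorm_leI)
    fix \<phi> assume \<phi>: "\<phi> \<in> polar \<alpha>"
    have "cmod (pint b c (\<lambda>z. exp (- z * \<zeta>) * \<phi> (G z))) \<le> (K * exp (- (b - c) * Re \<zeta> + c * \<bar>Im \<zeta>\<bar>)) * I"
      unfolding pint_def I_def
    proof (rule norm_integral_le_exp)
      fix t
      let ?w = "path_right b c t"
      have "path_deriv c t * (exp (- ?w * \<zeta>) * \<phi> (G ?w)) = exp (- ?w * \<zeta>) * \<phi> (smul (path_deriv c t) (G ?w))"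
        by (simp add: dual_scale[OF polarD(1)[OF \<phi>]])
      then have "cmod (path_deriv c t * (exp (- ?w * \<zeta>) * \<phi> (G ?w))) \<le> cmod (exp (- ?w * \<zeta>)) * p \<alpha> (smul (path_deriv c t) (G ?w))"
        by (simp only: norm_mult mult_left_mono[OF polarD(2)[OF \<phi>] norm_ge_zero])
      also have "\<dots> \<le> K * exp (- (b - c) * Re \<zeta> + c * \<bar>Im \<zeta>\<bar>) * exp (- (\<sigma> - \<mu>) * \<bar>t\<bar>)"
        unfolding K_def using \<mu> \<zeta> by (intro path_weight_bound c G) auto
      finally show "cmod (path_deriv c t * (exp (- ?w * \<zeta>) * \<phi> (G ?w))) \<le> K * exp (- (b - c) * Re \<zeta> + c * \<bar>Im \<zeta>\<bar>) * exp (- (\<sigma> - \<mu>) * \<bar>t\<bar>)" .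
    qed (use \<mu> in simp)
    then show "cmod (\<phi> v) \<le> (K * I) * exp (- (b - c) * Re \<zeta> + c * \<bar>Im \<zeta>\<bar>)" using v \<phi> by (simp add: mult_ac)
  qed
  then show ?thesis by blast
qed

text \<open>Since the radius is free, \<open>\<epsilon> / 2\<close> may be used for the given
  \<open>\<epsilon>\<close>. The exponent then exceeds \<open>- a * Re \<zeta>\<close> by
  \<open>\<epsilon> / 2 * (Re \<zeta> + \<bar>Im \<zeta>\<bar>)\<close>, which is at most
  \<open>\<epsilon> * cmod \<zeta>\<close>.\<close>

lemma lap_lo:
  assumes G: "G \<in> hol smul (- ray a)" "infra a G" and c: "c > 0"
  shows "lo a (lap a c G)"
  unfolding lo_def
proof (intro conjI allI impI)
  show "lap a c G \<in> hol smul {z. Re z > 0}" by (rule lap_pettis(2)[OF G c])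
  fix \<epsilon> :: real and \<alpha> assume e: "\<epsilon> > 0"
  then have e2: "\<epsilon> / 2 > 0" by simp
  obtain M where M: "\<And>t. p \<alpha> (G (path_right a (\<epsilon> / 2) t)) \<le> M * exp (\<epsilon> / 2 * \<bar>Re (path_right a (\<epsilon> / 2) t)\<bar>)"
    using infra_path[OF G(2) e2 e2, of \<alpha>] by blast
  obtain K where K: "\<And>\<zeta> v. \<epsilon> \<le> Re \<zeta> \<Longrightarrow> (\<forall>\<phi>\<in>polar \<alpha>. \<phi> v = pint a (\<epsilon> / 2) (\<lambda>z. exp (- z * \<zeta>) * \<phi> (G z))) \<Longrightarrow>
      p \<alpha> v \<le> K * exp (- (a - \<epsilon> / 2) * Re \<zeta> + \<epsilon> / 2 * \<bar>Im \<zeta>\<bar>)"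
    using path_integral_bound[OF e2 M, of \<epsilon>] e by auto
  have "p \<alpha> (lap a c G \<zeta>) \<le> \<bar>K\<bar> * exp (\<epsilon> * cmod \<zeta> - a * Re \<zeta>)" if \<zeta>: "\<epsilon> \<le> Re \<zeta>" for \<zeta>
  proof -
    have re: "Re \<zeta> > 0" using \<zeta> e by simp
    have "p \<alpha> (lap a c G \<zeta>) = p \<alpha> (lap a (\<epsilon> / 2) G \<zeta>)" by (simp only: lap_radius[OF G c e2 re])
    also have "\<dots> \<le> K * exp (- (a - \<epsilon> / 2) * Re \<zeta> + \<epsilon> / 2 * \<bar>Im \<zeta>\<bar>)"
      by (rule K[OF \<zeta>]) (use lap_weak(1)[OF G e2 re] polarD(1) in blast)
    also have "\<dots> \<le> \<bar>K\<bar> * exp (\<epsilon> * cmod \<zeta> - a * Re \<zeta>)"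
    proof (intro mult_mono)
      have "Re \<zeta> + \<bar>Im \<zeta>\<bar> \<le> 2 * cmod \<zeta>" using abs_Re_le_cmod[of \<zeta>] abs_Im_le_cmod[of \<zeta>] by linarith
      then have "\<epsilon> / 2 * (Re \<zeta> + \<bar>Im \<zeta>\<bar>) \<le> \<epsilon> / 2 * (2 * cmod \<zeta>)" using e by (intro mult_left_mono) auto
      then show "exp (- (a - \<epsilon> / 2) * Re \<zeta> + \<epsilon> / 2 * \<bar>Im \<zeta>\<bar>) \<le> exp (\<epsilon> * cmod \<zeta> - a * Re \<zeta>)"
        by (simp add: algebra_simps)
    qed auto
    finally show ?thesis .
  qed
  then show "\<exists>C. \<forall>z. \<epsilon> \<le> Re z \<longrightarrow> p \<alpha> (lap a c G z) \<le> C * exp (\<epsilon> * cmod z - a * Re z)" by blast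
qed

lemma lo_cong: "lo a f \<Longrightarrow> (\<And>z. Re z > 0 \<Longrightarrow> f z = g z) \<Longrightarrow> lo a g"
proof -
  assume f: "lo a f" and eq: "\<And>z. Re z > 0 \<Longrightarrow> f z = g z"
  have "g \<in> hol smul {z. Re z > 0}"
    by (rule hol_cong[of f]) (use f eq in \<open>simp_all add: lo_def open_halfspace_Re_gt\<close>)
  moreover have "\<exists>C. \<forall>z. \<epsilon> \<le> Re z \<longrightarrow> p \<alpha> (g z) \<le> C * exp (\<epsilon> * cmod z - a * Re z)" if e: "\<epsilon> > 0" for \<epsilon> \<alpha>
  proof -
    obtain C where "\<And>z. \<epsilon> \<le> Re z \<Longrightarrow> p \<alpha> (f z) \<le> C * exp (\<epsilon> * cmod z - a * Re z)"
      using lo_bound[OF f e, of \<alpha>] by blast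
    then show ?thesis using eq e by (intro exI[of _ C]) (metis less_le_trans)
  qed
  ultimately show ?thesis by (simp add: lo_def)
qed

text \<open>Both integrals are limits of the same increments of one entire primitive, as the vertex
  does not occur in the limit of \<open>pint_tendsto\<close>.\<close>

lemma lap_entire_shift:
  assumes G: "G \<in> hol smul UNIV" "infra a G" and c: "c > 0" and re: "Re \<zeta> > 0"
  shows "lap a c G \<zeta> = lap b c G \<zeta>"
proof (rule dual_separates)
  fix \<phi> assume \<phi>: "\<phi> \<in> dual smul"
  note Gs = hol_subset[OF G(1) subset_UNIV]
  note Gb = infra_shift[OF G, of b]
  have hol: "(\<lambda>z. exp (- z * \<zeta>) * \<phi> (G z)) holomorphic_on UNIV"
    by (intro holomorphic_intros hol_weak[OF G(1) open_UNIV \<phi>])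
  obtain H where H: "\<And>z. z \<in> UNIV \<Longrightarrow> (H has_field_derivative exp (- z * \<zeta>) * \<phi> (G z)) (at z)"
    by (rule convex_primitive[OF hol convex_UNIV open_UNIV]) (rule that)
  have "pint a c (\<lambda>z. exp (- z * \<zeta>) * \<phi> (G z)) = pint b c (\<lambda>z. exp (- z * \<zeta>) * \<phi> (G z))"
    by (rule pint_eqI[OF H _ pint_tendsto[OF H]])
      (rule UNIV_I lap_weak(2)[OF Gs G(2) c re \<phi>] lap_weak(2)[OF Gs Gb c re \<phi>])+
  then show "\<phi> (lap a c G \<zeta>) = \<phi> (lap b c G \<zeta>)"
    by (simp only: lap_weak(1)[OF Gs G(2) c re \<phi>] lap_weak(1)[OF Gs Gb c re \<phi>])
qed

text \<open>With an arbitrary vertex at hand, the transform of an entire function has every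
  exponential type, which is the condition for \<open>{\<infinity>}\<close>.\<close>

lemma lap_entire_lo:
  assumes G: "G \<in> hol smul UNIV" "infra a G" and c: "c > 0"
  shows "lo b (lap a c G)"
  by (rule lo_cong[OF lap_lo[OF hol_subset[OF G(1) subset_UNIV] infra_shift[OF G] c]])
    (rule lap_entire_shift[OF G c, symmetric])

text \<open>The difference \<open>h\<close> is entire and of infra-exponential growth on full
  strips, the ray included, so its Laplace integral closes up at infinity. Hence the transform
  depends only on the class in \<open>bv\<close>.\<close>

lemma lap_diff_hol_exp_empty:
  assumes F: "F \<in> hol smul (- ray a)" "infra a F" and G: "G \<in> hol smul (- ray a)" "infra a G"
    and h: "h \<in> hol_exp smul p {}" and eq: "\<And>z. z \<notin> ray a \<Longrightarrow> F z - G z = h z"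
    and c: "c > 0" and re: "Re \<zeta> > 0"
  shows "lap a c F \<zeta> = lap a c G \<zeta>"
proof (rule dual_separates)
  fix \<phi> assume \<phi>: "\<phi> \<in> dual smul"
  note hhol = hol_exp_emptyD(1)[OF h]
  have hol: "(\<lambda>z. exp (- z * \<zeta>) * \<phi> (h z)) holomorphic_on UNIV"
    by (intro holomorphic_intros hol_weak[OF hhol open_UNIV \<phi>])
  obtain H where H: "\<And>z. z \<in> UNIV \<Longrightarrow> (H has_field_derivative exp (- z * \<zeta>) * \<phi> (h z)) (at z)"
    by (rule convex_primitive[OF hol convex_UNIV open_UNIV]) (rule that)
  obtain B \<alpha> where B: "B > 0" "\<And>x. cmod (\<phi> x) \<le> B * p \<alpha> x" using \<phi> by (rule dual_bounded) (rule that)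
  have "decays {z. a - c \<le> Re z \<and> \<bar>Im z\<bar> \<le> c} (\<lambda>z. exp (- z * \<zeta>) * \<phi> (h z))"
  proof (rule dual_exp_decays[OF _ re B(2,1), where C = c and R = "a - c"])
    show "growth_on {z. a - c \<le> Re z \<and> \<bar>Im z\<bar> \<le> c} h \<alpha> (Re \<zeta> / 2)"
      using re by (intro growth_on_subset[OF hol_exp_emptyD(2)[OF h, of _ c]]) auto
  qed auto
  then obtain C d where d: "d > 0" "\<And>z. a - c \<le> Re z \<Longrightarrow> \<bar>Im z\<bar> \<le> c \<Longrightarrow> cmod (exp (- z * \<zeta>) * \<phi> (h z)) \<le> C * exp (- d * Re z)"
    by (auto simp: decays_def)
  have "pint a c (\<lambda>z. exp (- z * \<zeta>) * \<phi> (h z)) = 0"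
    by (rule pint_eq_0[OF c H continuous_on_subset[OF holomorphic_on_imp_continuous_on[OF hol] subset_UNIV] d]) auto
  moreover have "pint a c (\<lambda>z. exp (- z * \<zeta>) * \<phi> (h z)) =
      pint a c (\<lambda>z. exp (- z * \<zeta>) * \<phi> (F z)) - pint a c (\<lambda>z. exp (- z * \<zeta>) * \<phi> (G z))"
  proof -
    have "pint a c (\<lambda>z. exp (- z * \<zeta>) * \<phi> (h z)) = pint a c (\<lambda>z. exp (- z * \<zeta>) * \<phi> (F z) + (-1) * (exp (- z * \<zeta>) * \<phi> (G z)))"
    proof (rule pint_cong[OF c])
      fix z assume "dray a z = c"
      then have h: "h z = F z - G z" using eq c dray_pos_iff by metis
      show "exp (- z * \<zeta>) * \<phi> (h z) = exp (- z * \<zeta>) * \<phi> (F z) + (-1) * (exp (- z * \<zeta>) * \<phi> (G z))"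
        unfolding h dual_diff[OF \<phi>] by (simp add: algebra_simps)
    qed
    also have "\<dots> = pint a c (\<lambda>z. exp (- z * \<zeta>) * \<phi> (F z)) + pint a c (\<lambda>z. (-1) * (exp (- z * \<zeta>) * \<phi> (G z)))"
      using lap_weak(2)[OF F c re \<phi>] lap_weak(2)[OF G c re \<phi>]
      by (intro pint_add) (auto simp: path_integrable_def mult_ac)
    finally show ?thesis unfolding pint_cmult by simp
  qed
  ultimately show "\<phi> (lap a c F \<zeta>) = \<phi> (lap a c G \<zeta>)"
    by (simp add: lap_weak(1)[OF F c re \<phi>] lap_weak(1)[OF G c re \<phi>])
qed

lemma infra_add: "infra a F \<Longrightarrow> infra a G \<Longrightarrow> infra a (\<lambda>z. F z + G z)"
  by (simp add: infra_def growth_on_add)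

lemma infra_smul: "infra a F \<Longrightarrow> infra a (\<lambda>z. smul k (F z))"
  by (simp add: infra_def growth_on_smul)

lemma infra_cong: "infra a F \<Longrightarrow> (\<And>z. z \<notin> ray a \<Longrightarrow> F z = G z) \<Longrightarrow> infra a G"
  unfolding infra_def
proof (intro allI impI)
  fix \<alpha> and c C \<epsilon> :: real
  assume *: "\<forall>\<alpha> c C. \<forall>\<epsilon>>0. 0 < c \<longrightarrow> growth_on {z. c \<le> dray a z \<and> \<bar>Im z\<bar> \<le> C} F \<alpha> \<epsilon>"
    and eq: "\<And>z. z \<notin> ray a \<Longrightarrow> F z = G z" and "\<epsilon> > 0" "c > 0"
  then have "growth_on {z. c \<le> dray a z \<and> \<bar>Im z\<bar> \<le> C} F \<alpha> \<epsilon>" by blast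
  then show "growth_on {z. c \<le> dray a z \<and> \<bar>Im z\<bar> \<le> C} G \<alpha> \<epsilon>"
  proof (rule growth_on_cong)
    fix z assume "z \<in> {z. c \<le> dray a z \<and> \<bar>Im z\<bar> \<le> C}"
    then have "dray a z > 0" using \<open>c > 0\<close> by simp
    then show "F z = G z" using eq dray_pos_iff by blast
  qed
qed

lemma lap_cong: "c > 0 \<Longrightarrow> (\<And>z. z \<notin> ray a \<Longrightarrow> F z = G z) \<Longrightarrow> lap a c F = lap a c G"
  by (simp add: lap_def[abs_def] path_right_notin_ray)

lemma lap_add:
  assumes F: "F \<in> hol smul (- ray a)" "infra a F" and G: "G \<in> hol smul (- ray a)" "infra a G" and c: "c > 0" and re: "Re \<zeta> > 0"
  shows "lap a c (\<lambda>z. F z + G z) \<zeta> = lap a c F \<zeta> + lap a c G \<zeta>"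
proof (rule dual_separates)
  fix \<phi> assume \<phi>: "\<phi> \<in> dual smul"
  show "\<phi> (lap a c (\<lambda>z. F z + G z) \<zeta>) = \<phi> (lap a c F \<zeta> + lap a c G \<zeta>)"
    using pint_add[OF lap_weak(2)[OF F c re \<phi>] lap_weak(2)[OF G c re \<phi>]]
    by (simp add: lap_weak(1)[OF hol_add[OF F(1) G(1)] infra_add[OF F(2) G(2)] c re \<phi>] lap_weak(1)[OF F c re \<phi>]
      lap_weak(1)[OF G c re \<phi>] dual_add[OF \<phi>] distrib_left)
qed

lemma lap_smul:
  assumes F: "F \<in> hol smul (- ray a)" "infra a F" and c: "c > 0" and re: "Re \<zeta> > 0"
  shows "lap a c (\<lambda>z. smul k (F z)) \<zeta> = smul k (lap a c F \<zeta>)"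
proof (rule dual_separates)
  fix \<phi> assume \<phi>: "\<phi> \<in> dual smul"
  show "\<phi> (lap a c (\<lambda>z. smul k (F z)) \<zeta>) = \<phi> (smul k (lap a c F \<zeta>))"
    using pint_cmult[of a c k "\<lambda>z. exp (- z * \<zeta>) * \<phi> (F z)"]
    by (simp add: lap_weak(1)[OF hol_smul[OF F(1)] infra_smul[OF F(2)] c re \<phi>] lap_weak(1)[OF F c re \<phi>]
      dual_scale[OF \<phi>] mult.left_commute[of _ k])
qed

end

section \<open>The Borel transform\<close>

text \<open>The pulled back integrand on the ray from 1 in the direction \<open>u\<close>, extended
  by 0 to negative parameters so that all integrals are over the whole line.\<close>

definition ray_fun :: "complex \<Rightarrow> (complex \<Rightarrow> complex) \<Rightarrow> real \<Rightarrow> complex" where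
  "ray_fun u h t = (if t < 0 then 0 else u * h (1 + of_real t * u))"

lemma ray_fun_integral_tendsto:
  assumes H: "\<And>t. t \<ge> 0 \<Longrightarrow> (H has_field_derivative h (1 + of_real t * u)) (at (1 + of_real t * u))"
    and int: "integrable lborel (ray_fun u h)"
  shows "((\<lambda>T. H (1 + of_real T * u)) \<longlongrightarrow> H 1 + integral\<^sup>L lborel (ray_fun u h)) at_top"
proof -
  have "((\<lambda>T. \<integral>t. indicator {0..T} t *\<^sub>R ray_fun u h t \<partial>lborel) \<longlongrightarrow> (\<integral>t. ray_fun u h t \<partial>lborel)) at_top"
  proof (rule integral_dominated_convergence_at_top)
    show "integrable lborel (\<lambda>t. norm (ray_fun u h t))" using int by simp
    show "ray_fun u h \<in> borel_measurable lborel" using int by auto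
    show "(\<lambda>t. indicator {0..T} t *\<^sub>R ray_fun u h t) \<in> borel_measurable lborel" for T using int by auto
    show "\<forall>\<^sub>F T in at_top. AE t in lborel. norm (indicator {0..T} t *\<^sub>R ray_fun u h t) \<le> norm (ray_fun u h t)"
      by (auto intro!: always_eventually simp: indicator_def)
    have "\<forall>\<^sub>F T in at_top. indicator {0..T} t *\<^sub>R ray_fun u h t = ray_fun u h t" for t
      using eventually_ge_at_top[of t] by eventually_elim (auto simp: indicator_def ray_fun_def)
    then show "AE t in lborel. ((\<lambda>T. indicator {0..T} t *\<^sub>R ray_fun u h t) \<longlongrightarrow> ray_fun u h t) at_top"
      by (auto intro!: AE_I2 tendsto_eventually)
  qed
  moreover have "\<forall>\<^sub>F T in at_top. (\<integral>t. indicator {0..T} t *\<^sub>R ray_fun u h t \<partial>lborel) = H (1 + of_real T * u) - H 1"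
    using eventually_ge_at_top[of 0]
  proof eventually_elim
    case (elim T)
    have "(ray_fun u h has_integral H (1 + of_real T * u) - H (1 + of_real 0 * u)) {0..T}"
    proof (rule fundamental_theorem_of_calculus)
      show "((\<lambda>t. H (1 + of_real t * u)) has_vector_derivative ray_fun u h t) (at t within {0..T})" if "t \<in> {0..T}" for t
      proof -
        have "((\<lambda>t. 1 + complex_of_real t * u) has_vector_derivative u) (at t)"
          by (auto intro!: derivative_eq_intros simp: has_vector_derivative_complex_iff)
        from field_vector_diff_chain_at[OF this H] that
        have "((\<lambda>t. H (1 + of_real t * u)) has_vector_derivative u * h (1 + of_real t * u)) (at t)" by (simp add: comp_def)
        then show ?thesis using that by (auto simp: ray_fun_def intro: has_vector_derivative_at_within)
      qed
    qed (rule elim)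
    moreover have "set_integrable lborel {0..T} (ray_fun u h)"
      using int by (auto simp: set_integrable_def intro: integrable_mult_indicator)
    ultimately show "(\<integral>t. indicator {0..T} t *\<^sub>R ray_fun u h t \<partial>lborel) = H (1 + of_real T * u) - H 1"
      using set_borel_integral_eq_integral(2)[of "{0..T}" "ray_fun u h"] by (simp add: set_lebesgue_integral_def integral_unique)
  qed
  ultimately have "((\<lambda>T. H (1 + of_real T * u) - H 1) \<longlongrightarrow> (\<integral>t. ray_fun u h t \<partial>lborel)) at_top"
    by (rule Lim_transform_eventually)
  from tendsto_add[OF tendsto_const[of "H 1"] this] show ?thesis by simp
qed

lemma ray_fun_exp_integral:
  assumes "Re (k * u) < 0"
  shows "integrable lborel (ray_fun u (\<lambda>w. exp (k * w)))"
    and "integral\<^sup>L lborel (ray_fun u (\<lambda>w. exp (k * w))) = - exp k / k"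
proof -
  have k: "k \<noteq> 0" using assms by auto
  have le: "cmod (ray_fun u (\<lambda>w. exp (k * w)) t) \<le> (cmod u * exp (Re k)) * exp (- (- Re (k * u)) * \<bar>t\<bar>)" for t
  proof (cases "t < 0")
    case False
    have "Re (k * (1 + of_real t * u)) = Re k + Re (k * u) * t" by (simp add: algebra_simps)
    then show ?thesis using False by (simp add: ray_fun_def norm_mult exp_add mult.commute[of t])
  qed (simp add: ray_fun_def)
  show int: "integrable lborel (ray_fun u (\<lambda>w. exp (k * w)))"
  proof (rule integrable_exp_bound[OF _ _ le])
    show "ray_fun u (\<lambda>w. exp (k * w)) \<in> borel_measurable lborel"
      unfolding ray_fun_def[abs_def] by measurable
  qed (use assms in simp)
  have H: "((\<lambda>w. exp (k * w) / k) has_field_derivative exp (k * w)) (at w)" for w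
    using k by (auto intro!: derivative_eq_intros)
  have "((\<lambda>T. exp (k * (1 + of_real T * u)) / k) \<longlongrightarrow> 0) at_top"
  proof (rule tendsto_norm_zero_cancel)
    have "((\<lambda>T. exp (Re k + Re (k * u) * T) / cmod k) \<longlongrightarrow> 0 / cmod k) at_top"
      using assms k by (intro tendsto_divide tendsto_const) (real_asymp | simp)+
    moreover have "cmod (exp (k * (1 + of_real T * u)) / k) = exp (Re k + Re (k * u) * T) / cmod k" for T
      by (simp add: norm_divide algebra_simps)
    ultimately show "((\<lambda>T. cmod (exp (k * (1 + of_real T * u)) / k)) \<longlongrightarrow> 0) at_top" by (simp only: div_0)
  qed
  with ray_fun_integral_tendsto[OF H int]
  have "exp (k * 1) / k + integral\<^sup>L lborel (ray_fun u (\<lambda>w. exp (k * w))) = 0"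
    using tendsto_unique trivial_limit_at_top_linorder by blast
  then show "integral\<^sup>L lborel (ray_fun u (\<lambda>w. exp (k * w))) = - exp k / k"
    by (simp add: add_eq_0_iff)
qed

section \<open>The regularized Cauchy quotient\<close>

lemma cauchy_quotient_holomorphic:
  assumes "g holomorphic_on U" "open U" "z \<in> U"
  shows "(\<lambda>w. if w = z then deriv g z else (g w - g z) / (w - z)) holomorphic_on U"
  using pole_lemma_open[OF assms(1,2), of z] assms by simp

text \<open>The quotient has a removable singularity at \<open>z\<close>, so its integral is
  unchanged when the contour passes over \<open>z\<close>. The residue sits entirely in the other
  term, the multiple \<open>g z\<close> of a pure kernel integral.\<close>

lemma cauchy_quotient_pint:
  assumes g: "g holomorphic_on - ray a" and z: "z \<notin> ray a" and c: "0 < c1" "c1 \<le> c2"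
    and dec: "decays (band a c1 c2) (\<lambda>w. exp (- w) * g w)"
  defines "q \<equiv> \<lambda>w. exp (z - w) * (if w = z then deriv g z else (g w - g z) / (w - z))"
  shows "pint a c1 q = pint a c2 q"
    and "\<And>c. c1 \<le> c \<Longrightarrow> c \<le> c2 \<Longrightarrow> dray a z \<noteq> c \<Longrightarrow>
      pint a c (\<lambda>w. exp (z - w) / (w - z) * g w) = pint a c q + g z * pint a c (\<lambda>w. exp (- 1 * (w - z)) / (w - z))"
proof -
  have hol: "q holomorphic_on - ray a"
    unfolding q_def using cauchy_quotient_holomorphic[OF g open_slit] z by (intro holomorphic_intros) auto
  note sub = band_subset_slit[OF c(1), of a c2]
  have cont: "continuous_on (band a c1 c2) q"
    by (rule continuous_on_subset[OF holomorphic_on_imp_continuous_on[OF hol] sub])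
  obtain C d where d: "d > 0" and C: "\<And>w. w \<in> band a c1 c2 \<Longrightarrow> cmod (exp (- w) * g w) \<le> C * exp (- d * Re w)"
    using dec by (auto simp: decays_def)
  have dq: "decays (band a c1 c2) q"
  \<comment> \<open>Of the two terms of the numerator, one is a multiple of
    \<open>exp (- w) * g w\<close> and decays at the rate \<open>d\<close>, the other is a multiple
    of \<open>exp (- w)\<close> and decays at the rate 1.\<close>
  proof (rule decays_bandI[OF cont, where d = "min d 1" and R = "max 0 (Re z + 1)"])
    show "min d 1 > 0" using d by simp
    fix w assume w: "w \<in> band a c1 c2" "max 0 (Re z + 1) \<le> Re w"
    have "w \<noteq> z" using w by auto
    have 1: "1 \<le> cmod (w - z)" using w abs_Re_le_cmod[of "w - z"] by auto
    have "q w = (exp z * (exp (- w) * g w) - exp z * g z * exp (- w)) / (w - z)"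
      using \<open>w \<noteq> z\<close> by (simp add: q_def exp_diff exp_minus field_simps)
    also have "cmod \<dots> \<le> cmod (exp z * (exp (- w) * g w) - exp z * g z * exp (- w))"
      using 1 by (simp add: norm_divide divide_le_eq mult_le_cancel_left1)
    also have "\<dots> \<le> cmod (exp z) * cmod (exp (- w) * g w) + cmod (exp z) * cmod (g z) * cmod (exp (- w))"
      by (rule order_trans[OF norm_triangle_ineq4]) (simp add: norm_mult)
    also have "\<dots> \<le> cmod (exp z) * (\<bar>C\<bar> * exp (- min d 1 * Re w)) + cmod (exp z) * cmod (g z) * exp (- min d 1 * Re w)"
    proof (intro add_mono mult_left_mono)
      have "min d 1 * Re w \<le> d * Re w" "min d 1 * Re w \<le> 1 * Re w" using w by (intro mult_right_mono; simp)+
      then have e: "exp (- d * Re w) \<le> exp (- min d 1 * Re w)" "exp (- Re w) \<le> exp (- min d 1 * Re w)" by simp_all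
      show "cmod (exp (- w) * g w) \<le> \<bar>C\<bar> * exp (- min d 1 * Re w)"
        using e by (intro order_trans[OF C[OF w(1)]] mult_mono) auto
      show "cmod (exp (- w)) \<le> exp (- min d 1 * Re w)" using e by simp
    qed auto
    finally show "cmod (q w) \<le> (cmod (exp z) * \<bar>C\<bar> + cmod (exp z) * cmod (g z)) * exp (- min d 1 * Re w)"
      by (simp only: distrib_right mult.assoc)
  qed
  obtain H where H: "\<And>z. z \<notin> ray a \<Longrightarrow> (H has_field_derivative q z) (at z)"
    using slit_primitive[OF hol] by blast
  show "pint a c1 q = pint a c2 q"
    using sub by (intro pint_band_eq[OF c H dq cont]) auto
  show "pint a c (\<lambda>w. exp (z - w) / (w - z) * g w) = pint a c q + g z * pint a c (\<lambda>w. exp (- 1 * (w - z)) / (w - z))"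
    if cc: "c1 \<le> c" "c \<le> c2" and ne: "dray a z \<noteq> c" for c
  proof -
    have c0: "c > 0" using c cc by simp
    have r: "range (path_right a c) \<subseteq> band a c1 c2" using path_right_in_band[OF c0 cc] by auto
    have iq: "path_integrable a c q"
      by (rule path_integrableI[OF c0 continuous_on_subset[OF cont r] decays_subset[OF dq r]])
    have "path_integrable a c (\<lambda>w. exp (- 1 * (w - z)) / (w - z))"
      by (rule kernel_path_integrable[OF c0 _ ne]) simp
    then have ik': "path_integrable a c (\<lambda>w. g z * (exp (- 1 * (w - z)) / (w - z)))"
      unfolding path_integrable_def by (subst mult.left_commute) (rule integrable_mult_right)
    have "pint a c (\<lambda>w. exp (z - w) / (w - z) * g w) = pint a c (\<lambda>w. q w + g z * (exp (- 1 * (w - z)) / (w - z)))"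
    proof (rule pint_cong[OF c0])
      fix w assume "dray a w = c"
      then have "w \<noteq> z" using ne by auto
      have "exp (z - w) * ((g w - g z) / (w - z)) + g z * (exp (z - w) / (w - z)) =
          (exp (z - w) * (g w - g z) + g z * exp (z - w)) / (w - z)" by (simp add: add_divide_distrib)
      also have "exp (z - w) * (g w - g z) + g z * exp (z - w) = exp (z - w) * g w" by (simp add: algebra_simps)
      finally show "exp (z - w) / (w - z) * g w = q w + g z * (exp (- 1 * (w - z)) / (w - z))"
        using \<open>w \<noteq> z\<close> by (simp add: q_def)
    qed
    also have "\<dots> = pint a c q + g z * pint a c (\<lambda>w. exp (- 1 * (w - z)) / (w - z))"
      unfolding pint_add[OF iq ik'] pint_cmult ..
    finally show ?thesis .
  qed
qed

section \<open>The ray transforms and the Borel transform\<close>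

definition dirs :: "complex set" where "dirs = {1, \<i>, - \<i>}"

lemma dirs_norm: "u \<in> dirs \<Longrightarrow> cmod u = 1" and dirs_Re: "u \<in> dirs \<Longrightarrow> Re u \<ge> 0"
  by (auto simp: dirs_def)

text \<open>Along \<open>1 + t u\<close> the kernel and the type \<open>a\<close> of the function
  combine to \<open>exp (t * Re ((z - a) * u))\<close>, up to a factor independent of
  \<open>t\<close> and an arbitrarily small rate. On this half plane the integral in the direction
  \<open>u\<close> therefore converges.\<close>

definition side :: "real \<Rightarrow> complex \<Rightarrow> complex set" where
  "side a u = {z. Re ((z - of_real a) * u) < 0}"

lemma open_side: "open (side a u)"
  unfolding side_def by (intro open_Collect_less continuous_intros)

lemma side_cases: "side a 1 = {z. Re z < a}" "side a \<i> = {z. Im z > 0}" "side a (- \<i>) = {z. Im z < 0}"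
  by (auto simp: side_def)

lemma slit_sides: "- ray a = side a 1 \<union> side a \<i> \<union> side a (- \<i>)"
  by (auto simp: side_cases mem_ray)

context sc_lc_hausdorff
begin

text \<open>
  The path of integration starts at \<open>1\<close> because the growth conditions give no control near the imaginary
  axis; another starting point would change the transform by an entire function only.
\<close>

definition ray_transform :: "complex \<Rightarrow> (complex \<Rightarrow> 'e) \<Rightarrow> complex \<Rightarrow> 'e" where
  "ray_transform u f z = pettis (\<lambda>t. smul (exp (z * (1 + of_real t * u))) (if t < 0 then 0 else smul u (f (1 + of_real t * u))))"

lemma ray_weight_bound:
  assumes u: "u \<in> dirs" and t: "t \<ge> 0" and e: "0 < \<epsilon>" "\<epsilon> \<le> 1"
    and f: "\<And>z. \<epsilon> \<le> Re z \<Longrightarrow> p \<alpha> (f z) \<le> C * exp (\<epsilon> * cmod z - a * Re z)"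
    and d: "\<epsilon> + Re ((z - of_real a) * u) \<le> - d"
  shows "cmod (exp (z * (1 + of_real t * u))) * p \<alpha> (smul u (f (1 + of_real t * u))) \<le>
    \<bar>C\<bar> * exp (\<epsilon> + Re z - a) * exp (- d * \<bar>t\<bar>)"
proof -
  let ?w = "1 + of_real t * u"
  have re: "\<epsilon> \<le> Re ?w" using dirs_Re[OF u] t e by (simp add: add_increasing2)
  have w: "cmod ?w \<le> 1 + t" using norm_triangle_ineq[of 1 "of_real t * u"] t dirs_norm[OF u] by (simp add: norm_mult)
  have "cmod (exp (z * ?w)) * p \<alpha> (smul u (f ?w)) = exp (Re (z * ?w)) * p \<alpha> (f ?w)"
    by (simp add: seminorm_scale dirs_norm[OF u])
  also have "\<dots> \<le> exp (Re (z * ?w)) * (\<bar>C\<bar> * exp (\<epsilon> * cmod ?w - a * Re ?w))"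
    using f[OF re] by (intro mult_left_mono) (auto intro: order_trans mult_right_mono)
  also have "\<dots> = \<bar>C\<bar> * exp (Re (z * ?w) + (\<epsilon> * cmod ?w - a * Re ?w))" by (simp add: exp_add)
  also have "\<dots> \<le> \<bar>C\<bar> * exp (\<epsilon> + Re z - a + - d * \<bar>t\<bar>)"
  proof (intro mult_left_mono)
    have "\<epsilon> * cmod ?w \<le> \<epsilon> * (1 + t)" using w e by (intro mult_left_mono) auto
    moreover have "t * (\<epsilon> + Re ((z - of_real a) * u)) \<le> t * - d" using d t by (intro mult_left_mono) auto
    ultimately have "Re (z * ?w) + (\<epsilon> * cmod ?w - a * Re ?w) \<le> \<epsilon> + Re z - a + - d * \<bar>t\<bar>"
      using t by (simp add: algebra_simps)
    then show "exp (Re (z * ?w) + (\<epsilon> * cmod ?w - a * Re ?w)) \<le> exp (\<epsilon> + Re z - a + - d * \<bar>t\<bar>)" by simp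
  qed auto
  finally show ?thesis by (simp only: exp_add mult.assoc)
qed

lemma ray_transform_props:
  assumes f: "lo a f" and u: "u \<in> dirs"
  shows "\<And>z. z \<in> side a u \<Longrightarrow> has_pettis_integral smul lborel
      (\<lambda>t. smul (exp (z * (1 + of_real t * u))) (if t < 0 then 0 else smul u (f (1 + of_real t * u)))) (ray_transform u f z)"
    and "\<And>z \<phi>. z \<in> side a u \<Longrightarrow> \<phi> \<in> dual smul \<Longrightarrow>
      ((\<lambda>z. \<phi> (ray_transform u f z)) has_field_derivative integral\<^sup>L lborel (ray_fun u (\<lambda>w. w * exp (z * w) * \<phi> (f w)))) (at z)"
    and "ray_transform u f \<in> hol smul (side a u)"
proof -
  define F where "F t = (if t < 0 then 0 else smul u (f (1 + of_real t * u)))" for t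
  have fhol: "f \<in> hol smul {z. Re z > 0}" using f by (simp add: lo_def)
  have Fcont: "(F \<longlongrightarrow> F t) (at t)" if "t \<notin> {0}" for t
  proof -
    have 1: "continuous_on {..<0} F" by (rule continuous_on_eq[where f = "\<lambda>_. 0"]) (auto simp: F_def)
    have "continuous_on {0<..} (\<lambda>t. smul u (f (1 + of_real t * u)))"
      using dirs_Re[OF u]
      by (intro continuous_on_smul continuous_intros continuous_on_compose2[OF hol_continuous_on[OF fhol]])
        (auto intro!: add_pos_nonneg)
    then have 2: "continuous_on {0<..} F" by (rule continuous_on_eq) (auto simp: F_def)
    show ?thesis
    proof (cases "t < 0")
      case True
      then show ?thesis using 1 by (simp add: continuous_on_eq_continuous_at isCont_def)
    next
      case False
      then have "t > 0" using that by auto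
      then show ?thesis using 2 by (simp add: continuous_on_eq_continuous_at isCont_def)
    qed
  qed
  have der: "((\<lambda>z. exp (z * (1 + of_real t * u))) has_field_derivative
      (1 + of_real t * u) * exp (z * (1 + of_real t * u))) (at z)" for z t
    by (auto intro!: derivative_eq_intros)
  have scont: "((\<lambda>t. exp (z * (1 + of_real t * u))) \<longlongrightarrow> exp (z * (1 + of_real t * u))) (at t)" for z t
    by (intro tendsto_intros)
  have dom: "\<exists>r C d. r > 0 \<and> d > 0 \<and> (\<forall>z\<in>ball z0 r. \<forall>t. cmod (exp (z * (1 + of_real t * u))) * p \<alpha> (F t) \<le> C * exp (- d * \<bar>t\<bar>))"
    if z0: "z0 \<in> side a u" for z0 \<alpha>
  proof -
    \<comment> \<open>The distance of \<open>z0\<close> from the boundary of the half plane. Moving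
      \<open>z\<close> by \<open>\<eta> / 4\<close> and losing
      \<open>\<epsilon> \<le> \<eta> / 4\<close> leaves the decay rate
      \<open>\<eta> / 2\<close>.\<close>
    define \<eta> where "\<eta> = - Re ((z0 - of_real a) * u)"
    have \<eta>: "\<eta> > 0" using z0 by (simp add: \<eta>_def side_def)
    define \<epsilon> where "\<epsilon> = min 1 (\<eta> / 4)"
    have e: "0 < \<epsilon>" "\<epsilon> \<le> 1" "\<epsilon> \<le> \<eta> / 4" using \<eta> by (auto simp: \<epsilon>_def)
    obtain C where C: "\<And>z. \<epsilon> \<le> Re z \<Longrightarrow> p \<alpha> (f z) \<le> C * exp (\<epsilon> * cmod z - a * Re z)"
      using lo_bound[OF f e(1), of \<alpha>] by blast
    have "cmod (exp (z * (1 + of_real t * u))) * p \<alpha> (F t) \<le> (\<bar>C\<bar> * exp (\<epsilon> + Re z0 + \<eta> / 4 - a)) * exp (- (\<eta> / 2) * \<bar>t\<bar>)"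
      if z: "z \<in> ball z0 (\<eta> / 4)" for z t
    proof (cases "t < 0")
      case False
      have "Re ((z - z0) * u) \<le> cmod ((z - z0) * u)" by (rule complex_Re_le_cmod)
      also have "\<dots> \<le> \<eta> / 4" using z dirs_norm[OF u] by (simp add: norm_mult dist_norm norm_minus_commute)
      finally have "Re ((z - z0) * u) \<le> \<eta> / 4" .
      moreover have "Re ((z - of_real a) * u) = Re ((z - z0) * u) - \<eta>" by (simp add: \<eta>_def algebra_simps)
      ultimately have "\<epsilon> + Re ((z - of_real a) * u) \<le> - (\<eta> / 2)" using e by simp
      from ray_weight_bound[OF u _ e(1,2) C this, of t] False
      have "cmod (exp (z * (1 + of_real t * u))) * p \<alpha> (F t) \<le> \<bar>C\<bar> * exp (\<epsilon> + Re z - a) * exp (- (\<eta> / 2) * \<bar>t\<bar>)"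
        by (simp add: F_def)
      also have "\<dots> \<le> (\<bar>C\<bar> * exp (\<epsilon> + Re z0 + \<eta> / 4 - a)) * exp (- (\<eta> / 2) * \<bar>t\<bar>)"
      proof -
        have "Re z \<le> Re z0 + \<eta> / 4"
          using z abs_Re_le_cmod[of "z - z0"] by (auto simp: dist_norm norm_minus_commute)
        then show ?thesis by (intro mult_right_mono mult_left_mono) auto
      qed
      finally show ?thesis .
    qed (simp add: F_def)
    then show ?thesis using \<eta>
      by (intro exI[of _ "\<eta> / 4"] exI[of _ "\<bar>C\<bar> * exp (\<epsilon> + Re z0 + \<eta> / 4 - a)"] exI[of _ "\<eta> / 2"]) auto
  qed
  note * = parametric_pettis_integral[where S = "{0}" and F = F and s = "\<lambda>z t. exp (z * (1 + of_real t * u))",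
      OF _ Fcont open_side der scont dom]
  show "\<And>z. z \<in> side a u \<Longrightarrow> has_pettis_integral smul lborel
      (\<lambda>t. smul (exp (z * (1 + of_real t * u))) (if t < 0 then 0 else smul u (f (1 + of_real t * u)))) (ray_transform u f z)"
    unfolding ray_transform_def F_def[symmetric] by (rule *(1)) auto
  show "ray_transform u f \<in> hol smul (side a u)"
    unfolding ray_transform_def[abs_def] F_def[symmetric] by (rule *(3)) auto
  show "((\<lambda>z. \<phi> (ray_transform u f z)) has_field_derivative integral\<^sup>L lborel (ray_fun u (\<lambda>w. w * exp (z * w) * \<phi> (f w)))) (at z)"
    if "z \<in> side a u" "\<phi> \<in> dual smul" for z \<phi>
  proof -
    have "((\<lambda>z. \<phi> (ray_transform u f z)) has_field_derivative
        (\<integral>t. (1 + of_real t * u) * exp (z * (1 + of_real t * u)) * \<phi> (F t) \<partial>lborel)) (at z)"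
      unfolding ray_transform_def[abs_def] F_def[symmetric] using that by (intro *(2)) auto
    also have "(\<lambda>t. (1 + of_real t * u) * exp (z * (1 + of_real t * u)) * \<phi> (F t)) = ray_fun u (\<lambda>w. w * exp (z * w) * \<phi> (f w))"
      by (rule ext) (simp add: F_def ray_fun_def dual_scale[OF that(2)] dual_zero[OF that(2)])
    finally show ?thesis .
  qed
qed

lemma ray_transform_weak:
  assumes "lo a f" "u \<in> dirs" "z \<in> side a u" "\<phi> \<in> dual smul"
  shows "\<phi> (ray_transform u f z) = integral\<^sup>L lborel (ray_fun u (\<lambda>w. exp (z * w) * \<phi> (f w)))"
    and "integrable lborel (ray_fun u (\<lambda>w. exp (z * w) * \<phi> (f w)))"
proof -
  have eq: "(\<lambda>t. \<phi> (smul (exp (z * (1 + of_real t * u))) (if t < 0 then 0 else smul u (f (1 + of_real t * u))))) =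
      ray_fun u (\<lambda>w. exp (z * w) * \<phi> (f w))"
    by (rule ext) (simp add: ray_fun_def dual_scale[OF assms(4)] dual_zero[OF assms(4)])
  note ray_transform_props(1)[OF assms(1-3), unfolded has_pettis_integral_def, rule_format, OF assms(4), unfolded eq]
  then show "\<phi> (ray_transform u f z) = integral\<^sup>L lborel (ray_fun u (\<lambda>w. exp (z * w) * \<phi> (f w)))"
    "integrable lborel (ray_fun u (\<lambda>w. exp (z * w) * \<phi> (f w)))"
    by simp_all
qed

text \<open>Cauchy's theorem for the sector between two rays. On the chord from
  \<open>1 + T v\<close> to \<open>1 + T u\<close> the exponent is affine in the direction, so it is
  bounded by a constant minus \<open>\<eta> T\<close> as at both ends. After the loss of
  \<open>\<epsilon>\<close> the chord contributes at most a multiple of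
  \<open>T * exp (- \<eta> / 2 * T)\<close>.\<close>

lemma ray_transform_agree:
  assumes f: "lo a f" and u: "u \<in> dirs" "v \<in> dirs" and z: "z \<in> side a u" "z \<in> side a v"
  shows "ray_transform u f z = ray_transform v f z"
proof (rule dual_separates)
  fix \<phi> assume \<phi>: "\<phi> \<in> dual smul"
  define h where "h w = exp (z * w) * \<phi> (f w)" for w
  have "(\<lambda>w. \<phi> (f w)) holomorphic_on {w. Re w > 0}"
    using f \<phi> by (intro hol_weak) (auto simp: lo_def open_halfspace_Re_gt)
  then have hol: "h holomorphic_on {w. Re w > 0}" unfolding h_def by (intro holomorphic_intros)
  obtain H where H: "\<And>w. w \<in> {w. Re w > 0} \<Longrightarrow> (H has_field_derivative h w) (at w)"
    by (rule convex_primitive[OF hol convex_halfspace_Re_gt open_halfspace_Re_gt]) (rule that)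
  have Re_pos: "Re (1 + of_real t * u) > 0" if "t \<ge> 0" "u \<in> dirs" for t u
    using dirs_Re[OF that(2)] that(1) by (simp add: add_pos_nonneg)
  obtain B \<alpha> where B: "B > 0" "\<And>x. cmod (\<phi> x) \<le> B * p \<alpha> x" using \<phi> by (rule dual_bounded) (rule that)
  define \<eta> where "\<eta> = min (- Re ((z - of_real a) * u)) (- Re ((z - of_real a) * v))"
  have \<eta>: "\<eta> > 0" "Re ((z - of_real a) * u) \<le> - \<eta>" "Re ((z - of_real a) * v) \<le> - \<eta>"
    using z by (auto simp: \<eta>_def side_def)
  define \<epsilon> where "\<epsilon> = min 1 (\<eta> / 2)"
  have e: "0 < \<epsilon>" "\<epsilon> \<le> 1" "\<epsilon> \<le> \<eta> / 2" using \<eta> by (auto simp: \<epsilon>_def)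
  obtain C where C: "\<And>z. \<epsilon> \<le> Re z \<Longrightarrow> p \<alpha> (f z) \<le> C * exp (\<epsilon> * cmod z - a * Re z)"
    using lo_bound[OF f e(1), of \<alpha>] by blast
  define K where "K = B * \<bar>C\<bar> * exp (\<epsilon> + Re z - a)"
  have K: "K \<ge> 0" using B by (simp add: K_def)
  have lim: "((\<lambda>T. H (1 + of_real T * u) - H (1 + of_real T * v)) \<longlongrightarrow> 0) at_top"
  proof (rule tendsto_norm_zero_cancel, rule tendsto_sandwich[OF _ _ tendsto_const])
    show "((\<lambda>T. K * exp (- (\<eta> / 2) * T) * (2 * T)) \<longlongrightarrow> 0) at_top" using \<eta> by real_asymp
    show "\<forall>\<^sub>F T in at_top. cmod (H (1 + of_real T * u) - H (1 + of_real T * v)) \<le> K * exp (- (\<eta> / 2) * T) * (2 * T)"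
      using eventually_ge_at_top[of 0]
    proof eventually_elim
      case (elim T)
      let ?S = "closed_segment (1 + of_real T * v) (1 + of_real T * u)"
      \<comment> \<open>The directions have nonnegative real parts, so the chord stays in
        \<open>Re w \<ge> 1\<close>, where \<open>f\<close> is controlled.\<close>
      have seg: "\<epsilon> \<le> Re w \<and> cmod w \<le> 1 + T \<and> Re ((z - of_real a) * w) \<le> Re (z - of_real a) - \<eta> * T" if w: "w \<in> ?S" for w
      proof -
        obtain s where s: "0 \<le> s" "s \<le> 1" "w = (1 - s) *\<^sub>R (1 + of_real T * v) + s *\<^sub>R (1 + of_real T * u)"
          using w by (auto simp: in_segment)
        define x where "x = (1 - s) *\<^sub>R v + s *\<^sub>R u"
        have w: "w = 1 + of_real T * x" by (simp add: s(3) x_def scaleR_conv_of_real algebra_simps)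
        have "Re x \<ge> 0" using s dirs_Re[OF u(1)] dirs_Re[OF u(2)] by (simp add: x_def)
        then have 1: "\<epsilon> \<le> Re w" using e elim by (simp add: w add_increasing2)
        have "cmod x \<le> (1 - s) * cmod v + s * cmod u" unfolding x_def using s by (intro norm_triangle_le) auto
        then have "cmod x \<le> 1" by (simp add: dirs_norm u)
        then have "T * cmod x \<le> T * 1" using elim by (intro mult_left_mono) auto
        then have 2: "cmod w \<le> 1 + T" unfolding w using elim norm_triangle_ineq[of 1 "of_real T * x"] by (simp add: norm_mult)
        have "Re ((z - of_real a) * x) = (1 - s) * Re ((z - of_real a) * v) + s * Re ((z - of_real a) * u)"
          by (simp add: x_def algebra_simps)
        also have "\<dots> \<le> (1 - s) * - \<eta> + s * - \<eta>" using s \<eta> by (intro add_mono mult_left_mono) auto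
        finally have "Re ((z - of_real a) * x) \<le> - \<eta>" by (simp add: algebra_simps)
        then have "T * Re ((z - of_real a) * x) \<le> T * - \<eta>" using elim by (intro mult_left_mono) auto
        moreover have "Re ((z - of_real a) * w) = Re (z - of_real a) + T * Re ((z - of_real a) * x)" by (simp add: w algebra_simps)
        ultimately show ?thesis using 1 2 by (simp add: mult.commute)
      qed
      have "cmod (H (1 + of_real T * u) - H (1 + of_real T * v)) \<le> K * exp (- (\<eta> / 2) * T) * cmod (1 + of_real T * u - (1 + of_real T * v))"
      proof (rule field_differentiable_bound[OF convex_closed_segment])
        fix w assume w: "w \<in> ?S"
        show "(H has_field_derivative h w) (at w within ?S)"
          by (rule has_field_derivative_at_within[OF H]) (use seg[OF w] e in simp)
        have "cmod (h w) \<le> exp (Re (z * w)) * (B * (\<bar>C\<bar> * exp (\<epsilon> * cmod w - a * Re w)))"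
          unfolding h_def norm_mult norm_exp_eq_Re using seg[OF w] B(1)
          by (intro mult_left_mono order_trans[OF B(2)] order_trans[OF C] mult_right_mono) auto
        also have "\<dots> = B * \<bar>C\<bar> * exp (Re ((z - of_real a) * w) + \<epsilon> * cmod w)"
          by (simp add: exp_add[symmetric] algebra_simps exp_diff)
        also have "\<dots> \<le> B * \<bar>C\<bar> * exp (Re (z - of_real a) - \<eta> * T + \<epsilon> * (1 + T))"
          using seg[OF w] B e by (intro mult_left_mono) (auto intro!: add_mono mult_left_mono)
        also have "\<dots> \<le> B * \<bar>C\<bar> * exp (\<epsilon> + Re z - a + - (\<eta> / 2) * T)"
          using mult_right_mono[OF e(3) elim] B by (intro mult_left_mono) (auto simp: algebra_simps)
        finally show "cmod (h w) \<le> K * exp (- (\<eta> / 2) * T)" by (simp only: K_def mult.assoc exp_add[symmetric])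
      qed auto
      also have "cmod (1 + of_real T * u - (1 + of_real T * v)) \<le> 2 * T"
      proof -
        have "cmod (of_real T * u - of_real T * v) \<le> cmod (of_real T * u) + cmod (of_real T * v)" by (rule norm_triangle_ineq4)
        then show ?thesis using elim u by (simp add: norm_mult dirs_norm)
      qed
      finally show ?case using K by (simp add: mult_left_mono)
    qed
  qed simp
  have "((\<lambda>T. H (1 + of_real T * u)) \<longlongrightarrow> H 1 + integral\<^sup>L lborel (ray_fun u h)) at_top"
    "((\<lambda>T. H (1 + of_real T * v)) \<longlongrightarrow> H 1 + integral\<^sup>L lborel (ray_fun v h)) at_top"
    using Re_pos u ray_transform_weak(2)[OF f u(1) z(1) \<phi>] ray_transform_weak(2)[OF f u(2) z(2) \<phi>]
    by (intro ray_fun_integral_tendsto H; simp add: h_def[abs_def])+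
  from tendsto_unique[OF _ tendsto_diff[OF this] lim]
  show "\<phi> (ray_transform u f z) = \<phi> (ray_transform v f z)"
    using ray_transform_weak(1)[OF f u(1) z(1) \<phi>] ray_transform_weak(1)[OF f u(2) z(2) \<phi>] by (simp add: h_def[abs_def])
qed

text \<open>The case distinction picks one ray for each point; by \<open>borel_transform_eq\<close>
  every other admissible direction gives the same value. The last case is meant for real
  \<open>z < a\<close>.\<close>

definition borel_transform :: "(complex \<Rightarrow> 'e) \<Rightarrow> complex \<Rightarrow> 'e" where
  "borel_transform f z = (if Im z > 0 then ray_transform \<i> f z else if Im z < 0 then ray_transform (- \<i>) f z else ray_transform 1 f z)"

lemma borel_transform_eq:
  assumes "lo a f" "u \<in> dirs" "z \<in> side a u"
  shows "borel_transform f z = ray_transform u f z"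
proof -
  have d: "1 \<in> dirs" "\<i> \<in> dirs" "- \<i> \<in> dirs" by (auto simp: dirs_def)
  note agree = ray_transform_agree[OF assms(1) _ assms(2) _ assms(3)]
  consider "Im z > 0" | "Im z < 0" | "Im z = 0" by linarith
  then show ?thesis
  proof cases
    case 1
    then show ?thesis using agree[OF d(2)] by (simp add: borel_transform_def side_cases)
  next
    case 2
    then show ?thesis using agree[OF d(3)] by (simp add: borel_transform_def side_cases)
  next
    case 3
    then have "u = 1" using assms(2,3) by (auto simp: dirs_def side_def)
    then show ?thesis using 3 by (simp add: borel_transform_def)
  qed
qed

lemma borel_transform_hol:
  assumes "lo a f"
  shows "borel_transform f \<in> hol smul (- ray a)"
proof -
  have "borel_transform f \<in> hol smul (side a u)" if "u \<in> dirs" for u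
    by (rule hol_cong[OF ray_transform_props(3)[OF assms that] open_side]) (simp add: borel_transform_eq[OF assms that])
  then show ?thesis unfolding slit_sides by (intro hol_Un) (auto simp: dirs_def)
qed

text \<open>A vertical ray is available off the real axis and decays at the rate
  \<open>c / 2\<close>. The factor \<open>exp (Re z)\<close> stems from the starting point 1 of the
  ray, and on its account the inversion below is confined to \<open>Re \<zeta> > 1\<close>.\<close>

lemma borel_transform_bound:
  assumes f: "lo a f" and c: "c > 0"
  shows "\<exists>K. \<forall>z. c \<le> \<bar>Im z\<bar> \<longrightarrow> p \<alpha> (borel_transform f z) \<le> K * exp (Re z)"
proof -
  define \<epsilon> where "\<epsilon> = min 1 (c / 2)"
  have e: "0 < \<epsilon>" "\<epsilon> \<le> 1" "\<epsilon> \<le> c / 2" using c by (auto simp: \<epsilon>_def)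
  obtain C where C: "\<And>z. \<epsilon> \<le> Re z \<Longrightarrow> p \<alpha> (f z) \<le> C * exp (\<epsilon> * cmod z - a * Re z)"
    using lo_bound[OF f e(1), of \<alpha>] by blast
  define I where "I = (\<integral>t. exp (- (c / 2) * \<bar>t\<bar>) \<partial>lborel)"
  have "p \<alpha> (borel_transform f z) \<le> (\<bar>C\<bar> * exp (\<epsilon> - a) * I) * exp (Re z)" if z: "c \<le> \<bar>Im z\<bar>" for z
  proof -
    define u where "u = (if Im z > 0 then \<i> else - \<i>)"
    have u: "u \<in> dirs" by (simp add: u_def dirs_def)
    have zu: "Re ((z - of_real a) * u) = - \<bar>Im z\<bar>" by (auto simp: u_def)
    then have side: "z \<in> side a u" using z c by (simp add: side_def)
    have "p \<alpha> (ray_transform u f z) \<le> (\<bar>C\<bar> * exp (\<epsilon> + Re z - a)) * I"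
      unfolding I_def
    proof (rule has_pettis_integral_bound[OF ray_transform_props(1)[OF f u side]])
      fix t :: real
      show "p \<alpha> (smul (exp (z * (1 + of_real t * u))) (if t < 0 then 0 else smul u (f (1 + of_real t * u))))
          \<le> (\<bar>C\<bar> * exp (\<epsilon> + Re z - a)) * exp (- (c / 2) * \<bar>t\<bar>)"
      proof (cases "t < 0")
        case False
        have "\<epsilon> + Re ((z - of_real a) * u) \<le> - (c / 2)" using zu e z by simp
        from ray_weight_bound[OF u _ e(1,2) C this, of t] False show ?thesis
          unfolding seminorm_scale[of \<alpha> "exp (z * (1 + of_real t * u))"] by simp
      qed simp
    qed (use c in simp)
    then show ?thesis using borel_transform_eq[OF f u side] by (simp add: exp_add exp_diff mult_ac)
  qed
  then show ?thesis by blast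
qed

lemma lo_add: "lo a f \<Longrightarrow> lo a g \<Longrightarrow> lo a (\<lambda>z. f z + g z)"
proof -
  assume f: "lo a f" and g: "lo a g"
  have "\<exists>C. \<forall>z. \<epsilon> \<le> Re z \<longrightarrow> p \<alpha> (f z + g z) \<le> C * exp (\<epsilon> * cmod z - a * Re z)" if e: "\<epsilon> > 0" for \<epsilon> \<alpha>
  proof -
    obtain C D where "\<And>z. \<epsilon> \<le> Re z \<Longrightarrow> p \<alpha> (f z) \<le> C * exp (\<epsilon> * cmod z - a * Re z)"
      "\<And>z. \<epsilon> \<le> Re z \<Longrightarrow> p \<alpha> (g z) \<le> D * exp (\<epsilon> * cmod z - a * Re z)"
      using lo_bound[OF f e, of \<alpha>] lo_bound[OF g e, of \<alpha>] by blast
    then have "p \<alpha> (f z + g z) \<le> (C + D) * exp (\<epsilon> * cmod z - a * Re z)" if "\<epsilon> \<le> Re z" for z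
      using that by (intro order_trans[OF seminorm_triangle]) (simp add: distrib_right add_mono)
    then show ?thesis by blast
  qed
  then show ?thesis using f g hol_add by (simp add: lo_def)
qed

lemma lo_smul: "lo a f \<Longrightarrow> lo a (\<lambda>z. smul k (f z))"
proof -
  assume f: "lo a f"
  have "\<exists>C. \<forall>z. \<epsilon> \<le> Re z \<longrightarrow> p \<alpha> (smul k (f z)) \<le> C * exp (\<epsilon> * cmod z - a * Re z)" if e: "\<epsilon> > 0" for \<epsilon> \<alpha>
  proof -
    obtain C where "\<And>z. \<epsilon> \<le> Re z \<Longrightarrow> p \<alpha> (f z) \<le> C * exp (\<epsilon> * cmod z - a * Re z)"
      using lo_bound[OF f e, of \<alpha>] by blast
    then have "p \<alpha> (smul k (f z)) \<le> (cmod k * C) * exp (\<epsilon> * cmod z - a * Re z)" if "\<epsilon> \<le> Re z" for z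
      using that by (simp add: seminorm_scale mult.assoc mult_left_mono)
    then show ?thesis by blast
  qed
  then show ?thesis using f hol_smul by (simp add: lo_def)
qed

end

section \<open>Borel inversion and entire extension\<close>

lemma complex_sc_lc_hausdorff: "sc_lc_hausdorff ((*) :: complex \<Rightarrow> complex \<Rightarrow> complex) (\<lambda>_ :: unit. cmod)"
proof
  show "open U \<longleftrightarrow> (\<forall>x\<in>U. \<exists>\<alpha> :: unit. \<exists>\<epsilon>>0. \<forall>y. cmod (y - x) < \<epsilon> \<longrightarrow> y \<in> U)" for U :: "complex set"
    by (simp add: open_dist dist_norm)
  show "\<exists>\<gamma> :: unit. \<exists>C>0. \<forall>x. max (cmod x) (cmod x) \<le> C * cmod x"
    by (intro exI[of _ "()"] exI[of _ "1 :: real"]) auto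
  show "seq_complete (\<lambda>_ :: unit. cmod)"
    unfolding seq_complete_def
  proof (intro allI impI)
    fix X :: "nat \<Rightarrow> complex"
    assume "\<forall>\<alpha> :: unit. \<forall>\<epsilon>>0. \<exists>N. \<forall>m\<ge>N. \<forall>n\<ge>N. cmod (X m - X n) < \<epsilon>"
    then have "Cauchy X" by (auto simp: Cauchy_def dist_norm)
    then show "convergent X" by (simp add: Cauchy_convergent_iff)
  qed
qed (auto simp: algebra_simps norm_mult norm_triangle_ineq)

text \<open>Scalarized statements are instances of the vector-valued ones. Here the identity is a
  continuous functional, so that the Borel transform becomes an ordinary integral.\<close>

interpretation cplx: sc_lc_hausdorff "(*) :: complex \<Rightarrow> complex \<Rightarrow> complex" "\<lambda>_ :: unit. cmod"
  by (rule complex_sc_lc_hausdorff)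

lemma hol_complex_iff: "open \<Omega> \<Longrightarrow> f \<in> hol (*) \<Omega> \<longleftrightarrow> f holomorphic_on \<Omega>"
  by (simp add: hol_def holomorphic_on_open DERIV_def divide_inverse mult.commute)

lemma ident_dual_complex: "(\<lambda>x. x) \<in> dual ((*) :: complex \<Rightarrow> complex \<Rightarrow> complex)"
  by (rule cplx.dualI[where C = 1]) auto

lemma borel_transform_complex_eq:
  assumes "cplx.lo a g" "u \<in> dirs" "z \<in> side a u"
  shows "cplx.borel_transform g z = integral\<^sup>L lborel (ray_fun u (\<lambda>w. exp (z * w) * g w))"
    and "integrable lborel (ray_fun u (\<lambda>w. exp (z * w) * g w))"
    and "(cplx.borel_transform g has_field_derivative integral\<^sup>L lborel (ray_fun u (\<lambda>w. w * exp (z * w) * g w))) (at z)"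
proof -
  show "cplx.borel_transform g z = integral\<^sup>L lborel (ray_fun u (\<lambda>w. exp (z * w) * g w))"
    "integrable lborel (ray_fun u (\<lambda>w. exp (z * w) * g w))"
    using cplx.ray_transform_weak[OF assms ident_dual_complex] cplx.borel_transform_eq[OF assms] by simp_all
  have "(cplx.ray_transform u g has_field_derivative integral\<^sup>L lborel (ray_fun u (\<lambda>w. w * exp (z * w) * g w))) (at z)"
    using cplx.ray_transform_props(2)[OF assms ident_dual_complex] by simp
  moreover have "\<forall>\<^sub>F w in nhds z. cplx.ray_transform u g w = cplx.borel_transform g w"
    unfolding eventually_nhds using assms open_side cplx.borel_transform_eq[OF assms(1,2)]
    by (intro exI[of _ "side a u"]) auto
  ultimately show "(cplx.borel_transform g has_field_derivative integral\<^sup>L lborel (ray_fun u (\<lambda>w. w * exp (z * w) * g w))) (at z)"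
    using DERIV_cong_ev[OF refl _ refl] by fast
qed

lemma slit_dirs: "z \<notin> ray a \<Longrightarrow> \<exists>u\<in>dirs. z \<in> side a u"
  using slit_sides[of a] by (auto simp: dirs_def)

lemma norm_exp_mult_bound: "cmod (exp (- z * \<zeta>)) \<le> exp (- Re z * Re \<zeta> + \<bar>Im z\<bar> * \<bar>Im \<zeta>\<bar>)"
proof -
  have "Im z * Im \<zeta> \<le> \<bar>Im z\<bar> * \<bar>Im \<zeta>\<bar>" by (metis abs_ge_self abs_mult)
  then show ?thesis by simp
qed

lemma borel_laplace_weight:
  assumes g: "cplx.lo a g" and c: "c > 0"
  shows "\<exists>K\<ge>0. \<forall>z. \<bar>Im z\<bar> = c \<longrightarrow>
    cmod (exp (- z * \<zeta>) * cplx.borel_transform g z) \<le> K * exp (- (Re \<zeta> - 1) * Re z)"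
proof -
  obtain K where K: "\<And>z. c \<le> \<bar>Im z\<bar> \<Longrightarrow> cmod (cplx.borel_transform g z) \<le> K * exp (Re z)"
    using cplx.borel_transform_bound[OF g c] by blast
  have "cmod (exp (- z * \<zeta>) * cplx.borel_transform g z) \<le> (\<bar>K\<bar> * exp (c * \<bar>Im \<zeta>\<bar>)) * exp (- (Re \<zeta> - 1) * Re z)"
    if z: "\<bar>Im z\<bar> = c" for z
  proof -
    have "cmod (cplx.borel_transform g z) \<le> \<bar>K\<bar> * exp (Re z)"
      using K[of z] z by (auto intro: order_trans mult_right_mono)
    then have "cmod (exp (- z * \<zeta>) * cplx.borel_transform g z) \<le> exp (- Re z * Re \<zeta> + c * \<bar>Im \<zeta>\<bar>) * (\<bar>K\<bar> * exp (Re z))"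
      unfolding norm_mult using norm_exp_mult_bound[of z \<zeta>] z by (intro mult_mono) auto
    also have "\<dots> = \<bar>K\<bar> * (exp (- Re z * Re \<zeta> + c * \<bar>Im \<zeta>\<bar>) * exp (Re z))" by (simp only: mult_ac)
    also have "exp (- Re z * Re \<zeta> + c * \<bar>Im \<zeta>\<bar>) * exp (Re z) = exp (c * \<bar>Im \<zeta>\<bar>) * exp (- (Re \<zeta> - 1) * Re z)"
      by (simp flip: exp_add add: algebra_simps)
    finally show ?thesis by (simp only: mult_ac)
  qed
  then show ?thesis by (intro exI[of _ "\<bar>K\<bar> * exp (c * \<bar>Im \<zeta>\<bar>)"]) auto
qed

text \<open>
  Subtracting a multiple of an exponential makes the quotient \<open>g\<^sub>1\<close> regular at \<open>\<zeta>\<close>; multiplication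
  by \<open>w - \<zeta>\<close> becomes differentiation of \<open>e\<^sup>-\<^sup>z\<^sup>\<zeta>\<close> times the transform of \<open>g\<^sub>1\<close>, which has vanishing
  path integral, so only the elementary transform of the exponential contributes.
\<close>

lemma borel_inversion:
  assumes g: "cplx.lo a g" and \<zeta>: "Re \<zeta> > 1" and c: "c > 0"
  shows "path_integrable a c (\<lambda>z. exp (- z * \<zeta>) * cplx.borel_transform g z)"
    and "pint a c (\<lambda>z. exp (- z * \<zeta>) * cplx.borel_transform g z) = 2 * pi * \<i> * g \<zeta>"
proof -
  define P where "P = {w :: complex. Re w > 0}"
  have P: "open P" by (simp add: P_def open_halfspace_Re_gt)
  have ghol: "g holomorphic_on P" using g hol_complex_iff[OF P] by (simp add: cplx.lo_def P_def)
  \<comment> \<open>The subtracted exponential is of type \<open>a\<close>, as \<open>g\<close> is,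
    and takes the value \<open>g \<zeta>\<close> at \<open>\<zeta>\<close>; so \<open>k\<close>
    vanishes there and the growth condition is kept.\<close>
  define k where "k w = g w - g \<zeta> * exp (- of_real a * (w - \<zeta>))" for w
  have khol: "k holomorphic_on P" unfolding k_def by (intro holomorphic_intros ghol)
  define g1 where "g1 w = (if w = \<zeta> then deriv k \<zeta> else (k w - k \<zeta>) / (w - \<zeta>))" for w
  have g1hol: "g1 holomorphic_on P"
    unfolding g1_def by (rule cauchy_quotient_holomorphic[OF khol P]) (use \<zeta> in \<open>simp add: P_def\<close>)
  have k0: "k \<zeta> = 0" by (simp add: k_def)
  have g1k: "(w - \<zeta>) * g1 w = k w" for w using k0 by (simp add: g1_def)
  have lo1: "cplx.lo a g1"
    unfolding cplx.lo_def
  proof (intro conjI allI impI)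
    show "g1 \<in> hol (*) {z. Re z > 0}" using g1hol hol_complex_iff[OF P] by (simp add: P_def)
    fix \<epsilon> :: real and \<alpha> :: unit assume e: "\<epsilon> > 0"
    obtain C where C: "\<And>z. \<epsilon> \<le> Re z \<Longrightarrow> cmod (g z) \<le> C * exp (\<epsilon> * cmod z - a * Re z)"
      using cplx.lo_bound[OF g e] by blast
    have "cball \<zeta> 1 \<subseteq> P"
    proof
      fix w assume "w \<in> cball \<zeta> 1"
      then show "w \<in> P" using abs_Re_le_cmod[of "\<zeta> - w"] \<zeta> by (auto simp: P_def dist_norm)
    qed
    then have "bounded (g1 ` cball \<zeta> 1)"
      by (intro compact_imp_bounded compact_continuous_image continuous_on_subset[OF holomorphic_on_imp_continuous_on[OF g1hol]]) auto
    then obtain B where "\<forall>y\<in>g1 ` cball \<zeta> 1. cmod y \<le> B" using bounded_iff by blast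
    then have B: "\<And>w. w \<in> cball \<zeta> 1 \<Longrightarrow> cmod (g1 w) \<le> B" by blast
    \<comment> \<open>The first two summands handle \<open>g\<close> and the exponential where
      \<open>\<zeta>\<close> is at distance at least 1; the third handles the unit disc around
      \<open>\<zeta>\<close>, where \<open>g1\<close> is bounded by compactness.\<close>
    define D where "D = \<bar>C\<bar> + cmod (g \<zeta>) * exp (a * Re \<zeta>) + \<bar>B\<bar> * exp (\<bar>a\<bar> * (cmod \<zeta> + 1))"
    have "cmod (g1 w) \<le> D * exp (\<epsilon> * cmod w - a * Re w)" if w: "\<epsilon> \<le> Re w" for w
    proof (cases "w \<in> cball \<zeta> 1")
      case True
      have "cmod w \<le> cmod \<zeta> + 1" using True norm_triangle_ineq2[of w \<zeta>] by (simp add: dist_norm norm_minus_commute)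
      then have "\<bar>a\<bar> * \<bar>Re w\<bar> \<le> \<bar>a\<bar> * (cmod \<zeta> + 1)"
        using abs_Re_le_cmod[of w] by (intro mult_left_mono) auto
      then have "\<bar>a * Re w\<bar> \<le> \<bar>a\<bar> * (cmod \<zeta> + 1)" by (simp add: abs_mult)
      moreover have "0 \<le> \<epsilon> * cmod w" using e by simp
      ultimately have "1 \<le> exp (\<bar>a\<bar> * (cmod \<zeta> + 1) + (\<epsilon> * cmod w - a * Re w))"
        unfolding one_le_exp_iff by linarith
      then have "\<bar>B\<bar> * 1 \<le> \<bar>B\<bar> * exp (\<bar>a\<bar> * (cmod \<zeta> + 1) + (\<epsilon> * cmod w - a * Re w))" by (intro mult_left_mono) auto
      then have "cmod (g1 w) \<le> (\<bar>B\<bar> * exp (\<bar>a\<bar> * (cmod \<zeta> + 1))) * exp (\<epsilon> * cmod w - a * Re w)"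
        using B[OF True] by (simp add: exp_add mult.assoc)
      also have "\<dots> \<le> D * exp (\<epsilon> * cmod w - a * Re w)" by (intro mult_right_mono) (auto simp: D_def)
      finally show ?thesis .
    next
      case False
      then have 1: "1 \<le> cmod (w - \<zeta>)" "w \<noteq> \<zeta>" by (auto simp: dist_norm norm_minus_commute)
      then have "cmod (g1 w) \<le> cmod (k w)"
        by (simp add: g1_def k0 norm_divide divide_le_eq mult_le_cancel_left1)
      also have "\<dots> \<le> cmod (g w) + cmod (g \<zeta>) * exp (- a * (Re w - Re \<zeta>))"
        unfolding k_def by (rule order_trans[OF norm_triangle_ineq4]) (simp add: norm_mult)
      also have "\<dots> \<le> \<bar>C\<bar> * exp (\<epsilon> * cmod w - a * Re w) + cmod (g \<zeta>) * (exp (a * Re \<zeta>) * exp (\<epsilon> * cmod w - a * Re w))"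
      proof (intro add_mono mult_left_mono)
        show "cmod (g w) \<le> \<bar>C\<bar> * exp (\<epsilon> * cmod w - a * Re w)"
          using C[OF w] by (auto intro: order_trans mult_right_mono)
        show "exp (- a * (Re w - Re \<zeta>)) \<le> exp (a * Re \<zeta>) * exp (\<epsilon> * cmod w - a * Re w)"
          using e by (simp flip: exp_add add: algebra_simps)
      qed auto
      also have "\<dots> \<le> D * exp (\<epsilon> * cmod w - a * Re w)" by (simp add: D_def distrib_right)
      finally show ?thesis .
    qed
    then show "\<exists>C. \<forall>z. \<epsilon> \<le> Re z \<longrightarrow> cmod (g1 z) \<le> C * exp (\<epsilon> * cmod z - a * Re z)" by blast
  qed
  let ?\<beta> = "cplx.borel_transform g" and ?\<beta>1 = "cplx.borel_transform g1"
  define m where "m z = exp (- z * \<zeta>) * ?\<beta> z" for z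
  \<comment> \<open>A kernel with its pole at the vertex \<open>a\<close>, which lies inside every
    contour; its residue produces the value \<open>g \<zeta>\<close>.\<close>
  define \<kappa> where "\<kappa> z = exp (- (\<zeta> - 1) * (z - of_real a)) / (z - of_real a)" for z
  have der: "((\<lambda>z. exp (- z * \<zeta>) * ?\<beta>1 z) has_field_derivative m z + g \<zeta> * \<kappa> z) (at z)" if z: "z \<notin> ray a" for z
  proof -
    obtain u where u: "u \<in> dirs" "z \<in> side a u" using slit_dirs[OF z] by blast
    have za: "z \<noteq> of_real a" using z by (auto simp: mem_ray)
    let ?E = "\<lambda>w. exp ((z - of_real a) * w)"
    have re: "Re ((z - of_real a) * u) < 0" using u by (simp add: side_def)
    note b = borel_transform_complex_eq[OF g u] and b1 = borel_transform_complex_eq[OF lo1 u]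
    have eq: "ray_fun u (\<lambda>w. w * exp (z * w) * g1 w) t = \<zeta> * ray_fun u (\<lambda>w. exp (z * w) * g1 w) t
        + ray_fun u (\<lambda>w. exp (z * w) * g w) t - g \<zeta> * exp (of_real a * \<zeta>) * ray_fun u ?E t" for t
    proof -
      have "w * exp (z * w) * g1 w = \<zeta> * (exp (z * w) * g1 w) + exp (z * w) * g w - g \<zeta> * exp (of_real a * \<zeta>) * ?E w" for w
      proof -
        have "w * exp (z * w) * g1 w = \<zeta> * (exp (z * w) * g1 w) + exp (z * w) * ((w - \<zeta>) * g1 w)" by (simp add: algebra_simps)
        also have "exp (z * w) * ((w - \<zeta>) * g1 w) = exp (z * w) * g w - g \<zeta> * (exp (z * w) * exp (- of_real a * (w - \<zeta>)))"
          unfolding g1k k_def by (simp add: algebra_simps)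
        also have "exp (z * w) * exp (- of_real a * (w - \<zeta>)) = exp (of_real a * \<zeta>) * ?E w"
          by (simp flip: exp_add add: algebra_simps)
        finally show ?thesis by (simp add: mult.assoc)
      qed
      then have P: "w * exp (z * w) * g1 w = \<zeta> * (exp (z * w) * g1 w) + exp (z * w) * g w - g \<zeta> * exp (of_real a * \<zeta>) * ?E w" for w .
      show ?thesis
      proof (cases "t < 0")
        case False
        then show ?thesis by (simp only: ray_fun_def if_False P) (simp only: ring_distribs mult_ac)
      qed (simp add: ray_fun_def)
    qed
    have "integral\<^sup>L lborel (ray_fun u (\<lambda>w. w * exp (z * w) * g1 w)) = \<zeta> * ?\<beta>1 z + ?\<beta> z - g \<zeta> * exp (of_real a * \<zeta>) * (- exp (z - of_real a) / (z - of_real a))"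
      unfolding eq b(1) b1(1) ray_fun_exp_integral(2)[OF re, symmetric]
      using b(2) b1(2) ray_fun_exp_integral(1)[OF re] by simp
    then have "(?\<beta>1 has_field_derivative \<zeta> * ?\<beta>1 z + ?\<beta> z - g \<zeta> * exp (of_real a * \<zeta>) * (- exp (z - of_real a) / (z - of_real a))) (at z)"
      using b1(3) by simp
    then have "((\<lambda>z. exp (- z * \<zeta>) * ?\<beta>1 z) has_field_derivative exp (- z * \<zeta>) * (\<zeta> * ?\<beta>1 z + ?\<beta> z
        - g \<zeta> * exp (of_real a * \<zeta>) * (- exp (z - of_real a) / (z - of_real a))) + - \<zeta> * exp (- z * \<zeta>) * ?\<beta>1 z) (at z)"
      by (auto intro!: derivative_eq_intros)
    also have "exp (- z * \<zeta>) * (\<zeta> * ?\<beta>1 z + ?\<beta> z - g \<zeta> * exp (of_real a * \<zeta>) * (- exp (z - of_real a) / (z - of_real a)))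
        + - \<zeta> * exp (- z * \<zeta>) * ?\<beta>1 z = m z + g \<zeta> * ((exp (- z * \<zeta>) * exp (of_real a * \<zeta>) * exp (z - of_real a)) / (z - of_real a))"
      using za by (simp add: m_def field_simps)
    also have "exp (- z * \<zeta>) * exp (of_real a * \<zeta>) * exp (z - of_real a) = exp (- (\<zeta> - 1) * (z - of_real a))"
      by (simp flip: exp_add add: algebra_simps)
    finally show ?thesis by (simp add: \<kappa>_def)
  qed
  obtain K where K: "K \<ge> 0" "\<And>z. \<bar>Im z\<bar> = c \<Longrightarrow> cmod (m z) \<le> K * exp (- (Re \<zeta> - 1) * Re z)"
    using borel_laplace_weight[OF g c, of \<zeta>] by (auto simp: m_def)
  obtain K1 where K1: "K1 \<ge> 0" "\<And>z. \<bar>Im z\<bar> = c \<Longrightarrow> cmod (exp (- z * \<zeta>) * ?\<beta>1 z) \<le> K1 * exp (- (Re \<zeta> - 1) * Re z)"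
    using borel_laplace_weight[OF lo1 c, of \<zeta>] by blast
  have mcont: "continuous_on (band a c c) m"
  proof -
    have "?\<beta> holomorphic_on - ray a"
      using cplx.borel_transform_hol[OF g] hol_complex_iff[OF open_slit] by blast
    then have "m holomorphic_on - ray a" unfolding m_def by (intro holomorphic_intros)
    then show ?thesis using band_subset_slit[OF c] holomorphic_on_imp_continuous_on continuous_on_subset by blast
  qed
  have mdec: "decays (band a c c) m"
  proof (rule decays_bandI[OF mcont, where R = a])
    show "cmod (m z) \<le> K * exp (- (Re \<zeta> - 1) * Re z)" if "z \<in> band a c c" "a \<le> Re z" for z
      using that by (intro K(2)) (auto simp: band_def dray_def)
  qed (use \<zeta> in simp)
  have r: "range (path_right a c) \<subseteq> band a c c" using path_right_in_band[OF c] by auto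
  have mint: "path_integrable a c m"
    by (rule path_integrableI[OF c continuous_on_subset[OF mcont r] decays_subset[OF mdec r]])
  then show "path_integrable a c (\<lambda>z. exp (- z * \<zeta>) * cplx.borel_transform g z)" by (simp add: m_def[abs_def])
  have a0: "dray a (of_real a) = 0" by (simp add: dray_def)
  have \<kappa>int: "path_integrable a c \<kappa>"
    unfolding \<kappa>_def using \<zeta> c a0 by (intro kernel_path_integrable) auto
  have \<kappa>int': "path_integrable a c (\<lambda>z. g \<zeta> * \<kappa> z)"
    using \<kappa>int unfolding path_integrable_def by (subst mult.left_commute) (rule integrable_mult_right)
  have mk: "path_integrable a c (\<lambda>z. m z + g \<zeta> * \<kappa> z)"
    using mint \<kappa>int' by (simp add: path_integrable_def distrib_left)
  have "pint a c (\<lambda>z. m z + g \<zeta> * \<kappa> z) = 0"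
  proof (rule pint_eqI[OF der mk])
    show "path_right a c t \<notin> ray a" for t by (rule path_right_notin_ray[OF c])
    \<comment> \<open>The growth \<open>exp (Re z)\<close> of the transform is beaten by the kernel
      because \<open>Re \<zeta> > 1\<close>.\<close>
    have lim: "((\<lambda>x. exp (- Complex x s * \<zeta>) * ?\<beta>1 (Complex x s)) \<longlongrightarrow> 0) at_top" if "\<bar>s\<bar> = c" for s
    proof (rule tendsto_norm_zero_cancel, rule tendsto_0_if_nonneg_le[OF _ norm_ge_zero])
      show "((\<lambda>x. K1 * exp (- (Re \<zeta> - 1) * x)) \<longlongrightarrow> 0) at_top" using \<zeta> by real_asymp
      show "cmod (exp (- Complex x s * \<zeta>) * ?\<beta>1 (Complex x s)) \<le> K1 * exp (- (Re \<zeta> - 1) * x)" for x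
        using K1(2)[of "Complex x s"] that by simp
    qed
    show "((\<lambda>x. exp (- Complex x c * \<zeta>) * ?\<beta>1 (Complex x c) - exp (- Complex x (- c) * \<zeta>) * ?\<beta>1 (Complex x (- c))) \<longlongrightarrow> 0) at_top"
      using tendsto_diff[OF lim[of c] lim[of "- c"]] c by simp
  qed
  moreover have "pint a c \<kappa> = - (2 * pi * \<i>)"
    unfolding \<kappa>_def using \<zeta> c a0 by (intro pint_kernel_inside) auto
  ultimately have "pint a c m = 2 * pi * \<i> * g \<zeta>"
    unfolding pint_add[OF mint \<kappa>int'] pint_cmult by (simp add: algebra_simps add_eq_0_iff)
  then show "pint a c (\<lambda>z. exp (- z * \<zeta>) * cplx.borel_transform g z) = 2 * pi * \<i> * g \<zeta>" by (simp add: m_def[abs_def])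
qed

context sc_lc_hausdorff
begin

lemma lo_dual:
  assumes f: "lo a f" and \<phi>: "\<phi> \<in> dual smul"
  shows "cplx.lo a (\<lambda>w. \<phi> (f w))"
  unfolding cplx.lo_def
proof (intro conjI allI impI)
  show "(\<lambda>w. \<phi> (f w)) \<in> hol (*) {z. Re z > 0}"
    using f \<phi> hol_weak[of f "{z. Re z > 0}" \<phi>] by (simp add: hol_complex_iff open_halfspace_Re_gt lo_def)
  fix \<epsilon> :: real and \<alpha> :: unit assume e: "\<epsilon> > 0"
  obtain B \<alpha> where B: "B > 0" "\<And>x. cmod (\<phi> x) \<le> B * p \<alpha> x" using \<phi> by (rule dual_bounded) (rule that)
  obtain C where C: "\<And>z. \<epsilon> \<le> Re z \<Longrightarrow> p \<alpha> (f z) \<le> C * exp (\<epsilon> * cmod z - a * Re z)"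
    using lo_bound[OF f e, of \<alpha>] by blast
  have "cmod (\<phi> (f z)) \<le> (B * C) * exp (\<epsilon> * cmod z - a * Re z)" if "\<epsilon> \<le> Re z" for z
    using order_trans[OF B(2) mult_left_mono[OF C[OF that]]] B(1) by (simp add: mult.assoc)
  then show "\<exists>C. \<forall>z. \<epsilon> \<le> Re z \<longrightarrow> cmod (\<phi> (f z)) \<le> C * exp (\<epsilon> * cmod z - a * Re z)" by blast
qed

lemma borel_transform_dual:
  assumes f: "lo a f" and \<phi>: "\<phi> \<in> dual smul" and z: "z \<notin> ray a"
  shows "\<phi> (borel_transform f z) = cplx.borel_transform (\<lambda>w. \<phi> (f w)) z"
proof -
  obtain u where u: "u \<in> dirs" "z \<in> side a u" using slit_dirs[OF z] by blast
  show ?thesis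
    using borel_transform_eq[OF f u] ray_transform_weak(1)[OF f u \<phi>] borel_transform_complex_eq(1)[OF lo_dual[OF f \<phi>] u] by simp
qed

text \<open>The Laplace integral of the Borel transform is \<open>2 * pi * \<i> * f\<close>, so the
  difference in question is the Laplace integral of the entire function \<open>h\<close>. Its
  contour can be moved to any vertex \<open>b\<close>, which gives the type \<open>b\<close>. Where
  \<open>Re \<zeta>\<close> is bounded, the known estimate of type \<open>a\<close> is as good as
  one of type \<open>b\<close>.\<close>

lemma laplace_borel_transform_lo:
  assumes f: "lo a f" and G: "G \<in> hol smul (- ray a)" "infra a G" and h: "h \<in> hol smul UNIV"
    and eq: "\<And>z. z \<notin> ray a \<Longrightarrow> G z - borel_transform f z = h z"
  shows "lo b (\<lambda>\<zeta>. lap a 1 G \<zeta> - smul (2 * pi * \<i>) (f \<zeta>))"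
proof -
  define D where "D \<zeta> = lap a 1 G \<zeta> - smul (2 * pi * \<i>) (f \<zeta>)" for \<zeta>
  have "lo a (\<lambda>\<zeta>. lap a 1 G \<zeta> + smul (- (2 * pi * \<i>)) (f \<zeta>))"
    by (intro lo_add lo_smul f lap_lo G) simp
  then have loD: "lo a D" by (simp add: D_def[abs_def] scale_minus_left)
  have "\<exists>C. \<forall>z. \<epsilon> \<le> Re z \<longrightarrow> p \<alpha> (D z) \<le> C * exp (\<epsilon> * cmod z - b * Re z)" if e: "\<epsilon> > 0" for \<epsilon> \<alpha>
  proof -
    define c where "c = \<epsilon> / 2"
    have c: "c > 0" using e by (simp add: c_def)
    obtain C1 where C1: "\<And>z. \<epsilon> \<le> Re z \<Longrightarrow> p \<alpha> (D z) \<le> C1 * exp (\<epsilon> * cmod z - a * Re z)"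
      using lo_bound[OF loD e, of \<alpha>] by blast
    \<comment> \<open>On the lines \<open>\<bar>Im z\<bar> = c\<close> both \<open>G\<close> and the
      Borel transform are controlled, the latter at the rate 1. The arc around \<open>b\<close> may
      cross the ray, where only \<open>h\<close> is available, but it is compact.\<close>
    have growth: "growth_on (range (path_right b c)) h \<alpha> 1" for \<alpha>
    proof -
      have "growth_on {z. c \<le> \<bar>Im z\<bar> \<and> \<bar>Im z\<bar> \<le> c} G \<alpha> 1"
        using c by (intro growth_on_subset[OF infraD[OF G(2) _ c, of 1 c]]) (auto intro: order_trans[OF _ abs_Im_le_dray])
      moreover have "growth_on {z. c \<le> \<bar>Im z\<bar> \<and> \<bar>Im z\<bar> \<le> c} (borel_transform f) \<alpha> 1"
      proof -
        obtain K where K: "\<And>z. c \<le> \<bar>Im z\<bar> \<Longrightarrow> p \<alpha> (borel_transform f z) \<le> K * exp (Re z)"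
          using borel_transform_bound[OF f c, of \<alpha>] by blast
        have "p \<alpha> (borel_transform f z) \<le> \<bar>K\<bar> * exp (1 * \<bar>Re z\<bar>)" if "c \<le> \<bar>Im z\<bar>" for z
          by (rule order_trans[OF K[OF that] mult_mono]) auto
        then show ?thesis by (auto simp: growth_on_def)
      qed
      ultimately have "growth_on {z. c \<le> \<bar>Im z\<bar> \<and> \<bar>Im z\<bar> \<le> c} (\<lambda>z. G z + smul (-1) (borel_transform f z)) \<alpha> 1"
        by (intro growth_on_add growth_on_smul)
      then have 1: "growth_on {z. c \<le> \<bar>Im z\<bar> \<and> \<bar>Im z\<bar> \<le> c} h \<alpha> 1"
        by (rule growth_on_cong) (use eq c in \<open>auto simp: scale_minus_left mem_ray\<close>)
      have 2: "growth_on (path_right b c ` {-1..1}) h \<alpha> 1"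
        by (intro growth_on_compact compact_continuous_image continuous_on_path_right
            continuous_on_subset[OF hol_continuous_on[OF h]]) auto
      have "range (path_right b c) \<subseteq> {z. c \<le> \<bar>Im z\<bar> \<and> \<bar>Im z\<bar> \<le> c} \<union> path_right b c ` {-1..1}"
      proof
        fix z assume "z \<in> range (path_right b c)"
        then obtain t where t: "z = path_right b c t" by blast
        consider "t \<le> -1" | "t \<in> {-1..1}" | "t \<ge> 1" by fastforce
        then show "z \<in> {z. c \<le> \<bar>Im z\<bar> \<and> \<bar>Im z\<bar> \<le> c} \<union> path_right b c ` {-1..1}"
          using t c by cases (auto simp: path_right_left path_right_right)
      qed
      then show ?thesis using growth_on_subset[OF growth_on_Un[OF 1 2]] by blast
    qed
    obtain M where M: "\<And>t. p \<alpha> (h (path_right b c t)) \<le> M * exp (1 * \<bar>Re (path_right b c t)\<bar>)"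
      using growth[of \<alpha>] by (auto simp: growth_on_def)
    \<comment> \<open>The threshold 2 exceeds the growth rate 1 of \<open>h\<close> and lies in the
      range \<open>Re \<zeta> > 1\<close> of the inversion.\<close>
    obtain C2 where C2: "\<And>\<zeta> v. 2 \<le> Re \<zeta> \<Longrightarrow> (\<forall>\<phi>\<in>polar \<alpha>. \<phi> v = pint b c (\<lambda>z. exp (- z * \<zeta>) * \<phi> (h z))) \<Longrightarrow>
        p \<alpha> v \<le> C2 * exp (- (b - c) * Re \<zeta> + c * \<bar>Im \<zeta>\<bar>)"
      using path_integral_bound[OF c M, of 2] by auto
    have D_h: "\<phi> (D \<zeta>) = pint b c (\<lambda>z. exp (- z * \<zeta>) * \<phi> (h z))" if \<zeta>: "2 \<le> Re \<zeta>" and \<phi>: "\<phi> \<in> dual smul" for \<zeta> \<phi>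
    proof -
      have re: "Re \<zeta> > 0" using \<zeta> by simp
      let ?\<beta> = "cplx.borel_transform (\<lambda>w. \<phi> (f w))"
      note inv = borel_inversion[OF lo_dual[OF f \<phi>] _ c, of \<zeta>]
      have i1: "path_integrable a c (\<lambda>z. exp (- z * \<zeta>) * \<phi> (G z))" by (rule lap_weak(2)[OF G c re \<phi>])
      have i2: "path_integrable a c (\<lambda>z. exp (- z * \<zeta>) * ?\<beta> z)" using inv(1) \<zeta> by simp
      have i3: "path_integrable a c (\<lambda>z. (-1) * (exp (- z * \<zeta>) * ?\<beta> z))"
        using i2 unfolding path_integrable_def by (subst mult.left_commute) (rule integrable_mult_right)
      have eqh: "exp (- z * \<zeta>) * \<phi> (h z) = exp (- z * \<zeta>) * \<phi> (G z) + (-1) * (exp (- z * \<zeta>) * ?\<beta> z)" if "z \<notin> ray a" for z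
      proof -
        have "\<phi> (h z) = \<phi> (G z) - ?\<beta> z"
          by (simp add: eq[OF that, symmetric] dual_diff[OF \<phi>] borel_transform_dual[OF f \<phi> that])
        then show ?thesis by (simp only: right_diff_distrib) simp
      qed
      have i4: "path_integrable a c (\<lambda>z. exp (- z * \<zeta>) * \<phi> (h z))"
        using Bochner_Integration.integrable_add[OF i1[unfolded path_integrable_def] i3[unfolded path_integrable_def]]
        by (simp only: path_integrable_def eqh[OF path_right_notin_ray[OF c]] distrib_left)
      have "pint a c (\<lambda>z. exp (- z * \<zeta>) * \<phi> (h z)) = pint a c (\<lambda>z. exp (- z * \<zeta>) * \<phi> (G z) + (-1) * (exp (- z * \<zeta>) * ?\<beta> z))"
      proof (rule pint_cong[OF c eqh])
        show "z \<notin> ray a" if "dray a z = c" for z using dray_pos_iff[of a z] c that by simp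
      qed
      also have "\<dots> = \<phi> (lap a 1 G \<zeta>) - 2 * pi * \<i> * \<phi> (f \<zeta>)"
        unfolding pint_add[OF i1 i3] pint_cmult
        using inv(2) \<zeta> lap_radius[OF G zero_less_one c re] lap_weak(1)[OF G c re \<phi>] by simp
      also have "\<dots> = \<phi> (D \<zeta>)" by (simp add: D_def dual_diff[OF \<phi>] dual_scale[OF \<phi>])
      finally have "\<phi> (D \<zeta>) = pint a c (\<lambda>z. exp (- z * \<zeta>) * \<phi> (h z))" by simp
      \<comment> \<open>Both integrals are limits of the same increments of an entire
        primitive.\<close>
      also have "\<dots> = pint b c (\<lambda>z. exp (- z * \<zeta>) * \<phi> (h z))"
      proof -
        have hol: "(\<lambda>z. exp (- z * \<zeta>) * \<phi> (h z)) holomorphic_on UNIV"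
          by (intro holomorphic_intros hol_weak[OF h open_UNIV \<phi>])
        obtain H where H: "\<And>z. z \<in> UNIV \<Longrightarrow> (H has_field_derivative exp (- z * \<zeta>) * \<phi> (h z)) (at z)"
          by (rule convex_primitive[OF hol convex_UNIV open_UNIV]) (rule that)
        obtain B \<alpha> where B: "B > 0" "\<And>x. cmod (\<phi> x) \<le> B * p \<alpha> x" using \<phi> by (rule dual_bounded) (rule that)
        have "path_integrable b c (\<lambda>z. exp (- z * \<zeta>) * \<phi> (h z))"
        proof (rule path_integrableI[OF c])
          show "continuous_on (range (path_right b c)) (\<lambda>z. exp (- z * \<zeta>) * \<phi> (h z))"
            by (rule continuous_on_subset[OF holomorphic_on_imp_continuous_on[OF hol] subset_UNIV])
          show "decays (range (path_right b c)) (\<lambda>z. exp (- z * \<zeta>) * \<phi> (h z))"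
          proof (rule dual_exp_decays[OF growth_on_mono[OF growth] re B(2,1), where C = c and R = "b - c"])
            show "1 \<le> Re \<zeta> / 2" using \<zeta> by simp
          qed (use path_right_bounds[OF c] in auto)
        qed
        from pint_eqI[OF H i4 pint_tendsto[OF H this]] show ?thesis by simp
      qed
      finally show ?thesis .
    qed
    \<comment> \<open>For \<open>Re z < 2\<close> the change from type \<open>a\<close> to type
      \<open>b\<close> costs at most the factor \<open>exp (2 * \<bar>b - a\<bar>)\<close>.\<close>
    define C where "C = \<bar>C1\<bar> * exp (2 * \<bar>b - a\<bar>) + \<bar>C2\<bar>"
    have "p \<alpha> (D z) \<le> C * exp (\<epsilon> * cmod z - b * Re z)" if z: "\<epsilon> \<le> Re z" for z
    proof (cases "2 \<le> Re z")
      case True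
      have "p \<alpha> (D z) \<le> C2 * exp (- (b - c) * Re z + c * \<bar>Im z\<bar>)"
        using D_h[OF True] polarD(1) by (intro C2[OF True]) blast
      also have "\<dots> \<le> C * exp (\<epsilon> * cmod z - b * Re z)"
      proof (intro mult_mono)
        have "Re z + \<bar>Im z\<bar> \<le> 2 * cmod z" using abs_Re_le_cmod[of z] abs_Im_le_cmod[of z] by linarith
        then have "c * (Re z + \<bar>Im z\<bar>) \<le> c * (2 * cmod z)" using c by (intro mult_left_mono) auto
        then show "exp (- (b - c) * Re z + c * \<bar>Im z\<bar>) \<le> exp (\<epsilon> * cmod z - b * Re z)"
          by (simp add: c_def algebra_simps)
      qed (auto simp: C_def add_increasing)
      finally show ?thesis .
    next
      case False
      have "p \<alpha> (D z) \<le> C1 * exp (\<epsilon> * cmod z - a * Re z)" by (rule C1[OF z])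
      also have "\<dots> \<le> \<bar>C1\<bar> * exp (2 * \<bar>b - a\<bar> + (\<epsilon> * cmod z - b * Re z))"
      proof (intro mult_mono)
        have "(b - a) * Re z \<le> \<bar>b - a\<bar> * 2" using False z e by (intro mult_mono) auto
        then show "exp (\<epsilon> * cmod z - a * Re z) \<le> exp (2 * \<bar>b - a\<bar> + (\<epsilon> * cmod z - b * Re z))"
          by (simp add: algebra_simps)
      qed auto
      also have "\<dots> = (\<bar>C1\<bar> * exp (2 * \<bar>b - a\<bar>)) * exp (\<epsilon> * cmod z - b * Re z)" by (simp only: exp_add mult.assoc)
      also have "\<dots> \<le> C * exp (\<epsilon> * cmod z - b * Re z)" by (intro mult_right_mono) (auto simp: C_def)
      finally show ?thesis .
    qed
    then show ?thesis by blast
  qed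
  then have "lo b D" using loD by (simp add: lo_def)
  then show ?thesis by (simp add: D_def[abs_def])
qed

text \<open>After the exchange of the integrals, the integral of
  \<open>exp ((z - w) * \<zeta>)\<close> over \<open>\<zeta>\<close> from 1 to infinity remains. It
  equals \<open>exp (z - w) / (w - z)\<close> for \<open>Re z < Re w\<close>, and the condition on
  \<open>z\<close> places the whole contour to its right.\<close>

lemma laplace_borel_fubini:
  assumes G: "G \<in> hol smul (- ray a)" "infra a G" and f: "lo a (lap a 1 G)" and c: "c > 0"
    and z: "Re z < a - c" and \<phi>: "\<phi> \<in> dual smul"
  shows "\<phi> (ray_transform 1 (lap a 1 G) z) = pint a c (\<lambda>w. exp (z - w) / (w - z) * \<phi> (G w))"
proof -
  define P where "P s = path_deriv c s * \<phi> (G (path_right a c s))" for s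
  define k where "k t s = (if t < 0 then 0 else exp (z * (1 + of_real t)) * (exp (- path_right a c s * (1 + of_real t)) * P s))" for t s :: real
  \<comment> \<open>The modulus of the integrand at \<open>t = 0\<close>, which is integrable as a
    Laplace integrand at the point 1. The gap \<open>\<eta>\<close> between \<open>z\<close> and the
    contour adds decay in \<open>t\<close>, so that the majorant is a product.\<close>
  define B where "B s = exp (Re z) * (exp (- Re (path_right a c s)) * cmod (P s))" for s
  define \<eta> where "\<eta> = a - c - Re z"
  have \<eta>: "\<eta> > 0" using z by (simp add: \<eta>_def)
  have zside: "z \<in> side a 1" using z c by (simp add: side_cases)
  have one: "1 \<in> dirs" by (simp add: dirs_def)
  have path_meas [measurable]: "path_right a c \<in> borel_measurable borel"
    by (intro borel_measurable_continuous_onI continuous_on_path_right)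
  have "P \<in> borel_measurable lborel"
  proof (rule borel_measurable_except_finite[of "{-1, 1}"])
    show "(P \<longlongrightarrow> P t) (at t)" if "t \<notin> {-1, 1}" for t
      using dual_tendsto[OF \<phi> continuous_path_deriv_comp[OF c G(1) that]]
      by (simp add: P_def[abs_def] dual_scale[OF \<phi>])
  qed simp
  then have [measurable]: "P \<in> borel_measurable borel" by simp
  have i1: "integrable lborel (\<lambda>s. path_deriv c s * (exp (- path_right a c s * 1) * \<phi> (G (path_right a c s))))"
    using lap_weak(2)[OF G c _ \<phi>, of 1] by (simp add: path_integrable_def)
  have Bint: "integrable lborel B"
  proof -
    have "exp (- Re (path_right a c s)) * cmod (P s) = cmod (path_deriv c s * (exp (- path_right a c s * 1) * \<phi> (G (path_right a c s))))" for s
      by (simp add: P_def norm_mult)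
    then show ?thesis unfolding B_def using integrable_norm[OF i1] by (intro integrable_mult_right) simp
  qed
  have kmeas: "(\<lambda>(t, s). k t s) \<in> borel_measurable (lborel \<Otimes>\<^sub>M lborel)"
    unfolding k_def by measurable
  have AB: "integrable (lborel \<Otimes>\<^sub>M lborel) (\<lambda>(t, s). exp (- \<eta> * \<bar>t\<bar>) * B s)"
  proof (rule lborel_pair.Fubini_integrable)
    have [measurable]: "B \<in> borel_measurable borel" using Bint by auto
    show "(\<lambda>(t, s). exp (- \<eta> * \<bar>t\<bar>) * B s) \<in> borel_measurable (lborel \<Otimes>\<^sub>M lborel)" by measurable
    have "(\<lambda>t. \<integral>s. norm (case (t, s) of (t, s) \<Rightarrow> exp (- \<eta> * \<bar>t\<bar>) * B s) \<partial>lborel) = (\<lambda>t. exp (- \<eta> * \<bar>t\<bar>) * (\<integral>s. \<bar>B s\<bar> \<partial>lborel))"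
      by (simp add: abs_mult)
    then show "integrable lborel (\<lambda>t. \<integral>s. norm (case (t, s) of (t, s) \<Rightarrow> exp (- \<eta> * \<bar>t\<bar>) * B s) \<partial>lborel)"
      using integrable_exp_minus_abs[OF \<eta>] by simp
    show "AE t in lborel. integrable lborel (\<lambda>s. case (t, s) of (t, s) \<Rightarrow> exp (- \<eta> * \<bar>t\<bar>) * B s)"
      using Bint by simp
  qed
  have kint: "integrable (lborel \<Otimes>\<^sub>M lborel) (\<lambda>(t, s). k t s)"
  proof (rule Bochner_Integration.integrable_bound[OF AB kmeas], rule AE_I2, clarify)
    fix t s :: real
    have "cmod (k t s) \<le> exp (- \<eta> * \<bar>t\<bar>) * B s"
    proof (cases "t < 0")
      case False
      have "t * Re (z - path_right a c s) \<le> t * - \<eta>"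
        using path_right_bounds(1)[OF c, of a s] False by (intro mult_left_mono) (auto simp: \<eta>_def)
      then have "Re (z * (1 + of_real t)) + Re (- path_right a c s * (1 + of_real t)) \<le> - \<eta> * \<bar>t\<bar> + Re z + - Re (path_right a c s)"
        using False by (simp add: algebra_simps)
      then have "exp (Re (z * (1 + of_real t))) * exp (Re (- path_right a c s * (1 + of_real t))) * cmod (P s)
          \<le> exp (- \<eta> * \<bar>t\<bar>) * exp (Re z) * exp (- Re (path_right a c s)) * cmod (P s)"
        by (intro mult_right_mono) (simp_all flip: exp_add)
      then show ?thesis using False by (simp add: k_def B_def norm_mult mult.assoc)
    qed (simp add: k_def B_def)
    then show "norm (k t s) \<le> norm (exp (- \<eta> * \<bar>t\<bar>) * B s)" using order_trans[OF _ abs_ge_self] by (simp only: real_norm_def)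
  qed
  have "\<phi> (ray_transform 1 (lap a 1 G) z) = (\<integral>t. ray_fun 1 (\<lambda>w. exp (z * w) * \<phi> (lap a 1 G w)) t \<partial>lborel)"
    by (rule ray_transform_weak(1)[OF f one zside \<phi>])
  also have "\<dots> = (\<integral>t. (\<integral>s. k t s \<partial>lborel) \<partial>lborel)"
  proof (rule Bochner_Integration.integral_cong[OF refl])
    fix t :: real
    show "ray_fun 1 (\<lambda>w. exp (z * w) * \<phi> (lap a 1 G w)) t = (\<integral>s. k t s \<partial>lborel)"
    proof (cases "t < 0")
      case False
      then have re: "Re (1 + of_real t) > 0" by simp
      have "\<phi> (lap a 1 G (1 + of_real t)) = (\<integral>s. exp (- path_right a c s * (1 + of_real t)) * P s \<partial>lborel)"
        unfolding lap_radius[OF G zero_less_one c re] lap_weak(1)[OF G c re \<phi>] pint_def P_def by (simp only: mult_ac)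
      then show ?thesis using False by (simp add: ray_fun_def k_def)
    qed (simp add: ray_fun_def k_def)
  qed
  also have "\<dots> = (\<integral>s. (\<integral>t. k t s \<partial>lborel) \<partial>lborel)"
    by (rule lborel_pair.Fubini_integral[OF kint, symmetric])
  also have "\<dots> = pint a c (\<lambda>w. exp (z - w) / (w - z) * \<phi> (G w))"
    unfolding pint_def
  proof (rule Bochner_Integration.integral_cong[OF refl])
    fix s :: real
    let ?w = "path_right a c s"
    have neg: "Re ((z - ?w) * 1) < 0" using path_right_bounds(1)[OF c, of a s] z by simp
    have "k t s = ray_fun 1 (\<lambda>w. exp ((z - ?w) * w)) t * P s" for t
      by (simp add: k_def ray_fun_def exp_add[symmetric] algebra_simps mult_exp_exp)
    then have "(\<integral>t. k t s \<partial>lborel) = (- exp (z - ?w) / (z - ?w)) * P s"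
      using ray_fun_exp_integral(2)[OF neg] by simp
    also have "- exp (z - ?w) / (z - ?w) = exp (z - ?w) / (?w - z)"
      by (metis minus_diff_eq minus_divide_divide minus_minus)
    finally show "(\<integral>t. k t s \<partial>lborel) = path_deriv c s * (exp (z - ?w) / (?w - z) * \<phi> (G ?w))"
      by (simp add: P_def mult_ac)
  qed
  finally show ?thesis .
qed

text \<open>The kernel from Fubini's theorem, now used for \<open>z\<close> inside the contour. Its
  factor \<open>exp (z - w)\<close> equals 1 at the pole and makes the integral over the unbounded
  contour converge.\<close>

definition cauchy_transform :: "real \<Rightarrow> real \<Rightarrow> (complex \<Rightarrow> 'e) \<Rightarrow> complex \<Rightarrow> 'e" where
  "cauchy_transform a c G z = pettis (\<lambda>t. smul (exp (z - path_right a c t) / (path_right a c t - z))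
     (smul (path_deriv c t) (G (path_right a c t))))"

lemma cauchy_transform_props:
  assumes G: "G \<in> hol smul (- ray a)" "infra a G" and c: "c > 0"
  shows "cauchy_transform a c G \<in> hol smul {z. dray a z < c}"
    and "\<And>z \<phi>. dray a z < c \<Longrightarrow> \<phi> \<in> dual smul \<Longrightarrow>
      \<phi> (cauchy_transform a c G z) = pint a c (\<lambda>w. exp (z - w) / (w - z) * \<phi> (G w))"
proof -
  have op: "open {z. dray a z < c}" by (intro open_Collect_less continuous_on_dray continuous_intros)
  have ne: "path_right a c t \<noteq> z" if "z \<in> {z. dray a z < c}" for z t
    using dray_path_right[OF c, of a t] that by auto
  have ptend: "(path_right a c \<longlongrightarrow> path_right a c t) (at t)" for t
    using continuous_on_path_right[of UNIV a c] by (auto simp: continuous_on_def)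
  have der: "((\<lambda>z. exp (z - path_right a c t) / (path_right a c t - z)) has_field_derivative
      (exp (z - path_right a c t) * (path_right a c t - z) + exp (z - path_right a c t)) / (path_right a c t - z)\<^sup>2) (at z)"
    if "z \<in> {z. dray a z < c}" for z t
    using ne[OF that, of t] by (auto intro!: derivative_eq_intros simp: power2_eq_square)
  have cont: "((\<lambda>t. exp (z - path_right a c t) / (path_right a c t - z)) \<longlongrightarrow> exp (z - path_right a c t) / (path_right a c t - z)) (at t)"
    if "z \<in> {z. dray a z < c}" for z t
    using ne[OF that] by (intro tendsto_intros ptend) auto
  have dom: "\<exists>r C d. r > 0 \<and> d > 0 \<and> (\<forall>z\<in>ball z0 r. \<forall>t. cmod (exp (z - path_right a c t) / (path_right a c t - z)) *
      p \<alpha> (smul (path_deriv c t) (G (path_right a c t))) \<le> C * exp (- d * \<bar>t\<bar>))" if z0: "z0 \<in> {z. dray a z < c}" for z0 \<alpha>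
  proof -
    \<comment> \<open>Half the gap to the contour: on the disc of this radius the denominator is at
      least \<open>r\<close>.\<close>
    define r where "r = (c - dray a z0) / 2"
    have r: "r > 0" using z0 by (simp add: r_def)
    have half: "(0::real) < 1 / 2" by simp
    obtain M where M: "\<And>t. p \<alpha> (G (path_right a c t)) \<le> M * exp (1 / 2 * \<bar>Re (path_right a c t)\<bar>)"
      using infra_path[OF G(2) c half, of \<alpha>] by blast
    define K where "K = (1 + 2 * c) * \<bar>M\<bar> * exp (1 / 2 * (\<bar>a\<bar> + c) + 1) * exp (- (a - c) * Re 1 + c * \<bar>Im 1\<bar>)"
    have "cmod (exp (z - path_right a c t) / (path_right a c t - z)) * p \<alpha> (smul (path_deriv c t) (G (path_right a c t)))
        \<le> (exp (Re z0 + r) / r * K) * exp (- (1 / 2) * \<bar>t\<bar>)" if z: "z \<in> ball z0 r" for z t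
    proof -
      have d: "cmod (z - z0) < r" using z by (simp add: dist_norm norm_minus_commute)
      have "c \<le> dray a z + cmod (path_right a c t - z)" using dray_triangle[of a "path_right a c t" z] dray_path_right[OF c] by simp
      moreover have "dray a z \<le> dray a z0 + r" using dray_triangle[of a z z0] d by simp
      ultimately have r': "r \<le> cmod (path_right a c t - z)" by (simp add: r_def field_simps)
      have "Re z \<le> Re z0 + r" using abs_Re_le_cmod[of "z - z0"] d by simp
      then have "cmod (exp z) \<le> exp (Re z0 + r)" by simp
      then have w1: "cmod (exp z) / cmod (path_right a c t - z) \<le> exp (Re z0 + r) / r" using r r' by (intro frac_le) auto
      have w2: "cmod (exp (- path_right a c t * 1)) * p \<alpha> (smul (path_deriv c t) (G (path_right a c t))) \<le> K * exp (- (1 - 1 / 2) * \<bar>t\<bar>)"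
        unfolding K_def by (rule path_weight_bound[where \<mu> = "1 / 2" and \<sigma> = 1 and \<zeta> = 1 and G = G and b = a and t = t and \<alpha> = \<alpha>, OF c _ _ _ M]) auto
      have "cmod (exp z) / cmod (path_right a c t - z) * (cmod (exp (- path_right a c t * 1)) * p \<alpha> (smul (path_deriv c t) (G (path_right a c t))))
          \<le> exp (Re z0 + r) / r * (K * exp (- (1 - 1 / 2) * \<bar>t\<bar>))"
        by (rule mult_mono[OF w1 w2]) (use r in auto)
      moreover have "cmod (exp (z - path_right a c t) / (path_right a c t - z)) = cmod (exp z) / cmod (path_right a c t - z) * cmod (exp (- path_right a c t * 1))"
        by (simp add: norm_divide exp_diff exp_minus divide_inverse norm_mult norm_inverse)
      ultimately show ?thesis by (simp only: mult.assoc) simp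
    qed
    then show ?thesis using r by (intro exI[of _ r] exI[of _ "exp (Re z0 + r) / r * K"] exI[of _ "1/2"]) auto
  qed
  note * = parametric_pettis_integral[where S = "{-1, 1}" and F = "\<lambda>t. smul (path_deriv c t) (G (path_right a c t))"
      and s = "\<lambda>z t. exp (z - path_right a c t) / (path_right a c t - z)",
      OF _ continuous_path_deriv_comp[OF c G(1)] op der cont dom]
  show "cauchy_transform a c G \<in> hol smul {z. dray a z < c}"
    unfolding cauchy_transform_def[abs_def] by (rule *(3)) auto
  show "\<phi> (cauchy_transform a c G z) = pint a c (\<lambda>w. exp (z - w) / (w - z) * \<phi> (G w))"
    if z: "dray a z < c" and \<phi>: "\<phi> \<in> dual smul" for z \<phi>
  proof -
    have pet: "has_pettis_integral smul lborel (\<lambda>t. smul (exp (z - path_right a c t) / (path_right a c t - z))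
        (smul (path_deriv c t) (G (path_right a c t)))) (cauchy_transform a c G z)"
      unfolding cauchy_transform_def using z by (intro *(1)) auto
    have "\<phi> (cauchy_transform a c G z) = (\<integral>t. \<phi> (smul (exp (z - path_right a c t) / (path_right a c t - z))
        (smul (path_deriv c t) (G (path_right a c t)))) \<partial>lborel)"
      by (rule pet[unfolded has_pettis_integral_def, THEN bspec, OF \<phi>, THEN conjunct2, symmetric])
    then show ?thesis unfolding dual_scale[OF \<phi>] pint_def by (simp only: mult.left_commute[of "path_deriv c _"])
  qed
qed

lemma cauchy_transform_radius:
  assumes G: "G \<in> hol smul (- ray a)" "infra a G" and c: "dray a z < c1" "dray a z < c2"
  shows "cauchy_transform a c1 G z = cauchy_transform a c2 G z"
  using c
proof (induction c1 c2 rule: linorder_wlog)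
  case (le c1 c2)
  have c0: "0 < c1" "0 < c2" using le dray_nonneg[of a z] by linarith+
  have off: "cauchy_transform a c1 G z = cauchy_transform a c2 G z" if z: "z \<notin> ray a" and d: "dray a z < c1" for z
  proof (rule dual_separates)
    fix \<phi> assume \<phi>: "\<phi> \<in> dual smul"
    have "decays (band a c1 c2) (\<lambda>w. exp (- w) * \<phi> (G w))"
      using infra_band_decays[OF G(2) c0(1) _ \<phi>, of 1 c2] by simp
    note q = cauchy_quotient_pint[OF hol_weak[OF G(1) open_slit \<phi>] z c0(1) le(1) this]
    have "dray a z < c2" using d le by simp
    then show "\<phi> (cauchy_transform a c1 G z) = \<phi> (cauchy_transform a c2 G z)"
      using q(1) q(2)[of c1] q(2)[of c2] d le pint_kernel_inside[of a z c1 1] pint_kernel_inside[of a z c2 1]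
      by (simp add: cauchy_transform_props(2)[OF G c0(1) d \<phi>] cauchy_transform_props(2)[OF G c0(2) _ \<phi>])
  qed
  show ?case
  proof (cases "z \<in> ray a")
    case True
    define X where "X n = z + \<i> * of_real (1 / real (Suc n))" for n
    have X: "X \<longlonglongrightarrow> z"
    proof -
      have "(\<lambda>n. z + \<i> * of_real (1 / real (Suc n))) \<longlonglongrightarrow> z + \<i> * of_real 0"
        by (intro tendsto_intros LIMSEQ_Suc lim_const_over_n)
      then show ?thesis by (simp add: X_def[abs_def])
    qed
    have "Im (X n) = 1 / real (Suc n)" for n
      using True unfolding X_def by (simp add: mem_ray del: of_nat_Suc)
    then have Xne: "X n \<noteq> z" "X n \<notin> ray a" for n using True by (auto simp: mem_ray)
    have Xt: "filterlim X (at z) sequentially"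
      using X Xne by (simp add: filterlim_at)
    have "(\<lambda>n. dray a (X n)) \<longlonglongrightarrow> dray a z"
      using continuous_on_dray[of UNIV a] by (intro isCont_tendsto_compose[OF _ X]) (simp add: continuous_on_eq_continuous_at)
    then have ev: "\<forall>\<^sub>F n in sequentially. dray a (X n) < c1" using le(2) by (rule order_tendstoD)
    have 1: "(\<lambda>n. cauchy_transform a c1 G (X n)) \<longlonglongrightarrow> cauchy_transform a c1 G z"
      using filterlim_compose[OF hol_tendsto[OF cauchy_transform_props(1)[OF G c0(1)]] Xt] le by simp
    have 2: "(\<lambda>n. cauchy_transform a c2 G (X n)) \<longlonglongrightarrow> cauchy_transform a c2 G z"
      using filterlim_compose[OF hol_tendsto[OF cauchy_transform_props(1)[OF G c0(2)]] Xt] le by simp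
    have "\<forall>\<^sub>F n in sequentially. cauchy_transform a c1 G (X n) = cauchy_transform a c2 G (X n)"
      using ev by (rule eventually_mono) (rule off[OF Xne(2)])
    from LIMSEQ_unique[OF Lim_transform_eventually[OF 1 this] 2] show ?thesis .
  qed (use off le in auto)
qed simp

text \<open>
  By Fubini's theorem \<open>V\<close> below is, far to the left, the contour integral of \<open>e\<^sup>z\<^sup>-\<^sup>w / (w - z) G w\<close>. Once
  \<open>z\<close> lies outside the contour, this integral differs from the one over a contour around \<open>z\<close>, namely \<open>J\<close>,
  by the residue at \<open>z\<close>, a multiple of \<open>G z\<close>; the identity theorem does the rest.
\<close>

lemma entire_extension_if_lap_lo:
  assumes G: "G \<in> hol smul (- ray a)" "infra a G" and lo: "\<And>b. lo b (lap a 1 G)"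
  obtains H where "H \<in> hol smul UNIV" "\<And>z. z \<notin> ray a \<Longrightarrow> G z = H z"
proof -
  \<comment> \<open>The radius varies so that the contour always encloses \<open>z\<close>; locally
    it can be fixed, which makes \<open>J\<close> entire.\<close>
  define J where "J z = cauchy_transform a (dray a z + 1) G z" for z
  define V where "V = ray_transform 1 (lap a 1 G)"
  define H where "H z = smul (1 / (2 * pi * \<i>)) (V z - J z)" for z
  have one: "1 \<in> dirs" by (simp add: dirs_def)
  have V: "V \<in> hol smul UNIV"
    unfolding hol_def
  proof safe
    fix z
    \<comment> \<open>A Laplace transform of type \<open>Re z + 1\<close> has a convergent ray
      transform at \<open>z\<close>; as all types are available, \<open>V\<close> is entire.\<close>
    have "V \<in> hol smul (side (Re z + 1) 1)" unfolding V_def by (rule ray_transform_props(3)[OF lo one])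
    then show "\<exists>l. ((\<lambda>h. smul (inverse h) (V (z + h) - V z)) \<longlongrightarrow> l) (at 0)"
      by (auto simp: hol_def side_cases)
  qed
  have J_eq: "J z = cauchy_transform a c G z" if "dray a z < c" for z c
    unfolding J_def using that by (intro cauchy_transform_radius G) auto
  have J: "J \<in> hol smul UNIV"
    unfolding hol_def
  proof safe
    fix z
    have op: "open {w. dray a w < dray a z + 1}" by (intro open_Collect_less continuous_on_dray continuous_intros)
    have "J \<in> hol smul {w. dray a w < dray a z + 1}"
      using dray_nonneg[of a z] by (intro hol_cong[OF cauchy_transform_props(1)[OF G] op]) (auto simp: J_eq)
    then show "\<exists>l. ((\<lambda>h. smul (inverse h) (J (z + h) - J z)) \<longlongrightarrow> l) (at 0)" by (auto simp: hol_def)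
  qed
  have H: "H \<in> hol smul UNIV" unfolding H_def by (intro hol_smul hol_diff V J)
  have "G z = H z" if z: "z \<notin> ray a" for z
  proof (rule dual_separates)
    fix \<phi> assume \<phi>: "\<phi> \<in> dual smul"
    note ghol = hol_weak[OF G(1) open_slit \<phi>]
    show "\<phi> (G z) = \<phi> (H z)"
    proof (rule analytic_continuation_open[where f = "\<lambda>z. \<phi> (G z)" and g = "\<lambda>z. \<phi> (H z)"])
      show "open {z. Re z < a}" by (rule open_halfspace_Re_lt)
      show "{z. Re z < a} \<noteq> {}" by (auto intro!: exI[of _ "of_real (a - 1)"])
      show "connected (- ray a)" by (rule starlike_imp_connected[OF starlike_slit])
      show "{z. Re z < a} \<subseteq> - ray a" by (auto simp: mem_ray)
      show "(\<lambda>z. \<phi> (H z)) holomorphic_on - ray a"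
        by (rule holomorphic_on_subset[OF hol_weak[OF H open_UNIV \<phi>]]) simp
      show "z \<in> - ray a" using z by simp
      fix z assume "z \<in> {z. Re z < a}"
      then have z: "Re z < a" by simp
      then have zr: "z \<notin> ray a" by (auto simp: mem_ray)
      \<comment> \<open>\<open>z\<close> lies outside the contour of radius \<open>c1\<close>, where
        Fubini's theorem applies, and inside the one of radius \<open>c2\<close>.\<close>
      define c1 where "c1 = (a - Re z) / 2"
      define c2 where "c2 = dray a z + 1"
      have c1: "0 < c1" "Re z < a - c1" "c1 < dray a z" "c1 \<le> c2"
        using z Re_ge_dray[of a z] by (auto simp: c1_def c2_def field_simps)
      have c2: "0 < c2" "dray a z < c2" using dray_nonneg[of a z] by (auto simp: c2_def)
      have "decays (band a c1 c2) (\<lambda>w. exp (- w) * \<phi> (G w))"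
        using infra_band_decays[OF G(2) c1(1) _ \<phi>, of 1 c2] by simp
      note q = cauchy_quotient_pint[OF ghol zr c1(1,4) this]
      \<comment> \<open>The quotient integrals cancel. The kernel integral is 0 for the first
        contour and \<open>- (2 * pi * \<i>)\<close> for the second, and the difference is the
        stated multiple of the value at \<open>z\<close>.\<close>
      have "\<phi> (V z) - \<phi> (J z) = \<phi> (G z) * (2 * pi * \<i>)"
        using q(1) q(2)[of c1] q(2)[of c2] c1 c2 pint_kernel_outside[OF c1(1,2), of 1] pint_kernel_inside[OF c2(2), of 1]
        by (simp add: V_def laplace_borel_fubini[OF G lo c1(1,2) \<phi>] J_eq[OF c2(2)] cauchy_transform_props(2)[OF G c2 \<phi>])
      then show "\<phi> (G z) = \<phi> (H z)"
        by (simp add: H_def dual_scale[OF \<phi>] dual_diff[OF \<phi>])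
    qed (rule open_slit ghol)+
  qed
  with H show thesis by (rule that)
qed

end

section \<open>Representatives of infra-exponential growth\<close>

definition flat :: "real poly \<Rightarrow> real \<Rightarrow> real" where
  "flat q t = (if t \<le> 0 then 0 else poly q (inverse t) * exp (- inverse t))"

lemma power_poly_exp_tendsto: "((\<lambda>x. x ^ k * poly q x * exp (- x)) \<longlongrightarrow> (0::real)) at_top"
proof (induction q arbitrary: k)
  case (pCons c q)
  have "((\<lambda>x. c * (x ^ k / exp x) + x ^ Suc k * poly q x * exp (- x)) \<longlongrightarrow> c * 0 + 0) at_top"
    by (intro tendsto_add tendsto_mult_left tendsto_power_div_exp_0 pCons.IH)
  then show ?case by (simp add: algebra_simps exp_minus divide_inverse)
qed simp

text \<open>Polynomials in \<open>1 / t\<close> times \<open>exp (- 1 / t)\<close> are closed under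
  differentiation: \<open>q\<close> turns into \<open>x^2 * (q - q')\<close>. From the right of 0
  the difference quotient is again of this form and tends to 0.\<close>

lemma flat_has_derivative:
  "(flat q has_real_derivative flat ([:0, 0, 1:] * (q - pderiv q)) t) (at t)"
proof -
  consider "t < 0" | "t > 0" | "t = 0" by linarith
  then show ?thesis
  proof cases
    case 1
    have "((\<lambda>_. 0) has_real_derivative 0) (at t)" by simp
    then have "(flat q has_real_derivative 0) (at t)"
      by (rule has_field_derivative_transform_within_open[where S = "{..<0}"]) (use 1 in \<open>auto simp: flat_def\<close>)
    then show ?thesis using 1 by (simp add: flat_def)
  next
    case 2
    have "((\<lambda>t. poly q (inverse t) * exp (- inverse t)) has_real_derivative
        (inverse t * inverse t) * (poly q (inverse t) - poly (pderiv q) (inverse t)) * exp (- inverse t)) (at t)"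
      using 2 by (auto intro!: derivative_eq_intros DERIV_chain2[OF poly_DERIV] simp: algebra_simps)
    then have "(flat q has_real_derivative
        (inverse t * inverse t) * (poly q (inverse t) - poly (pderiv q) (inverse t)) * exp (- inverse t)) (at t)"
      by (rule has_field_derivative_transform_within_open[where S = "{0<..}"]) (use 2 in \<open>auto simp: flat_def\<close>)
    then show ?thesis using 2 by (simp add: flat_def algebra_simps)
  next
    case 3
    have "((\<lambda>h. flat q h / h) \<longlongrightarrow> 0) (at_left 0)"
      by (rule tendsto_eventually) (auto simp: eventually_at_filter flat_def)
    moreover have "((\<lambda>h. flat q h / h) \<longlongrightarrow> 0) (at_right 0)"
    proof -
      have "((\<lambda>h. inverse h ^ 1 * poly q (inverse h) * exp (- inverse h)) \<longlongrightarrow> 0) (at_right 0)"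
        by (rule filterlim_compose[OF power_poly_exp_tendsto filterlim_inverse_at_top_right])
      then show ?thesis
        by (rule Lim_transform_eventually) (auto simp: eventually_at_filter flat_def divide_inverse)
    qed
    ultimately have "((\<lambda>h. (flat q (0 + h) - flat q 0) / h) \<longlongrightarrow> 0) (at 0)"
      unfolding filterlim_at_split by (simp add: flat_def)
    then show ?thesis using 3 by (simp add: DERIV_def flat_def)
  qed
qed

text \<open>Every constructor is matched by a differentiation rule that stays inside the class, so
  members have derivatives of all orders although none is named. The constructors are those from
  which the cutoff is built.\<close>

inductive_set smooth_reals :: "(real \<Rightarrow> real) set" where
  flat: "flat q \<in> smooth_reals"
| const: "(\<lambda>_. c) \<in> smooth_reals"
| exp: "(\<lambda>t. exp (2 * t)) \<in> smooth_reals"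
| reflect: "f \<in> smooth_reals \<Longrightarrow> (\<lambda>t. f (1 - t)) \<in> smooth_reals"
| add: "f \<in> smooth_reals \<Longrightarrow> g \<in> smooth_reals \<Longrightarrow> (\<lambda>t. f t + g t) \<in> smooth_reals"
| mult: "f \<in> smooth_reals \<Longrightarrow> g \<in> smooth_reals \<Longrightarrow> (\<lambda>t. f t * g t) \<in> smooth_reals"
| inv: "f \<in> smooth_reals \<Longrightarrow> (\<forall>t. f t \<noteq> 0) \<Longrightarrow> (\<lambda>t. inverse (f t)) \<in> smooth_reals"

lemma smooth_reals_derivative:
  "f \<in> smooth_reals \<Longrightarrow> \<exists>f'\<in>smooth_reals. \<forall>t. (f has_real_derivative f' t) (at t)"
proof (induction rule: smooth_reals.induct)
  case (flat q)
  show ?case using flat_has_derivative smooth_reals.flat by blast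
next
  case (const c)
  show ?case by (rule bexI[OF _ smooth_reals.const[of 0]]) simp
next
  case exp
  show ?case
    by (rule bexI[OF _ smooth_reals.mult[OF smooth_reals.const[of 2] smooth_reals.exp]])
      (auto intro!: derivative_eq_intros)
next
  case (reflect f)
  then obtain f' where f': "f' \<in> smooth_reals" "\<And>t. (f has_real_derivative f' t) (at t)" by blast
  have "((\<lambda>t. f (1 - t)) has_real_derivative f' (1 - t) * (-1)) (at t)" for t
    by (rule DERIV_chain2[OF f'(2)]) (auto intro!: derivative_eq_intros)
  then show ?case
    by (intro bexI[OF _ smooth_reals.mult[OF smooth_reals.const[of "-1"] smooth_reals.reflect[OF f'(1)]]]) simp
next
  case (add f g)
  then obtain f' g' where *: "f' \<in> smooth_reals" "\<And>t. (f has_real_derivative f' t) (at t)"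
    "g' \<in> smooth_reals" "\<And>t. (g has_real_derivative g' t) (at t)" by blast
  show ?case
    by (rule bexI[OF _ smooth_reals.add[OF *(1,3)]]) (auto intro!: derivative_eq_intros *)
next
  case (mult f g)
  then obtain f' g' where *: "f' \<in> smooth_reals" "\<And>t. (f has_real_derivative f' t) (at t)"
    "g' \<in> smooth_reals" "\<And>t. (g has_real_derivative g' t) (at t)" by blast
  show ?case
    by (rule bexI[OF _ smooth_reals.add[OF smooth_reals.mult[OF *(1) mult.hyps(2)] smooth_reals.mult[OF *(3) mult.hyps(1)]]])
      (auto intro!: derivative_eq_intros *)
next
  case (inv f)
  then obtain f' where f': "f' \<in> smooth_reals" "\<And>t. (f has_real_derivative f' t) (at t)" by blast
  have i: "(\<lambda>t. inverse (f t)) \<in> smooth_reals" by (rule smooth_reals.inv) fact+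
  show ?case
    by (rule bexI[OF _ smooth_reals.mult[OF smooth_reals.mult[OF smooth_reals.const[of "-1"] f'(1)] smooth_reals.mult[OF i i]]])
      (use inv.hyps in \<open>auto intro!: derivative_eq_intros f'\<close>)
qed

text \<open>The quotient \<open>h t / (h t + h (1 - t))\<close>, where \<open>h t\<close> is
  \<open>exp (- 1 / t)\<close> for positive \<open>t\<close> and 0 otherwise; its denominator is
  positive because \<open>t\<close> or \<open>1 - t\<close> is.\<close>

lemma smooth_step:
  obtains \<psi> where "\<psi> \<in> smooth_reals" "\<And>t. t \<le> 0 \<Longrightarrow> \<psi> t = 0" "\<And>t. t \<ge> 1 \<Longrightarrow> \<psi> t = (1 :: real)"
proof -
  define h where "h = flat [:1:]"
  have h: "h \<in> smooth_reals" unfolding h_def by (rule smooth_reals.flat)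
  have pos: "h t > 0" if "t > 0" for t using that by (simp add: h_def flat_def)
  have nonneg: "h t \<ge> 0" for t by (simp add: h_def flat_def)
  have zero: "h t = 0" if "t \<le> 0" for t using that by (simp add: h_def flat_def)
  have "h t + h (1 - t) > 0" for t
    using pos[of t] pos[of "1 - t"] nonneg[of t] nonneg[of "1 - t"] by (cases "t > 0") auto
  then have ne: "\<forall>t. h t + h (1 - t) \<noteq> 0" by (metis less_irrefl)
  show thesis
  proof
    show "(\<lambda>t. h t * inverse (h t + h (1 - t))) \<in> smooth_reals"
      by (intro smooth_reals.mult smooth_reals.inv smooth_reals.add smooth_reals.reflect h ne)
    show "h t * inverse (h t + h (1 - t)) = 0" if "t \<le> 0" for t using zero[OF that] by simp
    show "h t * inverse (h t + h (1 - t)) = 1" if "t \<ge> 1" for t using zero[of "1 - t"] pos[of t] that by simp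
  qed
qed

section \<open>Partial derivatives of vector-valued functions\<close>

context lc_hausdorff
begin

lemma partial_eqI: "has_partial smul u f z l \<Longrightarrow> partial smul u f z = l"
  unfolding partial_def has_partial_def by (rule the_equality) (auto intro: tendsto_unique[rotated])

lemma has_partial_partial: "\<exists>l. has_partial smul u f z l \<Longrightarrow> has_partial smul u f z (partial smul u f z)"
  using partial_eqI by fastforce

lemma has_partial_cong:
  assumes "open \<Omega>" "z \<in> \<Omega>" "\<And>w. w \<in> \<Omega> \<Longrightarrow> f w = g w"
  shows "has_partial smul u f z l \<longleftrightarrow> has_partial smul u g z l"
proof -
  have "open ((\<lambda>h::real. z + of_real h * u) -` \<Omega>)" using assms(1) by (intro open_vimage continuous_intros)
  then have "\<forall>\<^sub>F h::real in at 0. z + of_real h * u \<in> \<Omega>"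
    using assms(2) eventually_at_topological[of "\<lambda>h::real. z + of_real h * u \<in> \<Omega>" 0 UNIV] by auto
  then have "\<forall>\<^sub>F h::real in at 0. smul (of_real (inverse h)) (f (z + of_real h * u) - f z)
      = smul (of_real (inverse h)) (g (z + of_real h * u) - g z)"
    by (rule eventually_mono) (simp add: assms(2,3))
  then show ?thesis unfolding has_partial_def by (rule tendsto_cong)
qed

lemma partial_cong:
  assumes "open \<Omega>" "z \<in> \<Omega>" "\<And>w. w \<in> \<Omega> \<Longrightarrow> f w = g w"
  shows "partial smul u f z = partial smul u g z"
proof -
  have "has_partial smul u f z = has_partial smul u g z"
    by (rule ext) (rule has_partial_cong[OF assms])
  then show ?thesis by (simp add: partial_def)
qed

lemma dbar_cong:
  assumes "open \<Omega>" "z \<in> \<Omega>" "\<And>w. w \<in> \<Omega> \<Longrightarrow> f w = g w"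
  shows "dbar smul f z = dbar smul g z"
  unfolding dbar_def by (simp only: partial_cong[of \<Omega> z f g, OF assms])

lemma has_partial_const: "has_partial smul u (\<lambda>_. x) z 0"
  by (simp add: has_partial_def)

lemma partial_const: "partial smul u (\<lambda>_. x) z = 0"
  by (rule partial_eqI[OF has_partial_const])

lemma has_partial_add:
  assumes "has_partial smul u f z l" "has_partial smul u g z m"
  shows "has_partial smul u (\<lambda>z. f z + g z) z (l + m)"
proof -
  have "f (z + of_real h * u) + g (z + of_real h * u) - (f z + g z) = (f (z + of_real h * u) - f z) + (g (z + of_real h * u) - g z)" for h :: real
    by (simp add: algebra_simps)
  then show ?thesis
    using tendsto_lc_add[OF assms[unfolded has_partial_def]] by (simp only: has_partial_def scale_right_distrib)
qed

lemma has_partial_smul: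
  assumes "has_partial smul u f z l"
  shows "has_partial smul u (\<lambda>z. smul c (f z)) z (smul c l)"
proof -
  have "smul (of_real (inverse h)) (smul c (f (z + of_real h * u)) - smul c (f z)) =
      smul c (smul (of_real (inverse h)) (f (z + of_real h * u) - f z))" for h :: real
    by (simp only: scale_right_diff_distrib[symmetric] scale_scale mult.commute)
  then show ?thesis
    using tendsto_smul[OF tendsto_const[of c] assms[unfolded has_partial_def]] by (simp only: has_partial_def)
qed

lemma has_partial_tendsto:
  assumes "has_partial smul u f z l"
  shows "((\<lambda>h::real. f (z + of_real h * u)) \<longlongrightarrow> f z) (at 0)"
proof -
  have "((\<lambda>h::real. complex_of_real h) \<longlongrightarrow> of_real 0) (at 0)" by (intro tendsto_intros)
  from tendsto_lc_add[OF tendsto_smul[OF this assms[unfolded has_partial_def]] tendsto_const[of "f z"]]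
  have "((\<lambda>h::real. smul (of_real h) (smul (of_real (inverse h)) (f (z + of_real h * u) - f z)) + f z) \<longlongrightarrow> f z) (at 0)" by simp
  then show ?thesis
    by (rule Lim_transform_eventually) (auto simp: eventually_at_filter simp flip: of_real_mult)
qed

lemma has_partial_mult:
  assumes \<theta>: "has_partial (*) u \<theta> z l" and f: "has_partial smul u f z m"
  shows "has_partial smul u (\<lambda>z. smul (\<theta> z) (f z)) z (smul l (f z) + smul (\<theta> z) m)"
proof -
  have "((\<lambda>h::real. smul (of_real (inverse h) * (\<theta> (z + of_real h * u) - \<theta> z)) (f (z + of_real h * u)) +
      smul (\<theta> z) (smul (of_real (inverse h)) (f (z + of_real h * u) - f z))) \<longlongrightarrow> smul l (f z) + smul (\<theta> z) m) (at 0)"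
    by (intro tendsto_lc_add tendsto_smul tendsto_const has_partial_tendsto[OF f] f[unfolded has_partial_def] \<theta>[unfolded has_partial_def])
  moreover have "smul (of_real (inverse h) * (\<theta> (z + of_real h * u) - \<theta> z)) (f (z + of_real h * u)) +
      smul (\<theta> z) (smul (of_real (inverse h)) (f (z + of_real h * u) - f z)) =
      smul (of_real (inverse h)) (smul (\<theta> (z + of_real h * u)) (f (z + of_real h * u)) - smul (\<theta> z) (f z))" for h :: real
    by (simp add: scale_right_diff_distrib scale_left_diff_distrib right_diff_distrib mult.commute)
  ultimately show ?thesis by (simp only: has_partial_def)
qed

text \<open>A partial derivative at a point of an open set depends only on values in that set, so
  the recursion over the order ignores values outside.\<close>

lemma cont_diff_cong:
  "open \<Omega> \<Longrightarrow> (\<And>z. z \<in> \<Omega> \<Longrightarrow> f z = g z) \<Longrightarrow> cont_diff smul k \<Omega> f \<Longrightarrow> cont_diff smul k \<Omega> g"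
proof (induction k arbitrary: f g)
  case 0
  then show ?case using continuous_on_cong[OF refl, of \<Omega> f g] by simp
next
  case (Suc k)
  note eq = Suc.prems(2) and op = Suc.prems(1)
  have "continuous_on \<Omega> g" using Suc.prems continuous_on_cong[OF refl, of \<Omega> f g] by simp
  moreover have "\<exists>l. has_partial smul u g z l" if "u \<in> {1, \<i>}" "z \<in> \<Omega>" for u z
  proof -
    have "\<exists>l. has_partial smul u f z l" using Suc.prems(3) that by auto
    then show ?thesis using has_partial_cong[of \<Omega> z f g, OF op that(2) eq] by simp
  qed
  moreover have "cont_diff smul k \<Omega> (partial smul u g)" if "u \<in> {1, \<i>}" for u
    by (rule Suc.IH[OF op partial_cong[of \<Omega> _ f g, OF op _ eq]]) (use Suc.prems(3) that in auto)
  ultimately show ?case by simp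
qed

lemma cont_diff_subset: "cont_diff smul k \<Omega> f \<Longrightarrow> \<Omega>' \<subseteq> \<Omega> \<Longrightarrow> cont_diff smul k \<Omega>' f"
  by (induction k arbitrary: f) (auto intro: continuous_on_subset)

lemma cont_diff_Un:
  "open \<Omega> \<Longrightarrow> open \<Omega>' \<Longrightarrow> cont_diff smul k \<Omega> f \<Longrightarrow> cont_diff smul k \<Omega>' f \<Longrightarrow> cont_diff smul k (\<Omega> \<union> \<Omega>') f"
  by (induction k arbitrary: f) (auto intro: continuous_on_open_Un)

lemma cont_diff_Suc: "cont_diff smul (Suc k) \<Omega> f \<Longrightarrow> cont_diff smul k \<Omega> f"
proof (induction k arbitrary: f)
  case (Suc k)
  note cont_diff.simps(2)[of smul "Suc k" \<Omega> f, THEN iffD1, OF Suc.prems]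
  then show ?case using Suc.IH unfolding cont_diff.simps(2)[of smul k] by blast
qed simp

lemma cont_diff_continuous: "cont_diff smul k \<Omega> f \<Longrightarrow> continuous_on \<Omega> f"
  by (cases k) auto

text \<open>Explicit formulas take the place of the definite description in \<open>partial\<close>,
  which is what inductions over the order need.\<close>

lemma cont_diff_SucI:
  assumes "open \<Omega>" "continuous_on \<Omega> f"
    "\<And>z. z \<in> \<Omega> \<Longrightarrow> has_partial smul 1 f z (f1 z)" "\<And>z. z \<in> \<Omega> \<Longrightarrow> has_partial smul \<i> f z (f2 z)"
    "cont_diff smul k \<Omega> f1" "cont_diff smul k \<Omega> f2"
  shows "cont_diff smul (Suc k) \<Omega> f"
proof -
  have "cont_diff smul k \<Omega> (partial smul 1 f)"
    by (rule cont_diff_cong[OF assms(1) _ assms(5)]) (simp add: partial_eqI[OF assms(3)])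
  moreover have "cont_diff smul k \<Omega> (partial smul \<i> f)"
    by (rule cont_diff_cong[OF assms(1) _ assms(6)]) (simp add: partial_eqI[OF assms(4)])
  ultimately show ?thesis using assms(2-4) by auto
qed

lemma cont_diff_SucD:
  assumes "cont_diff smul (Suc k) \<Omega> f" "u = 1 \<or> u = \<i>"
  shows "z \<in> \<Omega> \<Longrightarrow> has_partial smul u f z (partial smul u f z)" "cont_diff smul k \<Omega> (partial smul u f)"
  using assms has_partial_partial by auto

lemma cont_diff_const: "open \<Omega> \<Longrightarrow> cont_diff smul k \<Omega> (\<lambda>_. x)"
proof (induction k arbitrary: x)
  case (Suc k)
  show ?case
    by (rule cont_diff_SucI[OF Suc.prems _ has_partial_const has_partial_const Suc.IH[OF Suc.prems] Suc.IH[OF Suc.prems]]) simp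
qed simp

lemma cont_diff_add:
  "open \<Omega> \<Longrightarrow> cont_diff smul k \<Omega> f \<Longrightarrow> cont_diff smul k \<Omega> g \<Longrightarrow> cont_diff smul k \<Omega> (\<lambda>z. f z + g z)"
proof (induction k arbitrary: f g)
  case (Suc k)
  note f = cont_diff_SucD[OF Suc.prems(2)] and g = cont_diff_SucD[OF Suc.prems(3)]
  show ?case
    by (rule cont_diff_SucI[OF Suc.prems(1) _ has_partial_add[OF f(1) g(1)] has_partial_add[OF f(1) g(1)]
          Suc.IH[OF Suc.prems(1) f(2) g(2)] Suc.IH[OF Suc.prems(1) f(2) g(2)]])
      (use Suc.prems in \<open>auto intro: continuous_on_lc_add\<close>)
qed (auto intro: continuous_on_lc_add)

text \<open>By the product rule the partial derivatives are sums of products of the same kind, so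
  the induction has to run over all pairs of factors.\<close>

lemma cont_diff_mult:
  "open \<Omega> \<Longrightarrow> cont_diff (*) k \<Omega> \<theta> \<Longrightarrow> cont_diff smul k \<Omega> f \<Longrightarrow> cont_diff smul k \<Omega> (\<lambda>z. smul (\<theta> z) (f z))"
proof (induction k arbitrary: \<theta> f)
  case (Suc k)
  note x = cplx.cont_diff_SucD[OF Suc.prems(2)] and f = cont_diff_SucD[OF Suc.prems(3)]
  note IH = Suc.IH[OF Suc.prems(1)]
  have *: "cont_diff smul k \<Omega> (\<lambda>z. smul (partial (*) u \<theta> z) (f z) + smul (\<theta> z) (partial smul u f z))" if "u = 1 \<or> u = \<i>" for u
    by (intro cont_diff_add Suc.prems(1) IH x(2)[OF that] f(2)[OF that] cont_diff_Suc[OF Suc.prems(3)] cplx.cont_diff_Suc[OF Suc.prems(2)])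
  show ?case
    by (rule cont_diff_SucI[OF Suc.prems(1) _ has_partial_mult[OF x(1) f(1)] has_partial_mult[OF x(1) f(1)] * *])
      (use Suc.prems in \<open>auto intro: continuous_on_smul\<close>)
qed (auto intro: continuous_on_smul)

end

section \<open>Smooth scalar functions and the cutoff\<close>

lemma has_partial_complex_iff:
  "has_partial (*) u f z l \<longleftrightarrow> ((\<lambda>h. f (z + of_real h * u)) has_vector_derivative l) (at 0)"
  by (simp add: has_partial_def has_vector_derivative_complex_iff DERIV_def tendsto_complex_iff
      divide_inverse mult.commute del: of_real_inverse)

definition csmooth :: "(complex \<Rightarrow> complex) \<Rightarrow> bool" where
  "csmooth f \<longleftrightarrow> (\<forall>k. cont_diff (*) k UNIV f)"

lemma csmooth_const: "csmooth (\<lambda>_. c)"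
  by (simp add: csmooth_def cplx.cont_diff_const)

lemma csmooth_add: "csmooth f \<Longrightarrow> csmooth g \<Longrightarrow> csmooth (\<lambda>z. f z + g z)"
  by (simp add: csmooth_def cplx.cont_diff_add)

lemma csmooth_mult: "csmooth f \<Longrightarrow> csmooth g \<Longrightarrow> csmooth (\<lambda>z. f z * g z)"
  by (simp add: csmooth_def cplx.cont_diff_mult)

lemma csmooth_if_constant_partials:
  assumes "continuous_on UNIV f" "\<And>z. has_partial (*) 1 f z a" "\<And>z. has_partial (*) \<i> f z b"
  shows "csmooth f"
  unfolding csmooth_def
proof
  fix k
  show "cont_diff (*) k UNIV f"
  proof (cases k)
    case (Suc n)
    show ?thesis
      unfolding Suc by (rule cplx.cont_diff_SucI[OF open_UNIV assms(1-3)]) (auto intro: cplx.cont_diff_const)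
  qed (simp add: assms)
qed

lemma csmooth_Re: "csmooth (\<lambda>z. of_real (Re z))"
  by (rule csmooth_if_constant_partials[of _ 1 0])
    (auto intro!: continuous_intros derivative_eq_intros simp: has_partial_complex_iff has_vector_derivative_complex_iff)

lemma csmooth_Im: "csmooth (\<lambda>z. of_real (Im z))"
  by (rule csmooth_if_constant_partials[of _ 0 1])
    (auto intro!: continuous_intros derivative_eq_intros simp: has_partial_complex_iff has_vector_derivative_complex_iff)

text \<open>The chain rule reproduces the shape: the outer derivative is again in
  \<open>smooth_reals\<close>, and it is multiplied by a partial derivative of
  \<open>\<rho>\<close>, which the product rule can handle.\<close>

lemma csmooth_comp:
  assumes f: "f \<in> smooth_reals" and \<rho>: "csmooth (\<lambda>z. of_real (\<rho> z))"
  shows "csmooth (\<lambda>z. of_real (f (\<rho> z)))"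
  unfolding csmooth_def
proof
  fix k
  have cont: "continuous_on UNIV \<rho>"
  proof -
    have "continuous_on UNIV (\<lambda>z. complex_of_real (\<rho> z))"
      using \<rho>[unfolded csmooth_def, rule_format, of 0] by simp
    from continuous_on_Re[OF this] show ?thesis by simp
  qed
  show "cont_diff (*) k UNIV (\<lambda>z. of_real (f (\<rho> z)))"
    using f
  proof (induction k arbitrary: f)
    case 0
    obtain f' where "\<And>t. (f has_real_derivative f' t) (at t)" using smooth_reals_derivative[OF 0] by blast
    then have "continuous_on UNIV f" by (auto intro!: DERIV_isCont continuous_at_imp_continuous_on)
    then show ?case
      using cont by (auto intro!: continuous_intros intro: continuous_on_compose2)
  next
    case (Suc k)
    obtain f' where f': "f' \<in> smooth_reals" "\<And>t. (f has_real_derivative f' t) (at t)" using smooth_reals_derivative[OF Suc.prems] by blast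
    have "continuous_on UNIV f" using f'(2) by (auto intro!: DERIV_isCont continuous_at_imp_continuous_on)
    then have c: "continuous_on UNIV (\<lambda>z. complex_of_real (f (\<rho> z)))"
      using cont by (auto intro!: continuous_intros intro: continuous_on_compose2)
    let ?\<rho> = "\<lambda>z. complex_of_real (\<rho> z)"
    have \<rho>k: "cont_diff (*) (Suc k) UNIV ?\<rho>" by (rule \<rho>[unfolded csmooth_def, rule_format])
    have part: "has_partial (*) u (\<lambda>z. of_real (f (\<rho> z))) z (of_real (f' (\<rho> z)) * partial (*) u ?\<rho> z)" if "u = 1 \<or> u = \<i>" for u z
    proof -
      have "has_partial (*) u ?\<rho> z (partial (*) u ?\<rho> z)" by (rule cplx.cont_diff_SucD(1)[OF \<rho>k that]) simp
      then have d: "((\<lambda>h. \<rho> (z + of_real h * u)) has_real_derivative Re (partial (*) u ?\<rho> z)) (at 0)"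
        and i: "((\<lambda>h::real. 0 :: real) has_real_derivative Im (partial (*) u ?\<rho> z)) (at 0)"
        by (simp_all add: has_partial_complex_iff has_vector_derivative_complex_iff)
      have "Im (partial (*) u ?\<rho> z) = 0" using DERIV_unique[OF i DERIV_const] by simp
      then show ?thesis
        using DERIV_chain2[OF f'(2) d] by (simp add: has_partial_complex_iff has_vector_derivative_complex_iff)
    qed
    have "cont_diff (*) k UNIV (\<lambda>z. of_real (f' (\<rho> z)) * partial (*) u ?\<rho> z)" if "u = 1 \<or> u = \<i>" for u
      by (rule cplx.cont_diff_mult[OF open_UNIV Suc.IH[OF f'(1)] cplx.cont_diff_SucD(2)[OF \<rho>k that]])
    then show ?case
      by (intro cplx.cont_diff_SucI[OF open_UNIV c part part]) auto
  qed
qed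

text \<open>The support narrows like \<open>exp (- Re z)\<close> along the ray. At a fixed distance
  from the real axis it is therefore bounded, although \<open>\<theta>\<close> is 1 near the whole
  ray.\<close>

lemma csmooth_cutoff:
  obtains \<theta> N where "csmooth \<theta>" "open N" "ray a \<subseteq> N" "\<And>z. z \<in> N \<Longrightarrow> \<theta> z = 1"
    "\<And>z. \<theta> z \<noteq> 0 \<Longrightarrow> a - 2 \<le> Re z \<and> (Im z)\<^sup>2 * exp (2 * Re z) \<le> 2"
proof -
  obtain \<psi> where \<psi>: "\<psi> \<in> smooth_reals" "\<And>t. t \<le> 0 \<Longrightarrow> \<psi> t = 0" "\<And>t. t \<ge> 1 \<Longrightarrow> \<psi> t = (1 :: real)"
    using smooth_step by blast
  \<comment> \<open>Positive exactly where \<open>(Im z)^2 * exp (2 * Re z) < 2\<close>, and at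
    least 1 where that product is at most 1; these are the thresholds 0 and 1 of
    \<open>\<psi>\<close>.\<close>
  define \<rho> where "\<rho> z = 2 + (-1) * (Im z * Im z * exp (2 * Re z))" for z
  have \<rho>: "csmooth (\<lambda>z. of_real (\<rho> z))"
    unfolding \<rho>_def of_real_add of_real_mult
    by (intro csmooth_add csmooth_mult csmooth_const csmooth_Im csmooth_comp[OF smooth_reals.exp csmooth_Re])
  have \<sigma>: "csmooth (\<lambda>z. of_real (Re z + (2 - a)))"
    unfolding of_real_add by (intro csmooth_add csmooth_const csmooth_Re)
  \<comment> \<open>The second factor switches on between the real parts \<open>a - 2\<close> and
    \<open>a - 1\<close>.\<close>
  define \<theta> where "\<theta> z = complex_of_real (\<psi> (\<rho> z)) * of_real (\<psi> (Re z + (2 - a)))" for z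
  show thesis
  proof
    show "csmooth \<theta>" unfolding \<theta>_def by (rule csmooth_mult[OF csmooth_comp[OF \<psi>(1) \<rho>] csmooth_comp[OF \<psi>(1) \<sigma>]])
    show "open {z. Im z * Im z * exp (2 * Re z) < 1 \<and> a - 1 < Re z}"
      by (intro open_Collect_conj open_Collect_less continuous_intros)
    show "ray a \<subseteq> {z. Im z * Im z * exp (2 * Re z) < 1 \<and> a - 1 < Re z}" by (auto simp: mem_ray)
    show "\<theta> z = 1" if "z \<in> {z. Im z * Im z * exp (2 * Re z) < 1 \<and> a - 1 < Re z}" for z
      using that \<psi>(3)[of "\<rho> z"] \<psi>(3)[of "Re z + (2 - a)"] by (simp add: \<theta>_def \<rho>_def)
    show "a - 2 \<le> Re z \<and> (Im z)\<^sup>2 * exp (2 * Re z) \<le> 2" if "\<theta> z \<noteq> 0" for z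
    proof -
      have "\<not> \<rho> z \<le> 0" "\<not> Re z + (2 - a) \<le> 0" using that \<psi>(2) by (auto simp: \<theta>_def)
      then show ?thesis by (simp add: \<rho>_def power2_eq_square)
    qed
  qed
qed

text \<open>Continuity of one partial derivative and existence of the other give total
  differentiability; the Cauchy-Riemann equation makes the differential complex linear.\<close>

lemma holomorphic_if_dbar_zero:
  assumes \<Omega>: "open \<Omega>" and gx: "\<And>z. z \<in> \<Omega> \<Longrightarrow> has_partial (*) 1 g z (g1 z)"
    and gy: "\<And>z. z \<in> \<Omega> \<Longrightarrow> has_partial (*) \<i> g z (g2 z)" and cont: "continuous_on \<Omega> g2"
    and CR: "\<And>z. z \<in> \<Omega> \<Longrightarrow> g1 z + \<i> * g2 z = 0"
  shows "g holomorphic_on \<Omega>"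
  unfolding holomorphic_on_open[OF \<Omega>]
proof
  fix z0 assume z0: "z0 \<in> \<Omega>"
  obtain r where r: "r > 0" "ball z0 r \<subseteq> \<Omega>" using \<Omega> z0 openE by blast
  define X where "X = {Re z0 - r / 2<..<Re z0 + r / 2}"
  define Y where "Y = {Im z0 - r / 2<..<Im z0 + r / 2}"
  have box: "Complex x y \<in> \<Omega>" if "x \<in> X" "y \<in> Y" for x y
  proof -
    have "cmod (z0 - Complex x y) \<le> \<bar>Re z0 - x\<bar> + \<bar>Im z0 - y\<bar>" using cmod_le[of "z0 - Complex x y"] by simp
    also have "\<dots> < r / 2 + r / 2" using that by (intro add_strict_mono) (auto simp: X_def Y_def abs_if)
    finally show ?thesis using r(2) by (auto simp: dist_norm)
  qed
  have z0XY: "Re z0 \<in> X" "Im z0 \<in> Y" using r by (auto simp: X_def Y_def)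
  have shift: "((\<lambda>x. f x) has_vector_derivative l) (at t)" if "((\<lambda>h. f (t + h)) has_vector_derivative l) (at 0)"
    for f :: "real \<Rightarrow> complex" and l t
  proof -
    have "((\<lambda>x. x - t) has_real_derivative 1) (at t)" by (auto intro!: derivative_eq_intros)
    from vector_diff_chain_at[OF this[unfolded has_real_derivative_iff_has_vector_derivative], of "\<lambda>h. f (t + h)" l] that
    show ?thesis by (simp add: comp_def)
  qed
  have dx: "((\<lambda>x. g (Complex x (Im z0))) has_derivative (\<lambda>h. h *\<^sub>R g1 z0)) (at (Re z0) within X)"
  proof -
    have "((\<lambda>h. g (Complex (Re z0 + h) (Im z0))) has_vector_derivative g1 z0) (at 0)"
    proof -
      have "z0 + of_real h * 1 = Complex (Re z0 + h) (Im z0)" for h by (simp add: complex_eq_iff)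
      then show ?thesis using gx[OF z0] by (simp add: has_partial_complex_iff)
    qed
    from shift[OF this] show ?thesis by (auto simp: has_vector_derivative_def intro: has_derivative_at_withinI)
  qed
  have dy: "((\<lambda>y. g (Complex x y)) has_derivative blinfun_apply (blinfun_scaleR_left (g2 (Complex x y)))) (at y within Y)"
    if "x \<in> X" "y \<in> Y" for x y
  proof -
    have "((\<lambda>h. g (Complex x (y + h))) has_vector_derivative g2 (Complex x y)) (at 0)"
    proof -
      have "Complex x y + of_real h * \<i> = Complex x (y + h)" for h by (simp add: complex_eq_iff)
      then show ?thesis using gy[OF box[OF that]] by (simp add: has_partial_complex_iff)
    qed
    from shift[OF this] show ?thesis by (auto simp: has_vector_derivative_def intro: has_derivative_at_withinI)
  qed
  have "((\<lambda>(x, y). g (Complex x y)) has_derivative (\<lambda>(tx, ty). tx *\<^sub>R g1 z0 + blinfun_apply (blinfun_scaleR_left (g2 (Complex (Re z0) (Im z0)))) ty))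
      (at (Re z0, Im z0) within X \<times> Y)"
  proof (rule has_derivative_partialsI[OF dx dy])
    have "continuous_on (X \<times> Y) (\<lambda>(x, y). g2 (Complex x y))"
      unfolding case_prod_unfold using box
      by (intro continuous_on_compose2[OF cont]) (auto intro!: continuous_intros simp: Complex_eq)
    then have "continuous (at (Re z0, Im z0) within X \<times> Y) (\<lambda>(x, y). g2 (Complex x y))"
      using z0XY by (auto simp: continuous_on_eq_continuous_within)
    then show "continuous (at (Re z0, Im z0) within X \<times> Y) (\<lambda>(x, y). blinfun_scaleR_left (g2 (Complex x y)))"
      unfolding case_prod_unfold by (intro continuous_intros)
  qed (use z0XY in \<open>auto simp: Y_def\<close>)
  moreover have "at (Re z0, Im z0) within X \<times> Y = at (Re z0, Im z0)"
    using z0XY by (intro at_within_open) (auto simp: X_def Y_def open_Times)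
  ultimately have d: "((\<lambda>(x, y). g (Complex x y)) has_derivative (\<lambda>(tx, ty). tx *\<^sub>R g1 z0 + ty *\<^sub>R g2 z0)) (at (Re z0, Im z0))"
    by simp
  have "((\<lambda>z. (Re z, Im z)) has_derivative (\<lambda>h. (Re h, Im h))) (at z0)"
    by (rule bounded_linear_imp_has_derivative[OF bounded_linear_Pair[OF bounded_linear_Re bounded_linear_Im]])
  from has_derivative_compose[OF this d]
  have "(g has_derivative (\<lambda>h. Re h *\<^sub>R g1 z0 + Im h *\<^sub>R g2 z0)) (at z0)" by simp
  moreover have "g2 z0 = \<i> * g1 z0"
  proof -
    have "\<i> * (g1 z0 + \<i> * g2 z0) = 0" using CR[OF z0] by simp
    then show ?thesis by (simp add: algebra_simps)
  qed
  then have "Re h *\<^sub>R g1 z0 + Im h *\<^sub>R g2 z0 = g1 z0 * h" for h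
    by (simp add: scaleR_conv_of_real complex_eq_iff algebra_simps)
  ultimately show "\<exists>l. (g has_field_derivative l) (at z0)" by (auto simp: has_field_derivative_def)
qed

section \<open>Holomorphy and the Cauchy-Riemann operator\<close>

context sc_lc_hausdorff
begin

definition cderiv :: "(complex \<Rightarrow> 'e) \<Rightarrow> complex \<Rightarrow> 'e" where
  "cderiv f z = (SOME l. ((\<lambda>h. smul (inverse h) (f (z + h) - f z)) \<longlongrightarrow> l) (at 0))"

lemma cderiv: "f \<in> hol smul \<Omega> \<Longrightarrow> z \<in> \<Omega> \<Longrightarrow> ((\<lambda>h. smul (inverse h) (f (z + h) - f z)) \<longlongrightarrow> cderiv f z) (at 0)"
  unfolding cderiv_def by (rule someI_ex) (auto simp: hol_def)

lemma cderiv_weak: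
  assumes "f \<in> hol smul \<Omega>" "z \<in> \<Omega>" "\<phi> \<in> dual smul"
  shows "((\<lambda>z. \<phi> (f z)) has_field_derivative \<phi> (cderiv f z)) (at z)"
  using dual_tendsto[OF assms(3) cderiv[OF assms(1,2)]]
  by (simp add: DERIV_def dual_scale[OF assms(3)] dual_diff[OF assms(3)] divide_inverse mult.commute)

text \<open>The scalarizations of the derivative are holomorphic, and Cauchy's inequality, uniform
  over a polar, bounds the derivative locally; so weak holomorphy is enough.\<close>

lemma hol_cderiv:
  assumes f: "f \<in> hol smul \<Omega>" and \<Omega>: "open \<Omega>"
  shows "cderiv f \<in> hol smul \<Omega>"
proof (rule hol_if_weakly_hol[OF _ \<Omega>])
  fix \<phi> assume \<phi>: "\<phi> \<in> dual smul"
  have "(\<lambda>z. deriv (\<lambda>z. \<phi> (f z)) z) holomorphic_on \<Omega>"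
    by (rule holomorphic_deriv[OF hol_weak[OF f \<Omega> \<phi>] \<Omega>])
  then show "(\<lambda>z. \<phi> (cderiv f z)) holomorphic_on \<Omega>"
    by (rule holomorphic_transform) (use cderiv_weak[OF f _ \<phi>] in \<open>auto intro: DERIV_imp_deriv\<close>)
next
  fix \<alpha> z0 assume z0: "z0 \<in> \<Omega>"
  obtain r where r: "r > 0" "cball z0 r \<subseteq> \<Omega>" using \<Omega> z0 open_contains_cball by blast
  obtain C where C: "C \<ge> 0" "\<And>z. z \<in> cball z0 r \<Longrightarrow> p \<alpha> (f z) \<le> C"
    using continuous_on_compact_bounded[OF continuous_on_subset[OF hol_continuous_on[OF f] r(2)] compact_cball, of \<alpha>] by blast
  have "p \<alpha> (cderiv f z) \<le> C / (r / 2)" if z: "z \<in> ball z0 (r / 2)" for z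
  proof (rule seminorm_leI)
    fix \<phi> assume \<phi>: "\<phi> \<in> polar \<alpha>"
    have sub: "cball z (r / 2) \<subseteq> cball z0 r"
    proof
      fix y assume "y \<in> cball z (r / 2)"
      then show "y \<in> cball z0 r" using dist_triangle[of z0 y z] z by auto
    qed
    then have sub': "cball z (r / 2) \<subseteq> \<Omega>" using r(2) by blast
    note hol = hol_weak[OF f \<Omega> polarD(1)[OF \<phi>]]
    have "cmod ((deriv ^^ 1) (\<lambda>z. \<phi> (f z)) z) \<le> fact 1 * C / (r / 2) ^ 1"
    proof (rule Cauchy_inequality)
      show "(\<lambda>z. \<phi> (f z)) holomorphic_on ball z (r / 2)"
        by (rule holomorphic_on_subset[OF hol]) (use sub' in auto)
      show "continuous_on (cball z (r / 2)) (\<lambda>z. \<phi> (f z))"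
        by (rule continuous_on_subset[OF holomorphic_on_imp_continuous_on[OF hol] sub'])
      show "cmod (\<phi> (f y)) \<le> C" if "cmod (z - y) = r / 2" for y
      proof -
        have "y \<in> cball z0 r" using that sub by (auto simp: dist_norm)
        then show ?thesis by (rule order_trans[OF polarD(2)[OF \<phi>] C(2)])
      qed
    qed (use r in simp)
    moreover have "z \<in> \<Omega>" using sub' r(1) by auto
    ultimately show "cmod (\<phi> (cderiv f z)) \<le> C / (r / 2)"
      using DERIV_imp_deriv[OF cderiv_weak[OF f _ polarD(1)[OF \<phi>]]] by simp
  qed
  then show "\<exists>r>0. \<exists>C. \<forall>z\<in>ball z0 r. p \<alpha> (cderiv f z) \<le> C"
    using r(1) by (intro exI[of _ "r / 2"] conjI exI[of _ "C / (r / 2)"] ballI) simp_all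
qed

lemma hol_has_partial:
  assumes f: "f \<in> hol smul \<Omega>" "z \<in> \<Omega>" and u: "u \<noteq> 0"
  shows "has_partial smul u f z (smul u (cderiv f z))"
proof -
  have "filterlim (\<lambda>h::real. of_real h * u) (at 0) (at 0)"
    using u by (auto simp: filterlim_at eventually_at_filter intro!: tendsto_eq_intros)
  from tendsto_smul[OF tendsto_const[of u] filterlim_compose[OF cderiv[OF f] this]]
  have "((\<lambda>h::real. smul u (smul (inverse (of_real h * u)) (f (z + of_real h * u) - f z))) \<longlongrightarrow> smul u (cderiv f z)) (at 0)" .
  moreover have "smul u (smul (inverse (of_real h * u)) (f (z + of_real h * u) - f z)) =
      smul (of_real (inverse h)) (f (z + of_real h * u) - f z)" for h :: real
    using u by simp
  ultimately show ?thesis by (simp only: has_partial_def)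
qed

lemma hol_cont_diff: "open \<Omega> \<Longrightarrow> f \<in> hol smul \<Omega> \<Longrightarrow> cont_diff smul k \<Omega> f"
proof (induction k arbitrary: f)
  case (Suc k)
  note d = hol_cderiv[OF Suc.prems(2,1)]
  show ?case
    by (rule cont_diff_SucI[OF Suc.prems(1) hol_continuous_on[OF Suc.prems(2)] hol_has_partial[OF Suc.prems(2)] hol_has_partial[OF Suc.prems(2)]
          Suc.IH[OF Suc.prems(1) hol_smul[OF d]] Suc.IH[OF Suc.prems(1) hol_smul[OF d]]]) auto
qed (auto intro: hol_continuous_on)

lemma dbar_hol:
  assumes "f \<in> hol smul \<Omega>" "z \<in> \<Omega>"
  shows "dbar smul f z = 0"
  using partial_eqI[OF hol_has_partial[OF assms, of 1]] partial_eqI[OF hol_has_partial[OF assms, of \<i>]]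
  by (simp add: dbar_def scale_minus_left)

text \<open>The equation passes to scalarizations and yields weak holomorphy; the local bounds come
  from continuity.\<close>

lemma hol_if_dbar_zero:
  assumes \<Omega>: "open \<Omega>" and f: "cont_diff smul 1 \<Omega> f" and d: "\<And>z. z \<in> \<Omega> \<Longrightarrow> dbar smul f z = 0"
  shows "f \<in> hol smul \<Omega>"
proof (rule hol_if_weakly_hol[OF _ \<Omega>])
  have f1: "cont_diff smul (Suc 0) \<Omega> f" using f by simp
  fix \<phi> assume \<phi>: "\<phi> \<in> dual smul"
  have part: "has_partial (*) u (\<lambda>z. \<phi> (f z)) z (\<phi> (partial smul u f z))" if "u = 1 \<or> u = \<i>" "z \<in> \<Omega>" for u z
    using dual_tendsto[OF \<phi> cont_diff_SucD(1)[OF f1 that, unfolded has_partial_def]]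
    by (simp add: has_partial_def dual_scale[OF \<phi>] dual_diff[OF \<phi>])
  show "(\<lambda>z. \<phi> (f z)) holomorphic_on \<Omega>"
  proof (rule holomorphic_if_dbar_zero[OF \<Omega> part part])
    show "continuous_on \<Omega> (\<lambda>z. \<phi> (partial smul \<i> f z))"
      using cont_diff_SucD(2)[OF f1, of \<i>] by (intro dual_continuous_on[OF \<phi>]) simp
    show "\<phi> (partial smul 1 f z) + \<i> * \<phi> (partial smul \<i> f z) = 0" if "z \<in> \<Omega>" for z
    proof -
      have "\<phi> (dbar smul f z) = 0" using d[OF that] dual_zero[OF \<phi>] by simp
      then show ?thesis by (simp add: dbar_def dual_scale[OF \<phi>] dual_add[OF \<phi>])
    qed
  qed auto
next
  fix \<alpha> z0 assume z0: "z0 \<in> \<Omega>"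
  obtain r where r: "r > 0" "cball z0 r \<subseteq> \<Omega>" using \<Omega> z0 open_contains_cball by blast
  obtain C where "C \<ge> 0" "\<And>z. z \<in> cball z0 r \<Longrightarrow> p \<alpha> (f z) \<le> C"
    by (rule continuous_on_compact_bounded[OF continuous_on_subset[OF cont_diff_continuous[OF f] r(2)] compact_cball]) (rule that)
  then show "\<exists>r>0. \<exists>C. \<forall>z\<in>ball z0 r. p \<alpha> (f z) \<le> C"
    using r(1) by (intro exI[of _ r] conjI exI[of _ C] ballI) simp_all
qed

lemma dbar_add:
  assumes "cont_diff smul 1 \<Omega> f" "cont_diff smul 1 \<Omega> g" "z \<in> \<Omega>"
  shows "dbar smul (\<lambda>z. f z + g z) z = dbar smul f z + dbar smul g z"
proof -
  have *: "partial smul u (\<lambda>z. f z + g z) z = partial smul u f z + partial smul u g z" if "u = 1 \<or> u = \<i>" for u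
    using assms that by (intro partial_eqI has_partial_add cont_diff_SucD(1)[where k = 0 and \<Omega> = \<Omega>]) auto
  show ?thesis by (simp add: dbar_def * scale_right_distrib algebra_simps)
qed

lemma dbar_smul:
  assumes "cont_diff smul 1 \<Omega> f" "z \<in> \<Omega>"
  shows "dbar smul (\<lambda>z. smul c (f z)) z = smul c (dbar smul f z)"
proof -
  have *: "partial smul u (\<lambda>z. smul c (f z)) z = smul c (partial smul u f z)" if "u = 1 \<or> u = \<i>" for u
    using assms that by (intro partial_eqI has_partial_smul cont_diff_SucD(1)[where k = 0 and \<Omega> = \<Omega>]) auto
  show ?thesis by (simp add: dbar_def * scale_right_distrib mult.commute)
qed

lemma dbar_mult:
  assumes "cont_diff (*) 1 \<Omega> \<theta>" "cont_diff smul 1 \<Omega> f" "z \<in> \<Omega>"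
  shows "dbar smul (\<lambda>z. smul (\<theta> z) (f z)) z = smul (dbar (*) \<theta> z) (f z) + smul (\<theta> z) (dbar smul f z)"
proof -
  have *: "partial smul u (\<lambda>z. smul (\<theta> z) (f z)) z = smul (partial (*) u \<theta> z) (f z) + smul (\<theta> z) (partial smul u f z)"
    if "u = 1 \<or> u = \<i>" for u
    using assms that by (intro partial_eqI has_partial_mult cont_diff_SucD(1)[where k = 0 and \<Omega> = \<Omega>]
        cplx.cont_diff_SucD(1)[where k = 0 and \<Omega> = \<Omega>]) auto
  show ?thesis
    by (simp add: dbar_def * scale_right_distrib scale_left_distrib algebra_simps)
qed

lemma smooth_iter_partial: "f \<in> smooth smul \<Omega> \<Longrightarrow> iter_partial smul \<beta> f \<in> smooth smul \<Omega>"
proof -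
  have one: "partial smul u f \<in> smooth smul \<Omega>" if "f \<in> smooth smul \<Omega>" "u = 1 \<or> u = \<i>" for f u
  proof -
    have "cont_diff smul k \<Omega> (partial smul u f)" for k
      by (rule cont_diff_SucD(2)[OF _ that(2)]) (use that(1) in \<open>simp only: smooth_def mem_Collect_eq\<close>)
    then show ?thesis by (simp add: smooth_def)
  qed
  have pow: "(partial smul u ^^ n) f \<in> smooth smul \<Omega>" if "f \<in> smooth smul \<Omega>" "u = 1 \<or> u = \<i>" for f u n
    using that by (induction n) (auto intro: one)
  assume "f \<in> smooth smul \<Omega>"
  then show ?thesis by (simp add: iter_partial_def pow)
qed

lemma iter_partial_zero:
  assumes "open \<Omega>" "\<And>z. z \<in> \<Omega> \<Longrightarrow> f z = 0" "z \<in> \<Omega>"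
  shows "iter_partial smul \<beta> f z = 0"
proof -
  have one: "partial smul u f z = 0" if "\<And>z. z \<in> \<Omega> \<Longrightarrow> f z = 0" "z \<in> \<Omega>" for f u z
    using partial_cong[OF assms(1) that(2), of f "\<lambda>_. 0" u] that(1) by (simp add: partial_const)
  have pow: "(partial smul u ^^ n) f z = 0" if "\<And>z. z \<in> \<Omega> \<Longrightarrow> f z = 0" "z \<in> \<Omega>" for f u n z
    using that(2) by (induction n arbitrary: z) (auto intro: one that(1))
  show ?thesis unfolding iter_partial_def using assms by (intro pow) auto
qed

text \<open>On each region the function and its derivatives live on a bounded set, so continuity on
  the compact closure bounds them, and the weight is at most 1.\<close>

lemma smooth_exp_infI:
  assumes f: "f \<in> smooth smul UNIV" and W: "closed W" "\<And>z. z \<notin> W \<Longrightarrow> f z = 0"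
    and bdd: "\<And>n. n \<ge> 1 \<Longrightarrow> bounded (S_region n {\<infinity>} \<inter> W)"
  shows "f \<in> smooth_exp smul p {\<infinity>}"
proof -
  have "bdd_above ((\<lambda>(z, \<beta>). p \<alpha> (iter_partial smul \<beta> f z) * exp (- (1 / real n) * \<bar>Re z\<bar>)) `
         (S_region n {\<infinity>} \<times> {\<beta>. fst \<beta> + snd \<beta> \<le> m}))" if n: "n \<ge> 1" for n m \<alpha>
  proof -
    define B where "B = {\<beta> :: nat \<times> nat. fst \<beta> + snd \<beta> \<le> m}"
    have "B \<subseteq> {..m} \<times> {..m}" by (auto simp: B_def)
    then have fin: "finite B" by (rule finite_subset) simp
    have "\<exists>C\<ge>0. \<forall>z\<in>S_region n {\<infinity>}. p \<alpha> (iter_partial smul \<beta> f z) \<le> C" for \<beta>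
    proof -
      have cont: "continuous_on (closure (S_region n {\<infinity>} \<inter> W)) (iter_partial smul \<beta> f)"
      proof -
        have "cont_diff smul 0 UNIV (iter_partial smul \<beta> f)"
          using smooth_iter_partial[OF f, of \<beta>] unfolding smooth_def by blast
        from continuous_on_subset[OF cont_diff_continuous[OF this] subset_UNIV] show ?thesis .
      qed
      have comp: "compact (closure (S_region n {\<infinity>} \<inter> W))"
        using bdd[OF n] by (simp add: compact_closure)
      obtain C where C: "C \<ge> 0" "\<And>z. z \<in> closure (S_region n {\<infinity>} \<inter> W) \<Longrightarrow> p \<alpha> (iter_partial smul \<beta> f z) \<le> C"
        using continuous_on_compact_bounded[OF cont comp, of \<alpha>] by blast
      have "p \<alpha> (iter_partial smul \<beta> f z) \<le> C" if "z \<in> S_region n {\<infinity>}" for z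
      proof (cases "z \<in> W")
        case True
        then show ?thesis using that by (intro C(2) subsetD[OF closure_subset]) simp
      next
        case False
        have "iter_partial smul \<beta> f z = 0"
          by (rule iter_partial_zero[where \<Omega> = "- W"]) (use W False in \<open>auto simp: open_Compl\<close>)
        then show ?thesis using C(1) by simp
      qed
      then show ?thesis using C(1) by blast
    qed
    then obtain C where C: "\<And>\<beta>. C \<beta> \<ge> 0" "\<And>\<beta> z. z \<in> S_region n {\<infinity>} \<Longrightarrow> p \<alpha> (iter_partial smul \<beta> f z) \<le> C \<beta>" by metis
    show ?thesis
    \<comment> \<open>There are finitely many multi-indices of order at most \<open>m\<close>, so
      the sum of their bounds serves all of them.\<close>
    proof (rule bdd_aboveI2[where M = "\<Sum>\<beta>\<in>B. C \<beta>"], clarsimp)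
      fix z i j assume z: "z \<in> S_region n {\<infinity>}" "i + j \<le> m"
      have "p \<alpha> (iter_partial smul (i, j) f z) * exp (- (\<bar>Re z\<bar> / real n)) \<le> p \<alpha> (iter_partial smul (i, j) f z) * 1"
        by (intro mult_left_mono) auto
      also have "\<dots> \<le> C (i, j)" using C(2)[OF z(1)] by simp
      also have "\<dots> \<le> (\<Sum>\<beta>\<in>B. C \<beta>)" using z(2) C(1) fin by (intro member_le_sum) (auto simp: B_def)
      finally show "p \<alpha> (iter_partial smul (i, j) f z) * exp (- (\<bar>Re z\<bar> / real n)) \<le> (\<Sum>\<beta>\<in>B. C \<beta>)" .
    qed
  qed
  then show ?thesis using f by (simp add: smooth_exp_def finite_part_inf)
qed

text \<open>
  Near infinity the support of the cutoff \<open>\<theta>\<close> shrinks to the ray, so it meets the regions of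
  \<open>\<infinity>\<close> in bounded sets. Hence no growth condition on \<open>f\<close> is needed to solve the
  Cauchy-Riemann equation for \<open>f\<close> times the \<open>dbar\<close>-derivative of \<open>\<theta>\<close> with a solution \<open>u\<close> of
  infra-exponential growth, and \<open>\<theta> f - u\<close> is the required representative.
\<close>

lemma infra_representative:
  assumes adm: "admissible smul p" and f: "f \<in> hol smul (- ray a)"
  obtains F h where "F \<in> hol smul (- ray a)" "infra a F" "h \<in> hol smul UNIV" "\<And>z. z \<notin> ray a \<Longrightarrow> F z - f z = h z"
proof -
  obtain \<theta> N where \<theta>: "csmooth \<theta>" and N: "open N" "ray a \<subseteq> N" "\<And>z. z \<in> N \<Longrightarrow> \<theta> z = 1"
    and supp: "\<And>z. \<theta> z \<noteq> 0 \<Longrightarrow> a - 2 \<le> Re z \<and> (Im z)\<^sup>2 * exp (2 * Re z) \<le> 2"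
    using csmooth_cutoff[of a] by blast
  define W where "W = {z. a - 2 \<le> Re z \<and> (Im z)\<^sup>2 * exp (2 * Re z) \<le> 2}"
  have W: "closed W" unfolding W_def by (intro closed_Collect_conj closed_Collect_le continuous_intros)
  have \<theta>W: "\<theta> z = 0" if "z \<notin> W" for z using supp[of z] that by (auto simp: W_def)
  \<comment> \<open>At height at least \<open>c\<close> above or below the real axis the thin set
    \<open>W\<close> ends at a finite real part.\<close>
  have W_bound: "Re z \<le> ln (2 / c\<^sup>2) / 2" if "z \<in> W" "c > 0" "c \<le> \<bar>Im z\<bar>" for z c
  proof -
    have "c\<^sup>2 \<le> (Im z)\<^sup>2" using that by (simp add: abs_le_square_iff[symmetric])
    then have "c\<^sup>2 * exp (2 * Re z) \<le> (Im z)\<^sup>2 * exp (2 * Re z)" by (intro mult_right_mono) auto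
    also have "\<dots> \<le> 2" using that by (simp add: W_def)
    finally have "exp (2 * Re z) \<le> 2 / c\<^sup>2" using that by (simp add: field_simps)
    then have "2 * Re z \<le> ln (2 / c\<^sup>2)" using that by (subst ln_ge_iff) auto
    then show ?thesis using that by simp
  qed
  have \<theta>k: "cont_diff (*) k \<Omega> \<theta>" for k \<Omega>
    using cplx.cont_diff_subset[of k UNIV \<theta> \<Omega>] \<theta> by (simp add: csmooth_def)
  define d where "d = dbar (*) \<theta>"
  have dk: "cont_diff (*) k UNIV d" for k
    unfolding d_def dbar_def using cplx.cont_diff_SucD(2)[OF \<theta>k, of _ k UNIV]
    by (intro cplx.cont_diff_mult cplx.cont_diff_add cplx.cont_diff_const) auto
  have dN: "d z = 0" if "z \<in> N" for z
    using cplx.dbar_cong[OF N(1) that, of \<theta> "\<lambda>_. 1"] N(3) by (simp add: d_def dbar_def cplx.partial_const)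
  have dW: "d z = 0" if "z \<notin> W" for z
    using cplx.dbar_cong[of "- W" z \<theta> "\<lambda>_. 0"] W that \<theta>W by (simp add: d_def dbar_def cplx.partial_const open_Compl)
  \<comment> \<open>The value 0 on the ray continues the product smoothly, since \<open>d\<close>
    vanishes on the neighbourhood \<open>N\<close> of the ray.\<close>
  define g where "g z = (if z \<in> ray a then 0 else smul (d z) (f z))" for z
  have gk: "cont_diff smul k UNIV g" for k
  proof -
    have "cont_diff smul k (- ray a) g"
      by (rule cont_diff_cong[OF open_slit _ cont_diff_mult[OF open_slit cplx.cont_diff_subset[OF dk] hol_cont_diff[OF open_slit f]]])
        (auto simp: g_def)
    moreover have "cont_diff smul k N g"
      by (rule cont_diff_cong[OF N(1) _ cont_diff_const[OF N(1), of _ 0]]) (auto simp: g_def dN)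
    ultimately have "cont_diff smul k (- ray a \<union> N) g" by (rule cont_diff_Un[OF open_slit N(1)])
    moreover have "- ray a \<union> N = UNIV" using N(2) by auto
    ultimately show ?thesis by simp
  qed
  have "g \<in> smooth_exp smul p {\<infinity>}"
  proof (rule smooth_exp_infI[OF _ W])
    show "g \<in> smooth smul UNIV" using gk by (simp add: smooth_def)
    show "g z = 0" if "z \<notin> W" for z using dW[OF that] by (simp add: g_def)
    fix n :: nat assume n: "n \<ge> 1"
    define R where "R = max (real n) (ln (2 / (1 / real n)\<^sup>2) / 2)"
    have "S_region n {\<infinity>} \<inter> W \<subseteq> cbox (Complex (a - 2) (- real n)) (Complex R (real n))"
    proof
      fix z assume z: "z \<in> S_region n {\<infinity>} \<inter> W"
      then have S: "Re z \<le> real n \<or> 1 / real n \<le> \<bar>Im z\<bar>" "\<bar>Im z\<bar> \<le> real n"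
        using S_region_inf_subset[OF n] by auto
      have "Re z \<le> R"
      proof (cases "Re z \<le> real n")
        case False
        then show ?thesis using S(1) W_bound[of z "1 / real n"] z n by (simp add: R_def)
      qed (simp add: R_def)
      then show "z \<in> cbox (Complex (a - 2) (- real n)) (Complex R (real n))"
        using S(2) z by (auto simp: in_cbox_complex_iff W_def)
    qed
    then show "bounded (S_region n {\<infinity>} \<inter> W)" using bounded_cbox bounded_subset by blast
  qed
  moreover have "compact ({\<infinity>} :: ereal set)" by simp
  ultimately obtain u where u: "u \<in> smooth_exp smul p {\<infinity>}" and du: "\<And>z. dbar smul u z = g z"
    using adm unfolding admissible_def by (metis Compl_empty_eq UNIV_I finite_part_inf)
  have uk: "cont_diff smul k \<Omega> u" for k \<Omega>
    using u cont_diff_subset[of k UNIV u \<Omega>] by (simp add: smooth_exp_def smooth_def finite_part_inf)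
  have ug: "growth_on (S_region n {\<infinity>}) u \<alpha> (1 / real n)" if n: "n \<ge> 1" for n \<alpha>
  proof -
    have "bdd_above ((\<lambda>(z, \<beta>). p \<alpha> (iter_partial smul \<beta> u z) * exp (- (1 / real n) * \<bar>Re z\<bar>)) `
         (S_region n {\<infinity>} \<times> {\<beta>. fst \<beta> + snd \<beta> \<le> 0}))"
      using u n by (simp only: smooth_exp_def mem_Collect_eq)
    then have "bdd_above ((\<lambda>z. p \<alpha> (u z) * exp (- (1 / real n) * \<bar>Re z\<bar>)) ` S_region n {\<infinity>})"
    proof (rule bdd_above_mono, intro image_subsetI)
      fix z assume "z \<in> S_region n {\<infinity>}"
      then show "p \<alpha> (u z) * exp (- (1 / real n) * \<bar>Re z\<bar>) \<in>
          (\<lambda>(z, \<beta>). p \<alpha> (iter_partial smul \<beta> u z) * exp (- (1 / real n) * \<bar>Re z\<bar>)) `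
            (S_region n {\<infinity>} \<times> {\<beta>. fst \<beta> + snd \<beta> \<le> 0})"
        by (intro image_eqI[of _ _ "(z, (0, 0))"]) (simp_all add: iter_partial_def)
    qed
    then show ?thesis by (simp only: bdd_above_growth)
  qed
  define F where "F z = smul (\<theta> z) (f z) + smul (-1) (u z)" for z
  \<comment> \<open>On the ray the difference of \<open>F\<close> and \<open>f\<close> has no
    meaning. Near the ray \<open>\<theta> = 1\<close>, so the difference is \<open>- u\<close>,
    which is holomorphic there because \<open>g\<close> vanishes on \<open>N\<close>.\<close>
  define h where "h z = (if z \<in> ray a then smul (-1) (u z) else F z + smul (-1) (f z))" for z
  have \<theta>fk: "cont_diff smul k (- ray a) (\<lambda>z. smul (\<theta> z) (f z))" for k
    by (rule cont_diff_mult[OF open_slit \<theta>k hol_cont_diff[OF open_slit f]])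
  have muk: "cont_diff smul k \<Omega> (\<lambda>z. smul (-1) (u z))" if "open \<Omega>" for k \<Omega>
    by (rule cont_diff_mult[OF that cplx.cont_diff_const[OF that] uk])
  have F: "F \<in> hol smul (- ray a)"
  proof (rule hol_if_dbar_zero[OF open_slit])
    show "cont_diff smul 1 (- ray a) F"
      unfolding F_def by (intro cont_diff_add open_slit \<theta>fk muk)
    show "dbar smul F z = 0" if z: "z \<in> - ray a" for z
    proof -
      have "dbar smul F z = dbar smul (\<lambda>z. smul (\<theta> z) (f z)) z + dbar smul (\<lambda>z. smul (-1) (u z)) z"
        unfolding F_def by (rule dbar_add[OF \<theta>fk muk[OF open_slit] z])
      also have "dbar smul (\<lambda>z. smul (\<theta> z) (f z)) z = smul (d z) (f z)"
        using dbar_mult[OF \<theta>k hol_cont_diff[OF open_slit f] z] dbar_hol[OF f z] by (simp add: d_def)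
      also have "dbar smul (\<lambda>z. smul (-1) (u z)) z = smul (-1) (g z)"
        using dbar_smul[OF uk[of 1 UNIV], of z "-1"] du by simp
      finally show ?thesis using z by (simp add: g_def scale_minus_left)
    qed
  qed
  have h: "h \<in> hol smul UNIV"
  proof -
    have "(\<lambda>z. F z + smul (-1) (f z)) \<in> hol smul (- ray a)" by (intro hol_add hol_smul F f)
    then have 1: "h \<in> hol smul (- ray a)" by (rule hol_cong[OF _ open_slit]) (simp add: h_def)
    have "(\<lambda>z. smul (-1) (u z)) \<in> hol smul N"
    proof (intro hol_smul hol_if_dbar_zero[OF N(1)] uk)
      show "dbar smul u z = 0" if "z \<in> N" for z using du dN[OF that] by (simp add: g_def)
    qed
    then have 2: "h \<in> hol smul N" by (rule hol_cong[OF _ N(1)]) (simp add: h_def F_def N(3) scale_minus_left)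
    have "- ray a \<union> N = UNIV" using N(2) by auto
    then show ?thesis using hol_Un[OF 1 2] by simp
  qed
  have "infra a F"
    unfolding F_def
  proof (intro infra_add infra_smul)
    show "infra a u" by (rule infra_if_growth_inf) (rule ug)
    show "infra a (\<lambda>z. smul (\<theta> z) (f z))"
      unfolding infra_def
    proof (intro allI impI)
      fix \<alpha> and c C \<epsilon> :: real assume e: "\<epsilon> > 0" "c > 0"
      define X where "X = {z. c \<le> dray a z \<and> \<bar>Im z\<bar> \<le> C}"
      define R where "R = max a (ln (2 / c\<^sup>2) / 2)"
      \<comment> \<open>Only this compact part of the slit plane is needed to cover the support of
        \<open>\<theta>\<close> inside \<open>X\<close>. The radius \<open>C + 2\<close> allows for
        the support reaching 2 to the left of \<open>a\<close>.\<close>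
      define Y where "Y = band a c (C + 2) \<inter> {z. Re z \<le> R}"
      have "Y \<subseteq> - ray a" using band_subset_slit[OF e(2)] by (auto simp: Y_def)
      then have "growth_on Y (\<lambda>z. smul (\<theta> z) (f z)) \<alpha> \<epsilon>"
        using e unfolding Y_def
        by (intro growth_on_compact compact_band_part continuous_on_subset[OF cont_diff_continuous[OF \<theta>fk[of 0]]]) auto
      moreover have "growth_on (X - W) (\<lambda>z. smul (\<theta> z) (f z)) \<alpha> \<epsilon>"
        unfolding growth_on_def by (intro exI[of _ 0]) (auto simp: \<theta>W)
      ultimately have "growth_on (Y \<union> (X - W)) (\<lambda>z. smul (\<theta> z) (f z)) \<alpha> \<epsilon>" by (rule growth_on_Un)
      moreover have "X \<subseteq> Y \<union> (X - W)"
      proof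
        fix z assume z: "z \<in> X"
        show "z \<in> Y \<union> (X - W)"
        proof (cases "z \<in> W")
          case True
          have "dray a z \<le> C + 2"
          proof (cases "a \<le> Re z")
            case False
            then show ?thesis using cmod_le[of "z - of_real a"] True z by (auto simp: dray_def W_def X_def)
          qed (use z in \<open>auto simp: dray_def X_def\<close>)
          moreover have "Re z \<le> R"
          proof (cases "a \<le> Re z")
            case True
            then have "c \<le> \<bar>Im z\<bar>" using z by (auto simp: X_def dray_def)
            then show ?thesis using W_bound[OF \<open>z \<in> W\<close> e(2)] by (simp add: R_def)
          qed (simp add: R_def)
          ultimately show ?thesis using z by (auto simp: Y_def X_def band_def)
        qed (use z in simp)
      qed
      ultimately show "growth_on {z. c \<le> dray a z \<and> \<bar>Im z\<bar> \<le> C} (\<lambda>z. smul (\<theta> z) (f z)) \<alpha> \<epsilon>"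
        unfolding X_def[symmetric] by (rule growth_on_subset)
    qed
  qed
  with F h show thesis by (intro that[of F h]) (auto simp: h_def scale_minus_left)
qed

end

section \<open>Quotients and the two half-lines\<close>

text \<open>The algebraic scheme of the argument: \<open>V1\<close> holds the good representatives
  of the classes of \<open>V\<close>, \<open>r1\<close> is the trace of \<open>r\<close> on them,
  and \<open>L\<close> is a transform of representatives. Its linearity is asked modulo
  \<open>r2\<close> only, because the values of a transform outside its half plane are unspecified.
  The map \<open>\<Phi>\<close> has the form of the transform composed with the inverse canonical
  map.\<close>

lemma linear_iso_quotients_via:
  fixes smul :: "complex \<Rightarrow> 'e :: ab_group_add \<Rightarrow> 'e"
    and V V1 V2 :: "(complex \<Rightarrow> 'e) set" and r r1 r2 :: "((complex \<Rightarrow> 'e) \<times> (complex \<Rightarrow> 'e)) set"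
  assumes eq: "equiv V r" "equiv V1 r1" "equiv V2 r2"
    and V1: "V1 \<subseteq> V" and r1: "\<And>F G. F \<in> V1 \<Longrightarrow> G \<in> V1 \<Longrightarrow> (F, G) \<in> r1 \<longleftrightarrow> (F, G) \<in> r"
    and rep: "\<And>f. f \<in> V \<Longrightarrow> \<exists>F\<in>V1. (F, f) \<in> r"
    and L: "\<And>F. F \<in> V1 \<Longrightarrow> L F \<in> V2" and L_iff: "\<And>F G. F \<in> V1 \<Longrightarrow> G \<in> V1 \<Longrightarrow> (L F, L G) \<in> r2 \<longleftrightarrow> (F, G) \<in> r1"
    and L_surj: "\<And>g. g \<in> V2 \<Longrightarrow> \<exists>F\<in>V1. (L F, g) \<in> r2"
    and V1_add: "\<And>F G. F \<in> V1 \<Longrightarrow> G \<in> V1 \<Longrightarrow> (\<lambda>z. F z + G z) \<in> V1" and V1_smul: "\<And>F c. F \<in> V1 \<Longrightarrow> (\<lambda>z. smul c (F z)) \<in> V1"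
    and r_add: "\<And>f f' g g'. (f, f') \<in> r \<Longrightarrow> (g, g') \<in> r \<Longrightarrow> ((\<lambda>z. f z + g z), (\<lambda>z. f' z + g' z)) \<in> r"
    and r_smul: "\<And>f f' c. (f, f') \<in> r \<Longrightarrow> ((\<lambda>z. smul c (f z)), (\<lambda>z. smul c (f' z))) \<in> r"
    and r2_add: "\<And>f f' g g'. (f, f') \<in> r2 \<Longrightarrow> (g, g') \<in> r2 \<Longrightarrow> ((\<lambda>z. f z + g z), (\<lambda>z. f' z + g' z)) \<in> r2"
    and r2_smul: "\<And>f f' c. (f, f') \<in> r2 \<Longrightarrow> ((\<lambda>z. smul c (f z)), (\<lambda>z. smul c (f' z))) \<in> r2"
    and L_add: "\<And>F G. F \<in> V1 \<Longrightarrow> G \<in> V1 \<Longrightarrow> (L (\<lambda>z. F z + G z), (\<lambda>z. L F z + L G z)) \<in> r2"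
    and L_smul: "\<And>F c. F \<in> V1 \<Longrightarrow> (L (\<lambda>z. smul c (F z)), (\<lambda>z. smul c (L F z))) \<in> r2"
  defines "\<Phi> \<equiv> \<lambda>X. \<Union>G \<in> inv_into (V1 // r1) (\<lambda>X. \<Union>F\<in>X. r `` {F}) X. r2 `` {L G}"
  shows "linear_iso_quotients smul V r V2 r2 \<Phi>"
proof -
  define C where "C X = (\<Union>F\<in>X. r `` {F})" for X
  have cls: "s `` {x} = s `` {y} \<longleftrightarrow> (x, y) \<in> s" if "equiv A s" "x \<in> A" "y \<in> A" for A s and x y :: "complex \<Rightarrow> 'e"
    using that by (metis eq_equiv_class_iff)
  have C_cls: "C (r1 `` {F}) = r `` {F}" if F: "F \<in> V1" for F
  proof -
    have "r `` {G} = r `` {F}" if "(F, G) \<in> r1" for G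
    proof -
      have "G \<in> V1" using that eq(2) by (auto simp: equiv_def refl_on_def)
      then show ?thesis using that F V1 r1 cls[OF eq(1)] by blast
    qed
    moreover have "F \<in> r1 `` {F}" using F eq(2) equiv_class_self by fastforce
    ultimately show ?thesis unfolding C_def by blast
  qed
  \<comment> \<open>Injectivity of the canonical map says no more than that \<open>r1\<close> is the
    trace of \<open>r\<close>.\<close>
  have inj: "inj_on C (V1 // r1)"
  proof (rule inj_onI)
    fix X Y assume "X \<in> V1 // r1" "Y \<in> V1 // r1" and eqC: "C X = C Y"
    then obtain F G where F: "F \<in> V1" "X = r1 `` {F}" and G: "G \<in> V1" "Y = r1 `` {G}" by (auto simp: quotient_def)
    then have "r `` {F} = r `` {G}" using eqC C_cls by simp
    then have "(F, G) \<in> r" using cls[OF eq(1)] F G V1 by blast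
    then have "(F, G) \<in> r1" using r1 F G by blast
    then show "X = Y" using cls[OF eq(2)] F G by blast
  qed
  \<comment> \<open>The union over representatives collapses to a single class, since
    \<open>L\<close> respects the relations.\<close>
  have \<Phi>: "\<Phi> (r `` {F}) = r2 `` {L F}" if F: "F \<in> V1" for F
  proof -
    have "inv_into (V1 // r1) C (r `` {F}) = r1 `` {F}"
      using inv_into_f_f[OF inj quotientI[OF F]] C_cls[OF F] by simp
    then have "\<Phi> (r `` {F}) = (\<Union>G\<in>r1 `` {F}. r2 `` {L G})" by (simp add: \<Phi>_def C_def[abs_def])
    moreover have "r2 `` {L G} = r2 `` {L F}" if "(F, G) \<in> r1" for G
    proof -
      have "G \<in> V1" using that eq(2) by (auto simp: equiv_def refl_on_def)
      then show ?thesis using that F L L_iff cls[OF eq(3)] by blast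
    qed
    moreover have "F \<in> r1 `` {F}" using F eq(2) equiv_class_self by fastforce
    ultimately show ?thesis by blast
  qed
  have ex: "\<exists>F\<in>V1. X = r `` {F}" if X: "X \<in> V // r" for X
  proof -
    obtain f where f: "f \<in> V" "X = r `` {f}" using X by (auto simp: quotient_def)
    obtain F where "F \<in> V1" "(F, f) \<in> r" using rep[OF f(1)] by blast
    then show ?thesis using f cls[OF eq(1), of F f] V1 by blast
  qed
  have add: "class_add s (s `` {f}) (s `` {g}) = s `` {\<lambda>z. f z + g z}"
    if s: "equiv A s" and sa: "\<And>f f' g g'. (f, f') \<in> s \<Longrightarrow> (g, g') \<in> s \<Longrightarrow> ((\<lambda>z. f z + g z), (\<lambda>z. f' z + g' z)) \<in> s"
      and fg: "f \<in> A" "g \<in> A" for A s and f g :: "complex \<Rightarrow> 'e"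
  proof -
    have "s `` {\<lambda>z. f' z + g' z} = s `` {\<lambda>z. f z + g z}" if "(f, f') \<in> s" "(g, g') \<in> s" for f' g'
      using sa[OF that] s by (metis equiv_class_eq)
    moreover have "f \<in> s `` {f}" "g \<in> s `` {g}" using fg s equiv_class_self by fastforce+
    ultimately show ?thesis unfolding class_add_def by blast
  qed
  have scale: "class_scale smul s c (s `` {f}) = s `` {\<lambda>z. smul c (f z)}"
    if s: "equiv A s" and sa: "\<And>f f' c. (f, f') \<in> s \<Longrightarrow> ((\<lambda>z. smul c (f z)), (\<lambda>z. smul c (f' z))) \<in> s"
      and f: "f \<in> A" for A s c and f :: "complex \<Rightarrow> 'e"
  proof -
    have "s `` {\<lambda>z. smul c (f' z)} = s `` {\<lambda>z. smul c (f z)}" if "(f, f') \<in> s" for f'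
      using sa[OF that] s by (metis equiv_class_eq)
    moreover have "f \<in> s `` {f}" using f s equiv_class_self by fastforce
    ultimately show ?thesis unfolding class_scale_def by blast
  qed
  have add_r: "class_add r (r `` {f}) (r `` {g}) = r `` {\<lambda>z. f z + g z}" if "f \<in> V" "g \<in> V" for f g
    by (rule add[OF eq(1) _ that]) (rule r_add)
  have add_r2: "class_add r2 (r2 `` {f}) (r2 `` {g}) = r2 `` {\<lambda>z. f z + g z}" if "f \<in> V2" "g \<in> V2" for f g
    by (rule add[OF eq(3) _ that]) (rule r2_add)
  have scale_r: "class_scale smul r c (r `` {f}) = r `` {\<lambda>z. smul c (f z)}" if "f \<in> V" for f c
    by (rule scale[OF eq(1) _ that]) (rule r_smul)
  have scale_r2: "class_scale smul r2 c (r2 `` {f}) = r2 `` {\<lambda>z. smul c (f z)}" if "f \<in> V2" for f c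
    by (rule scale[OF eq(3) _ that]) (rule r2_smul)
  show ?thesis
    unfolding linear_iso_quotients_def
  proof (intro conjI ballI allI)
    show "bij_betw \<Phi> (V // r) (V2 // r2)"
      unfolding bij_betw_def
    proof
      show "inj_on \<Phi> (V // r)"
      proof (rule inj_onI)
        fix X Y assume "X \<in> V // r" "Y \<in> V // r" and e: "\<Phi> X = \<Phi> Y"
        then obtain F G where F: "F \<in> V1" "X = r `` {F}" and G: "G \<in> V1" "Y = r `` {G}" using ex by metis
        then have "r2 `` {L F} = r2 `` {L G}" using e \<Phi> by simp
        then have "(L F, L G) \<in> r2" using cls[OF eq(3)] L F G by blast
        then have "(F, G) \<in> r" using L_iff r1 F G by blast
        then show "X = Y" using cls[OF eq(1)] F G V1 by blast
      qed
      show "\<Phi> ` (V // r) = V2 // r2"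
      proof
        show "\<Phi> ` (V // r) \<subseteq> V2 // r2"
        proof
          fix Y assume "Y \<in> \<Phi> ` (V // r)"
          then obtain F where "F \<in> V1" "Y = r2 `` {L F}" using ex \<Phi> by (metis imageE)
          then show "Y \<in> V2 // r2" using L by (auto intro: quotientI)
        qed
        show "V2 // r2 \<subseteq> \<Phi> ` (V // r)"
        proof
          fix Y assume "Y \<in> V2 // r2"
          then obtain g where g: "g \<in> V2" "Y = r2 `` {g}" by (auto simp: quotient_def)
          obtain F where F: "F \<in> V1" "(L F, g) \<in> r2" using L_surj[OF g(1)] by blast
          then have "Y = \<Phi> (r `` {F})" using \<Phi>[OF F(1)] g cls[OF eq(3) L[OF F(1)] g(1)] by simp
          moreover have "r `` {F} \<in> V // r" using F V1 by (auto intro: quotientI)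
          ultimately show "Y \<in> \<Phi> ` (V // r)" by blast
        qed
      qed
    qed
    show "\<Phi> (class_add r X Y) = class_add r2 (\<Phi> X) (\<Phi> Y)" if XY: "X \<in> V // r" "Y \<in> V // r" for X Y
    proof -
      obtain F G where F: "F \<in> V1" "X = r `` {F}" and G: "G \<in> V1" "Y = r `` {G}" using XY ex by metis
      have "\<Phi> (class_add r X Y) = r2 `` {L (\<lambda>z. F z + G z)}"
        unfolding F(2) G(2) add_r[OF subsetD[OF V1 F(1)] subsetD[OF V1 G(1)]] by (rule \<Phi>[OF V1_add[OF F(1) G(1)]])
      also have "\<dots> = r2 `` {\<lambda>z. L F z + L G z}"
        using equiv_class_eq[OF eq(3) L_add[OF F(1) G(1)]] .
      also have "\<dots> = class_add r2 (\<Phi> X) (\<Phi> Y)"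
        unfolding F(2) G(2) \<Phi>[OF F(1)] \<Phi>[OF G(1)] by (rule add_r2[OF L[OF F(1)] L[OF G(1)], symmetric])
      finally show ?thesis .
    qed
    show "\<Phi> (class_scale smul r c X) = class_scale smul r2 c (\<Phi> X)" if X: "X \<in> V // r" for c X
    proof -
      obtain F where F: "F \<in> V1" "X = r `` {F}" using X ex by metis
      have "\<Phi> (class_scale smul r c X) = r2 `` {L (\<lambda>z. smul c (F z))}"
        unfolding F(2) scale_r[OF subsetD[OF V1 F(1)]] by (rule \<Phi>[OF V1_smul[OF F(1)]])
      also have "\<dots> = r2 `` {\<lambda>z. smul c (L F z)}"
        using equiv_class_eq[OF eq(3) L_smul[OF F(1)]] .
      also have "\<dots> = class_scale smul r2 c (\<Phi> X)"
        unfolding F(2) \<Phi>[OF F(1)] by (rule scale_r2[OF L[OF F(1)], symmetric])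
      finally show ?thesis .
    qed
  qed
qed

section \<open>Reflection at the origin\<close>

lemma minus_in_nbhd: "- z \<in> nbhd c K \<longleftrightarrow> z \<in> nbhd c (uminus ` K)"
proof -
  have fp: "finite_part (uminus ` K) = uminus ` finite_part K"
  proof -
    have "ereal x \<in> uminus ` K \<longleftrightarrow> ereal (- x) \<in> K" for x
      by (metis ereal_minus_minus_image ereal_uminus_uminus imageI uminus_ereal.simps(1))
    then show ?thesis
      by (auto simp: finite_part_def image_iff) (metis add.inverse_inverse of_real_minus)
  qed
  have "edist_to z (uminus ` finite_part K) = edist_to (- z) (finite_part K)"
  proof -
    have "cmod (z - - w) = cmod (- z - w)" for w using norm_minus_cancel[of "z - - w"] by simp
    then show ?thesis by (simp add: edist_to_def image_image)
  qed
  moreover have "\<infinity> \<in> uminus ` K \<longleftrightarrow> - \<infinity> \<in> K" "- \<infinity> \<in> uminus ` K \<longleftrightarrow> \<infinity> \<in> K"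
    by (metis ereal_minus_minus_image ereal_uminus_uminus imageI)+
  ultimately show ?thesis by (auto simp: nbhd_def fp)
qed

lemma S_region_uminus: "S_region n (uminus ` K) = uminus ` S_region n K"
proof -
  have uminus_eq: "uminus ` X = {z :: complex. - z \<in> X}" for X
    by (force simp: image_iff)
  have "nbhd c (uminus ` K) = uminus ` nbhd c K" for c
    by (auto simp: uminus_eq minus_in_nbhd)
  then have "closure (nbhd (1 / real n) (uminus ` K)) = uminus ` closure (nbhd (1 / real n) K)"
    by (simp add: closure_injective_linear_image[OF linear_uminus])
  then show ?thesis by (auto simp: S_region_def uminus_eq)
qed

lemma closure_ext_left: "closure_ext {..a} = {..ereal a}"
proof
  show "closure_ext {..a} \<subseteq> {..ereal a}"
    unfolding closure_ext_def by (rule closure_minimal) auto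
  have inf: "- \<infinity> \<in> closure (ereal ` {..a})"
  proof (rule Lim_in_closed_set[OF closed_closure])
    show "((\<lambda>x. ereal x) \<longlongrightarrow> - \<infinity>) at_bot" by (simp add: tendsto_MInfty eventually_at_bot_dense)
    show "\<forall>\<^sub>F x in at_bot. ereal x \<in> closure (ereal ` {..a})"
      using eventually_le_at_bot[of a] by eventually_elim (auto intro!: subsetD[OF closure_subset])
  qed simp
  show "{..ereal a} \<subseteq> closure_ext {..a}"
  proof
    fix x assume "x \<in> {..ereal a}"
    then show "x \<in> closure_ext {..a}"
      using inf closure_subset[of "ereal ` {..a}"] by (cases x) (auto simp: closure_ext_def)
  qed
qed

lemma closure_ext_left_diff: "closure_ext {..a} - ereal ` {..a} = {- \<infinity>}"
proof -
  have "x \<in> ereal ` {..a}" if "x \<le> ereal a" "x \<noteq> - \<infinity>" for x using that by (cases x) auto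
  then show ?thesis by (auto simp: closure_ext_left)
qed

lemma finite_part_left: "finite_part {..ereal a} = complex_of_real ` {..a}"
  by (auto simp: finite_part_def)

lemma atMost_ereal_eq_uminus: "{..ereal a} = uminus ` {ereal (- a)..}"
proof -
  have "x \<in> uminus ` {ereal (- a)..}" if "x \<le> ereal a" for x
    using that by (intro image_eqI[of _ _ "- x"]) (cases x; simp)+
  moreover have "- x \<le> ereal a" if "ereal (- a) \<le> x" for x using that by (cases x) auto
  ultimately show ?thesis by auto
qed

context lc_hausdorff
begin

lemma hol_reflect:
  assumes "f \<in> hol smul \<Omega>"
  shows "(\<lambda>z. f (- z)) \<in> hol smul {z. - z \<in> \<Omega>}"
  unfolding hol_def
proof safe
  fix z assume "- z \<in> \<Omega>"
  then obtain l where l: "((\<lambda>h. smul (inverse h) (f (- z + h) - f (- z))) \<longlongrightarrow> l) (at 0)"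
    using assms by (auto simp: hol_def)
  have "filterlim (\<lambda>h :: complex. - h) (at 0) (at 0)"
    by (auto simp: filterlim_at eventually_at_filter intro!: tendsto_eq_intros)
  from tendsto_smul[OF tendsto_const[of "-1"] filterlim_compose[OF l this]]
  have "((\<lambda>h. smul (inverse h) (f (- (z + h)) - f (- z))) \<longlongrightarrow> smul (-1) l) (at 0)"
    by (simp add: scale_minus_left)
  then show "\<exists>l. ((\<lambda>h. smul (inverse h) (f (- (z + h)) - f (- z))) \<longlongrightarrow> l) (at 0)" ..
qed

lemma hol_reflect_iff: "f \<in> hol smul {z. - z \<in> \<Omega>} \<longleftrightarrow> (\<lambda>z. f (- z)) \<in> hol smul \<Omega>"
  using hol_reflect[of f "{z. - z \<in> \<Omega>}"] hol_reflect[of "\<lambda>z. f (- z)" \<Omega>] by auto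

lemma hol_exp_iff:
  "f \<in> hol_exp smul p K \<longleftrightarrow> f \<in> hol smul (- finite_part K) \<and> (\<forall>n\<ge>1. \<forall>\<alpha>. growth_on (S_region n K) f \<alpha> (1 / real n))"
  by (simp only: hol_exp_def bdd_above_growth mem_Collect_eq)

lemma hol_exp_reflect_iff: "f \<in> hol_exp smul p (uminus ` K) \<longleftrightarrow> (\<lambda>z. f (- z)) \<in> hol_exp smul p K"
proof -
  have "ereal x \<in> uminus ` K \<longleftrightarrow> ereal (- x) \<in> K" for x
    by (metis ereal_minus_minus_image ereal_uminus_uminus imageI uminus_ereal.simps(1))
  then have "- finite_part (uminus ` K) = {z. - z \<in> - finite_part K}"
    by (auto simp: finite_part_def image_iff) (metis add.inverse_inverse of_real_minus)+
  moreover have "growth_on (uminus ` X) f \<alpha> \<epsilon> \<longleftrightarrow> growth_on X (\<lambda>z. f (- z)) \<alpha> \<epsilon>" for X \<alpha> \<epsilon>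
    by (simp add: growth_on_def)
  ultimately show ?thesis by (simp only: hol_exp_iff S_region_uminus hol_reflect_iff)
qed

lemma LO_left_iff: "f \<in> LO smul p {..ereal a} \<longleftrightarrow> (\<lambda>z. f (- z)) \<in> LO smul p {ereal (- a)..}"
proof -
  have I: "Inf {- ereal a..} = ereal (- a)" by simp
  have h: "{z. Re z < 0} = {z. - z \<in> {z. Re z > 0}}" by auto
  have img: "(\<lambda>z. p \<alpha> (f z) * exp (- (1 / real k) * cmod z - a * \<bar>Re z\<bar>)) ` {z. Re z \<le> - (1 / real k)} =
      (\<lambda>z. p \<alpha> (f (- z)) * exp (- (1 / real k) * cmod z + - a * \<bar>Re z\<bar>)) ` {z. Re z \<ge> 1 / real k}" for k \<alpha>
  proof -
    have "{z. Re z \<le> - (1 / real k)} = uminus ` {z. Re z \<ge> 1 / real k}"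
      by (rule set_eqI, rule iffI, rule image_eqI[of _ _ "- z" for z]) auto
    then show ?thesis by (simp only: image_image) simp
  qed
  have "f \<in> LO smul p {..ereal a} \<longleftrightarrow> f \<in> hol smul {z. Re z < 0} \<and> (\<forall>k\<ge>1. \<forall>\<alpha>.
      bdd_above ((\<lambda>z. p \<alpha> (f z) * exp (- (1 / real k) * cmod z - a * \<bar>Re z\<bar>)) ` {z. Re z \<le> - (1 / real k)}))"
    by (simp add: LO_def half_plane_def)
  moreover have "(\<lambda>z. f (- z)) \<in> LO smul p {ereal (- a)..} \<longleftrightarrow> (\<lambda>z. f (- z)) \<in> hol smul {z. Re z > 0} \<and> (\<forall>k\<ge>1. \<forall>\<alpha>.
      bdd_above ((\<lambda>z. p \<alpha> (f (- z)) * exp (- (1 / real k) * cmod z + - a * \<bar>Re z\<bar>)) ` {z. Re z \<ge> 1 / real k}))"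
    by (simp add: LO_def half_plane_def I algebra_simps)
  ultimately show ?thesis by (simp only: img h hol_reflect_iff)
qed

lemma LO_minus_inf_iff: "f \<in> LO smul p {- \<infinity>} \<longleftrightarrow> (\<lambda>z. f (- z)) \<in> LO smul p {\<infinity>}"
proof -
  have h: "{z. Re z < 0} = {z. - z \<in> {z. Re z > 0}}" by auto
  have img: "(\<lambda>z. p \<alpha> (f z) * exp (- (1 / real k) * cmod z - - real k * \<bar>Re z\<bar>)) ` {z. Re z \<le> - (1 / real k)} =
      (\<lambda>z. p \<alpha> (f (- z)) * exp (- (1 / real k) * cmod z + real k * \<bar>Re z\<bar>)) ` {z. Re z \<ge> 1 / real k}" for k \<alpha>
  proof -
    have "{z. Re z \<le> - (1 / real k)} = uminus ` {z. Re z \<ge> 1 / real k}"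
      by (rule set_eqI, rule iffI, rule image_eqI[of _ _ "- z" for z]) auto
    then show ?thesis by (simp only: image_image) simp
  qed
  have "f \<in> LO smul p {- \<infinity>} \<longleftrightarrow> f \<in> hol smul {z. Re z < 0} \<and> (\<forall>k\<ge>1. \<forall>\<alpha>.
      bdd_above ((\<lambda>z. p \<alpha> (f z) * exp (- (1 / real k) * cmod z - - real k * \<bar>Re z\<bar>)) ` {z. Re z \<le> - (1 / real k)}))"
    by (simp add: LO_def half_plane_def)
  moreover have "(\<lambda>z. f (- z)) \<in> LO smul p {\<infinity>} \<longleftrightarrow> (\<lambda>z. f (- z)) \<in> hol smul {z. Re z > 0} \<and> (\<forall>k\<ge>1. \<forall>\<alpha>.
      bdd_above ((\<lambda>z. p \<alpha> (f (- z)) * exp (- (1 / real k) * cmod z + real k * \<bar>Re z\<bar>)) ` {z. Re z \<ge> 1 / real k}))"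
    by (simp add: LO_def half_plane_def)
  ultimately show ?thesis by (simp only: img h hol_reflect_iff)
qed

section \<open>Quotients by subspaces of functions\<close>

definition fun_subspace :: "(complex \<Rightarrow> 'e) set \<Rightarrow> bool" where
  "fun_subspace V \<longleftrightarrow> (\<lambda>_. 0) \<in> V \<and> (\<forall>f\<in>V. \<forall>g\<in>V. (\<lambda>z. f z + g z) \<in> V) \<and> (\<forall>c. \<forall>f\<in>V. (\<lambda>z. smul c (f z)) \<in> V)"

lemma fun_subspace_hol: "fun_subspace (hol smul \<Omega>)"
  by (simp add: fun_subspace_def hol_zero hol_add hol_smul)

lemma quot_rel_add:
  assumes "fun_subspace V" "fun_subspace W" "(f, f') \<in> quot_rel \<Omega> V W" "(g, g') \<in> quot_rel \<Omega> V W"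
  shows "((\<lambda>z. f z + g z), (\<lambda>z. f' z + g' z)) \<in> quot_rel \<Omega> V W"
proof -
  obtain h k where h: "h \<in> W" "\<And>z. z \<in> \<Omega> \<Longrightarrow> f z - f' z = h z" and k: "k \<in> W" "\<And>z. z \<in> \<Omega> \<Longrightarrow> g z - g' z = k z"
    using assms(3,4) by (auto simp: quot_rel_def)
  have "f z + g z - (f' z + g' z) = h z + k z" if "z \<in> \<Omega>" for z
    using h(2)[OF that] k(2)[OF that] by (simp add: algebra_simps flip: h(2)[OF that] k(2)[OF that])
  moreover have "(\<lambda>z. h z + k z) \<in> W" using assms(2) h k by (simp add: fun_subspace_def)
  ultimately show ?thesis using assms(1,3,4) by (auto simp: quot_rel_def fun_subspace_def)
qed

lemma quot_rel_smul:
  assumes "fun_subspace V" "fun_subspace W" "(f, f') \<in> quot_rel \<Omega> V W"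
  shows "((\<lambda>z. smul c (f z)), (\<lambda>z. smul c (f' z))) \<in> quot_rel \<Omega> V W"
proof -
  obtain h where h: "h \<in> W" "\<And>z. z \<in> \<Omega> \<Longrightarrow> f z - f' z = h z" using assms(3) by (auto simp: quot_rel_def)
  have "smul c (f z) - smul c (f' z) = smul c (h z)" if "z \<in> \<Omega>" for z
    by (simp only: h(2)[OF that, symmetric] scale_right_diff_distrib)
  moreover have "(\<lambda>z. smul c (h z)) \<in> W" using assms(2) h by (simp add: fun_subspace_def)
  ultimately show ?thesis using assms(1,3) by (auto simp: quot_rel_def fun_subspace_def)
qed

lemma equiv_quot_rel:
  assumes W: "fun_subspace W"
  shows "equiv V (quot_rel \<Omega> V W)"
proof (rule equivI)
  show "quot_rel \<Omega> V W \<subseteq> V \<times> V" by (auto simp: quot_rel_def)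
  show "refl_on V (quot_rel \<Omega> V W)"
    using W by (auto simp: refl_on_def quot_rel_def fun_subspace_def intro!: bexI[of _ "\<lambda>_. 0"])
  show "sym (quot_rel \<Omega> V W)"
  proof (rule symI)
    fix f g assume "(f, g) \<in> quot_rel \<Omega> V W"
    then obtain h where h: "f \<in> V" "g \<in> V" "h \<in> W" "\<And>z. z \<in> \<Omega> \<Longrightarrow> f z - g z = h z" by (auto simp: quot_rel_def)
    have "(\<lambda>z. smul (-1) (h z)) \<in> W" using W h unfolding fun_subspace_def by blast
    moreover have "g z - f z = smul (-1) (h z)" if "z \<in> \<Omega>" for z
      by (simp add: h(4)[OF that, symmetric] scale_minus_left)
    ultimately show "(g, f) \<in> quot_rel \<Omega> V W" using h by (auto simp: quot_rel_def)
  qed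
  show "trans (quot_rel \<Omega> V W)"
  proof (rule transI)
    fix f g k assume "(f, g) \<in> quot_rel \<Omega> V W" "(g, k) \<in> quot_rel \<Omega> V W"
    then obtain h h' where h: "f \<in> V" "k \<in> V" "h \<in> W" "h' \<in> W" "\<And>z. z \<in> \<Omega> \<Longrightarrow> f z - g z = h z"
      "\<And>z. z \<in> \<Omega> \<Longrightarrow> g z - k z = h' z" by (auto simp: quot_rel_def)
    have "(\<lambda>z. h z + h' z) \<in> W" using W h by (simp add: fun_subspace_def)
    moreover have "f z - k z = h z + h' z" if "z \<in> \<Omega>" for z
      by (simp add: h(5)[OF that, symmetric] h(6)[OF that, symmetric])
    ultimately show "(f, k) \<in> quot_rel \<Omega> V W" using h by (auto simp: quot_rel_def)
  qed
qed

text \<open>At the two exceptional parameters of the contour \<open>vector_derivative\<close> may be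
  an unspecified value; integrals do not see finite sets.\<close>

lemma has_pettis_integral_cong_finite:
  assumes "finite S" "\<And>t :: real. t \<notin> S \<Longrightarrow> f t = g t"
  shows "has_pettis_integral smul lborel f v \<longleftrightarrow> has_pettis_integral smul lborel g v"
proof -
  have "countable S" using assms(1) by (rule countable_finite)
  then have "integrable lborel (\<lambda>t. \<phi> (f t)) \<longleftrightarrow> integrable lborel (\<lambda>t. \<phi> (g t))"
    "integral\<^sup>L lborel (\<lambda>t. \<phi> (f t)) = integral\<^sup>L lborel (\<lambda>t. \<phi> (g t))" for \<phi> :: "'e \<Rightarrow> complex"
    by (rule integrable_discrete_difference[where X=S] integral_discrete_difference[where X=S]; simp add: assms(2))+
  then show ?thesis by (simp add: has_pettis_integral_def)
qed

end

section \<open>The isomorphism for both half-lines at once\<close>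

context sc_lc_hausdorff
begin

text \<open>The substitution \<open>z = s * w\<close> turns the exponent \<open>z * \<zeta>\<close>
  into \<open>w * (s * \<zeta>)\<close>, and the differential contributes the factor
  \<open>s\<close>.\<close>

lemma boundary_path_integral:
  assumes F: "(\<lambda>z. F (s * z)) \<in> hol smul (- ray a)" "infra a (\<lambda>z. F (s * z))" and c: "c > 0" and \<zeta>: "Re (s * \<zeta>) > 0"
    and path: "\<And>t. \<gamma> t = s * path_right a c t"
  shows "has_path_integral smul \<gamma> (\<lambda>z. smul (exp (- z * \<zeta>)) (F z)) (smul s (lap a c (\<lambda>z. F (s * z)) (s * \<zeta>)))"
proof -
  define g where "g t = smul (exp (- path_right a c t * (s * \<zeta>))) (smul (path_deriv c t) (F (s * path_right a c t)))" for t
  have "has_pettis_integral smul lborel g (lap a c (\<lambda>z. F (s * z)) (s * \<zeta>))"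
    unfolding g_def by (rule lap_pettis(1)[OF F c \<zeta>])
  then have "has_pettis_integral smul lborel (\<lambda>t. smul s (g t)) (smul s (lap a c (\<lambda>z. F (s * z)) (s * \<zeta>)))"
    by (simp add: has_pettis_integral_def dual_scale)
  moreover have "smul (vector_derivative \<gamma> (at t)) (smul (exp (- \<gamma> t * \<zeta>)) (F (\<gamma> t))) = smul s (g t)" if "t \<notin> {-1, 1}" for t
  proof -
    have "(\<gamma> has_vector_derivative s * path_deriv c t) (at t)"
      unfolding path[abs_def] by (rule has_vector_derivative_mult_right[OF path_right_vector_derivative[OF that]])
    then have "vector_derivative \<gamma> (at t) = s * path_deriv c t" by (rule vector_derivative_at)
    then show ?thesis by (simp add: g_def path mult_ac)
  qed
  ultimately show ?thesis
    unfolding has_path_integral_def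
    using has_pettis_integral_cong_finite[of "{-1, 1}" "\<lambda>t. smul (vector_derivative \<gamma> (at t)) (smul (exp (- \<gamma> t * \<zeta>)) (F (\<gamma> t)))" "\<lambda>t. smul s (g t)"]
    by simp
qed

text \<open>The sign \<open>s\<close> treats the two half-lines simultaneously: \<open>s z\<close> ranges over the right one.\<close>

lemma asymptotic_laplace_iso:
  fixes A :: "real set" and s :: complex and a :: real
  assumes adm: "admissible smul p" and s: "s = 1 \<or> s = -1"
  defines "K \<equiv> closure_ext A" and "R \<equiv> \<lambda>(f :: complex \<Rightarrow> 'e) z. f (s * z)"
  assumes fin: "finite_part K = complex_of_real ` A" and slit: "- complex_of_real ` A = {z. s * z \<notin> ray a}"
    and half: "half_plane K = {z. Re (s * z) > 0}"
    and hol_slit: "\<And>f. f \<in> hol smul (- complex_of_real ` A) \<longleftrightarrow> R f \<in> hol smul (- ray a)"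
    and hol_entire: "\<And>f. f \<in> hol smul UNIV \<longleftrightarrow> R f \<in> hol smul UNIV"
    and exp_K: "\<And>f. f \<in> hol_exp smul p K \<longleftrightarrow> R f \<in> hol smul (- ray a) \<and> infra a (R f)"
    and exp_inf: "\<And>f. f \<in> hol_exp smul p (K - ereal ` A) \<longleftrightarrow> R f \<in> hol smul UNIV \<and> infra a (R f)"
    and exp_empty: "\<And>f. f \<in> hol_exp smul p {} \<longleftrightarrow> R f \<in> hol_exp smul p {}"
    and LO_K: "\<And>f. f \<in> LO smul p K \<longleftrightarrow> lo a (R f)"
    and LO_inf: "\<And>f. f \<in> LO smul p (K - ereal ` A) \<longleftrightarrow> (\<forall>b. lo b (R f))"
    and path: "\<And>c t. c > 0 \<Longrightarrow> boundary_path K c t = s * path_right a c t"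
  shows "linear_iso_quotients smul (hol smul (- complex_of_real ` A)) (hyp_rel smul A)
    (LO smul p K) (LO_rel smul p A) (asymptotic_laplace smul p A)"
proof -
  have ss: "s * (s * z) = z" for z using s by auto
  have slit': "s * z \<notin> ray a \<longleftrightarrow> z \<in> - complex_of_real ` A" for z using slit by blast
  let ?V = "hol smul (- complex_of_real ` A)" and ?V1 = "hol_exp smul p K" and ?V2 = "LO smul p K"
  define L where "L F = laplace smul K (bv_rel smul p K `` {F})" for F
  have sub: "fun_subspace ?V" "fun_subspace (hol smul UNIV)" by (rule fun_subspace_hol)+
  have Rz: "R (\<lambda>_. 0) = (\<lambda>_. 0)" and Ra: "R (\<lambda>z. f z + g z) = (\<lambda>z. R f z + R g z)"
    and Rs: "R (\<lambda>z. smul c (f z)) = (\<lambda>z. smul c (R f z))" and Rd: "R (\<lambda>z. f z - g z) = (\<lambda>z. R f z - R g z)" for f g c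
    by (simp_all add: R_def)
  have infra0: "infra a (\<lambda>_. 0)" by (auto simp: infra_def growth_on_def intro!: exI[of _ 0])
  have lo0: "lo b (\<lambda>_. 0)" for b by (auto simp: lo_def hol_zero intro!: exI[of _ 0])
  have sub1: "fun_subspace ?V1" "fun_subspace (hol_exp smul p (K - ereal ` A))"
    unfolding fun_subspace_def by (simp_all add: exp_K exp_inf Ra Rs Rz hol_zero hol_add hol_smul infra0 infra_add infra_smul)
  have sub2: "fun_subspace ?V2" "fun_subspace (LO smul p (K - ereal ` A))"
    unfolding fun_subspace_def by (simp_all add: LO_K LO_inf Ra Rs Rz lo0 lo_add lo_smul)
  \<comment> \<open>Read on the right half plane, the transform is \<open>lap\<close> up to the sign
    \<open>s\<close>; any radius and any representative give the same value.\<close>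
  have L: "R (L F) \<zeta> = smul s (lap a 1 (R F) \<zeta>)" if F: "F \<in> ?V1" and \<zeta>: "Re \<zeta> > 0" for F \<zeta>
  proof -
    let ?X = "bv_rel smul p K `` {F}"
    have self: "F \<in> ?X"
      using F zero_hol_exp[of "{}"] by (auto simp: bv_rel_def quot_rel_def intro!: bexI[of _ "\<lambda>_. 0"])
    have re: "Re (s * (s * \<zeta>)) > 0" using \<zeta> by (simp add: ss)
    have int: "has_path_integral smul (boundary_path K c) (\<lambda>z. smul (exp (- z * (s * \<zeta>))) (G z)) (smul s (lap a 1 (R F) \<zeta>))"
      if G: "G \<in> ?X" and c: "c > 0" for G c
    proof -
      obtain h where h: "G \<in> ?V1" "h \<in> hol_exp smul p {}" "\<And>z. z \<in> - complex_of_real ` A \<Longrightarrow> F z - G z = h z"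
        using G fin by (auto simp: bv_rel_def quot_rel_def)
      note GV = exp_K[THEN iffD1, OF h(1)] and FV = exp_K[THEN iffD1, OF F]
      have "has_path_integral smul (boundary_path K c) (\<lambda>z. smul (exp (- z * (s * \<zeta>))) (G z)) (smul s (lap a c (R G) \<zeta>))"
        using boundary_path_integral[OF _ _ c re path[OF c], of G] GV by (simp add: R_def ss)
      moreover have "lap a c (R G) \<zeta> = lap a 1 (R F) \<zeta>"
      proof -
        have "lap a c (R F) \<zeta> = lap a c (R G) \<zeta>"
        proof (rule lap_diff_hol_exp_empty[OF _ _ _ _ exp_empty[THEN iffD1, OF h(2)] _ c \<zeta>])
          show "R F z - R G z = R h z" if "z \<notin> ray a" for z
            using h(3)[of "s * z"] that slit'[of "s * z"] by (simp add: R_def ss)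
        qed (use GV FV in auto)
        then show ?thesis using lap_radius[OF _ _ c zero_less_one \<zeta>, of "R F" a] FV by simp
      qed
      ultimately show ?thesis by simp
    qed
    have "L F (s * \<zeta>) = smul s (lap a 1 (R F) \<zeta>)"
      unfolding L_def laplace_def
    \<comment> \<open>Existence holds because all positive radii and all representatives agree;
      uniqueness needs just one positive radius, at which the Pettis integral is unique.\<close>
    proof (rule the_equality)
      show "\<forall>G\<in>?X. \<forall>\<^sub>F c in at_right 0. has_path_integral smul (boundary_path K c)
          (\<lambda>z. smul (exp (- z * (s * \<zeta>))) (G z)) (smul s (lap a 1 (R F) \<zeta>))"
        using int by (auto intro!: eventually_at_rightI[of 0 1])
      fix v assume "\<forall>G\<in>?X. \<forall>\<^sub>F c in at_right 0. has_path_integral smul (boundary_path K c)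
          (\<lambda>z. smul (exp (- z * (s * \<zeta>))) (G z)) v"
      then have "\<forall>\<^sub>F c in at_right 0. has_path_integral smul (boundary_path K c)
          (\<lambda>z. smul (exp (- z * (s * \<zeta>))) (F z)) v" using self by blast
      moreover have "\<forall>\<^sub>F c in at_right (0 :: real). c > 0" by (simp add: eventually_at_filter)
      ultimately have "\<forall>\<^sub>F c in at_right 0. has_path_integral smul (boundary_path K c)
          (\<lambda>z. smul (exp (- z * (s * \<zeta>))) (F z)) v \<and> c > 0" by (rule eventually_conj)
      from eventually_happens'[OF trivial_limit_at_right_real this]
      obtain c where "has_path_integral smul (boundary_path K c) (\<lambda>z. smul (exp (- z * (s * \<zeta>))) (F z)) v" "c > 0" by blast
      then show "v = smul s (lap a 1 (R F) \<zeta>)"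
        using int[OF self] has_pettis_integral_unique unfolding has_path_integral_def by blast
    qed
    then show ?thesis by (simp add: R_def)
  qed
  have Llo: "lo a (R (L F))" if F: "F \<in> ?V1" for F
    by (rule lo_cong[OF lo_smul[OF lap_lo[of "R F" a 1]]]) (use F exp_K L[OF F] in auto)
  have hyp_iff: "(F, G) \<in> hyp_rel smul A \<longleftrightarrow> F \<in> ?V \<and> G \<in> ?V \<and> (\<exists>h\<in>hol smul UNIV. \<forall>z. z \<notin> ray a \<longrightarrow> R F z - R G z = h z)" for F G
  proof -
    have "(\<exists>h\<in>hol smul UNIV. \<forall>z\<in>- complex_of_real ` A. F z - G z = h z) \<longleftrightarrow> (\<exists>h\<in>hol smul UNIV. \<forall>z. z \<notin> ray a \<longrightarrow> R F z - R G z = h z)"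
    proof
      assume "\<exists>h\<in>hol smul UNIV. \<forall>z\<in>- complex_of_real ` A. F z - G z = h z"
      then obtain h where h: "h \<in> hol smul UNIV" "\<And>z. s * z \<notin> ray a \<Longrightarrow> F z - G z = h z" using slit' by blast
      then show "\<exists>h\<in>hol smul UNIV. \<forall>z. z \<notin> ray a \<longrightarrow> R F z - R G z = h z"
        using hol_entire[of h] by (intro bexI[of _ "R h"]) (auto simp: R_def ss)
    next
      assume "\<exists>h\<in>hol smul UNIV. \<forall>z. z \<notin> ray a \<longrightarrow> R F z - R G z = h z"
      then obtain h where h: "h \<in> hol smul UNIV" "\<And>z. z \<notin> ray a \<Longrightarrow> R F z - R G z = h z" by blast
      have "R (R h) = h" by (simp add: R_def ss)
      moreover have "F z - G z = R h z" if "z \<in> - complex_of_real ` A" for z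
        using h(2)[of "s * z"] that slit'[of z] by (simp add: R_def ss)
      ultimately show "\<exists>h\<in>hol smul UNIV. \<forall>z\<in>- complex_of_real ` A. F z - G z = h z"
        using h(1) hol_entire[of "R h"] by (intro bexI[of _ "R h"]) simp_all
    qed
    then show ?thesis by (simp add: hyp_rel_def quot_rel_def)
  qed
  \<comment> \<open>Two functions of infra-exponential growth that differ by an entire function pass
    their growth on to it. So the relation can be stated with plain entire functions, exactly as for
    hyperfunctions.\<close>
  have exp_iff: "(F, G) \<in> exp_rel smul p A \<longleftrightarrow> F \<in> ?V1 \<and> G \<in> ?V1 \<and> (\<exists>h\<in>hol smul UNIV. \<forall>z. z \<notin> ray a \<longrightarrow> R F z - R G z = h z)" for F G
  proof (cases "F \<in> ?V1 \<and> G \<in> ?V1")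
    case True
    note FV = exp_K[THEN iffD1, OF conjunct1[OF True]] and GV = exp_K[THEN iffD1, OF conjunct2[OF True]]
    have "(\<exists>h\<in>hol_exp smul p (K - ereal ` A). \<forall>z\<in>- complex_of_real ` A. F z - G z = h z) \<longleftrightarrow> (\<exists>h\<in>hol smul UNIV. \<forall>z. z \<notin> ray a \<longrightarrow> R F z - R G z = h z)"
    proof
      assume "\<exists>h\<in>hol_exp smul p (K - ereal ` A). \<forall>z\<in>- complex_of_real ` A. F z - G z = h z"
      then obtain h where h: "R h \<in> hol smul UNIV" "\<And>z. s * z \<notin> ray a \<Longrightarrow> F z - G z = h z" using slit' exp_inf by blast
      then show "\<exists>h\<in>hol smul UNIV. \<forall>z. z \<notin> ray a \<longrightarrow> R F z - R G z = h z"
        by (intro bexI[of _ "R h"]) (auto simp: R_def ss)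
    next
      assume "\<exists>h\<in>hol smul UNIV. \<forall>z. z \<notin> ray a \<longrightarrow> R F z - R G z = h z"
      then obtain h where h: "h \<in> hol smul UNIV" "\<And>z. z \<notin> ray a \<Longrightarrow> R F z - R G z = h z" by blast
      have "infra a (\<lambda>z. R F z + smul (-1) (R G z))" using FV GV by (intro infra_add infra_smul) auto
      then have "infra a h" by (rule infra_cong) (simp add: h(2)[symmetric] scale_minus_left)
      moreover have "R (R h) = h" by (simp add: R_def ss)
      ultimately have "R h \<in> hol_exp smul p (K - ereal ` A)" using h(1) by (simp add: exp_inf)
      moreover have "F z - G z = R h z" if "z \<in> - complex_of_real ` A" for z
        using h(2)[of "s * z"] that slit'[of z] by (simp add: R_def ss)
      ultimately show "\<exists>h\<in>hol_exp smul p (K - ereal ` A). \<forall>z\<in>- complex_of_real ` A. F z - G z = h z" by blast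
    qed
    then show ?thesis using True by (simp add: exp_rel_def quot_rel_def fin K_def[symmetric])
  qed (auto simp: exp_rel_def quot_rel_def K_def)
  have LO_iff: "(f, g) \<in> LO_rel smul p A \<longleftrightarrow> f \<in> ?V2 \<and> g \<in> ?V2 \<and> (\<forall>b. lo b (\<lambda>z. R f z - R g z))" for f g
  proof -
    have "(\<exists>h\<in>LO smul p (K - ereal ` A). \<forall>z\<in>half_plane K. f z - g z = h z) \<longleftrightarrow> (\<forall>b. lo b (\<lambda>z. R f z - R g z))"
    proof
      assume "\<exists>h\<in>LO smul p (K - ereal ` A). \<forall>z\<in>half_plane K. f z - g z = h z"
      then obtain h where h: "\<And>b. lo b (R h)" "\<And>z. Re (s * z) > 0 \<Longrightarrow> f z - g z = h z" using LO_inf half by auto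
      show "\<forall>b. lo b (\<lambda>z. R f z - R g z)"
      proof
        fix b show "lo b (\<lambda>z. R f z - R g z)"
          by (rule lo_cong[OF h(1)[of b]]) (simp only: R_def, rule h(2)[symmetric], simp only: ss)
      qed
    next
      assume "\<forall>b. lo b (\<lambda>z. R f z - R g z)"
      then show "\<exists>h\<in>LO smul p (K - ereal ` A). \<forall>z\<in>half_plane K. f z - g z = h z"
        by (intro bexI[of _ "\<lambda>z. f z - g z"]) (simp_all add: LO_inf Rd)
    qed
    then show ?thesis by (simp add: LO_rel_def quot_rel_def K_def[symmetric])
  qed
  have lap_diff_lo: "lo b (\<lambda>z. R (L F) z - R (L G) z) \<longleftrightarrow> lo b (lap a 1 (\<lambda>z. R F z - R G z))"
    if F: "F \<in> ?V1" and G: "G \<in> ?V1" for F G b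
  proof -
    note FV = exp_K[THEN iffD1, OF F] and GV = exp_K[THEN iffD1, OF G]
    have eq: "R (L F) z - R (L G) z = smul s (lap a 1 (\<lambda>z. R F z - R G z) z)" if z: "Re z > 0" for z
    proof -
      have "lap a 1 (\<lambda>z. R F z + smul (-1) (R G z)) z = lap a 1 (R F) z + smul (-1) (lap a 1 (R G) z)"
        using lap_add[of "R F" a "\<lambda>z. smul (-1) (R G z)" 1 z] lap_smul[of "R G" a 1 z "-1"] FV GV z
          hol_smul[of "R G" "- ray a" "-1"] infra_smul[of a "R G" "-1"] by (simp del: scale_minus_left)
      then show ?thesis
        unfolding L[OF F z] L[OF G z] by (simp add: scale_minus_left scale_right_diff_distrib)
    qed
    show ?thesis
    proof
      assume "lo b (\<lambda>z. R (L F) z - R (L G) z)"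
      from lo_smul[OF this, of s] show "lo b (lap a 1 (\<lambda>z. R F z - R G z))"
        by (rule lo_cong) (simp add: eq ss[of 1, simplified])
    next
      assume "lo b (lap a 1 (\<lambda>z. R F z - R G z))"
      from lo_smul[OF this, of s] show "lo b (\<lambda>z. R (L F) z - R (L G) z)"
        by (rule lo_cong) (simp add: eq)
    qed
  qed
  have "linear_iso_quotients smul ?V (hyp_rel smul A) ?V2 (LO_rel smul p A)
    (\<lambda>X. \<Union>G \<in> inv_into (?V1 // exp_rel smul p A) (\<lambda>X. \<Union>F\<in>X. hyp_rel smul A `` {F}) X. LO_rel smul p A `` {L G})"
  proof (rule linear_iso_quotients_via)
    show "equiv ?V (hyp_rel smul A)" unfolding hyp_rel_def by (rule equiv_quot_rel[OF sub(2)])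
    show "equiv ?V1 (exp_rel smul p A)" unfolding exp_rel_def K_def[symmetric] by (rule equiv_quot_rel[OF sub1(2)])
    show "equiv ?V2 (LO_rel smul p A)" unfolding LO_rel_def K_def[symmetric] by (rule equiv_quot_rel[OF sub2(2)])
    show V1: "?V1 \<subseteq> ?V" using exp_K hol_slit by blast
    show "(F, G) \<in> exp_rel smul p A \<longleftrightarrow> (F, G) \<in> hyp_rel smul A" if "F \<in> ?V1" "G \<in> ?V1" for F G
      using that V1 by (auto simp: hyp_iff exp_iff)
    show "\<exists>F\<in>?V1. (F, f) \<in> hyp_rel smul A" if f: "f \<in> ?V" for f
    proof -
      obtain F h where F: "F \<in> hol smul (- ray a)" "infra a F" "h \<in> hol smul UNIV" "\<And>z. z \<notin> ray a \<Longrightarrow> F z - R f z = h z"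
        using infra_representative[OF adm, of "R f" a] f hol_slit by blast
      have RF: "R (R F) = F" by (simp add: R_def ss)
      then have "R F \<in> ?V1" using F by (simp add: exp_K)
      moreover have "(R F, f) \<in> hyp_rel smul A" using f V1 \<open>R F \<in> ?V1\<close> F RF by (auto simp: hyp_iff)
      ultimately show ?thesis by blast
    qed
    show "L F \<in> ?V2" if "F \<in> ?V1" for F using Llo[OF that] by (simp add: LO_K)
    \<comment> \<open>Well-definedness and injectivity in one: the transform of the difference
      \<open>D\<close> has every exponential type if and only if \<open>D\<close> extends to an
      entire function.\<close>
    show "(L F, L G) \<in> LO_rel smul p A \<longleftrightarrow> (F, G) \<in> exp_rel smul p A" if FG: "F \<in> ?V1" "G \<in> ?V1" for F G
    proof -
      define D where "D z = R F z - R G z" for z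
      have "(\<lambda>z. R F z + smul (-1) (R G z)) \<in> hol smul (- ray a) \<and> infra a (\<lambda>z. R F z + smul (-1) (R G z))"
        using FG[THEN exp_K[THEN iffD1]] by (intro conjI hol_add hol_smul infra_add infra_smul) (rule conjunct1 conjunct2, assumption)+
      then have D: "D \<in> hol smul (- ray a)" "infra a D" by (simp_all add: D_def[abs_def] scale_minus_left)
      have "(L F, L G) \<in> LO_rel smul p A \<longleftrightarrow> (\<forall>b. lo b (lap a 1 D))"
        using FG Llo by (simp add: LO_iff lap_diff_lo LO_K D_def[abs_def])
      also have "\<dots> \<longleftrightarrow> (\<exists>h\<in>hol smul UNIV. \<forall>z. z \<notin> ray a \<longrightarrow> D z = h z)"
      proof
        assume "\<forall>b. lo b (lap a 1 D)"
        then show "\<exists>h\<in>hol smul UNIV. \<forall>z. z \<notin> ray a \<longrightarrow> D z = h z"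
          using entire_extension_if_lap_lo[OF D] by metis
      next
        assume "\<exists>h\<in>hol smul UNIV. \<forall>z. z \<notin> ray a \<longrightarrow> D z = h z"
        then obtain h where h: "h \<in> hol smul UNIV" "\<And>z. z \<notin> ray a \<Longrightarrow> D z = h z" by blast
        have "lo b (lap a 1 h)" for b by (rule lap_entire_lo[OF h(1) infra_cong[OF D(2) h(2)]]) simp_all
        moreover have "lap a 1 D = lap a 1 h" by (rule lap_cong[OF _ h(2)]) simp_all
        ultimately show "\<forall>b. lo b (lap a 1 D)" by simp
      qed
      finally show ?thesis using FG by (simp add: exp_iff D_def)
    qed
    show "\<exists>F\<in>?V1. (L F, g) \<in> LO_rel smul p A" if g: "g \<in> ?V2" for g
    proof -
      \<comment> \<open>The factor \<open>1 / (2 * pi * \<i>)\<close> undoes the constant of Borel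
        inversion, and \<open>s\<close> undoes the sign in \<open>L\<close>.\<close>
      define f where "f z = smul (s / (2 * pi * \<i>)) (R g z)" for z
      have f: "lo a f" unfolding f_def using g by (intro lo_smul) (simp add: LO_K)
      \<comment> \<open>Infra-exponential growth is not known for the Borel transform itself;
        admissibility supplies a function with it that differs by an entire one.\<close>
      obtain G h where G: "G \<in> hol smul (- ray a)" "infra a G" "h \<in> hol smul UNIV" "\<And>z. z \<notin> ray a \<Longrightarrow> G z - borel_transform f z = h z"
        using infra_representative[OF adm borel_transform_hol[OF f]] by blast
      have RG: "R (R G) = G" by (simp add: R_def ss)
      then have V: "R G \<in> ?V1" using G by (simp add: exp_K)
      have "lo b (\<lambda>z. R (L (R G)) z - R g z)" for b
      proof (rule lo_cong[OF lo_smul[OF laplace_borel_transform_lo[OF f G]]])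
        fix z :: complex assume z: "Re z > 0"
        have "s * (2 * pi * \<i>) * (s / (2 * pi * \<i>)) = 1" using s by auto
        then have "smul (s * (2 * pi * \<i>)) (f z) = R g z" by (simp only: f_def scale_scale scale_one)
        then show "smul s (lap a 1 G z - smul (2 * pi * \<i>) (f z)) = R (L (R G)) z - R g z"
          using L[OF V z] by (simp only: RG scale_right_diff_distrib scale_scale)
      qed
      then have "(L (R G), g) \<in> LO_rel smul p A" using V g Llo by (simp add: LO_iff LO_K)
      with V show ?thesis by blast
    qed
    show "(\<lambda>z. F z + G z) \<in> ?V1" if "F \<in> ?V1" "G \<in> ?V1" for F G using sub1(1) that by (simp add: fun_subspace_def)
    show "(\<lambda>z. smul c (F z)) \<in> ?V1" if "F \<in> ?V1" for F c using sub1(1) that by (simp add: fun_subspace_def)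
    show "((\<lambda>z. f z + g z), (\<lambda>z. f' z + g' z)) \<in> hyp_rel smul A" if "(f, f') \<in> hyp_rel smul A" "(g, g') \<in> hyp_rel smul A" for f f' g g'
      using that unfolding hyp_rel_def by (rule quot_rel_add[OF sub])
    show "((\<lambda>z. smul c (f z)), (\<lambda>z. smul c (f' z))) \<in> hyp_rel smul A" if "(f, f') \<in> hyp_rel smul A" for f f' c
      using that unfolding hyp_rel_def by (rule quot_rel_smul[OF sub])
    show "((\<lambda>z. f z + g z), (\<lambda>z. f' z + g' z)) \<in> LO_rel smul p A" if "(f, f') \<in> LO_rel smul p A" "(g, g') \<in> LO_rel smul p A" for f f' g g'
      using that unfolding LO_rel_def K_def[symmetric] by (rule quot_rel_add[OF sub2])
    show "((\<lambda>z. smul c (f z)), (\<lambda>z. smul c (f' z))) \<in> LO_rel smul p A" if "(f, f') \<in> LO_rel smul p A" for f f' c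
      using that unfolding LO_rel_def K_def[symmetric] by (rule quot_rel_smul[OF sub2])
    show "(L (\<lambda>z. F z + G z), (\<lambda>z. L F z + L G z)) \<in> LO_rel smul p A" if FG: "F \<in> ?V1" "G \<in> ?V1" for F G
    proof -
      have V: "(\<lambda>z. F z + G z) \<in> ?V1" using sub1(1) FG by (simp add: fun_subspace_def)
      have "R (L (\<lambda>z. F z + G z)) z - (R (L F) z + R (L G) z) = 0" if z: "Re z > 0" for z
        using lap_add[of "R F" a "R G" 1 z] FG exp_K z
        by (simp add: L[OF V z] L[OF FG(1) z] L[OF FG(2) z] Ra scale_right_distrib)
      then have "lo b (\<lambda>z. R (L (\<lambda>z. F z + G z)) z - (R (L F) z + R (L G) z))" for b by (intro lo_cong[OF lo0]) simp
      then show ?thesis using Llo[OF V] lo_add[OF Llo[OF FG(1)] Llo[OF FG(2)]] by (simp add: LO_iff LO_K Ra)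
    qed
    show "(L (\<lambda>z. smul c (F z)), (\<lambda>z. smul c (L F z))) \<in> LO_rel smul p A" if F: "F \<in> ?V1" for F c
    proof -
      have V: "(\<lambda>z. smul c (F z)) \<in> ?V1" using sub1(1) F by (simp add: fun_subspace_def)
      have "R (L (\<lambda>z. smul c (F z))) z - smul c (R (L F) z) = 0" if z: "Re z > 0" for z
        using lap_smul[of "R F" a 1 z c] F exp_K z by (simp add: L[OF V z] L[OF F z] Rs mult.commute)
      then have "lo b (\<lambda>z. R (L (\<lambda>z. smul c (F z))) z - smul c (R (L F) z))" for b by (intro lo_cong[OF lo0]) simp
      then show ?thesis using Llo[OF V] lo_smul[OF Llo[OF F]] by (simp add: LO_iff LO_K Rs)
    qed
  qed
  then show ?thesis
    by (simp add: asymptotic_laplace_def[abs_def] canonical_map_def[abs_def] L_def K_def)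
qed

end

theorem theorem7p4:
  fixes smul :: "complex \<Rightarrow> 'e :: {ab_group_add, t2_space} \<Rightarrow> 'e"
    and p :: "'i \<Rightarrow> 'e \<Rightarrow> real"
    and A :: "real set" and a :: real
  assumes "lc_hausdorff smul p"
    and "seq_complete p"
    and "admissible smul p"
    and "A = {..a} \<or> A = {a..}"
  shows "linear_iso_quotients smul
           (hol smul (- complex_of_real ` A)) (hyp_rel smul A)
           (LO smul p (closure_ext A)) (LO_rel smul p A)
           (asymptotic_laplace smul p A)"
proof -
  interpret sc_lc_hausdorff smul p
    using assms(1,2) by (intro sc_lc_hausdorff.intro sc_lc_hausdorff_axioms.intro)
  show ?thesis
    using assms(4)
  proof
    assume A: "A = {a..}"
    have "path_right (real_of_ereal (Inf {ereal a..})) c t = path_right a c t" for c t by simp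
    then show ?thesis
      unfolding A
      by (intro asymptotic_laplace_iso[OF assms(3), of 1 _ a])
        (simp_all add: closure_ext_right closure_ext_right_diff[unfolded closure_ext_right] finite_part_right ray_def[symmetric]
          Compl_eq half_plane_def hol_exp_right_iff hol_exp_inf_iff[of _ a] LO_right_iff LO_inf_iff boundary_path_def
          del: Inf_atLeast)
  next
    assume A: "A = {..a}"
    \<comment> \<open>For the left half-line the sign is \<open>-1\<close> and the vertex is
      \<open>- a\<close>; every condition is transported by the reflection.\<close>
    have "z \<notin> complex_of_real ` {..a} \<longleftrightarrow> - z \<notin> ray (- a)" for z
      by (auto simp: mem_ray image_iff complex_eq_iff)
    then have slit: "- complex_of_real ` {..a} = {z. - z \<in> - ray (- a)}" by auto
    have mi: "{- \<infinity>} = uminus ` {\<infinity> :: ereal}" by simp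
    have "f \<in> hol_exp smul p {- \<infinity>} \<longleftrightarrow> (\<lambda>z. f (- z)) \<in> hol_exp smul p {\<infinity>}" for f
      unfolding mi by (rule hol_exp_reflect_iff)
    moreover have "f \<in> hol_exp smul p {..ereal a} \<longleftrightarrow> (\<lambda>z. f (- z)) \<in> hol_exp smul p {ereal (- a)..}" for f
      unfolding atMost_ereal_eq_uminus by (rule hol_exp_reflect_iff)
    moreover have "f \<in> hol_exp smul p {} \<longleftrightarrow> (\<lambda>z. f (- z)) \<in> hol_exp smul p {}" for f
      using hol_exp_reflect_iff[of f "{}"] by simp
    moreover have "f \<in> hol smul UNIV \<longleftrightarrow> (\<lambda>z. f (- z)) \<in> hol smul UNIV" for f
      using hol_reflect_iff[of f UNIV] by simp
    moreover have "f \<in> hol smul (- complex_of_real ` {..a}) \<longleftrightarrow> (\<lambda>z. f (- z)) \<in> hol smul (- ray (- a))" for f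
      unfolding slit by (rule hol_reflect_iff)
    ultimately show ?thesis
      unfolding A
      by (intro asymptotic_laplace_iso[OF assms(3), of "-1" _ "- a"])
        (simp_all add: slit closure_ext_left closure_ext_left_diff[unfolded closure_ext_left] finite_part_left
          half_plane_def hol_exp_right_iff hol_exp_inf_iff[of _ "- a"] LO_left_iff LO_minus_inf_iff LO_right_iff LO_inf_iff
          boundary_path_def del: uminus_ereal.simps)
  qed
qed

end
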